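(* Let $X$ be a CAT(0) triangle-pentagon complex, and let $X^{\star}$ be the simplicial complex obtained from $X$ by coning each pentagon from its center, endowed with the metric $d^{\star}$. Then no vertex of $X^{\star}$ has a link containing a full cycle of length $3$ or $4$. In particular, $X^{\star}$ is flag and locally $5$-large. Moreover, any vertex of $X^{\star}$ that is $5$-large but not $6$-large is the center of a pentagon of $X$.
   Context: Triangle-pentagon complex. A triangle-pentagon complex of a simple graph $\Gamma$ is a two-dimensional cell complex $X$ with $1$-skeleton $\Gamma$ whose $2$-cells are (solid) triangles and pentagons whose boundaries are identified by isomorphisms with graph triangles ($3$-cycles) and graph pentagons ($5$-cycles) in $\Gamma$. It is required that there are no full (induced) $4$-cycles in $\Gamma$ and that the pentagons of $X$ have no diagonals (non-consecutive vertices of a pentagon are not adjacent). The complex $X^{\star}$. $X^{\star}$ is the $2$-dimensional simplicial complex whose vertices are the vertices of $X$ together with one new vertex (the center) for each pentagon of $X$; whose edges are the edges of $X$ together with the edges joining the center of each pentagon to its five vertices; and whose triangles are the triangles of $X$ together with, for each pentagon, the five triangles spanned by its center and one of its sides. Metrics. $X$ carries a metric $d$, namely a piecewise Euclidean length metric in which each $2$-cell is a convex Euclidean triangle or pentagon and there are finitely many isometry types of $2$-cells. $X$ is called CAT(0) if $(X,d)$ is a CAT(0) space (a geodesic space all of whose geodesic triangles satisfy the CAT(0) comparison inequality with the Euclidean plane). The metric $d^{\star}$ on $X^{\star}$ is the piecewise Euclidean length metric in which: every triangle of $X^{\star}$ that is a triangle of $X$ is equilateral with side length $1$ (angles $\pi/3$);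 every triangle of $X^{\star}$ coming from a pentagon has angle $2\pi/5$ at the center of the pentagon, angles $3\pi/10$ at its other two vertices, and the side lying on the boundary of the pentagon has length $1$ (so each subdivided pentagon is isometric to a regular Euclidean pentagon of side $1$). It is part of the setting that $d$ and $d^{\star}$ agree at every vertex $v$ of $X$: the sum of the angles around $v$ is the same for $d$ and for $d^{\star}$, i.e. every injective loop in the link of $v$ in $X$ has the same angular length in $(X,d)$ as the corresponding (subdivided) loop in the link of $v$ in $(X^{\star},d^{\star})$. Combinatorial notions for a simplicial complex $Y$. $Y$ is flag if every finite set of pairwise adjacent vertices spans a simplex. A subcomplex is full if every simplex of $Y$ whose vertices all lie in it belongs to it. A cycle is a subcomplex isomorphic to a triangulation of the circle; a $j$-cycle is one with $j$ edges. The link $Y_\sigma$ of a simplex $\sigma$ consists of all simplices disjoint from $\sigma$ that together with $\sigma$ span a simplex. A flag simplicial complex is $k$-large ($k\ge 4$) if it has no full $j$-cycles with $j<k$. $Y$ is locally $k$-large if all its links are $k$-large. A vertex is called $k$-large if its link is $k$-large. *)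

theory Defs
  imports "HOL-Analysis.Analysis"
begin

section \<open>Simplicial complexes\<close>

text \<open>A simplicial complex is the family of its (finite, nonempty) simplices.\<close>

definition flag :: "'a set set \<Rightarrow> bool" where
  "flag Y \<longleftrightarrow> (\<forall>S. finite S \<and> S \<noteq> {} \<and> S \<subseteq> \<Union>Y \<and>
      (\<forall>x\<in>S. \<forall>y\<in>S. x \<noteq> y \<longrightarrow> {x, y} \<in> Y) \<longrightarrow> S \<in> Y)"

definition subcomplex :: "'a set set \<Rightarrow> 'a set set \<Rightarrow> bool" where
  "subcomplex L Y \<longleftrightarrow> L \<subseteq> Y \<and> (\<forall>\<sigma>\<in>L. \<forall>\<tau>. \<tau> \<noteq> {} \<and> \<tau> \<subseteq> \<sigma> \<longrightarrow> \<tau> \<in> L)"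

definition full_subcomplex :: "'a set set \<Rightarrow> 'a set set \<Rightarrow> bool" where
  "full_subcomplex L Y \<longleftrightarrow> subcomplex L Y \<and> (\<forall>\<sigma>\<in>Y. \<sigma> \<subseteq> \<Union>L \<longrightarrow> \<sigma> \<in> L)"

text \<open>The triangulation of the circle with \<open>j\<close> edges, for \<open>j \<ge> 3\<close>.\<close>

definition circle :: "nat \<Rightarrow> nat set set" where
  "circle j = (\<lambda>i. {i}) ` {..<j} \<union> (\<lambda>i. {i, Suc i mod j}) ` {..<j}"

definition cycle_of_length :: "nat \<Rightarrow> 'a set set \<Rightarrow> bool" where
  "cycle_of_length j L \<longleftrightarrow> 3 \<le> j \<and> (\<exists>f. inj_on f {..<j} \<and> L = (`) f ` circle j)"

definition has_full_cycle :: "nat \<Rightarrow> 'a set set \<Rightarrow> bool" where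
  "has_full_cycle j Y \<longleftrightarrow> (\<exists>L. cycle_of_length j L \<and> full_subcomplex L Y)"

definition link :: "'a set set \<Rightarrow> 'a set \<Rightarrow> 'a set set" where
  "link Y \<sigma> = {\<tau> \<in> Y. \<tau> \<inter> \<sigma> = {} \<and> \<tau> \<union> \<sigma> \<in> Y}"

definition large :: "nat \<Rightarrow> 'a set set \<Rightarrow> bool" where
  "large k Y \<longleftrightarrow> flag Y \<and> (\<forall>j<k. \<not> has_full_cycle j Y)"

definition locally_large :: "nat \<Rightarrow> 'a set set \<Rightarrow> bool" where
  "locally_large k Y \<longleftrightarrow> (\<forall>\<sigma>\<in>Y. large k (link Y \<sigma>))"

definition large_vertex :: "nat \<Rightarrow> 'a set set \<Rightarrow> 'a \<Rightarrow> bool" where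
  "large_vertex k Y v \<longleftrightarrow> large k (link Y {v})"

section \<open>CAT(0) spaces\<close>

definition geodesic_segment :: "'a set \<Rightarrow> ('a \<Rightarrow> 'a \<Rightarrow> real) \<Rightarrow> 'a \<Rightarrow> 'a \<Rightarrow> 'a set \<Rightarrow> bool" where
  "geodesic_segment M d x y S \<longleftrightarrow>
     (\<exists>\<gamma>. \<gamma> 0 = x \<and> \<gamma> (d x y) = y \<and> S = \<gamma> ` {0..d x y} \<and> S \<subseteq> M \<and>
        (\<forall>s\<in>{0..d x y}. \<forall>t\<in>{0..d x y}. d (\<gamma> s) (\<gamma> t) = \<bar>s - t\<bar>))"

definition geodesic_space :: "'a set \<Rightarrow> ('a \<Rightarrow> 'a \<Rightarrow> real) \<Rightarrow> bool" where
  "geodesic_space M d \<longleftrightarrow>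
     Metric_space M d \<and> (\<forall>x\<in>M. \<forall>y\<in>M. \<exists>S. geodesic_segment M d x y S)"

text \<open>\<open>x'\<close> is the point of \<open>[p', q']\<close> that corresponds to the point \<open>x\<close> of a geodesic
  segment \<open>S\<close> from \<open>p\<close> to \<open>q\<close>. The Euclidean plane is the type \<^typ>\<open>complex\<close>.\<close>

definition comparison_point ::
    "('a \<Rightarrow> 'a \<Rightarrow> real) \<Rightarrow> 'a \<Rightarrow> 'a set \<Rightarrow> complex \<Rightarrow> complex \<Rightarrow> 'a \<Rightarrow> complex \<Rightarrow> bool" where
  "comparison_point d p S p' q' x x' \<longleftrightarrow>
     x \<in> S \<and> x' \<in> closed_segment p' q' \<and> dist p' x' = d p x"

definition cat0_space :: "'a set \<Rightarrow> ('a \<Rightarrow> 'a \<Rightarrow> real) \<Rightarrow> bool" where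
  "cat0_space M d \<longleftrightarrow> geodesic_space M d \<and>
     (\<forall>p\<in>M. \<forall>q\<in>M. \<forall>r\<in>M. \<forall>A B C. \<forall>p' q' r'.
        geodesic_segment M d p q A \<and> geodesic_segment M d q r B \<and> geodesic_segment M d r p C \<and>
        dist p' q' = d p q \<and> dist q' r' = d q r \<and> dist r' p' = d r p \<longrightarrow>
        (let cmp = (\<lambda>x x'. comparison_point d p A p' q' x x' \<or>
                           comparison_point d q B q' r' x x' \<or>
                           comparison_point d r C r' p' x x')
         in \<forall>x y x' y'. cmp x x' \<and> cmp y y' \<longrightarrow> d x y \<le> dist x' y'))"

section \<open>Piecewise Euclidean polygonal complexes\<close>

text \<open>The 2-cells are given by an index set, so that different cells may a priori have the same
  boundary. The boundary of the cell \<open>c\<close> is the closed edge path through the list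
  \<open>bd c\<close> of its vertices, in cyclic order; metrically \<open>c\<close> is the convex polygon with
  vertex list \<open>shape c\<close>, the vertex \<open>bd c ! k\<close> being placed at \<open>shape c ! k\<close>.\<close>

record ('v, 'c) pe_complex =
  verts :: "'v set"
  edges :: "'v set set"
  cells :: "'c set"
  bd :: "'c \<Rightarrow> 'v list"
  elen :: "'v set \<Rightarrow> real"
  shape :: "'c \<Rightarrow> complex list"

definition nxt :: "'a list \<Rightarrow> nat \<Rightarrow> 'a" where
  "nxt xs k = xs ! (Suc k mod length xs)"

definition prv :: "'a list \<Rightarrow> nat \<Rightarrow> 'a" where
  "prv xs k = xs ! ((k + length xs - 1) mod length xs)"

definition graph_complex :: "('v, 'c) pe_complex \<Rightarrow> 'v set set" where
  "graph_complex K = (\<lambda>v. {v}) ` verts K \<union> edges K"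

definition triangles :: "('v, 'c) pe_complex \<Rightarrow> 'c set" where
  "triangles K = {c \<in> cells K. length (bd K c) = 3}"

definition pentagons :: "('v, 'c) pe_complex \<Rightarrow> 'c set" where
  "pentagons K = {c \<in> cells K. length (bd K c) = 5}"

definition triangle_pentagon_complex :: "('v, 'c) pe_complex \<Rightarrow> bool" where
  "triangle_pentagon_complex X \<longleftrightarrow>
     (\<forall>e\<in>edges X. e \<subseteq> verts X \<and> card e = 2) \<and>
     (\<forall>c\<in>cells X. length (bd X c) \<in> {3, 5} \<and> distinct (bd X c) \<and>
        (\<forall>k<length (bd X c). {bd X c ! k, nxt (bd X c) k} \<in> edges X)) \<and>
     \<not> has_full_cycle 4 (graph_complex X) \<and>
     (\<forall>c\<in>pentagons X. \<forall>k<5. \<forall>l<5. {bd X c ! k, bd X c ! l} \<in> edges X \<longrightarrow>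
        l = Suc k mod 5 \<or> k = Suc l mod 5)"

definition convex_polygon :: "complex list \<Rightarrow> bool" where
  "convex_polygon zs \<longleftrightarrow> distinct zs \<and> aff_dim (convex hull (set zs)) = 2 \<and>
     (\<forall>k<length zs. closed_segment (zs ! k) (nxt zs k) edge_of convex hull (set zs))"

definition isometric_sets :: "complex set \<Rightarrow> complex set \<Rightarrow> bool" where
  "isometric_sets A B \<longleftrightarrow> (\<exists>f. f ` A = B \<and> (\<forall>x\<in>A. \<forall>y\<in>A. dist (f x) (f y) = dist x y))"

definition cell_polygon :: "('v, 'c) pe_complex \<Rightarrow> 'c \<Rightarrow> complex set" where
  "cell_polygon K c = convex hull (set (shape K c))"

definition piecewise_euclidean :: "('v, 'c) pe_complex \<Rightarrow> bool" where
  "piecewise_euclidean K \<longleftrightarrow>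
     (\<forall>e\<in>edges K. elen K e > 0) \<and>
     (\<forall>c\<in>cells K. length (shape K c) = length (bd K c) \<and> convex_polygon (shape K c) \<and>
        (\<forall>k<length (bd K c).
           dist (shape K c ! k) (nxt (shape K c) k) = elen K {bd K c ! k, nxt (bd K c) k})) \<and>
     (\<exists>F. finite F \<and> F \<subseteq> cells K \<and>
        (\<forall>c\<in>cells K. \<exists>c'\<in>F. isometric_sets (cell_polygon K c) (cell_polygon K c')))"

subsection \<open>The length metric\<close>

text \<open>A point of the 1-skeleton is given by its barycentric coordinates; any other point lies in
  the interior of exactly one 2-cell.\<close>

datatype ('v, 'c) point = Skel "'v \<Rightarrow> real" | Inner 'c complex

definition supp :: "('v \<Rightarrow> real) \<Rightarrow> 'v set" where
  "supp b = {v. b v \<noteq> 0}"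

definition points :: "('v, 'c) pe_complex \<Rightarrow> ('v, 'c) point set" where
  "points K =
     {Skel b | b \<sigma>. \<sigma> \<in> graph_complex K \<and> supp b \<subseteq> \<sigma> \<and> (\<forall>v. b v \<ge> 0) \<and> sum b \<sigma> = 1} \<union>
     {Inner c z | c z. c \<in> cells K \<and> z \<in> interior (cell_polygon K c)}"

text \<open>\<open>in_cell K c x z\<close>: the point \<open>x\<close> lies in the closed cell \<open>c\<close>, at the
  place \<open>z\<close> of its polygon.\<close>

fun in_cell :: "('v, 'c) pe_complex \<Rightarrow> 'c \<Rightarrow> ('v, 'c) point \<Rightarrow> complex \<Rightarrow> bool" where
  "in_cell K c (Skel b) z \<longleftrightarrow>
     (\<exists>k<length (bd K c). supp b \<subseteq> {bd K c ! k, nxt (bd K c) k}) \<and>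
     z = (\<Sum>k<length (bd K c). b (bd K c ! k) *\<^sub>R (shape K c ! k))"
| "in_cell K c (Inner c' w) z \<longleftrightarrow> c' = c \<and> w = z"

text \<open>\<open>cell_dist K x y l\<close>: \<open>x\<close> and \<open>y\<close> lie in a common closed cell, in which their
  distance is \<open>l\<close>.\<close>

inductive cell_dist :: "('v, 'c) pe_complex \<Rightarrow> ('v, 'c) point \<Rightarrow> ('v, 'c) point \<Rightarrow> real \<Rightarrow> bool"
  for K where
  edge: "\<lbrakk>{u, v} \<in> edges K; supp a \<subseteq> {u, v}; supp b \<subseteq> {u, v}\<rbrakk>
    \<Longrightarrow> cell_dist K (Skel a) (Skel b) (elen K {u, v} * \<bar>a u - b u\<bar>)"
| face: "\<lbrakk>c \<in> cells K; in_cell K c x z; in_cell K c y w\<rbrakk> \<Longrightarrow> cell_dist K x y (dist z w)"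

text \<open>\<open>chain K x y l\<close>: a finite chain of segments, each contained in a closed cell, of total
  length \<open>l\<close> leads from \<open>x\<close> to \<open>y\<close>.\<close>

inductive chain :: "('v, 'c) pe_complex \<Rightarrow> ('v, 'c) point \<Rightarrow> ('v, 'c) point \<Rightarrow> real \<Rightarrow> bool"
  for K where
  refl: "x \<in> points K \<Longrightarrow> chain K x x 0"
| step: "\<lbrakk>chain K x y l; z \<in> points K; cell_dist K y z m\<rbrakk> \<Longrightarrow> chain K x z (l + m)"

text \<open>The value 0 for points that no chain connects makes the metric axioms fail if the complex
  is not connected.\<close>

definition pe_dist :: "('v, 'c) pe_complex \<Rightarrow> ('v, 'c) point \<Rightarrow> ('v, 'c) point \<Rightarrow> real" where
  "pe_dist K x y = (if \<exists>l. chain K x y l then Inf {l. chain K x y l} else 0)"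

definition cat0_complex :: "('v, 'c) pe_complex \<Rightarrow> bool" where
  "cat0_complex K \<longleftrightarrow> piecewise_euclidean K \<and> cat0_space (points K) (pe_dist K)"

subsection \<open>Angles and links\<close>

definition vec_angle :: "complex \<Rightarrow> complex \<Rightarrow> real" where
  "vec_angle x y = arccos (x \<bullet> y / (norm x * norm y))"

text \<open>The corner \<open>(c, k)\<close> of the cell \<open>c\<close> at its \<open>k\<close>-th vertex is an edge of the
  link of that vertex; the vertices of the link are the neighbours of the vertex in the graph.
  If different cells share two consecutive sides, then the link has multiple edges.\<close>

definition corners :: "('v, 'c) pe_complex \<Rightarrow> 'v \<Rightarrow> ('c \<times> nat) set" where
  "corners K v = {(c, k). c \<in> cells K \<and> k < length (bd K c) \<and> bd K c ! k = v}"

definition corner_ends :: "('v, 'c) pe_complex \<Rightarrow> 'c \<times> nat \<Rightarrow> 'v set" where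
  "corner_ends K = (\<lambda>(c, k). {nxt (bd K c) k, prv (bd K c) k})"

definition corner_angle :: "('v, 'c) pe_complex \<Rightarrow> 'c \<times> nat \<Rightarrow> real" where
  "corner_angle K = (\<lambda>(c, k).
     vec_angle (nxt (shape K c) k - shape K c ! k) (prv (shape K c) k - shape K c ! k))"

text \<open>An injective loop in the link, given by the set of link edges that it traverses. It may
  consist of two edges with the same end points.\<close>

definition link_loop :: "('v, 'c) pe_complex \<Rightarrow> 'v \<Rightarrow> ('c \<times> nat) set \<Rightarrow> bool" where
  "link_loop K v Q \<longleftrightarrow> (\<exists>us qs. length us = length qs \<and> 2 \<le> length qs \<and>
     distinct us \<and> distinct qs \<and> set qs = Q \<and> Q \<subseteq> corners K v \<and>
     (\<forall>i<length qs. corner_ends K (qs ! i) = {us ! i, nxt us i}))"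

definition angular_length :: "('v, 'c) pe_complex \<Rightarrow> ('c \<times> nat) set \<Rightarrow> real" where
  "angular_length K Q = (\<Sum>q\<in>Q. corner_angle K q)"

section \<open>The coned complex\<close>

definition pentagon_radius :: real where
  "pentagon_radius = 1 / (2 * sin (pi / 5))"

text \<open>The vertices are \<open>Inl v\<close> for the old vertices and \<open>Inr p\<close> for the centers of
  the pentagons \<open>p\<close>. The cells are \<open>Inl c\<close> for the old triangles and
  \<open>Inr (p, i)\<close> for the triangle spanned by the center of \<open>p\<close> and its \<open>i\<close>-th side.
  Placed in the plane, the latter is a central triangle of the regular pentagon with side length 1
  and center 0. Edges of \<open>X\<close> that lie on no 2-cell also get length 1.\<close>

definition star :: "('v, 'c) pe_complex \<Rightarrow> ('v + 'c, 'c + 'c \<times> nat) pe_complex" where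
  "star X = \<lparr>
     verts = Inl ` verts X \<union> Inr ` pentagons X,
     edges = (`) Inl ` edges X \<union> {{Inr p, Inl v} | p v. p \<in> pentagons X \<and> v \<in> set (bd X p)},
     cells = Inl ` triangles X \<union> Inr ` (pentagons X \<times> {..<5}),
     bd = (\<lambda>t. case t of Inl c \<Rightarrow> map Inl (bd X c)
                 | Inr (p, i) \<Rightarrow> [Inr p, Inl (bd X p ! i), Inl (nxt (bd X p) i)]),
     elen = (\<lambda>e. if e \<in> (`) Inl ` edges X then 1 else pentagon_radius),
     shape = (\<lambda>t. case t of Inl c \<Rightarrow> [0, 1, cis (pi / 3)]
                 | Inr (p, i) \<Rightarrow> [0, of_real pentagon_radius, of_real pentagon_radius * cis (2 * pi / 5)])
   \<rparr>"

text \<open>The simplicial complex underlying a complex all of whose 2-cells are triangles.\<close>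

definition simplices :: "('v, 'c) pe_complex \<Rightarrow> 'v set set" where
  "simplices K = graph_complex K \<union> (\<lambda>c. set (bd K c)) ` cells K"

definition parent_cell :: "'c + 'c \<times> nat \<Rightarrow> 'c" where
  "parent_cell t = (case t of Inl c \<Rightarrow> c | Inr (p, i) \<Rightarrow> p)"

text \<open>The corners in the coned complex, one for a triangle and two for a pentagon, into which
  a corner of the original complex is subdivided.\<close>

definition subdivided_corner ::
    "('v, 'c) pe_complex \<Rightarrow> 'c \<times> nat \<Rightarrow> (('c + 'c \<times> nat) \<times> nat) set" where
  "subdivided_corner X = (\<lambda>(c, k).
     {(t, m) \<in> corners (star X) (Inl (bd X c ! k)). parent_cell t = c})"

definition metrics_agree_at :: "('v, 'c) pe_complex \<Rightarrow> 'v \<Rightarrow> bool" where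
  "metrics_agree_at X v \<longleftrightarrow> (\<forall>Q. link_loop X v Q \<longrightarrow>
     angular_length X Q = angular_length (star X) (\<Union>q\<in>Q. subdivided_corner X q))"

end

theory Submission
  imports Defs "HOL-Library.Z2" "HOL-Library.Function_Algebras"
begin

text \<open>The link condition for \<open>X\<close>: every injective loop in a link has angular length at least
\<open>2 \<pi>\<close>, since otherwise a geodesic arriving at the vertex could be extended neither way around.
As the metrics agree at the vertices, a cycle of length at most 5 in the link of an old vertex of the
coned complex would be too short.

That every graph triangle of \<open>X\<close> bounds a 2-cell is the main point, needed for flagness. A CAT(0)
complex is contractible along geodesics, so the triangle is the boundary of a finite set of 2-cells
modulo 2: a cocycle with values in \<open>\<int>/2\<close> has local potentials, and sums to zero around the
triangle. Extending geodesics inside this filling shows that at each corner of the triangle the filling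
is a fan whose angle is at most the Euclidean comparison angle; the total is at most \<open>\<pi>\<close>.
Counting angles with the standard metric, which has the same sums at interior vertices, leaves room for
just one triangle.\<close>

section \<open>Geometry of CAT(0) spaces\<close>

text \<open>The complex need not be locally finite: infinitely many cells may meet at a point, and
  edges on no cell may be arbitrarily short. Compactness is therefore used only on finite sets of
  cells or corners, and constants valid for all cells come from the finitely many isometry types.
  The distance is an infimum over chains. Upper bounds for it are immediate; lower bounds come from
  maps of small neighbourhoods into the plane that do not stretch, and convexity of the distance
  then makes local geodesics global. Coefficients modulo 2 avoid orientations, and the filling is
  found by linear duality: if the triangle were no finite sum of cell boundaries, a functional
  separating it from them would be a cocycle that does not vanish on it. The final count is tight:
  each vertex of the triangle has at least one corner of the filling, of angle at least \<pi> / 3,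
  so a pentagon corner of 3 \<pi> / 5 or a second corner exceeds the total.\<close>

lemma comparison_triangle_exists:
 fixes a b c :: real
 assumes "0 \<le> a" "0 \<le> b" "0 \<le> c" "a \<le> b + c" "b \<le> a + c" "c \<le> a + b"
 obtains p q r :: complex where "dist p q = a" "dist q r = b" "dist r p = c"
proof (cases "a = 0")
 case True
 then have "b = c" using assms by simp
 have "dist (0::complex) 0 = a" "dist (0::complex) (of_real c) = b" "dist (of_real c) (0::complex) = c"
  using True \<open>b = c\<close> assms by (auto simp: dist_norm)
 then show ?thesis by (rule that)
next
 case False
 then have a: "a > 0" using assms by simp
 \<comment> \<open>With p = 0 and q = a, the law of cosines gives the real part x of the third
   vertex; the triangle inequalities bound it by c in absolute value.\<close>
 define x where "x = (a\<^sup>2 + c\<^sup>2 - b\<^sup>2) / (2 * a)"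
 have xa: "2 * a * x = a\<^sup>2 + c\<^sup>2 - b\<^sup>2" using a by (simp add: x_def)
 have 1: "2 * a * x \<le> 2 * a * c"
 proof -
  have "(a - c)\<^sup>2 \<le> b\<^sup>2" using assms by (intro abs_le_square_iff[THEN iffD1]) auto
  then show ?thesis unfolding xa by (simp add: power2_eq_square algebra_simps)
 qed
 have 2: "2 * a * x \<ge> - (2 * a * c)"
 proof -
  have "b\<^sup>2 \<le> (a + c)\<^sup>2" using assms by (intro power_mono) auto
  then show ?thesis unfolding xa by (simp add: power2_eq_square algebra_simps)
 qed
 have "x \<le> c" using 1 a by simp
 moreover have "- c \<le> x"
 proof -
  have "2 * a * (- c) \<le> 2 * a * x" using 2 by simp
  then show ?thesis using a by (simp only: mult_le_cancel_left_pos)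
 qed
 ultimately have "x\<^sup>2 \<le> c\<^sup>2" by (intro abs_le_square_iff[THEN iffD1]) auto
 define y where "y = sqrt (c\<^sup>2 - x\<^sup>2)"
 have y2: "y\<^sup>2 = c\<^sup>2 - x\<^sup>2" using \<open>x\<^sup>2 \<le> c\<^sup>2\<close> by (simp add: y_def)
 have A: "dist 0 (of_real a :: complex) = a" using a by (simp add: dist_norm)
 have B: "dist (of_real a) (Complex x y) = b"
 proof -
  have "(a - x)\<^sup>2 + y\<^sup>2 = b\<^sup>2" unfolding y2 using xa by (simp add: power2_eq_square algebra_simps)
  then show ?thesis using assms by (simp add: dist_norm cmod_def)
 qed
 have C: "dist (Complex x y) 0 = c"
  using y2 assms by (simp add: dist_norm cmod_def)
 show ?thesis by (rule that[OF A B C])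
qed

locale cat0 =
 fixes M :: "'a set" and d :: "'a => 'a => real"
 assumes cat0: "cat0_space M d"
begin

lemma metric: "Metric_space M d" and geodesic: "geodesic_space M d"
 using cat0 unfolding cat0_space_def geodesic_space_def by auto

lemma nonneg [simp]: "0 \<le> d x y"
 and sym: "d x y = d y x"
 and zero_iff: "x \<in> M ==> y \<in> M ==> d x y = 0 \<longleftrightarrow> x = y"
 and self_zero [simp]: "x \<in> M ==> d x x = 0"
 and tri: "x \<in> M ==> y \<in> M ==> z \<in> M ==> d x z \<le> d x y + d y z"
 using metric unfolding Metric_space_def by auto

lemma geodesic_ex: "p \<in> M ==> q \<in> M ==> \<exists>S. geodesic_segment M d p q S"
 using geodesic unfolding geodesic_space_def by auto

text \<open>Two geodesics meeting at x concatenate to a geodesic if the triangle inequality at x is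
  an equality. The comparison axiom speaks of given segments, so this is how a point known only by
  its distances enters it.\<close>

lemma geodesic_through:
 assumes "p \<in> M" "q \<in> M" "x \<in> M" "d p x + d x q = d p q"
 obtains S where "geodesic_segment M d p q S" "x \<in> S"
proof -
 have ex: "\<exists>f. f 0 = u \<and> f (d u v) = v \<and> f ` {0..d u v} \<subseteq> M \<and>
   (\<forall>s\<in>{0..d u v}. \<forall>t\<in>{0..d u v}. d (f s) (f t) = \<bar>s - t\<bar>)" if "u \<in> M" "v \<in> M" for u v
  using geodesic_ex[OF that] unfolding geodesic_segment_def by auto
 obtain f where f: "f 0 = p" "f (d p x) = x" "f ` {0..d p x} \<subseteq> M"
   "\<forall>s\<in>{0..d p x}. \<forall>t\<in>{0..d p x}. d (f s) (f t) = \<bar>s - t\<bar>"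
  using ex[of p x] assms by auto
 obtain g where g: "g 0 = x" "g (d x q) = q" "g ` {0..d x q} \<subseteq> M"
   "\<forall>s\<in>{0..d x q}. \<forall>t\<in>{0..d x q}. d (g s) (g t) = \<bar>s - t\<bar>"
  using ex[of x q] assms by auto
 define h where "h t = (if t \<le> d p x then f t else g (t - d p x))" for t
 have hM: "h t \<in> M" if "0 \<le> t" "t \<le> d p q" for t
  using that f(3) g(3) assms(4) unfolding h_def by (auto simp: image_subset_iff)
 \<comment> \<open>The pieces from p to \<open>f s\<close>, from \<open>f s\<close> to
   \<open>g t\<close> and from \<open>g t\<close> to q have total length at least
   \<open>d p q\<close>, which leaves no slack for the middle one.\<close>
 have mixed: "d (f s) (g t) = d p x + t - s"
  if s: "0 \<le> s" "s \<le> d p x" and t: "0 \<le> t" "t \<le> d x q" for s t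
 proof -
  have M: "f s \<in> M" "g t \<in> M" using f(3) g(3) s t by (auto simp: image_subset_iff)
  have "d (f s) x = d p x - s" using f(2,4) s by (metis abs_of_nonneg abs_minus_commute atLeastAtMost_iff
    diff_ge_0_iff_ge dual_order.refl nonneg)
  moreover have "d x (g t) = t" using g(1,4) t by (metis abs_of_nonneg abs_minus_commute atLeastAtMost_iff
    diff_zero dual_order.refl nonneg)
  moreover have "d p (f s) = s" using f(1,4) s by (metis abs_of_nonneg abs_minus_commute atLeastAtMost_iff
    diff_zero dual_order.refl nonneg)
  moreover have "d (g t) q = d x q - t" using g(2,4) t by (metis abs_of_nonneg abs_minus_commute atLeastAtMost_iff
    diff_ge_0_iff_ge dual_order.refl nonneg)
  moreover have "d p q \<le> d p (f s) + d (f s) (g t) + d (g t) q"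
   using tri[of p "f s" q] tri[of "f s" "g t" q] M assms by auto
  moreover have "d (f s) (g t) \<le> d (f s) x + d x (g t)" using tri M assms by auto
  ultimately show ?thesis using assms(4) by linarith
 qed
 have "geodesic_segment M d p q (h ` {0..d p q})"
  unfolding geodesic_segment_def
 proof (intro exI[of _ h] conjI ballI)
  show "h 0 = p" using f(1) by (simp add: h_def)
  show "h (d p q) = q" using f(2) g(1,2) assms zero_iff[of x q] unfolding h_def
   by (auto simp flip: assms(4) simp: add_increasing2 dest: antisym)
  show "h ` {0..d p q} \<subseteq> M" using hM by auto
  fix s t assume st: "s \<in> {0..d p q}" "t \<in> {0..d p q}"
  consider "s \<le> d p x" "t \<le> d p x" | "s \<le> d p x" "t > d p x" | "s > d p x" "t \<le> d p x"
   | "s > d p x" "t > d p x" by linarith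
  then show "d (h s) (h t) = \<bar>s - t\<bar>"
  proof cases
   case 1 then show ?thesis using st f(4) by (simp add: h_def)
  next
   case 2 then show ?thesis using st mixed[of s "t - d p x"] assms(4) by (simp add: h_def)
  next
   case 3 then show ?thesis using st mixed[of t "s - d p x"] assms(4) sym[of "h s" "h t"] by (simp add: h_def)
  next
   case 4 then show ?thesis using st g(4) assms(4) by (simp add: h_def)
  qed
 qed simp
 moreover have "x \<in> h ` {0..d p q}"
 proof (intro image_eqI[of _ _ "d p x"])
  show "x = h (d p x)" using f(2) by (simp add: h_def)
  show "d p x \<in> {0..d p q}" using assms(4) nonneg[of p x] nonneg[of x q] unfolding atLeastAtMost_iff by linarith
 qed
 ultimately show ?thesis by (rule that)
qed

lemma geodesic_ends:
 assumes "p \<in> M" "q \<in> M"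
 obtains S where "geodesic_segment M d p q S" "p \<in> S" "q \<in> S"
proof -
 obtain S where S: "geodesic_segment M d p q S"
  using geodesic_ex[of p q] assms by auto
 then obtain f where "f 0 = p" "f (d p q) = q" "S = f ` {0..d p q}"
  unfolding geodesic_segment_def by auto
 then have "p \<in> S" "q \<in> S"
  using nonneg[of p q] by (metis atLeastAtMost_iff image_eqI order_refl)+
 with S show ?thesis by (rule that)
qed

lemma geodesic_point:
 assumes "p \<in> M" "q \<in> M" "0 \<le> t" "t \<le> d p q"
 obtains x where "x \<in> M" "d p x = t" "d x q = d p q - t"
proof -
 obtain f where f: "f 0 = p" "f (d p q) = q" "f ` {0..d p q} \<subseteq> M"
   "\<forall>s\<in>{0..d p q}. \<forall>t\<in>{0..d p q}. d (f s) (f t) = \<bar>s - t\<bar>"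
  using geodesic_ex[OF assms(1,2)] unfolding geodesic_segment_def by auto
 show ?thesis
 proof (rule that[of "f t"])
  show "f t \<in> M" using f(3) assms by auto
  show "d p (f t) = t" using f(1,4) assms by (metis abs_of_nonneg abs_minus_commute atLeastAtMost_iff
    diff_zero dual_order.refl nonneg)
  show "d (f t) q = d p q - t" using f(2,4) assms by (metis abs_of_nonneg abs_minus_commute atLeastAtMost_iff
    diff_ge_0_iff_ge dual_order.refl nonneg)
 qed
qed

lemma comparison:
 assumes "p \<in> M" "q \<in> M" "r \<in> M"
  and "geodesic_segment M d p q A" "geodesic_segment M d q r B" "geodesic_segment M d r p C"
  and "dist p' q' = d p q" "dist q' r' = d q r" "dist r' p' = d r p"
  and "comparison_point d p A p' q' x x' \<or> comparison_point d q B q' r' x x' \<or>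
   comparison_point d r C r' p' x x'"
  and "comparison_point d p A p' q' y y' \<or> comparison_point d q B q' r' y y' \<or>
   comparison_point d r C r' p' y y'"
 shows "d x y \<le> dist x' y'"
proof -
 note * = cat0[unfolded cat0_space_def Let_def, THEN conjunct2, THEN bspec, OF assms(1), THEN bspec,
  OF assms(2), THEN bspec, OF assms(3), rule_format, of A B C p' q' r' x x' y y']
 show ?thesis by (rule *) (use assms in simp_all)
qed

text \<open>The comparison points divide two sides of a Euclidean triangle in the same ratio, so
  they are exactly t times the third side apart.\<close>

lemma contraction:
 assumes M: "p \<in> M" "q \<in> M" "r \<in> M" "x \<in> M" "y \<in> M" and t: "0 \<le> t" "t \<le> 1"
  and x: "d p x = t * d p q" "d x q = (1 - t) * d p q"
  and y: "d p y = t * d p r" "d y r = (1 - t) * d p r"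
 shows "d x y \<le> t * d q r"
proof -
 have "d p x + d x q = d p q" using x by (simp add: algebra_simps)
 then obtain A where A: "geodesic_segment M d p q A" "x \<in> A" using geodesic_through M by metis
 have "d r y + d y p = d r p" using y sym by (simp add: algebra_simps)
 then obtain C where C: "geodesic_segment M d r p C" "y \<in> C" using geodesic_through M by metis
 obtain B where B: "geodesic_segment M d q r B" using geodesic_ends M by metis
 obtain p' q' r' :: complex where T: "dist p' q' = d p q" "dist q' r' = d q r" "dist r' p' = d r p"
  by (rule comparison_triangle_exists[of "d p q" "d q r" "d r p"])
   (use tri[of p r q] tri[of q p r] tri[of r q p] M in \<open>simp_all add: sym[of q p] sym[of r q] sym[of r p] add.commute\<close>)
 let ?x = "p' + of_real t * (q' - p')" and ?y = "p' + of_real t * (r' - p')"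
 have seg: "p' + of_real t * (w - p') \<in> closed_segment p' w" for w
  unfolding closed_segment_def using t
  by (auto intro!: exI[of _ t] simp: algebra_simps scaleR_conv_of_real)
 have "comparison_point d p A p' q' x ?x"
  unfolding comparison_point_def using A seg x t T by (auto simp: dist_norm norm_mult norm_minus_commute)
 moreover have "comparison_point d r C r' p' y ?y"
 proof -
  have "?y - r' = of_real (1 - t) * (p' - r')" by (simp add: algebra_simps)
  then have "norm (?y - r') = (1 - t) * norm (p' - r')"
   using t by (simp only: norm_mult norm_of_real)
  then have "dist r' ?y = (1 - t) * dist r' p'"
   by (simp only: dist_norm norm_minus_commute[of r'])
  then show ?thesis
   unfolding comparison_point_def using C seg y T
   by (auto simp: closed_segment_commute[of r' p'] sym[of r])
 qed
 ultimately have "d x y \<le> dist ?x ?y"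
  using comparison[OF M(1-3) A(1) B C(1) T] by blast
 also have "\<dots> = t * dist q' r'"
 proof -
  have "?x - ?y = of_real t * (q' - r')" by (simp add: algebra_simps)
  then show ?thesis using t by (simp add: dist_norm norm_mult)
 qed
 finally show ?thesis using T by simp
qed

text \<open>The vertex a is an end of a side, hence its own comparison point. So the distance to x
  is at most the Euclidean one, and a norm is convex.\<close>

lemma convexity:
 assumes M: "p \<in> M" "q \<in> M" "a \<in> M" "x \<in> M" and t: "0 \<le> t" "t \<le> 1"
  and x: "d p x = t * d p q" "d x q = (1 - t) * d p q"
 shows "d a x \<le> (1 - t) * d a p + t * d a q"
proof -
 have "d p x + d x q = d p q" using x by (simp add: algebra_simps)
 then obtain A where A: "geodesic_segment M d p q A" "x \<in> A" using geodesic_through M by metis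
 obtain B where B: "geodesic_segment M d q a B" "a \<in> B" using geodesic_ends M by metis
 obtain C where C: "geodesic_segment M d a p C" using geodesic_ends M by metis
 obtain p' q' a' :: complex where T: "dist p' q' = d p q" "dist q' a' = d q a" "dist a' p' = d a p"
  by (rule comparison_triangle_exists[of "d p q" "d q a" "d a p"])
   (use tri[of p a q] tri[of q p a] tri[of a q p] M in \<open>simp_all add: sym[of q p] sym[of a q] sym[of a p] add.commute\<close>)
 let ?x = "p' + of_real t * (q' - p')"
 have seg: "?x \<in> closed_segment p' q'"
  unfolding closed_segment_def using t
  by (auto intro!: exI[of _ t] simp: algebra_simps scaleR_conv_of_real)
 have "comparison_point d p A p' q' x ?x"
  unfolding comparison_point_def using A seg x t T by (auto simp: dist_norm norm_mult norm_minus_commute)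
 moreover have "comparison_point d q B q' a' a a'"
  unfolding comparison_point_def using B T by auto
 ultimately have "d x a \<le> dist ?x a'"
  using comparison[OF M(1-3) A(1) B(1) C T] by blast
 also have "\<dots> = norm (of_real (1 - t) * (p' - a') + of_real t * (q' - a'))"
  by (simp add: dist_norm algebra_simps)
 also have "\<dots> \<le> norm (of_real (1 - t) * (p' - a')) + norm (of_real t * (q' - a'))"
  by (rule norm_triangle_ineq)
 also have "\<dots> = (1 - t) * dist a' p' + t * dist q' a'"
  using t by (simp only: norm_mult norm_of_real dist_norm norm_minus_commute[of p' a'] abs_of_nonneg diff_ge_0_iff_ge)
 finally show ?thesis using T sym by metis
qed

text \<open>\<open>contraction\<close> for the degenerate triangle p, q, q: points at the same
  parameter are at distance at most a multiple of \<open>d q q\<close>.\<close>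

lemma geodesic_unique:
 assumes "p \<in> M" "q \<in> M" "x \<in> M" "y \<in> M" "d p x + d x q = d p q" "d p y + d y q = d p q" "d p x = d p y"
 shows "x = y"
proof (cases "d p q = 0")
 case True
 then have "d p x = 0" "d p y = 0" using assms nonneg[of p x] nonneg[of x q] nonneg[of p y] nonneg[of y q] by linarith+
 then show ?thesis using assms zero_iff by metis
next
 case False
 then have pos: "d p q > 0" using nonneg[of p q] by linarith
 let ?t = "d p x / d p q"
 have "d x y \<le> ?t * d q q"
 proof (rule contraction[of p])
  show "?t \<le> 1" using assms(5) pos nonneg[of x q] by (simp del: nonneg)
  have e: "(1 - ?t) * d p q = d p q - d p x" using pos by (simp add: field_simps)
  show "d x q = (1 - ?t) * d p q" "d y q = (1 - ?t) * d p q" unfolding e using assms(5,6,7) by linarith+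
 qed (use assms pos in auto)
 then show ?thesis using assms zero_iff[of x y] nonneg[of x y] by simp
qed

text \<open>The convex function \<open>d a\<close> grows at unit rate on the geodesic from b to c,
  hence at least at unit rate beyond c. The overlap from b to c must not degenerate, since a bend at
  b = c would go unnoticed.\<close>

lemma convex_extension:
 assumes M: "a \<in> M" "b \<in> M" "c \<in> M" "e \<in> M"
  and abc: "d a b + d b c = d a c" and bce: "d b c + d c e = d b e" and "b \<noteq> c"
 shows "d a c + d c e = d a e"
proof -
 have bc: "d b c > 0" using zero_iff[of b c] nonneg[of b c] assms by linarith
 then have be: "d b e > 0" using bce nonneg[of c e] by linarith
 let ?t = "d b c / d b e"
 have e: "(1 - ?t) * d b e = d c e"
 proof -
  have "(1 - ?t) * d b e = d b e - d b c" using be by (simp add: left_diff_distrib)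
  then show ?thesis using bce by simp
 qed
 have "d a c \<le> (1 - ?t) * d a b + ?t * d a e"
  by (rule convexity) (use M be e bce nonneg[of c e] in \<open>auto simp del: nonneg\<close>, simp)
 then have "d a c * d b e \<le> ((1 - ?t) * d a b + ?t * d a e) * d b e"
  using be by (intro mult_right_mono) auto
 also have "\<dots> = ((1 - ?t) * d b e) * d a b + (?t * d b e) * d a e" by (simp add: algebra_simps)
 also have "\<dots> = d c e * d a b + d b c * d a e" unfolding e using be by simp
 finally have "(d a b + d b c) * (d b c + d c e) \<le> d c e * d a b + d b c * d a e"
  using abc bce by simp
 then have "d b c * (d a b + d b c + d c e) \<le> d b c * d a e" by (simp add: algebra_simps)
 then have "d a c + d c e \<le> d a e" using bc abc by simp
 then show ?thesis using tri[of a c e] M by linarith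
qed

text \<open>Among the times up to which the curve is isometric there is a last one, and
  \<open>convex_extension\<close> would carry it further. As \<open>lip\<close> bounds distances
  from above, \<open>loc\<close> only asks for lower bounds.\<close>

lemma local_geodesic:
 assumes L: "0 \<le> L" and M: "\<And>s. s \<in> {0..L} ==> c s \<in> M"
  and lip: "\<And>s t. s \<in> {0..L} ==> t \<in> {0..L} ==> s \<le> t ==> d (c s) (c t) \<le> t - s"
  and loc: "\<And>t. 0 < t ==> t < L ==> \<exists>\<epsilon>>0. \<forall>s s'. t - \<epsilon> < s --> s < t --> t < s' --> s' < t + \<epsilon> -->
    0 \<le> s --> s' \<le> L --> s' - s \<le> d (c s) (c s')"
 shows "d (c 0) (c L) = L"
proof (cases "L = 0")
 case True then show ?thesis using M by simp
next
 case False
 then have Lp: "0 < L" using L by simp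
 \<comment> \<open>The argument starts at an interior time s, because \<open>loc\<close> says
   nothing about the end 0; afterwards s tends to 0.\<close>
 have fwd: "d (c s) (c L) = L - s" if s: "0 < s" "s < L" for s
 proof -
  define G where "G = {t \<in> {s..L}. d (c s) (c t) = t - s}"
  have sG: "s \<in> G" using s M by (auto simp: G_def)
  have bdd: "bdd_above G" by (auto simp: G_def)
  define T where "T = Sup G"
  have T: "s \<le> T" "T \<le> L" using sG bdd unfolding T_def
   by (auto intro!: cSup_upper cSup_least simp: G_def)
  have TG: "d (c s) (c T) = T - s"
  proof (rule ccontr)
   assume ne: "d (c s) (c T) \<noteq> T - s"
   then have lt: "d (c s) (c T) < T - s" using lip[of s T] s T by auto
   define \<delta> where "\<delta> = (T - s - d (c s) (c T)) / 2"
   have "T - \<delta> < T" using lt by (simp add: \<delta>_def)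
   then obtain t where t: "t \<in> G" "T - \<delta> < t" using less_cSupD[of G "T - \<delta>"] sG unfolding T_def by auto
   have "t \<le> T" using t bdd unfolding T_def by (intro cSup_upper)
   have "t - s = d (c s) (c t)" using t by (simp add: G_def)
   also have "\<dots> \<le> d (c s) (c T) + d (c T) (c t)" using t s T M by (intro tri) (auto simp: G_def)
   also have "d (c T) (c t) \<le> T - t" using lip[of t T] t \<open>t \<le> T\<close> s T sym[of "c t"] by (auto simp: G_def)
   finally show False using t(2) unfolding \<delta>_def by (simp add: field_simps)
  qed
  have "T = L"
  proof (rule ccontr)
   assume "T \<noteq> L"
   then have TL: "0 < T" "T < L" using T s by auto
   obtain \<epsilon> where e: "\<epsilon> > 0" "\<forall>s s'. T - \<epsilon> < s --> s < T --> T < s' --> s' < T + \<epsilon> -->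
    0 \<le> s --> s' \<le> L --> s' - s \<le> d (c s) (c s')" using loc[OF TL] by blast
   define s' where "s' = min L (T + \<epsilon> / 2)"
   have s': "T < s'" "s' < T + \<epsilon>" "s' \<le> L" using e TL by (auto simp: s'_def)
   \<comment> \<open>r lies before T but not before s, so that \<open>c r\<close> is on the part
     already known to be geodesic. If T = s there is no such time, and r is only kept
     nonnegative.\<close>
   define r where "r = max (T - \<epsilon> / 2) (if T = s then 0 else s)"
   have r: "T - \<epsilon> < r" "r < T" "0 \<le> r" "T \<noteq> s ==> s \<le> r" using e TL T s by (auto simp: r_def)
   have rs': "s' - r \<le> d (c r) (c s')" using e r s' by blast
   have inM: "c r \<in> M" "c T \<in> M" "c s' \<in> M" "c s \<in> M" using M r s' TL s by auto
   have l: "d (c r) (c T) \<le> T - r" "d (c T) (c s') \<le> s' - T" using lip r s' TL by auto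
   have tr: "d (c r) (c s') \<le> d (c r) (c T) + d (c T) (c s')" using tri inM by auto
   have ex: "d (c r) (c T) = T - r" "d (c T) (c s') = s' - T" "d (c r) (c s') = s' - r"
    using l tr rs' by linarith+
   have "d (c s) (c s') = s' - s"
   proof (cases "T = s")
    case True then show ?thesis using ex by simp
   next
    case False
    have "d (c s) (c r) \<le> r - s" using lip r False s TL by auto
    moreover have "d (c s) (c T) \<le> d (c s) (c r) + d (c r) (c T)" using tri inM by auto
    ultimately have "d (c s) (c r) + d (c r) (c T) = d (c s) (c T)" using TG ex by linarith
    moreover have "c r \<noteq> c T" using ex r inM by auto
    ultimately have "d (c s) (c T) + d (c T) (c s') = d (c s) (c s')"
     using convex_extension[of "c s" "c r" "c T" "c s'"] inM ex by auto
    then show ?thesis using TG ex by simp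
   qed
   then have "s' \<in> G" using s' T by (auto simp: G_def)
   then have "s' \<le> T" unfolding T_def using bdd by (intro cSup_upper)
   then show False using s' by simp
  qed
  then show ?thesis using TG by simp
 qed
 have "L \<le> d (c 0) (c L) + 2 * e" if "e > 0" for e
 proof -
  define s where "s = min e (L / 2)"
  have s: "0 < s" "s < L" "s \<le> e" using that Lp by (auto simp: s_def)
  have "d (c s) (c L) \<le> d (c s) (c 0) + d (c 0) (c L)" using M s by (intro tri) auto
  moreover have "d (c s) (c 0) \<le> s" using lip[of 0 s] s sym[of "c 0"] by auto
  ultimately show ?thesis using fwd[of s] s by linarith
 qed
 then have "L \<le> d (c 0) (c L)" using field_le_epsilon[of L "d (c 0) (c L)"]
  by (metis field_sum_of_halves mult_2 half_gt_zero)
 then show ?thesis using lip[of 0 L] Lp by auto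
qed

end

section \<open>Angles and convex polygons in the plane\<close>

text \<open>Twice the signed area of the triangle a, b, c: positive if they run counterclockwise,
  zero if they are collinear.\<close>

definition crs :: "complex => complex => complex => real" where
 "crs a b c = Im (cnj (b - a) * (c - a))"

lemma crs_alt: "crs a b c = Re (b - a) * Im (c - a) - Im (b - a) * Re (c - a)"
 by (simp add: crs_def algebra_simps)

lemma crs_rotate: "crs a b c = crs b c a"
 by (simp add: crs_alt algebra_simps)

lemma crs_swap: "crs b a c = - crs a b c"
 by (simp add: crs_alt algebra_simps)

lemma cnj_mult_rotate: "cnj u * (of_real r * u * w) = of_real (r * (norm u)\<^sup>2) * w"
proof -
 have "cnj u * (of_real r * u * w) = of_real r * (u * cnj u) * w" by (simp add: mult_ac)
 then show ?thesis by (simp only: complex_norm_square[symmetric] of_real_mult)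
qed

lemma vec_angle_cis:
 assumes "u \<noteq> 0" "0 < r" "0 \<le> \<theta>" "\<theta> \<le> pi"
 shows "vec_angle u (of_real r * u * cis \<theta>) = \<theta>"
proof -
 have "(u \<bullet> (of_real r * u * cis \<theta>)) = Re (cnj u * (of_real r * u * cis \<theta>))"
  by (simp add: inner_complex_def)
 also have "cnj u * (of_real r * u * cis \<theta>) = of_real (r * (norm u)\<^sup>2) * cis \<theta>"
  by (rule cnj_mult_rotate)
 also have "Re \<dots> = r * (norm u)\<^sup>2 * cos \<theta>" by simp
 finally have "u \<bullet> (of_real r * u * cis \<theta>) = r * (norm u)\<^sup>2 * cos \<theta>" .
 then show ?thesis
  unfolding vec_angle_def using assms
  by (simp add: norm_mult power2_eq_square field_simps arccos_cos)
qed

lemma Im_cnj_cis: "Im (cnj u * (of_real r * u * cis \<theta>)) = r * (norm u)\<^sup>2 * sin \<theta>"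
 unfolding cnj_mult_rotate by simp

text \<open>Links the unoriented \<open>vec_angle\<close> with rotations: on the closed left side of
  u it is the argument of w / u, so that angles are added by multiplying values of
  \<open>cis\<close>.\<close>

lemma polar_relative:
 assumes "u \<noteq> 0" "w \<noteq> 0" "0 \<le> Im (cnj u * w)"
 obtains r \<theta> where "0 < r" "0 \<le> \<theta>" "\<theta> \<le> pi" "w = of_real r * u * cis \<theta>" "vec_angle u w = \<theta>"
  "Im (cnj u * w) = norm u * norm w * sin \<theta>"
proof -
 define q where "q = w / u"
 have q: "q \<noteq> 0" "w = q * u" using assms by (auto simp: q_def)
 have e: "Im (cnj u * w) = (norm u)\<^sup>2 * Im q"
 proof -
  have "cnj u * w = of_real ((norm u)\<^sup>2) * q" using cnj_mult_rotate[of u 1 q] q(2) by (simp add: mult_ac)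
  then show ?thesis by simp
 qed
 have "0 \<le> Im q" using assms(1,3) unfolding e by (simp add: zero_le_mult_iff)
 then have A: "0 \<le> Arg q" using Arg_less_0[of q] by linarith
 have w: "w = of_real (norm q) * u * cis (Arg q)"
  using q(2) by (metis mult.commute mult.left_commute rcis_cmod_Arg rcis_def)
 show ?thesis
 proof (rule that[of "norm q" "Arg q"])
  show "vec_angle u w = Arg q" unfolding w using A assms Arg_le_pi[of q] q by (intro vec_angle_cis) auto
  have "Im (cnj u * w) = norm q * (norm u)\<^sup>2 * sin (Arg q)" unfolding w by (rule Im_cnj_cis)
  also have "\<dots> = norm u * norm w * sin (Arg q)" using q by (simp add: norm_mult power2_eq_square)
  finally show "Im (cnj u * w) = norm u * norm w * sin (Arg q)" .
 qed (use q A w Arg_le_pi in auto)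
qed

lemma vec_angle_commute: "vec_angle u w = vec_angle w u"
 by (simp add: vec_angle_def inner_commute mult.commute)

lemma vec_angle_cnj: "vec_angle (cnj u) (cnj w) = vec_angle u w"
 by (simp add: vec_angle_def inner_complex_def)

lemma vec_angle_bounds: "0 \<le> vec_angle u w" "vec_angle u w \<le> pi"
proof -
 have "\<bar>u \<bullet> w / (norm u * norm w)\<bar> \<le> 1"
  using Cauchy_Schwarz_ineq2[of u w] by (cases "u = 0 \<or> w = 0") (auto simp: abs_mult divide_le_eq)
 then have "- 1 \<le> u \<bullet> w / (norm u * norm w)" "u \<bullet> w / (norm u * norm w) \<le> 1" by linarith+
 then show "0 \<le> vec_angle u w" "vec_angle u w \<le> pi"
  unfolding vec_angle_def by (auto intro: arccos_lbound arccos_ubound)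
qed

text \<open>The arguments add up to some \<alpha> + \<beta> in [0, 2 \<pi>]. The third sign
  condition makes the sine of the sum positive, so the sum is at most \<pi> and is again an
  unoriented angle.\<close>

lemma vec_angle_add:
 assumes "0 < Im (cnj u * v)" "0 < Im (cnj v * w)" "0 < Im (cnj u * w)"
 shows "vec_angle u w = vec_angle u v + vec_angle v w"
proof -
 have nz: "u \<noteq> 0" "v \<noteq> 0" "w \<noteq> 0" using assms by auto
 obtain r \<alpha> where v: "0 < r" "0 \<le> \<alpha>" "\<alpha> \<le> pi" "v = of_real r * u * cis \<alpha>" "vec_angle u v = \<alpha>"
  using polar_relative[of u v] nz assms by (metis less_imp_le)
 obtain r' \<beta> where w: "0 < r'" "0 \<le> \<beta>" "\<beta> \<le> pi" "w = of_real r' * v * cis \<beta>" "vec_angle v w = \<beta>"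
  using polar_relative[of v w] nz assms by (metis less_imp_le)
 have weq: "w = of_real (r * r') * u * cis (\<alpha> + \<beta>)"
  unfolding w(4) v(4) by (simp add: cis_mult mult_ac flip: cis_mult)
 have "0 < (r * r') * (norm u)\<^sup>2 * sin (\<alpha> + \<beta>)"
  using assms(3) unfolding weq Im_cnj_cis .
 moreover have "0 < (r * r') * (norm u)\<^sup>2" using v(1) w(1) nz(1) by simp
 ultimately have sp: "0 < sin (\<alpha> + \<beta>)" using zero_less_mult_pos by blast
 have "\<alpha> + \<beta> \<le> pi"
 proof (rule ccontr)
  assume "\<not> \<alpha> + \<beta> \<le> pi"
  then have "0 \<le> sin (\<alpha> + \<beta> - pi)" using v w by (intro sin_ge_zero) auto
  then show False using sp by simp
 qed
 then have "vec_angle u w = \<alpha> + \<beta>"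
  unfolding weq using v w nz by (intro vec_angle_cis) auto
 then show ?thesis using v w by simp
qed

lemma crs_degenerate [simp]: "crs a a b = 0" "crs a b b = 0" "crs a b a = 0"
 by (simp_all add: crs_alt)

text \<open>Multiplying the rotations at the three corners turns the product of the sides into its
  negative, so the angle sum is an odd multiple of \<pi>; lying in [0, 3 \<pi>], it is \<pi> or 3
  \<pi>.\<close>

lemma triangle_angle_sum_ccw:
 assumes "a \<noteq> b" "b \<noteq> c" "c \<noteq> a" "0 \<le> crs a b c"
 shows "vec_angle (b - a) (c - a) + vec_angle (c - b) (a - b) + vec_angle (a - c) (b - c) = pi"
proof -
 have cr: "0 \<le> crs b c a" "0 \<le> crs c a b" using assms(4) crs_rotate by metis+
 obtain r \<alpha> where 1: "0 < r" "0 \<le> \<alpha>" "\<alpha> \<le> pi" "c - a = of_real r * (b - a) * cis \<alpha>"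
   "vec_angle (b - a) (c - a) = \<alpha>"
  by (rule polar_relative[of "b - a" "c - a"]) (use assms in \<open>auto simp: crs_def\<close>)
 obtain s \<beta> where 2: "0 < s" "0 \<le> \<beta>" "\<beta> \<le> pi" "a - b = of_real s * (c - b) * cis \<beta>"
   "vec_angle (c - b) (a - b) = \<beta>"
  by (rule polar_relative[of "c - b" "a - b"]) (use assms cr in \<open>auto simp: crs_def\<close>)
 obtain t \<gamma> where 3: "0 < t" "0 \<le> \<gamma>" "\<gamma> \<le> pi" "b - c = of_real t * (a - c) * cis \<gamma>"
   "vec_angle (a - c) (b - c) = \<gamma>"
  by (rule polar_relative[of "a - c" "b - c"]) (use assms cr in \<open>auto simp: crs_def\<close>)
 have "(c - a) * (a - b) * (b - c) =
   (of_real r * (b - a) * cis \<alpha>) * (of_real s * (c - b) * cis \<beta>) * (of_real t * (a - c) * cis \<gamma>)"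
  using 1(4) 2(4) 3(4) by simp
 also have "\<dots> = - ((c - a) * (a - b) * (b - c)) * (of_real (r * s * t) * (cis \<alpha> * cis \<beta> * cis \<gamma>))"
  by (simp add: algebra_simps)
 finally have prod: "(c - a) * (a - b) * (b - c) = - ((c - a) * (a - b) * (b - c)) * (of_real (r * s * t) * (cis \<alpha> * cis \<beta> * cis \<gamma>))" .
 have "- 1 = of_real (r * s * t) * cis (\<alpha> + \<beta> + \<gamma>)"
 proof -
  have nz: "(c - a) * (a - b) * (b - c) \<noteq> 0" using assms by simp
  have cancel: "- 1 = y" if "x \<noteq> 0" "x = - x * y" for x y :: complex
  proof -
   have "x * (1 + y) = x - (- x * y)" by (simp add: algebra_simps)
   also have "\<dots> = 0" using that(2) by simp
   finally have "1 + y = 0" using that(1) by simp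
   then show ?thesis by (metis add_eq_0_iff)
  qed
  from cancel[OF nz prod] show ?thesis by (simp only: cis_mult)
 qed
 moreover have "r * s * t = 1"
  using arg_cong[OF calculation, of norm] 1 2 3 by (simp add: norm_mult)
 ultimately have "cis (\<alpha> + \<beta> + \<gamma>) = - 1" by simp
 then have "cos (\<alpha> + \<beta> + \<gamma>) = - 1" by (metis cis.sel(1) one_complex.sel(1) uminus_complex.sel(1))
 then obtain n :: int where n: "\<alpha> + \<beta> + \<gamma> = (2 * of_int n + 1) * pi"
  unfolding cos_eq_minus1 by (auto simp: algebra_simps)
 have "0 \<le> (2 * real_of_int n + 1) * pi" "(2 * real_of_int n + 1) * pi \<le> 3 * pi"
  using n 1 2 3 by linarith+
 then have "0 \<le> 2 * real_of_int n + 1" "2 * real_of_int n + 1 \<le> 3"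
  using pi_gt_zero by (simp_all add: zero_le_mult_iff)
 then have "n = 0 \<or> n = 1" by linarith
 \<comment> \<open>With angles \<pi> at a and b, c - a is a negative multiple of b - a, and a - b
   one of c - b; composing the two makes a - b a positive multiple of b - a.\<close>
 moreover have "n \<noteq> 1"
 proof
  assume "n = 1"
  then have "\<alpha> + \<beta> + \<gamma> = 3 * pi" using n by simp
  then have "\<alpha> = pi" "\<beta> = pi" using 1 2 3 by linarith+
  then have ca: "c - a = - of_real r * (b - a)" and ab: "a - b = - of_real s * (c - b)"
   using 1(4) 2(4) by simp_all
  have "c - b = (c - a) - (b - a)" by simp
  then have "c - b = - of_real (r + 1) * (b - a)" unfolding ca by (simp add: algebra_simps)
  then have "a - b = - of_real s * (- of_real (r + 1) * (b - a))" using ab by simp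
  then have "of_real (s * (r + 1) + 1) * (b - a) = 0" by (simp add: algebra_simps)
  moreover have "s * (r + 1) + 1 > 0" using 1 2 by (simp add: add_pos_pos)
  ultimately show False using assms(1) by (metis eq_iff_diff_eq_0 mult_eq_0_iff of_real_eq_0_iff less_irrefl)
 qed
 ultimately show ?thesis using n 1 2 3 by simp
qed

lemma triangle_angle_sum:
 assumes "a \<noteq> b" "b \<noteq> c" "c \<noteq> a"
 shows "vec_angle (b - a) (c - a) + vec_angle (c - b) (a - b) + vec_angle (a - c) (b - c) = pi"
proof (cases "0 \<le> crs a b c")
 case True then show ?thesis using triangle_angle_sum_ccw assms by blast
next
 case False
 then have "0 \<le> crs a c b" using crs_swap[of a c b] crs_rotate[of a b c] crs_rotate[of b c a] by linarith
 then show ?thesis using triangle_angle_sum_ccw[of a c b] assms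
  by (simp add: vec_angle_commute add_ac)
qed

lemma vec_angle_law_of_cosines:
 assumes "a \<noteq> b" "a \<noteq> c"
 shows "cos (vec_angle (b - a) (c - a)) =
  ((dist a b)\<^sup>2 + (dist a c)\<^sup>2 - (dist b c)\<^sup>2) / (2 * dist a b * dist a c)"
proof -
 let ?u = "b - a" and ?w = "c - a"
 have "\<bar>?u \<bullet> ?w / (norm ?u * norm ?w)\<bar> \<le> 1"
  using Cauchy_Schwarz_ineq2[of ?u ?w] assms by (auto simp: abs_mult divide_le_eq)
 then have "cos (vec_angle ?u ?w) = ?u \<bullet> ?w / (norm ?u * norm ?w)"
  unfolding vec_angle_def by (intro cos_arccos_abs)
 moreover have "(dist b c)\<^sup>2 = (norm ?u)\<^sup>2 + (norm ?w)\<^sup>2 - 2 * (?u \<bullet> ?w)"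
  unfolding dist_norm power2_norm_eq_inner by (simp add: inner_diff inner_commute)
 ultimately show ?thesis by (simp add: dist_norm norm_minus_commute)
qed

text \<open>The pentagon with vertices a, b, c, e', e in this cyclic order is cut by its diagonals
  from a into three triangles; the orientation conditions allow the angles at a, c and e' to be
  added.\<close>

lemma pentagon_angle_sum:
 assumes p: "0 < crs a b c" "0 < crs a b e'" "0 < crs a b e"
   "0 < crs b c e'" "0 < crs b c e" "0 < crs c e' a" "0 < crs c e' b" "0 < crs c e' e"
   "0 < crs e' e a" "0 < crs e' e b" "0 < crs e' e c" "0 < crs e a b" "0 < crs e a c" "0 < crs e a e'"
 shows "vec_angle (b - a) (e - a) + vec_angle (c - b) (a - b) + vec_angle (e' - c) (b - c)
   + vec_angle (e - e') (c - e') + vec_angle (a - e) (e' - e) = 3 * pi"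
proof -
 have t1: "vec_angle (b - a) (c - a) + vec_angle (c - b) (a - b) + vec_angle (a - c) (b - c) = pi"
  using p(1) by (intro triangle_angle_sum_ccw) auto
 have t2: "vec_angle (e' - c) (a - c) + vec_angle (a - e') (c - e') + vec_angle (c - a) (e' - a) = pi"
  using p(6) crs_rotate[of c e' a] by (intro triangle_angle_sum_ccw) auto
 have t3: "vec_angle (e - e') (a - e') + vec_angle (a - e) (e' - e) + vec_angle (e' - a) (e - a) = pi"
  using p(9) by (intro triangle_angle_sum_ccw) auto
 have a1: "vec_angle (b - a) (e' - a) = vec_angle (b - a) (c - a) + vec_angle (c - a) (e' - a)"
  using p(1,2,6) crs_rotate[of a c e'] crs_rotate[of c e' a] unfolding crs_def by (intro vec_angle_add) simp_all
 have a2: "vec_angle (b - a) (e - a) = vec_angle (b - a) (e' - a) + vec_angle (e' - a) (e - a)"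
  using p(2,3,9) crs_rotate[of a e' e] crs_rotate[of e' e a] unfolding crs_def by (intro vec_angle_add) simp_all
 have a3: "vec_angle (e' - c) (b - c) = vec_angle (e' - c) (a - c) + vec_angle (a - c) (b - c)"
  using p(6,7,1) crs_rotate[of c a b] crs_rotate[of b c a] unfolding crs_def by (intro vec_angle_add) simp_all
 have a4: "vec_angle (e - e') (c - e') = vec_angle (e - e') (a - e') + vec_angle (a - e') (c - e')"
  using p(9,6,11) crs_rotate[of c e' a] unfolding crs_def by (intro vec_angle_add) simp_all
 show ?thesis using t1 t2 t3 a1 a2 a3 a4 by linarith
qed

section \<open>Supporting lines and orientation of convex polygons\<close>

lemma polygon_vertex_extreme:
 assumes P: "convex_polygon zs" and k: "k < length zs"
 shows "zs ! k extreme_point_of (convex hull (set zs))"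
proof -
 have "closed_segment (zs ! k) (nxt zs k) face_of convex hull (set zs)"
  using P k unfolding convex_polygon_def edge_of_def by blast
 moreover have "{zs ! k} face_of closed_segment (zs ! k) (nxt zs k)"
  unfolding face_of_singleton by (simp add: extreme_point_of_segment)
 ultimately show ?thesis by (metis face_of_trans face_of_singleton)
qed

text \<open>A face of a polyhedron is exposed, so the side is cut out by an affine function that
  vanishes on it and therefore is a multiple of \<open>crs (zs ! k) (nxt zs k)\<close>. The sign of
  that multiple gives s, which tells on which side of the line the polygon lies. A further vertex
  cannot lie on the line, being extreme.\<close>

lemma polygon_side:
 assumes P: "convex_polygon zs" and k: "k < length zs"
 obtains s :: real where "s = 1 \<or> s = - 1"
  "\<And>j. j < length zs ==> j \<noteq> k ==> j \<noteq> Suc k mod length zs ==> 0 < s * crs (zs ! k) (nxt zs k) (zs ! j)"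
  "\<And>z. z \<in> convex hull (set zs) ==> 0 \<le> s * crs (zs ! k) (nxt zs k) z"
  "\<And>z. z \<in> convex hull (set zs) ==> crs (zs ! k) (nxt zs k) z = 0 ==> z \<in> closed_segment (zs ! k) (nxt zs k)"
proof -
 let ?a = "zs ! k" and ?b = "nxt zs k" and ?P = "convex hull (set zs)"
 have F: "closed_segment ?a ?b face_of ?P" "aff_dim (closed_segment ?a ?b) = 1"
  using P k unfolding convex_polygon_def edge_of_def by blast+
 have ab: "?a \<noteq> ?b" using F(2) by auto
 have "polyhedron ?P" by (simp add: polyhedron_convex_hull)
 then have "closed_segment ?a ?b exposed_face_of ?P" using F exposed_face_of_polyhedron by blast
 then obtain n c where n: "?P \<subseteq> {x. n \<bullet> x \<le> c}" "closed_segment ?a ?b = ?P \<inter> {x. n \<bullet> x = c}"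
  unfolding exposed_face_of_def by blast
 have na: "n \<bullet> ?a = c" and nb: "n \<bullet> ?b = c" using n(2) by (metis IntD2 ends_in_segment mem_Collect_eq)+
 have n0: "n \<noteq> 0"
 proof
  assume "n = 0"
  then have "c = 0" using na by simp
  then have "closed_segment ?a ?b = ?P" using n(2) \<open>n = 0\<close> by auto
  then show False using F(2) P unfolding convex_polygon_def by simp
 qed
 \<comment> \<open>The normal n is orthogonal to the side, so l is its coordinate with respect to
   the side turned by a right angle.\<close>
 define l where "l = (\<i> * (?b - ?a)) \<bullet> n / (norm (?b - ?a))\<^sup>2"
 have nl: "n \<bullet> x - c = l * crs ?a ?b x" for x
 proof -
  let ?u = "Re (?b - ?a)" and ?v = "Im (?b - ?a)"
  have uv: "?u\<^sup>2 + ?v\<^sup>2 > 0" using ab by (metis cmod_power2 eq_iff_diff_eq_0 norm_eq_zero zero_less_power2)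
  have orth: "Re n * ?u + Im n * ?v = 0" using na nb by (simp add: inner_complex_def algebra_simps)
  have l: "l * (?u\<^sup>2 + ?v\<^sup>2) = Im n * ?u - Re n * ?v"
  proof -
   have "(\<i> * (?b - ?a)) \<bullet> n = Im n * ?u - Re n * ?v" by (simp add: inner_complex_def algebra_simps)
   then have "l = (Im n * ?u - Re n * ?v) / (?u\<^sup>2 + ?v\<^sup>2)" unfolding l_def cmod_power2 by simp
   then show ?thesis using uv by (simp del: minus_complex.sel)
  qed
  have "n \<bullet> x - c = Re n * Re (x - ?a) + Im n * Im (x - ?a)"
   using na by (simp add: inner_complex_def algebra_simps)
  then have "(n \<bullet> x - c) * (?u\<^sup>2 + ?v\<^sup>2) = (Re n * Re (x - ?a) + Im n * Im (x - ?a)) * (?u\<^sup>2 + ?v\<^sup>2)" by simp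
  also have "\<dots> = (Im n * ?u - Re n * ?v) * (?u * Im (x - ?a) - ?v * Re (x - ?a))
    + (Re n * ?u + Im n * ?v) * (?u * Re (x - ?a) + ?v * Im (x - ?a))"
   by (simp add: power2_eq_square algebra_simps)
  also have "\<dots> = (l * (?u\<^sup>2 + ?v\<^sup>2)) * crs ?a ?b x" unfolding orth l crs_alt by simp
  finally have eq: "(n \<bullet> x - c) * (?u\<^sup>2 + ?v\<^sup>2) = (l * crs ?a ?b x) * (?u\<^sup>2 + ?v\<^sup>2)" by (simp only: mult_ac)
  have "?u\<^sup>2 + ?v\<^sup>2 \<noteq> 0" using uv by linarith
  then show ?thesis using eq mult_right_cancel by blast
 qed
 have l0: "l \<noteq> 0"
 proof
  assume l: "l = 0"
  have "n \<bullet> x = c" for x using nl[of x] l by simp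
  from this[of 0] this[of n] show False using n0 by simp
 qed
 show ?thesis
 proof (rule that[of "- sgn l"])
  show "- sgn l = 1 \<or> - sgn l = - 1" using l0 by (auto simp: sgn_if)
  show le: "0 \<le> - sgn l * crs ?a ?b z" if "z \<in> ?P" for z
  proof -
   have "l * crs ?a ?b z \<le> 0" using n(1) that nl[of z] by auto
   then show ?thesis using l0 by (auto simp: sgn_if mult_le_0_iff)
  qed
  show seg: "z \<in> closed_segment ?a ?b" if "z \<in> ?P" "crs ?a ?b z = 0" for z
   using that nl[of z] n(2) by auto
  show "0 < - sgn l * crs ?a ?b (zs ! j)"
   if j: "j < length zs" "j \<noteq> k" "j \<noteq> Suc k mod length zs" for j
  proof -
   have jP: "zs ! j \<in> ?P" using j by (simp add: hull_inc)
   have "crs ?a ?b (zs ! j) \<noteq> 0"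
   proof
    assume "crs ?a ?b (zs ! j) = 0"
    then have "zs ! j \<in> closed_segment ?a ?b" using seg jP by blast
    moreover have "zs ! j \<noteq> ?a" "zs ! j \<noteq> ?b"
    proof -
     have "distinct zs" using P by (simp add: convex_polygon_def)
     moreover have "Suc k mod length zs < length zs" using k by (intro mod_less_divisor) auto
     ultimately show "zs ! j \<noteq> ?a" "zs ! j \<noteq> ?b" using j k unfolding nxt_def by (metis nth_eq_iff_index_eq)+
    qed
    ultimately have "zs ! j \<in> open_segment ?a ?b" by (simp add: open_segment_def)
    moreover have "?a \<in> ?P" "?b \<in> ?P" using F(1) face_of_imp_subset by force+
    ultimately show False using polygon_vertex_extreme[OF P j(1)] unfolding extreme_point_of_def by blast
   qed
   then show ?thesis using le[OF jP] l0 by (metis less_eq_real_def mult_eq_0_iff neg_equal_0_iff_equal sgn_0_0)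
  qed
 qed
qed

text \<open>Consecutive sides have the same sign, because the triangle of their three vertices has
  one orientation and \<open>crs\<close> is invariant under cyclic shifts. So all sides agree with
  side 0.\<close>

lemma polygon_orientation:
 assumes P: "convex_polygon zs" and n: "3 \<le> length zs"
 obtains s :: real where "s = 1 \<or> s = - 1"
  "\<And>k j. k < length zs ==> j < length zs ==> j \<noteq> k ==> j \<noteq> Suc k mod length zs ==>
    0 < s * crs (zs ! k) (nxt zs k) (zs ! j)"
  "\<And>k z. k < length zs ==> z \<in> convex hull (set zs) ==> 0 \<le> s * crs (zs ! k) (nxt zs k) z"
proof -
 let ?n = "length zs" and ?P = "convex hull (set zs)"
 have n0: "0 < ?n" using n by linarith
 obtain s where s: "s = (1::real) \<or> s = - 1" "\<And>z. z \<in> ?P ==> 0 \<le> s * crs (zs ! 0) (nxt zs 0) z"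
  by (rule polygon_side[OF P n0]) (rule that)
 have all: "\<forall>z\<in>?P. 0 \<le> s * crs (zs ! k) (nxt zs k) z" if "k < ?n" for k
  using that
 proof (induction k)
  case 0 then show ?case using s by auto
 next
  case (Suc k)
  let ?a = "zs ! k" and ?b = "zs ! Suc k" and ?c = "nxt zs (Suc k)"
  have nk: "nxt zs k = ?b" using Suc by (simp add: nxt_def)
  have c1: "Suc (Suc k) mod ?n < ?n" using Suc by (intro mod_less_divisor) auto
  have c: "Suc (Suc k) mod ?n \<noteq> k" "Suc (Suc k) mod ?n \<noteq> Suc k" "k \<noteq> Suc (Suc k) mod ?n"
   using Suc n by (auto simp: mod_if)
  obtain t where t: "t = (1::real) \<or> t = - 1"
    "\<And>j. j < ?n ==> j \<noteq> Suc k ==> j \<noteq> Suc (Suc k) mod ?n ==> 0 < t * crs ?b ?c (zs ! j)"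
    "\<And>z. z \<in> ?P ==> 0 \<le> t * crs ?b ?c z"
   by (rule polygon_side[OF P Suc.prems]) (rule that)
  have "0 < t * crs ?b ?c ?a" using t(2)[of k] Suc c by simp
  then have "0 < t * crs ?a ?b ?c" by (subst crs_rotate)
  moreover have "0 \<le> s * crs ?a ?b ?c"
   using Suc nk c1 by (simp add: hull_inc nxt_def)
  ultimately have "t = s" using s(1) t(1) by auto
  then show ?case using t(3) by blast
 qed
 show ?thesis
 proof (rule that[OF s(1)])
  show "0 \<le> s * crs (zs ! k) (nxt zs k) z" if "k < ?n" "z \<in> ?P" for k z using all that by blast
  show "0 < s * crs (zs ! k) (nxt zs k) (zs ! j)"
   if "k < ?n" "j < ?n" "j \<noteq> k" "j \<noteq> Suc k mod ?n" for k j
  proof -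
   obtain t where "t = (1::real) \<or> t = - 1"
     "\<And>i. i < ?n ==> i \<noteq> k ==> i \<noteq> Suc k mod ?n ==> 0 < t * crs (zs ! k) (nxt zs k) (zs ! i)"
    by (rule polygon_side[OF P \<open>k < ?n\<close>]) (rule that)
   then have t: "t = (1::real) \<or> t = - 1" "0 < t * crs (zs ! k) (nxt zs k) (zs ! j)" using that by auto
   moreover have "0 \<le> s * crs (zs ! k) (nxt zs k) (zs ! j)"
   proof -
    have "zs ! j \<in> ?P" using that(2) by (simp add: hull_inc)
    then show ?thesis using all[OF that(1)] by blast
   qed
   ultimately show ?thesis using s(1) by auto
  qed
 qed
qed

text \<open>The triangles of the fan at vertex 0 cover the polygon. Seen from vertex 0, z is to one
  side of vertex 1 and to the other side of the last vertex; the triangle at the first change of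
  sign contains z.\<close>

lemma polygon_fan:
 assumes n: "3 \<le> length zs"
  and s: "\<And>k j. k < length zs ==> j < length zs ==> j \<noteq> k ==> j \<noteq> Suc k mod length zs ==>
    0 < s * crs (zs ! k) (nxt zs k) (zs ! j)"
  and z: "\<And>k. k < length zs ==> 0 < s * crs (zs ! k) (nxt zs k) z"
 shows "z \<in> convex hull (set zs)"
proof -
 let ?n = "length zs"
 define g where "g i = s * crs (zs ! 0) (zs ! i) z" for i
 have g1: "g 1 > 0"
 proof -
  have "Suc 0 mod ?n = 1" using n by simp
  then show ?thesis using z[of 0] n unfolding g_def nxt_def by (metis less_le_trans zero_less_numeral)
 qed
 have "nxt zs (?n - 1) = zs ! 0" using n by (cases zs) (auto simp: nxt_def)
 then have "0 < s * crs (zs ! (?n - 1)) (zs ! 0) z" using z[of "?n - 1"] n by simp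
 then have gn: "g (?n - 1) < 0" unfolding g_def crs_swap[of "zs ! 0" "zs ! (?n - 1)" z] by simp
 define i where "i = (LEAST i. 1 \<le> i \<and> g (Suc i) \<le> 0)"
 have ex: "1 \<le> ?n - 2 \<and> g (Suc (?n - 2)) \<le> 0" using gn n by (auto simp: Suc_diff_Suc numeral_2_eq_2)
 have i: "1 \<le> i" "g (Suc i) \<le> 0" using LeastI[of "\<lambda>i. 1 \<le> i \<and> g (Suc i) \<le> 0", OF ex] by (auto simp: i_def)
 have "i \<le> ?n - 2" unfolding i_def using ex by (rule Least_le)
 then have i': "Suc i < ?n" using n by linarith
 have gi: "g i > 0"
 proof (cases "i = 1")
  case False
  then have "\<not> (1 \<le> i - 1 \<and> g (Suc (i - 1)) \<le> 0)" unfolding i_def by (intro not_less_Least) (use i(1) False in \<open>auto simp: i_def\<close>)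
  then have "g (Suc (i - 1)) > 0" using i(1) False by auto
  moreover have "Suc (i - 1) = i" using i(1) by simp
  ultimately show ?thesis by simp
 qed (use g1 in simp)
 let ?a = "zs ! 0" and ?b = "zs ! i" and ?c = "zs ! Suc i"
 have si: "nxt zs i = ?c" using i' by (simp add: nxt_def)
 have "0 < ?n" using i' by linarith
 then have T: "0 < s * crs ?a ?b ?c" using s[of i 0] i i' si crs_rotate[of ?a ?b ?c] by simp
 have w: "0 < s * crs ?b ?c z" "0 \<le> s * crs ?c ?a z" "0 < s * crs ?a ?b z"
  using z[of i] i' si i(2) gi crs_swap[of ?c ?a z] unfolding g_def by auto
 \<comment> \<open>Barycentric coordinates of z as ratios of signed areas.\<close>
 define u where "u = (s * crs ?b ?c z) / (s * crs ?a ?b ?c)"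
 define v where "v = (s * crs ?c ?a z) / (s * crs ?a ?b ?c)"
 define t where "t = (s * crs ?a ?b z) / (s * crs ?a ?b ?c)"
 have sum: "crs ?b ?c z + crs ?c ?a z + crs ?a ?b z = crs ?a ?b ?c"
  by (simp add: crs_alt algebra_simps)
 have s1: "u + v + t = 1"
 proof -
  have "u + v + t = (s * (crs ?b ?c z + crs ?c ?a z + crs ?a ?b z)) / (s * crs ?a ?b ?c)"
   by (simp add: u_def v_def t_def add_divide_distrib distrib_left)
  also have "\<dots> = 1" unfolding sum using T by (intro divide_self) linarith
  finally show ?thesis .
 qed
 have bary: "of_real (crs ?a ?b ?c) * z = of_real (crs ?b ?c z) * ?a + of_real (crs ?c ?a z) * ?b + of_real (crs ?a ?b z) * ?c"
  by (simp add: complex_eq_iff crs_alt algebra_simps)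
 have "z = u *\<^sub>R ?a + v *\<^sub>R ?b + t *\<^sub>R ?c"
 proof -
  have nz: "crs ?a ?b ?c \<noteq> 0" "s \<noteq> 0" using T by auto
  have "of_real (crs ?a ?b ?c) * (u *\<^sub>R ?a + v *\<^sub>R ?b + t *\<^sub>R ?c) = of_real (crs ?a ?b ?c) * z"
   unfolding bary using nz by (simp add: u_def v_def t_def scaleR_conv_of_real distrib_left)
  then show ?thesis using nz by simp
 qed
 moreover have "u \<ge> 0" "v \<ge> 0" "t \<ge> 0" using w T unfolding u_def v_def t_def by (auto intro!: divide_nonneg_nonneg simp only: less_imp_le)
 ultimately have "z \<in> convex hull {?a, ?b, ?c}" using s1 unfolding convex_hull_3 by auto
 also have "\<dots> \<subseteq> convex hull (set zs)" using i' by (intro hull_mono) (auto intro!: nth_mem)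
 finally show ?thesis .
qed

text \<open>The points strictly on the inner side of all sides form an open set, which
  \<open>polygon_fan\<close> places inside the hull; a point of the hull fails to belong to it only
  by lying on a side.\<close>

lemma polygon_interior_iff:
 assumes P: "convex_polygon zs" and n: "3 \<le> length zs" and z: "z \<in> convex hull (set zs)"
 shows "z \<in> interior (convex hull (set zs)) \<longleftrightarrow> (\<forall>k<length zs. z \<notin> closed_segment (zs ! k) (nxt zs k))"
proof
 assume zi: "z \<in> interior (convex hull (set zs))"
 show "\<forall>k<length zs. z \<notin> closed_segment (zs ! k) (nxt zs k)"
 proof (intro allI impI notI)
  fix k assume k: "k < length zs" "z \<in> closed_segment (zs ! k) (nxt zs k)"
  have F: "closed_segment (zs ! k) (nxt zs k) face_of convex hull (set zs)"
    "aff_dim (closed_segment (zs ! k) (nxt zs k)) = 1"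
   using P k unfolding convex_polygon_def edge_of_def by blast+
  then have "closed_segment (zs ! k) (nxt zs k) \<noteq> convex hull (set zs)"
   using P unfolding convex_polygon_def by auto
  then show False using face_of_disjoint_interior[OF F(1)] zi k by blast
 qed
next
 assume z': "\<forall>k<length zs. z \<notin> closed_segment (zs ! k) (nxt zs k)"
 obtain s where s: "s = (1::real) \<or> s = - 1"
  "\<And>k j. k < length zs ==> j < length zs ==> j \<noteq> k ==> j \<noteq> Suc k mod length zs ==>
    0 < s * crs (zs ! k) (nxt zs k) (zs ! j)"
  "\<And>k z. k < length zs ==> z \<in> convex hull (set zs) ==> 0 \<le> s * crs (zs ! k) (nxt zs k) z"
  by (rule polygon_orientation[OF P n]) (rule that)
 let ?U = "{w. \<forall>k\<in>{..<length zs}. 0 < s * crs (zs ! k) (nxt zs k) w}"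
 have "open ?U"
 proof -
  have "?U = (\<Inter>k\<in>{..<length zs}. {w. 0 < s * crs (zs ! k) (nxt zs k) w})" by auto
  also have "open \<dots>"
   unfolding crs_def by (intro open_INT) (auto intro!: open_Collect_less continuous_intros)
  finally show ?thesis .
 qed
 moreover have "?U \<subseteq> convex hull (set zs)"
  using polygon_fan[OF n s(2)] by auto
 moreover have "z \<in> ?U"
 proof (intro CollectI ballI)
  fix k assume k: "k \<in> {..<length zs}"
  have k': "k < length zs" using k by simp
  have "crs (zs ! k) (nxt zs k) z = 0 ==> z \<in> closed_segment (zs ! k) (nxt zs k)"
   by (rule polygon_side[OF P k']) (use z in blast)
  then have "crs (zs ! k) (nxt zs k) z \<noteq> 0" using z' k' by blast
  then show "0 < s * crs (zs ! k) (nxt zs k) z" using s(3)[OF _ z] k s(1) by fastforce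
 qed
 ultimately show "z \<in> interior (convex hull (set zs))" using interior_maximal by blast
qed

text \<open>Along side k, the signed area over side j is affine and of constant sign. A zero at an
  inner point makes it vanish at both ends, which then are both vertices of side j; with at least
  three sides this is impossible.\<close>

lemma closed_segment_sides:
 assumes P: "convex_polygon zs" and n: "3 \<le> length zs" and k: "k < length zs" "j < length zs"
  and z: "z \<in> closed_segment (zs ! k) (nxt zs k)" "z \<in> closed_segment (zs ! j) (nxt zs j)" and kj: "k \<noteq> j"
 shows "z = zs ! k \<or> z = nxt zs k"
proof (rule ccontr)
 assume c: "\<not> ?thesis"
 have op: "z \<in> open_segment (zs ! k) (nxt zs k)" using z(1) c by (auto simp: open_segment_def)
 obtain s where s: "s = (1::real) \<or> s = - 1"
  "\<And>i. i < length zs ==> i \<noteq> j ==> i \<noteq> Suc j mod length zs ==> 0 < s * crs (zs ! j) (nxt zs j) (zs ! i)"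
  "\<And>z. z \<in> convex hull (set zs) ==> 0 \<le> s * crs (zs ! j) (nxt zs j) z"
  by (rule polygon_side[OF P k(2)]) (rule that)
 obtain t where t: "0 < t" "t < 1" "z = (1 - t) *\<^sub>R (zs ! k) + t *\<^sub>R nxt zs k"
  using op unfolding in_segment by auto
 have lin: "crs a b ((1 - t) *\<^sub>R x + t *\<^sub>R y) = (1 - t) * crs a b x + t * crs a b y" for a b x y
  by (simp add: crs_alt algebra_simps)
 obtain u where u: "z = (1 - u) *\<^sub>R (zs ! j) + u *\<^sub>R nxt zs j" using z(2) unfolding in_segment by auto
 have lin': "crs a b ((1 - u) *\<^sub>R x + u *\<^sub>R y) = (1 - u) * crs a b x + u * crs a b y" for a b x y
  by (simp add: crs_alt algebra_simps)
 have "crs (zs ! j) (nxt zs j) z = 0" unfolding u lin' by (simp add: crs_alt)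
 then have eq: "(1 - t) * (s * crs (zs ! j) (nxt zs j) (zs ! k)) + t * (s * crs (zs ! j) (nxt zs j) (nxt zs k)) = 0"
  unfolding t(3) lin by (metis distrib_left mult.left_commute mult_zero_right)
 have sk: "Suc k mod length zs < length zs" "Suc j mod length zs < length zs" using k by (auto intro: mod_less_divisor)
 have nn: "0 \<le> s * crs (zs ! j) (nxt zs j) (zs ! k)" "0 \<le> s * crs (zs ! j) (nxt zs j) (nxt zs k)"
  using s(3) k sk by (auto simp: nxt_def hull_inc)
 have "s * crs (zs ! j) (nxt zs j) (zs ! k) = 0" "s * crs (zs ! j) (nxt zs j) (nxt zs k) = 0"
 proof -
  have "(1 - t) * (s * crs (zs ! j) (nxt zs j) (zs ! k)) = 0 \<and> t * (s * crs (zs ! j) (nxt zs j) (nxt zs k)) = 0"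
   using nn t(1,2) by (intro add_nonneg_eq_0_iff[THEN iffD1, OF _ _ eq] conjI mult_nonneg_nonneg[OF _ nn(1)] mult_nonneg_nonneg[OF _ nn(2)]) auto
  then show "s * crs (zs ! j) (nxt zs j) (zs ! k) = 0" "s * crs (zs ! j) (nxt zs j) (nxt zs k) = 0"
   using t(1,2) by auto
 qed
 then have "k = Suc j mod length zs" "Suc k mod length zs \<in> {j, Suc j mod length zs}"
  using s(2)[of k] s(2)[of "Suc k mod length zs"] k sk kj unfolding nxt_def
  by (metis less_irrefl, metis insertCI less_irrefl)
 then show False using kj k n by (auto simp: mod_if split: if_splits)
qed

lemma length_3E:
 assumes "length zs = 3" obtains a b c where "zs = [a, b, c]"
proof -
 have "length zs = Suc (Suc (Suc 0))" using assms by simp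
 then have "\<exists>a b c. zs = [a, b, c]" unfolding length_Suc_conv by auto
 then show ?thesis using that by blast
qed

lemma length_5E:
 assumes "length zs = 5" obtains a b c d e where "zs = [a, b, c, d, e]"
proof -
 have "length zs = Suc (Suc (Suc (Suc (Suc 0))))" using assms by simp
 then have "\<exists>a b c d e. zs = [a, b, c, d, e]" unfolding length_Suc_conv by auto
 then show ?thesis using that by blast
qed

lemma lessThan_3: "{..<3::nat} = {0, 1, 2}" and lessThan_5: "{..<5::nat} = {0, 1, 2, 3, 4}"
 by auto

lemma polygon_angle_sum:
 assumes P: "convex_polygon zs" and n: "length zs = 3 \<or> length zs = 5"
 shows "(\<Sum>k<length zs. vec_angle (nxt zs k - zs ! k) (prv zs k - zs ! k)) = (real (length zs) - 2) * pi"
proof -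
 have P': "distinct zs" using P unfolding convex_polygon_def by auto
 obtain s where s: "s = (1::real) \<or> s = - 1"
  "\<And>k j. k < length zs ==> j < length zs ==> j \<noteq> k ==> j \<noteq> Suc k mod length zs ==>
    0 < s * crs (zs ! k) (nxt zs k) (zs ! j)"
 proof -
  have n3: "3 \<le> length zs" using n by auto
  show thesis by (rule polygon_orientation[OF P n3]) (rule that)
 qed
 from n show ?thesis
 proof
  assume n: "length zs = 3"
  then obtain a b c where zs: "zs = [a, b, c]"
   by (rule length_3E)
  have "vec_angle (b - a) (c - a) + vec_angle (c - b) (a - b) + vec_angle (a - c) (b - c) = pi"
   using P' zs by (intro triangle_angle_sum) auto
  then show ?thesis unfolding n lessThan_3 by (simp add: zs nxt_def prv_def)
 next
  assume n: "length zs = 5"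
  then obtain a b c e' e where zs: "zs = [a, b, c, e', e]"
   by (rule length_5E)
  have pos: "0 < s * crs a b c" "0 < s * crs a b e'" "0 < s * crs a b e"
   "0 < s * crs b c e'" "0 < s * crs b c e" "0 < s * crs c e' a" "0 < s * crs c e' b" "0 < s * crs c e' e"
   "0 < s * crs e' e a" "0 < s * crs e' e b" "0 < s * crs e' e c" "0 < s * crs e a b" "0 < s * crs e a c" "0 < s * crs e a e'"
   using s(2)[of 0 2] s(2)[of 0 3] s(2)[of 0 4] s(2)[of 1 3] s(2)[of 1 4] s(2)[of 2 0] s(2)[of 2 1] s(2)[of 2 4]
    s(2)[of 3 0] s(2)[of 3 1] s(2)[of 3 2] s(2)[of 4 1] s(2)[of 4 2] s(2)[of 4 3]
   by (simp_all add: zs nxt_def)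
  have "vec_angle (b - a) (e - a) + vec_angle (c - b) (a - b) + vec_angle (e' - c) (b - c)
   + vec_angle (e - e') (c - e') + vec_angle (a - e) (e' - e) = 3 * pi"
   using s(1)
  proof
   assume "s = 1"
   then show ?thesis using pos by (intro pentagon_angle_sum) simp_all
  next
   assume s: "s = - 1"
   \<comment> \<open>Complex conjugation makes a clockwise pentagon counterclockwise and preserves
     its angles.\<close>
   have cc: "crs (cnj x) (cnj y) (cnj z) = - crs x y z" for x y z by (simp add: crs_alt algebra_simps)
   have "vec_angle (cnj b - cnj a) (cnj e - cnj a) + vec_angle (cnj c - cnj b) (cnj a - cnj b) + vec_angle (cnj e' - cnj c) (cnj b - cnj c)
   + vec_angle (cnj e - cnj e') (cnj c - cnj e') + vec_angle (cnj a - cnj e) (cnj e' - cnj e) = 3 * pi"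
    using pos s by (intro pentagon_angle_sum) (simp_all add: cc)
   then show ?thesis unfolding complex_cnj_diff[symmetric] vec_angle_cnj .
  qed
  then show ?thesis unfolding n lessThan_5 by (simp add: zs nxt_def prv_def add_ac)
 qed
qed

subsection \<open>Isometric polygons\<close>

lemma point_on_segment_unique:
 fixes a b x :: complex
 assumes "dist a x = t * dist a b" "dist x b = (1 - t) * dist a b"
 shows "x = (1 - t) *\<^sub>R a + t *\<^sub>R b"
proof (cases "a = b")
 case True then show ?thesis using assms by (simp add: scaleR_left_diff_distrib)
next
 case False
 have "dist a b = dist a x + dist x b" using assms by (simp add: algebra_simps)
 then have "x \<in> closed_segment a b" by (simp add: between between_mem_segment[symmetric])
 then obtain u where u: "0 \<le> u" "x = (1 - u) *\<^sub>R a + u *\<^sub>R b" unfolding in_segment by auto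
 have "a - x = u *\<^sub>R (a - b)" unfolding u(2) by (simp add: algebra_simps)
 then have "dist a x = u * dist a b" using u(1) by (simp add: dist_norm)
 then have "u = t" using assms(1) False by simp
 then show ?thesis using u by simp
qed

text \<open>The point dividing a segment in a given ratio is determined by its distances to the
  ends, which an isometry keeps.\<close>

lemma isometry_affine:
 fixes A :: "complex set" and f :: "complex => complex"
 assumes A: "convex A" and f: "\<And>x y. x \<in> A ==> y \<in> A ==> dist (f x) (f y) = dist x y"
  and pq: "p \<in> A" "q \<in> A" and t: "0 \<le> t" "t \<le> 1"
 shows "f ((1 - t) *\<^sub>R p + t *\<^sub>R q) = (1 - t) *\<^sub>R f p + t *\<^sub>R f q"
proof (rule point_on_segment_unique)
 let ?x = "(1 - t) *\<^sub>R p + t *\<^sub>R q"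
 have x: "?x \<in> A" using A pq t unfolding convex_alt by blast
 have "p - ?x = t *\<^sub>R (p - q)" "?x - q = (1 - t) *\<^sub>R (p - q)" by (simp_all add: algebra_simps)
 then have "dist p ?x = t * dist p q" "dist ?x q = (1 - t) * dist p q"
  using t by (simp_all add: dist_norm)
 then show "dist (f p) (f ?x) = t * dist (f p) (f q)" "dist (f ?x) (f q) = (1 - t) * dist (f p) (f q)"
  using f x pq by simp_all
qed

lemma isometry_extreme:
 fixes A :: "complex set" and f :: "complex => complex"
 assumes f: "\<And>x y. x \<in> A ==> y \<in> A ==> dist (f x) (f y) = dist x y"
  and x: "x extreme_point_of A"
 shows "f x extreme_point_of (f ` A)"
 unfolding extreme_point_of_def
proof (intro conjI ballI)
 have xA: "x \<in> A" using x by (simp add: extreme_point_of_def)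
 then show "f x \<in> f ` A" by simp
 fix p' q' assume "p' \<in> f ` A" "q' \<in> f ` A"
 then obtain p q where pq: "p \<in> A" "q \<in> A" "p' = f p" "q' = f q" by auto
 show "f x \<notin> open_segment p' q'"
 proof
  assume o: "f x \<in> open_segment p' q'"
  then have "dist (f p) (f q) = dist (f p) (f x) + dist (f x) (f q)"
   unfolding pq open_segment_def by (simp add: between between_mem_segment[symmetric])
  then have "x \<in> closed_segment p q" using f pq xA by (simp add: between between_mem_segment[symmetric])
  moreover have "x \<noteq> p" "x \<noteq> q" using o pq by (auto simp: open_segment_def)
  ultimately show False using x pq unfolding extreme_point_of_def open_segment_def by blast
 qed
qed

lemma finite_uniform_radius:
 assumes "finite A" and "\<And>x. x \<in> A ==> \<exists>\<rho>>0. Q x \<rho>"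
  and "\<And>x \<rho> \<rho>'. x \<in> A ==> Q x \<rho> ==> 0 < \<rho>' ==> \<rho>' \<le> \<rho> ==> Q x \<rho>'"
 shows "\<exists>\<rho>>0::real. \<forall>x\<in>A. Q x \<rho>"
 using assms
proof (induction A rule: finite_induct)
 case empty then show ?case by (auto intro: exI[of _ 1])
next
 case (insert a A)
 then obtain \<rho> where r: "\<rho> > 0" "\<forall>x\<in>A. Q x \<rho>" by (metis insertCI)
 obtain \<rho>' where r': "\<rho>' > 0" "Q a \<rho>'" using insert.prems(1) by blast
 have "\<forall>x\<in>insert a A. Q x (min \<rho> \<rho>')"
  using r r' insert.prems(2) by (metis insertE insertI1 insertI2 min.cobounded1 min.cobounded2 min_less_iff_conj)
 then show ?case using r r' by (intro exI[of _ "min \<rho> \<rho>'"]) auto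
qed

text \<open>A condition invariant under isometries of the polygon with vertex set \<open>V\<close>:
  the point dividing a segment between two vertices in the ratio s keeps distance
  \<open>\<rho>\<close> from all segments between vertices that miss it. For s = 0 the points are
  the vertices; for 0 < s < 1 they include inner points of the sides.\<close>

definition segment_gap :: "real => complex set => real => bool" where
 "segment_gap s V \<rho> \<longleftrightarrow> (\<forall>p\<in>V. \<forall>q\<in>V. \<forall>p'\<in>V. \<forall>q'\<in>V. (1 - s) *\<^sub>R p + s *\<^sub>R q \<notin> closed_segment p' q' -->
   (\<forall>y\<in>closed_segment p' q'. \<rho> \<le> dist ((1 - s) *\<^sub>R p + s *\<^sub>R q) y))"

lemma segment_gap_mono: "segment_gap s V \<rho> ==> \<rho>' \<le> \<rho> ==> segment_gap s V \<rho>'"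
 unfolding segment_gap_def by (meson order_trans)

lemma segment_gap_exists:
 assumes "finite V"
 shows "\<exists>\<rho>>0. segment_gap s V \<rho>"
proof -
 let ?Q = "\<lambda>(p,q,p',q') \<rho>. (1 - s) *\<^sub>R p + s *\<^sub>R q \<notin> closed_segment p' q' -->
   (\<forall>y\<in>closed_segment p' q'. \<rho> \<le> dist ((1 - s) *\<^sub>R p + s *\<^sub>R q) y)"
 have "\<exists>\<rho>>0. \<forall>x\<in>V \<times> V \<times> V \<times> V. ?Q x \<rho>"
 proof (rule finite_uniform_radius)
  show "finite (V \<times> V \<times> V \<times> V)" using assms by simp
  fix x assume "x \<in> V \<times> V \<times> V \<times> V"
  obtain p q p' q' where x: "x = (p, q, p', q')" by (cases x) auto
  show "\<exists>\<rho>>0. ?Q x \<rho>"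
  proof (cases "(1 - s) *\<^sub>R p + s *\<^sub>R q \<in> closed_segment p' q'")
   case True then show ?thesis using x by (auto intro: exI[of _ 1])
  next
   case False
   then show ?thesis using separate_point_closed[OF closed_segment False] x by auto
  qed
 qed (auto intro: order_trans)
 then obtain \<rho> where "\<rho> > 0" and r: "\<And>x. x \<in> V \<times> V \<times> V \<times> V ==> ?Q x \<rho>" by blast
 moreover have "segment_gap s V \<rho>"
  unfolding segment_gap_def using r[of "(p, q, p', q')" for p q p' q'] by simp
 ultimately show ?thesis by blast
qed

text \<open>An isometry of the hulls takes extreme points to extreme points, hence vertices to
  vertices, and is affine on segments. It may permute the vertices, which is why
  \<open>segment_gap\<close> quantifies over all of them.\<close>

lemma segment_gap_isometric:
 assumes iso: "isometric_sets (convex hull V) (convex hull W)"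
  and V: "\<And>p. p \<in> V ==> p extreme_point_of (convex hull V)"
  and s: "0 \<le> s" "s \<le> 1" and W: "segment_gap s W \<rho>"
 shows "segment_gap s V \<rho>"
proof -
 obtain f where f: "f ` (convex hull V) = convex hull W"
   "\<And>x y. x \<in> convex hull V ==> y \<in> convex hull V ==> dist (f x) (f y) = dist x y"
  using iso unfolding isometric_sets_def by blast
 have aff: "f ((1 - t) *\<^sub>R p + t *\<^sub>R q) = (1 - t) *\<^sub>R f p + t *\<^sub>R f q"
  if "p \<in> V" "q \<in> V" "0 \<le> t" "t \<le> 1" for p q t
  using that by (intro isometry_affine[of "convex hull V"]) (auto simp: f hull_inc)
 have fV: "f p \<in> W" if "p \<in> V" for p
  using isometry_extreme[of "convex hull V" f p] f V that extreme_point_of_convex_hull by metis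
 have inV: "(1 - t) *\<^sub>R p + t *\<^sub>R q \<in> convex hull V" if "p \<in> V" "q \<in> V" "0 \<le> t" "t \<le> 1" for p q t
  using that convex_convex_hull[of V] unfolding convex_alt by (auto simp: hull_inc)
 show ?thesis unfolding segment_gap_def
 proof (intro ballI impI)
  fix p q p' q' y assume V': "p \<in> V" "q \<in> V" "p' \<in> V" "q' \<in> V"
   and n: "(1 - s) *\<^sub>R p + s *\<^sub>R q \<notin> closed_segment p' q'" and y: "y \<in> closed_segment p' q'"
  let ?x = "(1 - s) *\<^sub>R p + s *\<^sub>R q"
  have im: "f z \<in> closed_segment (f p') (f q')" if "z \<in> closed_segment p' q'" for z
   using that aff V' unfolding in_segment by blast
  have "f ?x \<notin> closed_segment (f p') (f q')"
  proof
   assume "f ?x \<in> closed_segment (f p') (f q')"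
   then obtain t where t: "0 \<le> t" "t \<le> 1" "f ?x = (1 - t) *\<^sub>R f p' + t *\<^sub>R f q'" unfolding in_segment by blast
   then have "f ?x = f ((1 - t) *\<^sub>R p' + t *\<^sub>R q')" using aff V' by simp
   then have "dist ?x ((1 - t) *\<^sub>R p' + t *\<^sub>R q') = 0"
    using f(2)[of ?x "(1 - t) *\<^sub>R p' + t *\<^sub>R q'"] inV V' s t by simp
   then show False using n t unfolding in_segment by auto
  qed
  then have "\<rho> \<le> dist (f ?x) (f y)"
   using W fV V' im[OF y] aff[OF V'(1,2) s] unfolding segment_gap_def by (metis (no_types, lifting))
  also have "\<dots> = dist ?x y"
  proof -
   have "y \<in> convex hull V" using y inV V' unfolding in_segment by blast
   then show ?thesis using f(2) inV V' s by blast
  qed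
  finally show "\<rho> \<le> dist ?x y" .
 qed
qed

section \<open>Points, cells and chains\<close>

text \<open>The closed form of \<open>polygon_fan\<close>: on the segment from w to an inner point
  all points other than w satisfy the strict inequalities, and the hull is closed.\<close>

lemma polygon_from_crs:
 assumes P: "convex_polygon zs" and n: "3 \<le> length zs" and s: "s = (1::real) \<or> s = - 1"
  and o: "\<And>k z. k < length zs ==> z \<in> convex hull (set zs) ==> 0 \<le> s * crs (zs ! k) (nxt zs k) z"
  and w: "\<And>k. k < length zs ==> 0 \<le> s * crs (zs ! k) (nxt zs k) w"
 shows "w \<in> convex hull (set zs)"
proof -
 let ?P = "convex hull (set zs)"
 have "rel_interior ?P = interior ?P"
  using P interior_rel_interior_gen[of ?P] unfolding convex_polygon_def by simp
 moreover have "?P \<noteq> {}" using n by auto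
 ultimately obtain z0 where z0: "z0 \<in> interior ?P"
  using rel_interior_eq_empty[of ?P] by auto
 then have z0P: "z0 \<in> ?P" using interior_subset by blast
 have pos: "0 < s * crs (zs ! k) (nxt zs k) z0" if k: "k < length zs" for k
 proof -
  have "z0 \<notin> closed_segment (zs ! k) (nxt zs k)"
   using z0 polygon_interior_iff[OF P n z0P] k by blast
  moreover have "crs (zs ! k) (nxt zs k) z0 = 0 ==> z0 \<in> closed_segment (zs ! k) (nxt zs k)"
   by (rule polygon_side[OF P k]) (use z0P in blast)
  ultimately show ?thesis using o[OF k z0P] s by (metis less_eq_real_def mult_eq_0_iff one_neq_zero zero_neq_neg_one)
 qed
 have strict: "\<And>k j. k < length zs ==> j < length zs ==> j \<noteq> k ==> j \<noteq> Suc k mod length zs ==>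
    0 < s * crs (zs ! k) (nxt zs k) (zs ! j)"
 proof -
  fix k j assume kj: "k < length zs" "j < length zs" "j \<noteq> k" "j \<noteq> Suc k mod length zs"
  obtain t where t: "t = (1::real) \<or> t = - 1"
   "\<And>j. j < length zs ==> j \<noteq> k ==> j \<noteq> Suc k mod length zs ==> 0 < t * crs (zs ! k) (nxt zs k) (zs ! j)"
   by (rule polygon_side[OF P kj(1)]) (rule that)
  have "zs ! j \<in> ?P" using kj by (simp add: hull_inc)
  then show "0 < s * crs (zs ! k) (nxt zs k) (zs ! j)"
   using o[OF kj(1), of "zs ! j"] t(2)[OF kj(2-4)] t(1) s by auto
 qed
 define f where "f e = (1 - e) *\<^sub>R w + e *\<^sub>R z0" for e :: real
 have fin: "f e \<in> ?P" if e: "0 < e" "e \<le> 1" for e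
 proof (rule polygon_fan[OF n strict])
  fix k assume k: "k < length zs"
  have "s * crs (zs ! k) (nxt zs k) (f e) =
    (1 - e) * (s * crs (zs ! k) (nxt zs k) w) + e * (s * crs (zs ! k) (nxt zs k) z0)"
   unfolding f_def by (simp add: crs_alt algebra_simps)
  also have "\<dots> > 0"
   by (rule add_nonneg_pos[OF mult_nonneg_nonneg[OF _ w[OF k]] mult_pos_pos[OF _ pos[OF k]]]) (use e in auto)
  finally show "0 < s * crs (zs ! k) (nxt zs k) (f e)" .
 qed
 have "closed ?P" by (simp add: compact_convex_hull finite_imp_compact compact_imp_closed)
 moreover have "(f \<longlongrightarrow> f 0) (at_right 0)"
  unfolding f_def by (intro tendsto_intros)
 moreover have "eventually (\<lambda>e. f e \<in> ?P) (at_right 0)"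
  using fin by (auto simp: eventually_at_right_field intro!: exI[of _ 1])
 ultimately have "f 0 \<in> ?P" using Lim_in_closed_set[of ?P f "at_right 0" "f 0"] by simp
 then show ?thesis by (simp add: f_def)
qed

section \<open>Euclidean coordinates relative to a side\<close>

definition along :: "complex => complex => complex => real" where
 "along P Q w = (w - P) \<bullet> (Q - P) / dist P Q"

definition height :: "complex => complex => complex => real" where
 "height P Q w = \<bar>crs P Q w\<bar> / dist P Q"

text \<open>\<open>height\<close> is unsigned so that polygons on either side of the line can be
  treated alike; in return the two coordinates are isometric only on each closed half-plane.\<close>

lemma along_height_dist:
 assumes "P \<noteq> Q" "0 \<le> crs P Q w * crs P Q w'"
 shows "(along P Q w - along P Q w')\<^sup>2 + (height P Q w - height P Q w')\<^sup>2 = (dist w w')\<^sup>2"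
proof -
 have D: "(dist P Q)\<^sup>2 = (Re (Q - P))\<^sup>2 + (Im (Q - P))\<^sup>2" "dist P Q \<noteq> 0"
  using assms(1) by (simp_all add: dist_norm cmod_power2 norm_minus_commute[of P])
 have "\<bar>crs P Q w\<bar> - \<bar>crs P Q w'\<bar> = crs P Q w - crs P Q w' \<or> \<bar>crs P Q w\<bar> - \<bar>crs P Q w'\<bar> = - (crs P Q w - crs P Q w')"
  using assms(2) by (auto simp: zero_le_mult_iff)
 then have h: "(\<bar>crs P Q w\<bar> - \<bar>crs P Q w'\<bar>)\<^sup>2 = (crs P Q w - crs P Q w')\<^sup>2" by (auto simp: power2_commute)
 have "(along P Q w - along P Q w')\<^sup>2 + (height P Q w - height P Q w')\<^sup>2
   = (((w - P) \<bullet> (Q - P) - (w' - P) \<bullet> (Q - P))\<^sup>2 + (crs P Q w - crs P Q w')\<^sup>2) / (dist P Q)\<^sup>2"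
  unfolding along_def height_def h[symmetric]
  by (simp only: diff_divide_distrib[symmetric] power_divide add_divide_distrib)
 also have "((w - P) \<bullet> (Q - P) - (w' - P) \<bullet> (Q - P))\<^sup>2 + (crs P Q w - crs P Q w')\<^sup>2
   = (dist w w')\<^sup>2 * (dist P Q)\<^sup>2"
  unfolding D(1) dist_norm[of w w'] cmod_power2 inner_complex_def crs_alt
  by (simp add: power2_eq_square algebra_simps)
 finally show ?thesis using D(2) by simp
qed

text \<open>The other sides stay away from an inner point of side k, so near it only the half-plane
  condition of side k is left.\<close>

lemma side_neighbourhood:
 assumes P: "convex_polygon zs" and n: "3 \<le> length zs" and k: "k < length zs"
  and z: "z \<in> open_segment (zs ! k) (nxt zs k)"
 obtains s \<rho> :: real where "s = 1 \<or> s = - 1" "0 < \<rho>"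
  "\<And>w. dist w z < \<rho> ==> 0 \<le> s * crs (zs ! k) (nxt zs k) w ==> w \<in> convex hull (set zs)"
proof -
 obtain s where s: "s = (1::real) \<or> s = - 1"
  "\<And>k z. k < length zs ==> z \<in> convex hull (set zs) ==> 0 \<le> s * crs (zs ! k) (nxt zs k) z"
  by (rule polygon_orientation[OF P n]) (rule that)
 have zP: "z \<in> convex hull (set zs)"
 proof -
  have "Suc k mod length zs < length zs" using k by (intro mod_less_divisor) auto
  then have "{zs ! k, nxt zs k} \<subseteq> set zs" using k by (auto simp: nxt_def)
  then have "convex hull {zs ! k, nxt zs k} \<subseteq> convex hull (set zs)" by (rule hull_mono)
  then show ?thesis using z by (auto simp: open_segment_def segment_convex_hull)
 qed
 have pos: "0 < s * crs (zs ! j) (nxt zs j) z" if j: "j < length zs" "j \<noteq> k" for j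
 proof -
  have "z \<notin> closed_segment (zs ! j) (nxt zs j)"
   using closed_segment_sides[OF P n k j(1)] z j by (auto simp: open_segment_def)
  moreover have "crs (zs ! j) (nxt zs j) z = 0 ==> z \<in> closed_segment (zs ! j) (nxt zs j)"
   by (rule polygon_side[OF P j(1)]) (use zP in blast)
  ultimately show ?thesis using s(2)[OF j(1) zP] s(1)
   by (metis less_eq_real_def mult_eq_0_iff one_neq_zero zero_neq_neg_one)
 qed
 let ?U = "\<Inter>j\<in>{..<length zs} - {k}. {w. 0 < s * crs (zs ! j) (nxt zs j) w}"
 have "open ?U"
  unfolding crs_def by (intro open_INT) (auto intro!: open_Collect_less continuous_intros)
 moreover have "z \<in> ?U" using pos by auto
 ultimately obtain \<rho> where r: "\<rho> > 0" "ball z \<rho> \<subseteq> ?U" using open_contains_ball by blast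
 show ?thesis
 proof (rule that[OF s(1) r(1)])
  fix w assume w: "dist w z < \<rho>" "0 \<le> s * crs (zs ! k) (nxt zs k) w"
  have "w \<in> ball z \<rho>" using w by (simp add: dist_commute)
  then have "w \<in> ?U" using r(2) by blast
  then have "0 \<le> s * crs (zs ! j) (nxt zs j) w" if "j < length zs" for j
   using w(2) that by (cases "j = k") (auto intro!: less_imp_le)
  then show "w \<in> convex hull (set zs)" using polygon_from_crs[OF P n s] by blast
 qed
qed

section \<open>Places of points in cells, and distances from chains\<close>

locale npc_complex =
 fixes X :: "('v, 'c) pe_complex"
 assumes tpc: "triangle_pentagon_complex X" and cat: "cat0_complex X"
begin

sublocale cat0 "points X" "pe_dist X"
 using cat unfolding cat0_complex_def by unfold_locales simp

abbreviation M where "M \<equiv> points X"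
abbreviation d where "d \<equiv> pe_dist X"
abbreviation bds where "bds \<equiv> bd X"
abbreviation len where "len c \<equiv> length (bd X c)"
abbreviation shp where "shp \<equiv> shape X"
abbreviation poly where "poly \<equiv> cell_polygon X"

lemma pe: "piecewise_euclidean X" using cat unfolding cat0_complex_def by simp

lemma edge_verts: "e \<in> edges X ==> e \<subseteq> verts X" and edge_card: "e \<in> edges X ==> card e = 2"
 using tpc unfolding triangle_pentagon_complex_def by auto

lemma edge_neq: "{u, v} \<in> edges X ==> u \<noteq> v"
 using edge_card[of "{u, v}"] by auto

lemma edgeE: assumes "e \<in> edges X" obtains u v where "e = {u, v}" "u \<noteq> v" "u \<in> verts X" "v \<in> verts X"
 using edge_card[OF assms] edge_verts[OF assms] that unfolding card_2_iff by auto

lemma elen_pos: "e \<in> edges X ==> 0 < elen X e"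
 using pe unfolding piecewise_euclidean_def by auto

lemma cell_len: "c \<in> cells X ==> len c = 3 \<or> len c = 5"
 and cell_distinct: "c \<in> cells X ==> distinct (bds c)"
 and cell_side: "c \<in> cells X ==> k < len c ==> {bds c ! k, nxt (bds c) k} \<in> edges X"
 using tpc unfolding triangle_pentagon_complex_def by auto

lemma cell_len3: "c \<in> cells X ==> 3 \<le> len c" using cell_len by fastforce

lemma shape_len: "c \<in> cells X ==> length (shp c) = len c"
 and shape_convex: "c \<in> cells X ==> convex_polygon (shp c)"
 and shape_side: "c \<in> cells X ==> k < len c ==>
  dist (shp c ! k) (nxt (shp c) k) = elen X {bds c ! k, nxt (bds c) k}"
 using pe unfolding piecewise_euclidean_def by auto

lemma Suc_mod: "c \<in> cells X ==> k < len c ==> Suc k mod len c < len c"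
 by (rule mod_less_divisor) auto

lemma shape_distinct: "c \<in> cells X ==> distinct (shp c)"
 using shape_convex unfolding convex_polygon_def by blast

text \<open>The place that \<open>in_cell\<close> relates to a point, turned into a total function;
  \<open>incell\<close> keeps the incidence.\<close>

definition cpos :: "'c => ('v, 'c) point => complex" where
 "cpos c x = (case x of Skel b => \<Sum>k<len c. b (bds c ! k) *\<^sub>R (shp c ! k) | Inner _ w => w)"

definition incell :: "'c => ('v, 'c) point => bool" where
 "incell c x \<longleftrightarrow> in_cell X c x (cpos c x)"

lemma in_cell_iff: "in_cell X c x z \<longleftrightarrow> incell c x \<and> z = cpos c x"
 by (cases x) (auto simp: incell_def cpos_def)

lemma incell_Inner [simp]: "incell c (Inner c' w) \<longleftrightarrow> c' = c"
 and cpos_Inner [simp]: "cpos c (Inner c' w) = w"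
 by (auto simp: incell_def cpos_def)

lemma incell_Skel: "incell c (Skel b) \<longleftrightarrow> (\<exists>k<len c. supp b \<subseteq> {bds c ! k, nxt (bds c) k})"
 by (auto simp: incell_def cpos_def)

lemma cell_dist_face: "c \<in> cells X ==> incell c x ==> incell c y ==> cell_dist X x y (dist (cpos c x) (cpos c y))"
 by (rule cell_dist.face) (auto simp: in_cell_iff)

lemma cell_dist_nonneg: "cell_dist X x y m ==> 0 \<le> m"
 by (induction rule: cell_dist.induct) (auto intro!: mult_nonneg_nonneg less_imp_le[OF elen_pos])

lemma chain_points: "chain X x y l ==> x \<in> M \<and> y \<in> M \<and> 0 \<le> l"
 by (induction rule: chain.induct) (auto simp: cell_dist_nonneg)

lemma pe_dist_le: assumes "chain X x y l" shows "d x y \<le> l"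
proof -
 have "Inf {l. chain X x y l} \<le> l"
  using assms chain_points by (intro cInf_lower bdd_belowI[of _ 0]) auto
 then show ?thesis unfolding pe_dist_def using assms by auto
qed

lemma chain_single: "x \<in> M ==> y \<in> M ==> cell_dist X x y m ==> chain X x y m"
 using chain.step[OF chain.refl, of x X y m] by simp

lemma d_le_cell_dist: "x \<in> M ==> y \<in> M ==> cell_dist X x y m ==> d x y \<le> m"
 using chain_single pe_dist_le by blast

lemma d_le_cell: "c \<in> cells X ==> x \<in> M ==> y \<in> M ==> incell c x ==> incell c y ==>
  d x y \<le> dist (cpos c x) (cpos c y)"
 using d_le_cell_dist cell_dist_face by blast

text \<open>If no chain joined x and y, then \<open>pe_dist\<close> would take its default value 0,
  and the metric axioms would give x = y; but the trivial chain joins x to itself.\<close>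

lemma ex_chain: assumes "x \<in> M" "y \<in> M" "0 < e" obtains l where "chain X x y l" "l < d x y + e"
proof (cases "\<exists>l. chain X x y l")
 case True
 then have "{l. chain X x y l} \<noteq> {}" by auto
 moreover have "Inf {l. chain X x y l} < d x y + e" using True assms by (simp add: pe_dist_def)
 ultimately have "\<exists>l\<in>{l. chain X x y l}. l < d x y + e" by (intro cInf_lessD)
 then show ?thesis using that by auto
next
 case False
 then have "d x y = 0" by (simp add: pe_dist_def)
 then have "x = y" using zero_iff assms by simp
 then show ?thesis using False chain.refl[OF assms(1)] by auto
qed

text \<open>Points at the same place of a cell are joined by a step of length 0, so the metric
  axioms identify them.\<close>

lemma incell_inj: "c \<in> cells X ==> x \<in> M ==> y \<in> M ==> incell c x ==> incell c y ==> cpos c x = cpos c y ==> x = y"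
 using d_le_cell[of c x y] zero_iff[of x y] nonneg[of x y] by simp

text \<open>The source of lower bounds for \<open>d\<close>. Suppose \<Phi> maps S into the plane
  and does not stretch any single step that starts in S and is too short to leave the disc of radius
  \<rho> around p. Then a chain too short to leave the disc stays in S, and its ends are mapped no
  farther apart than its length.\<close>

lemma chart_chain:
 assumes loc: "\<And>y z m. y \<in> S ==> dist (\<Phi> y) p < \<rho> ==> z \<in> M ==> cell_dist X y z m ==>
   dist (\<Phi> y) p + m < \<rho> ==> z \<in> S \<and> dist (\<Phi> z) (\<Phi> y) \<le> m"
  and "chain X b y l" "b \<in> S" "dist (\<Phi> b) p + l < \<rho>"
 shows "y \<in> S \<and> dist (\<Phi> y) (\<Phi> b) \<le> l"
 using assms(2-)
proof (induction rule: chain.induct)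
 case (refl x) then show ?case by simp
next
 case (step x y l z m)
 have m: "0 \<le> m" using step cell_dist_nonneg by blast
 have l: "0 \<le> l" using step chain_points by blast
 have IH: "y \<in> S" "dist (\<Phi> y) (\<Phi> x) \<le> l" using step m by auto
 have "dist (\<Phi> y) p \<le> l + dist (\<Phi> x) p" using IH dist_triangle[of "\<Phi> y" p "\<Phi> x"] by simp
 then have "z \<in> S \<and> dist (\<Phi> z) (\<Phi> y) \<le> m" using step.prems m by (intro loc[OF IH(1) _ step.hyps(2,3)]) auto
 then show ?case using IH dist_triangle[of "\<Phi> z" "\<Phi> x" "\<Phi> y"] by auto
qed

lemma chart_dist:
 assumes loc: "\<And>y z m. y \<in> S ==> dist (\<Phi> y) p < \<rho> ==> z \<in> M ==> cell_dist X y z m ==>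
   dist (\<Phi> y) p + m < \<rho> ==> z \<in> S \<and> dist (\<Phi> z) (\<Phi> y) \<le> m"
  and b: "b \<in> S" "b \<in> M" "y \<in> M" "dist (\<Phi> b) p + d b y < \<rho>"
 shows "y \<in> S" "dist (\<Phi> y) (\<Phi> b) \<le> d b y"
proof -
 have *: "y \<in> S \<and> dist (\<Phi> y) (\<Phi> b) \<le> d b y + e" if "0 < e" for e
 proof -
  define e' where "e' = min e (\<rho> - dist (\<Phi> b) p - d b y)"
  have "0 < e'" using that b by (simp add: e'_def)
  then obtain l where "chain X b y l" "l < d b y + e'" using ex_chain b by blast
  then show ?thesis
  proof -
   have "dist (\<Phi> b) p + l < \<rho>" "l \<le> d b y + e" using \<open>l < d b y + e'\<close> unfolding e'_def by linarith+
   then show ?thesis using chart_chain[where p = p and \<rho> = \<rho> and S = S and \<Phi> = \<Phi>, OF loc \<open>chain X b y l\<close>] b by auto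
  qed
 qed
 show "y \<in> S" using *[of 1] by simp
 show "dist (\<Phi> y) (\<Phi> b) \<le> d b y" by (rule field_le_epsilon) (use * in blast)
qed

section \<open>Vertices and points of edges\<close>

definition vpoint :: "'v => ('v, 'c) point" where
 "vpoint v = Skel (\<lambda>w. if w = v then 1 else 0)"

definition epoint :: "'v => 'v => real => ('v, 'c) point" where
 "epoint u v t = Skel (\<lambda>w. if w = u then 1 - t else if w = v then t else 0)"

lemma epoint_0: "epoint u v 0 = vpoint u" and epoint_1: "u \<noteq> v ==> epoint u v 1 = vpoint v"
 and epoint_swap: "u \<noteq> v ==> epoint u v t = epoint v u (1 - t)"
 by (auto simp: epoint_def vpoint_def intro!: ext)

lemma vpoint_inj: "vpoint u = vpoint v \<longleftrightarrow> u = v"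
 by (auto simp: vpoint_def fun_eq_iff split: if_splits)

lemma epoint_inj: "u \<noteq> v ==> epoint u v s = epoint u v t \<longleftrightarrow> s = t"
 by (auto simp: epoint_def fun_eq_iff split: if_splits)

lemma vpoint_in: "v \<in> verts X ==> vpoint v \<in> M"
proof -
 assume "v \<in> verts X"
 then have "{v} \<in> graph_complex X" by (simp add: graph_complex_def)
 then show ?thesis unfolding points_def vpoint_def
  by (intro UnI1 CollectI exI[of _ "\<lambda>w. if w = v then 1 else 0"] exI[of _ "{v}"]) (auto simp: supp_def)
qed

lemma epoint_in: "{u, v} \<in> edges X ==> 0 \<le> t ==> t \<le> 1 ==> epoint u v t \<in> M"
proof -
 assume e: "{u, v} \<in> edges X" "0 \<le> t" "t \<le> 1"
 then have "{u, v} \<in> graph_complex X" by (simp add: graph_complex_def)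
 then show ?thesis unfolding points_def epoint_def using e edge_neq[OF e(1)]
  by (intro UnI1 CollectI exI[of _ "\<lambda>w. if w = u then 1 - t else if w = v then t else 0"] exI[of _ "{u, v}"])
   (auto simp: supp_def)
qed

lemma Inner_in: "Inner c z \<in> M \<longleftrightarrow> c \<in> cells X \<and> z \<in> interior (poly c)"
 by (auto simp: points_def)

lemma Skel_on_edge:
 assumes "Skel b \<in> M" "supp b \<subseteq> {u, v}" "u \<noteq> v"
 shows "Skel b = epoint u v (b v)" "0 \<le> b v" "b v \<le> 1" "b u = 1 - b v"
proof -
 obtain \<sigma> where s: "\<sigma> \<in> graph_complex X" "supp b \<subseteq> \<sigma>" "\<And>w. 0 \<le> b w" "sum b \<sigma> = 1"
  using assms(1) by (auto simp: points_def)
 have fin: "finite \<sigma>" using s(1) edge_card by (auto simp: graph_complex_def intro: card_ge_0_finite)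
 have "sum b \<sigma> = sum b (supp b)" using s(2) fin by (intro sum.mono_neutral_right) (auto simp: supp_def)
 also have "\<dots> = sum b {u, v}" using assms(2) by (intro sum.mono_neutral_left) (auto simp: supp_def)
 finally have 1: "b u + b v = 1" using s(4) assms(3) by simp
 then show "b u = 1 - b v" by simp
 show "0 \<le> b v" using s by simp
 show "b v \<le> 1" using 1 s(3)[of u] by simp
 show "Skel b = epoint u v (b v)"
  using 1 assms(2) unfolding epoint_def by (auto simp: fun_eq_iff supp_def)
qed

lemma points_cases:
 assumes "x \<in> M"
 obtains (vertex) v where "v \<in> verts X" "x = vpoint v"
  | (edge) u v t where "{u, v} \<in> edges X" "u \<noteq> v" "0 < t" "t < 1" "x = epoint u v t"
  | (inner) c z where "c \<in> cells X" "z \<in> interior (poly c)" "x = Inner c z"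
proof (cases x)
 case (Inner c z) then show ?thesis using inner assms Inner_in by blast
next
 case (Skel b)
 then obtain \<sigma> where s: "\<sigma> \<in> graph_complex X" "supp b \<subseteq> \<sigma>" "sum b \<sigma> = 1"
  using assms by (auto simp: points_def)
 from s(1) consider v where "v \<in> verts X" "\<sigma> = {v}" | "\<sigma> \<in> edges X" by (auto simp: graph_complex_def)
 then show ?thesis
 proof cases
  case 1
  then have "b v = 1" "\<And>w. w \<noteq> v ==> b w = 0" using s by (auto simp: supp_def)
  then have "x = vpoint v" using Skel by (auto simp: vpoint_def fun_eq_iff)
  then show ?thesis using vertex 1 by blast
 next
  case 2
  then obtain u v where uv: "\<sigma> = {u, v}" "u \<noteq> v" "u \<in> verts X" "v \<in> verts X" by (rule edgeE)
  have E: "x = epoint u v (b v)" "0 \<le> b v" "b v \<le> 1"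
   using Skel_on_edge[of b u v] assms s uv Skel by auto
  then consider "b v = 0" | "b v = 1" | "0 < b v" "b v < 1" by linarith
  then show ?thesis
  proof cases
   case 1 then show ?thesis using vertex[of u] E uv epoint_0 by simp
  next
   case 2 then show ?thesis using vertex[of v] E uv epoint_1 by simp
  next
   case 3 then show ?thesis using edge[of u v "b v"] E uv \<open>\<sigma> \<in> edges X\<close> by simp
  qed
 qed
qed

definition is_side :: "'c => nat => 'v => 'v => bool" where
 "is_side c k u v \<longleftrightarrow> k < len c \<and> {u, v} = {bds c ! k, nxt (bds c) k}"

definition vpos :: "'c => 'v => complex" where
 "vpos c v = cpos c (vpoint v)"

lemma vpos_nth: assumes "c \<in> cells X" "k < len c" shows "vpos c (bds c ! k) = shp c ! k"
proof -
 have "vpos c (bds c ! k) = (\<Sum>j<len c. (if j = k then 1 else 0) *\<^sub>R (shp c ! j))"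
  unfolding vpos_def cpos_def vpoint_def point.case
  using cell_distinct[OF assms(1)] assms(2) by (intro sum.cong refl) (auto simp: nth_eq_iff_index_eq)
 also have "\<dots> = (\<Sum>j<len c. if j = k then shp c ! j else 0)" by (intro sum.cong) auto
 also have "\<dots> = shp c ! k" using assms(2) by simp
 finally show ?thesis .
qed

lemma cpos_epoint: assumes "u \<noteq> v" shows "cpos c (epoint u v t) = (1 - t) *\<^sub>R vpos c u + t *\<^sub>R vpos c v"
 unfolding cpos_def epoint_def vpos_def vpoint_def point.case scaleR_sum_right sum.distrib[symmetric]
 using assms by (intro sum.cong) auto

lemma is_side_cases:
 assumes "c \<in> cells X" "is_side c k u v"
 obtains "u = bds c ! k" "v = nxt (bds c) k" "vpos c u = shp c ! k" "vpos c v = nxt (shp c) k"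
  | "v = bds c ! k" "u = nxt (bds c) k" "vpos c v = shp c ! k" "vpos c u = nxt (shp c) k"
proof -
 have k: "k < len c" and e: "{u, v} = {bds c ! k, nxt (bds c) k}" using assms by (auto simp: is_side_def)
 have n: "vpos c (nxt (bds c) k) = nxt (shp c) k"
  using vpos_nth[OF assms(1) Suc_mod[OF assms(1) k]] shape_len[OF assms(1)] by (simp add: nxt_def)
 from e have "(u = bds c ! k \<and> v = nxt (bds c) k) \<or> (v = bds c ! k \<and> u = nxt (bds c) k)"
  by (auto simp: doubleton_eq_iff)
 then show ?thesis using that n vpos_nth[OF assms(1) k] by blast
qed

lemma is_side_edge: "c \<in> cells X ==> is_side c k u v ==> {u, v} \<in> edges X"
 using cell_side by (auto simp: is_side_def)

lemma is_side_dist: assumes c: "c \<in> cells X" and s: "is_side c k u v"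
 shows "dist (vpos c u) (vpos c v) = elen X {u, v}"
proof -
 have k: "k < len c" using s by (simp add: is_side_def)
 show ?thesis
  using c s by (rule is_side_cases) (use shape_side[OF c k] in \<open>simp_all add: dist_commute insert_commute\<close>)
qed

lemma is_side_neq: "c \<in> cells X ==> is_side c k u v ==> u \<noteq> v \<and> vpos c u \<noteq> vpos c v"
 using is_side_dist[of c k u v] is_side_edge[of c k u v] elen_pos[of "{u,v}"] edge_neq[of u v] by auto

lemma is_side_vpos: assumes c: "c \<in> cells X" and s: "is_side c k u v"
 shows "vpos c u \<in> set (shp c) \<and> vpos c v \<in> set (shp c)"
proof -
 have k: "k < len c" using s by (simp add: is_side_def)
 have "shp c ! k \<in> set (shp c)" "nxt (shp c) k \<in> set (shp c)"
  using k Suc_mod[OF c k] shape_len[OF c] by (simp_all add: nxt_def)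
 note V = this
 from c s show ?thesis by (rule is_side_cases) (use V in simp_all)
qed

lemma incell_epoint: "is_side c k u v ==> incell c (epoint u v t)"
 unfolding epoint_def incell_Skel is_side_def supp_def by (auto intro!: exI[of _ k])

lemma incell_vpoint: "c \<in> cells X ==> v \<in> set (bds c) ==> incell c (vpoint v)"
 unfolding vpoint_def incell_Skel supp_def by (auto simp: in_set_conv_nth)

lemma incell_vpoint_iff: "c \<in> cells X ==> incell c (vpoint v) \<longleftrightarrow> v \<in> set (bds c)"
proof
 assume c: "c \<in> cells X" "incell c (vpoint v)"
 then obtain k where "k < len c" "supp (\<lambda>w. if w = v then 1 else 0 :: real) \<subseteq> {bds c ! k, nxt (bds c) k}"
  unfolding vpoint_def incell_Skel by blast
 moreover have "v \<in> supp (\<lambda>w. if w = v then 1 else 0 :: real)" by (simp add: supp_def)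
 ultimately have "k < len c" "v \<in> {bds c ! k, nxt (bds c) k}" by blast+
 then show "v \<in> set (bds c)" using Suc_mod[OF c(1)] by (auto simp: nxt_def)
qed (rule incell_vpoint)

lemma incell_Skel_side:
 assumes "c \<in> cells X" "x \<in> M" "incell c x" "\<And>z. x \<noteq> Inner c z"
 obtains k u v t where "is_side c k u v" "x = epoint u v t" "0 \<le> t" "t \<le> 1"
  "u = bds c ! k" "v = nxt (bds c) k" "cpos c x \<in> closed_segment (shp c ! k) (nxt (shp c) k)"
proof (cases x)
 case (Inner c' z) then show ?thesis using assms by auto
next
 case (Skel b)
 then obtain k where k: "k < len c" "supp b \<subseteq> {bds c ! k, nxt (bds c) k}" using assms incell_Skel by auto
 let ?u = "bds c ! k" and ?v = "nxt (bds c) k"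
 have s: "is_side c k ?u ?v" using k by (simp add: is_side_def)
 have uv: "?u \<noteq> ?v" using is_side_neq[OF assms(1) s] by simp
 note E = Skel_on_edge[of b ?u ?v]
 have x: "x = epoint ?u ?v (b ?v)" "0 \<le> b ?v" "b ?v \<le> 1" using E assms(2) k uv Skel by auto
 have "cpos c x = (1 - b ?v) *\<^sub>R (shp c ! k) + b ?v *\<^sub>R nxt (shp c) k"
  unfolding x(1) cpos_epoint[OF uv] using is_side_cases[OF assms(1) s] uv by metis
 then have "cpos c x \<in> closed_segment (shp c ! k) (nxt (shp c) k)" using x unfolding in_segment by blast
 then show ?thesis using that s x by blast
qed

lemma poly_alt: "poly c = convex hull (set (shp c))" by (simp add: cell_polygon_def)

lemma poly_closed: "closed (poly c)" "compact (poly c)" "convex (poly c)"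
 unfolding poly_alt by (simp_all add: compact_convex_hull finite_imp_compact compact_imp_closed)

lemma shape_ge3: "c \<in> cells X ==> 3 \<le> length (shp c)" using shape_len cell_len3 by simp

lemma side_in_poly: assumes "c \<in> cells X" "k < len c"
 shows "closed_segment (shp c ! k) (nxt (shp c) k) \<subseteq> poly c"
proof -
 have "{shp c ! k, nxt (shp c) k} \<subseteq> set (shp c)"
  using assms Suc_mod[OF assms] shape_len[OF assms(1)] by (auto simp: nxt_def)
 then show ?thesis unfolding poly_alt segment_convex_hull by (rule hull_mono)
qed

lemma cpos_in_poly: assumes "c \<in> cells X" "x \<in> M" "incell c x" shows "cpos c x \<in> poly c"
proof (cases "\<exists>z. x = Inner c z")
 case True
 then obtain z where z: "x = Inner c z" using assms by auto
 then have "z \<in> interior (poly c)" using assms(2) Inner_in by blast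
 then show ?thesis using z interior_subset by (metis cpos_Inner subsetD)
next
 case False
 then show ?thesis using incell_Skel_side[OF assms] side_in_poly[OF assms(1)] by (metis is_side_def subsetD)
qed

lemma cell_point_exists: assumes c: "c \<in> cells X" and z: "z \<in> poly c"
 obtains x where "x \<in> M" "incell c x" "cpos c x = z"
proof (cases "z \<in> interior (poly c)")
 case True
 then show ?thesis using that[of "Inner c z"] c Inner_in by auto
next
 case False
 then obtain k where k: "k < len c" "z \<in> closed_segment (shp c ! k) (nxt (shp c) k)"
  using polygon_interior_iff[OF shape_convex[OF c] shape_ge3[OF c], of z] z shape_len[OF c]
  unfolding poly_alt by auto
 then obtain t where t: "0 \<le> t" "t \<le> 1" "z = (1 - t) *\<^sub>R (shp c ! k) + t *\<^sub>R nxt (shp c) k"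
  unfolding in_segment by auto
 let ?u = "bds c ! k" and ?v = "nxt (bds c) k"
 have s: "is_side c k ?u ?v" using k by (simp add: is_side_def)
 have uv: "?u \<noteq> ?v" using is_side_neq[OF c s] by simp
 have "cpos c (epoint ?u ?v t) = z"
  unfolding cpos_epoint[OF uv] t(3) using is_side_cases[OF c s] uv by metis
 then show ?thesis using that[of "epoint ?u ?v t"] incell_epoint[OF s] epoint_in[OF is_side_edge[OF c s]] t by simp
qed

text \<open>The inverse of \<open>cpos c\<close> on the polygon; the choice is unique by
  \<open>incell_inj\<close>.\<close>

definition cpt :: "'c => complex => ('v, 'c) point" where
 "cpt c z = (SOME x. x \<in> M \<and> incell c x \<and> cpos c x = z)"

lemma cpt: assumes "c \<in> cells X" "z \<in> poly c"
 shows "cpt c z \<in> M" "incell c (cpt c z)" "cpos c (cpt c z) = z"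
proof -
 have "\<exists>x. x \<in> M \<and> incell c x \<and> cpos c x = z" using cell_point_exists[OF assms] by blast
 then have "cpt c z \<in> M \<and> incell c (cpt c z) \<and> cpos c (cpt c z) = z" unfolding cpt_def by (rule someI_ex)
 then show "cpt c z \<in> M" "incell c (cpt c z)" "cpos c (cpt c z) = z" by auto
qed

lemma cpt_unique: "c \<in> cells X ==> x \<in> M ==> incell c x ==> cpt c (cpos c x) = x"
 using incell_inj[of c "cpt c (cpos c x)" x] cpt[of c "cpos c x"] cpos_in_poly[of c x] by simp

lemma cpt_interior: "c \<in> cells X ==> z \<in> interior (poly c) ==> cpt c z = Inner c z"
 using cpt_unique[of c "Inner c z"] Inner_in by simp

lemma cpt_lipschitz: "c \<in> cells X ==> z \<in> poly c ==> w \<in> poly c ==> d (cpt c z) (cpt c w) \<le> dist z w"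
 using d_le_cell[of c "cpt c z" "cpt c w"] cpt[of c z] cpt[of c w] by simp

lemma incell_interior: assumes c: "c \<in> cells X" "x \<in> M" "incell c x" "cpos c x \<in> interior (poly c)"
 shows "x = Inner c (cpos c x)"
 using cpt_unique[OF c(1-3)] cpt_interior[OF c(1,4)] by simp

text \<open>A constant for the finitely many representatives carries over by isometry. Thus it
  serves all cells, infinitely many of which may share a vertex or an edge.\<close>

lemma uniform_gap: assumes s: "0 \<le> s" "s \<le> 1"
 obtains \<rho> where "0 < \<rho>" "\<And>c. c \<in> cells X ==> segment_gap s (set (shp c)) \<rho>"
proof -
 obtain F where F: "finite F" "F \<subseteq> cells X" "\<And>c. c \<in> cells X ==> \<exists>c'\<in>F. isometric_sets (poly c) (poly c')"
  using pe unfolding piecewise_euclidean_def by blast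
 have "\<exists>\<rho>>0. \<forall>c\<in>F. segment_gap s (set (shp c)) \<rho>"
  by (rule finite_uniform_radius[OF F(1)]) (auto intro: segment_gap_exists segment_gap_mono)
 then obtain \<rho> where r: "\<rho> > 0" "\<forall>c\<in>F. segment_gap s (set (shp c)) \<rho>" by blast
 show ?thesis
 proof (rule that[OF r(1)])
  fix c assume c: "c \<in> cells X"
  obtain c' where c': "c' \<in> F" "isometric_sets (poly c) (poly c')" using F(3)[OF c] by blast
  show "segment_gap s (set (shp c)) \<rho>"
  proof (rule segment_gap_isometric[OF c'(2)[unfolded poly_alt] _ s])
   fix p assume "p \<in> set (shp c)"
   then show "p extreme_point_of convex hull set (shp c)"
    using polygon_vertex_extreme[OF shape_convex[OF c]] by (auto simp: in_set_conv_nth)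
  next
   show "segment_gap s (set (shp c')) \<rho>" using r c' by blast
  qed
 qed
qed

end

lemma dist_of_real_scaled: "0 \<le> l ==> dist (of_real (l * s) :: complex) (of_real (l * t)) = l * \<bar>s - t\<bar>"
 by (simp only: dist_of_real dist_real_def right_diff_distrib[symmetric] abs_mult abs_of_nonneg)

context npc_complex begin

subsection \<open>Charts\<close>

text \<open>\<open>chart_dist\<close> with the open cell as chart: within a ball inside the polygon
  no step can leave the cell.\<close>

lemma inner_chart:
 assumes c: "c \<in> cells X" and r: "ball z0 \<rho> \<subseteq> interior (poly c)"
  and b: "dist w z0 + d (Inner c w) y < \<rho>" "y \<in> M"
 obtains w' where "y = Inner c w'" "w' \<in> interior (poly c)" "dist w w' \<le> d (Inner c w) y"
proof -
 let ?S = "{Inner c w | w. w \<in> interior (poly c)}"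
 let ?\<Phi> = "cpos c"
 have loc: "z \<in> ?S \<and> dist (?\<Phi> z) (?\<Phi> y) \<le> m"
  if y: "y \<in> ?S" "dist (?\<Phi> y) z0 < \<rho>" and z: "z \<in> M" "cell_dist X y z m" "dist (?\<Phi> y) z0 + m < \<rho>" for y z m
 proof -
  obtain w where w: "y = Inner c w" using y by blast
  from z(2) show ?thesis
  proof cases
   case (edge u v a b) then show ?thesis using w by simp
  next
   case (face c' z1 z2)
   then have i: "c' = c" "incell c z" "m = dist (cpos c y) (cpos c z)" using w by (auto simp: in_cell_iff)
   then have "dist (cpos c z) z0 < \<rho>" using z(3) dist_triangle[of "cpos c z" z0 "cpos c y"] by (simp add: dist_commute)
   then have "cpos c z \<in> interior (poly c)" using r by (auto simp: dist_commute)
   then have "z = Inner c (cpos c z)" using incell_interior c z i by blast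
   then show ?thesis using \<open>cpos c z \<in> interior (poly c)\<close> i by (auto simp: dist_commute)
  qed
 qed
 have "w \<in> ball z0 \<rho>" using b(1) nonneg[of "Inner c w" y] by (simp add: dist_commute del: nonneg)
 then have "w \<in> interior (poly c)" using r by blast
 then have B: "Inner c w \<in> ?S" "Inner c w \<in> M" using c Inner_in by auto
 have b': "dist (?\<Phi> (Inner c w)) z0 + d (Inner c w) y < \<rho>" using b by simp
 show ?thesis using chart_dist[where S = ?S and \<Phi> = ?\<Phi>, OF loc B b(2) b'] that by (auto simp: dist_commute)
qed

section \<open>Folding the cells at an edge into the plane\<close>

definition pages :: "'v => 'v => 'c set" where
 "pages u v = {c \<in> cells X. \<exists>k. is_side c k u v}"

text \<open>The edge goes to the real axis, starting at 0; the page j goes to the lower half-plane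
  and all other pages together to the upper one. Each page is mapped isometrically, and a path from
  j into any other page is unfolded. On \<open>Skel b\<close> only the coordinate \<open>b v\<close>
  is read, which is meaningful for points of the edge.\<close>

definition fold_map :: "'v => 'v => 'c => ('v, 'c) point => complex" where
 "fold_map u v j x = (case x of Skel b => of_real (elen X {u, v} * b v)
   | Inner c w => Complex (along (vpos c u) (vpos c v) w) ((if c = j then - 1 else 1) * height (vpos c u) (vpos c v) w))"

lemma page_side: assumes "c \<in> pages u v" obtains k where "c \<in> cells X" "is_side c k u v"
 using assms by (auto simp: pages_def)

lemma page_crs: assumes c: "c \<in> pages u v" and z: "z \<in> poly c" "w \<in> poly c"
 shows "0 \<le> crs (vpos c u) (vpos c v) z * crs (vpos c u) (vpos c v) w"
proof -
 obtain k where k: "c \<in> cells X" "is_side c k u v" using c by (rule page_side)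
 have kl: "k < length (shp c)" using k shape_len by (simp add: is_side_def)
 obtain s where s: "s = (1::real) \<or> s = - 1"
  "\<And>j. j < length (shp c) ==> j \<noteq> k ==> j \<noteq> Suc k mod length (shp c) ==> 0 < s * crs (shp c ! k) (nxt (shp c) k) (shp c ! j)"
  "\<And>z. z \<in> convex hull (set (shp c)) ==> 0 \<le> s * crs (shp c ! k) (nxt (shp c) k) z"
  by (rule polygon_side[OF shape_convex[OF k(1)] kl]) (rule that)
 let ?A = "crs (shp c ! k) (nxt (shp c) k)"
 have "0 \<le> s * ?A z" "0 \<le> s * ?A w" using s(3) z unfolding poly_alt by auto
 then have "0 \<le> (s * ?A z) * (s * ?A w)" by (rule mult_nonneg_nonneg)
 then have "0 \<le> ?A z * ?A w" using s(1) by auto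
 moreover have "crs (vpos c u) (vpos c v) z * crs (vpos c u) (vpos c v) w = ?A z * ?A w"
  using k(1,2) by (rule is_side_cases) (simp_all add: crs_swap[of "nxt (shp c) k" "shp c ! k"])
 ultimately show ?thesis by simp
qed

text \<open>The formula of \<open>fold_map\<close> at inner points of a page, extended to its whole
  closed polygon.\<close>

definition page_coord :: "'v => 'v => 'c => 'c => complex => complex" where
 "page_coord u v j c w = Complex (along (vpos c u) (vpos c v) w) ((if c = j then - 1 else 1) * height (vpos c u) (vpos c v) w)"

lemma page_coord_dist:
 assumes c: "c \<in> pages u v" and z: "z \<in> poly c" "w \<in> poly c"
 shows "dist (page_coord u v j c z) (page_coord u v j c w) = dist z w"
proof -
 obtain k where k: "c \<in> cells X" "is_side c k u v" using c by (rule page_side)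
 have ne: "vpos c u \<noteq> vpos c v" using is_side_neq k by blast
 have "(dist (page_coord u v j c z) (page_coord u v j c w))\<^sup>2 = (dist z w)\<^sup>2"
  unfolding along_height_dist[OF ne page_crs[OF c z], symmetric]
  by (auto simp: page_coord_def dist_norm cmod_power2 power2_commute)
 then show ?thesis by (simp add: power2_eq_iff_nonneg)
qed

lemma page_coord_edge:
 assumes c: "c \<in> pages u v" and t: "0 \<le> t" "t \<le> 1"
 shows "page_coord u v j c (cpos c (epoint u v t)) = of_real (elen X {u, v} * t)"
proof -
 obtain k where k: "c \<in> cells X" "is_side c k u v" using c by (rule page_side)
 have ne: "u \<noteq> v" "vpos c u \<noteq> vpos c v" using is_side_neq k by blast+
 let ?P = "vpos c u" and ?Q = "vpos c v"
 let ?z = "(1 - t) *\<^sub>R ?P + t *\<^sub>R ?Q"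
 have z: "?z - ?P = t *\<^sub>R (?Q - ?P)" by (simp add: algebra_simps)
 have "along ?P ?Q ?z = t * dist ?P ?Q"
  unfolding along_def z using ne by (simp add: dist_norm norm_minus_commute power2_norm_eq_inner[symmetric] power2_eq_square)
 moreover have "crs ?P ?Q ?z = 0" unfolding crs_alt z by (simp add: algebra_simps)
 ultimately show ?thesis unfolding cpos_epoint[OF ne(1)] page_coord_def height_def
  using is_side_dist[OF k] by (simp add: complex_eq_iff mult.commute)
qed

lemma fold_map_Inner: "fold_map u v j (Inner c w) = page_coord u v j c w"
 by (simp add: fold_map_def page_coord_def)

lemma fold_map_epoint: "u \<noteq> v ==> fold_map u v j (epoint u v t) = of_real (elen X {u, v} * t)"
 by (auto simp: fold_map_def epoint_def)

text \<open>The closed edge with the open pages. The other sides of the pages are left out, since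
  further cells may be attached there.\<close>

definition book :: "'v => 'v => ('v, 'c) point set" where
 "book u v = {Inner c w | c w. c \<in> pages u v \<and> w \<in> interior (poly c)} \<union> {epoint u v s | s. 0 \<le> s \<and> s \<le> 1}"

lemma epoint_eq_iff:
 assumes "u \<noteq> v" "u' \<noteq> v'" "0 < t" "t < 1" "epoint u v t = epoint u' v' t'" "0 \<le> t'" "t' \<le> 1"
 shows "{u, v} = {u', v'}"
proof -
 have f: "(\<lambda>w. if w = u then 1 - t else if w = v then t else 0) = (\<lambda>w. if w = u' then 1 - t' else if w = v' then t' else 0)"
  using assms(5) by (simp add: epoint_def)
 have "u = u' \<or> u = v'" "v = u' \<or> v = v'"
  using fun_cong[OF f, of u] fun_cong[OF f, of v] assms(1-4) by (auto split: if_splits)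
 then show ?thesis using assms(1,2) by auto
qed

text \<open>Near an inner point of an edge the complex is a book, on which \<open>fold_map\<close>
  does not stretch. One radius works for all pages, even infinitely many, by
  \<open>uniform_gap\<close>; it is also at most the distance to either end, so that short chains do
  not reach the ends of the edge.\<close>

lemma book_facts:
 assumes e: "{u, v} \<in> edges X" and t: "0 < t" "t < 1"
 obtains \<rho> where "0 < \<rho>"
  "\<And>c y. c \<in> pages u v ==> y \<in> M ==> incell c y ==> dist (cpos c y) (cpos c (epoint u v t)) < \<rho> ==>
    y \<in> book u v \<and> fold_map u v j y = page_coord u v j c (cpos c y)"
  "\<And>y z. y \<in> book u v ==> y \<in> M ==> z \<in> M ==>
    dist (fold_map u v j y) (of_real (elen X {u, v} * t)) + d y z < \<rho> ==>
    z \<in> book u v \<and> dist (fold_map u v j z) (fold_map u v j y) \<le> d y z"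
proof -
 have uv: "u \<noteq> v" using edge_neq[OF e] .
 let ?x = "epoint u v t" and ?l = "elen X {u, v}"
 let ?o = "of_real (?l * t) :: complex"
 have l: "?l > 0" using elen_pos[OF e] .
 obtain \<rho>0 where r0: "0 < \<rho>0" "\<And>c. c \<in> cells X ==> segment_gap t (set (shp c)) \<rho>0"
  using uniform_gap[of t] t by auto
 define \<rho> where "\<rho> = min \<rho>0 (min (?l * t) (?l * (1 - t)))"
 have r: "0 < \<rho>" "\<rho> \<le> \<rho>0" "\<rho> \<le> ?l * t" "\<rho> \<le> ?l * (1 - t)" using r0 l t by (auto simp: \<rho>_def)
 have near: "y \<in> book u v \<and> fold_map u v j y = page_coord u v j c (cpos c y)"
  if c: "c \<in> pages u v" and y: "y \<in> M" "incell c y" and dy: "dist (cpos c y) (cpos c ?x) < \<rho>" for c y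
 proof (cases "\<exists>z. y = Inner c z")
  case True
  then obtain z where z: "y = Inner c z" by blast
  then have "z \<in> interior (poly c)" using y Inner_in by simp
  then show ?thesis using c z fold_map_Inner by (auto simp: book_def)
 next
  case False
  obtain k where k: "c \<in> cells X" "is_side c k u v" using c by (rule page_side)
  obtain k' u' v' t' where s: "is_side c k' u' v'" "y = epoint u' v' t'" "0 \<le> t'" "t' \<le> 1"
   "u' = bds c ! k'" "v' = nxt (bds c) k'" "cpos c y \<in> closed_segment (shp c ! k') (nxt (shp c) k')"
   using incell_Skel_side[OF k(1) y] False by metis
  \<comment> \<open>A boundary point of the page this close to the given point lies on the common
    edge, as the other sides of the polygon are at least \<open>\<rho>0\<close> away.\<close>
  have kk: "k' = k"
  proof (rule ccontr)
   assume ne: "k' \<noteq> k"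
   have x: "cpos c ?x = (1 - t) *\<^sub>R vpos c u + t *\<^sub>R vpos c v" by (rule cpos_epoint[OF uv])
   have V: "vpos c u \<in> set (shp c)" "vpos c v \<in> set (shp c)" "shp c ! k' \<in> set (shp c)" "nxt (shp c) k' \<in> set (shp c)"
    using is_side_vpos[OF k] is_side_vpos[OF k(1) s(1)] is_side_cases[OF k(1) s(1)] by metis+
   have xo: "cpos c ?x \<in> open_segment (vpos c u) (vpos c v)"
    unfolding x in_segment using t is_side_neq[OF k] by auto
   have xk: "cpos c ?x \<in> closed_segment (shp c ! k) (nxt (shp c) k)" "cpos c ?x \<noteq> shp c ! k" "cpos c ?x \<noteq> nxt (shp c) k"
    using k(1,2) by (rule is_side_cases; use xo in \<open>auto simp: open_segment_def closed_segment_commute\<close>)+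
   have "cpos c ?x \<notin> closed_segment (shp c ! k') (nxt (shp c) k')"
    using closed_segment_sides[OF shape_convex[OF k(1)] shape_ge3[OF k(1)], of k k'] xk ne k s(1) shape_len[OF k(1)]
    by (auto simp: is_side_def)
   then have "\<rho>0 \<le> dist (cpos c ?x) (cpos c y)"
    using r0(2)[OF k(1)] V s(7) unfolding segment_gap_def x by blast
   then show False using dy r by (simp add: dist_commute)
  qed
  have "{u', v'} = {u, v}" using s k kk by (simp add: is_side_def)
  then have "y = epoint u v t' \<or> y = epoint u v (1 - t')"
   using s(2) uv epoint_swap[of u' v' t'] by (auto simp: doubleton_eq_iff)
  then obtain t'' where t'': "y = epoint u v t''" "0 \<le> t''" "t'' \<le> 1" using s(3,4) by (elim disjE) auto
  then show ?thesis using c page_coord_edge[OF c t''(2,3)] fold_map_epoint[OF uv] by (auto simp: book_def)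
 qed
 have loc: "z \<in> book u v \<and> dist (fold_map u v j z) (fold_map u v j y) \<le> m"
  if y: "y \<in> book u v" "dist (fold_map u v j y) ?o < \<rho>"
   and z: "z \<in> M" "cell_dist X y z m" "dist (fold_map u v j y) ?o + m < \<rho>" for y z m
 proof -
  have yM: "y \<in> M" using y(1) epoint_in[OF e] by (auto simp: book_def Inner_in pages_def)
  have that_face: ?thesis if c: "c \<in> pages u v" "incell c y" "incell c z" "m = dist (cpos c y) (cpos c z)"
   "fold_map u v j y = page_coord u v j c (cpos c y)" for c
  proof -
   have cc: "c \<in> cells X" using c(1) by (simp add: pages_def)
   obtain k where k: "is_side c k u v" using c(1) page_side by blast
   have xM: "?x \<in> M" "incell c ?x" using epoint_in[OF e] t incell_epoint[OF k] by auto
   have P: "cpos c y \<in> poly c" "cpos c z \<in> poly c" "cpos c ?x \<in> poly c"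
    using cpos_in_poly[OF cc] yM z(1) c xM by blast+
   have "dist (cpos c y) (cpos c ?x) = dist (fold_map u v j y) ?o"
    using page_coord_dist[OF c(1) P(1,3), of j] page_coord_edge[OF c(1), of t j] t c(5) by simp
   then have "dist (cpos c z) (cpos c ?x) < \<rho>"
    using z(3) c(4) dist_triangle[of "cpos c z" "cpos c ?x" "cpos c y"] by (simp add: dist_commute)
   from near[OF c(1) z(1) c(3) this] show ?thesis
    using page_coord_dist[OF c(1) P(2,1), of j] c(4,5) by (simp add: dist_commute)
  qed
  from y(1) consider (I) c w where "y = Inner c w" "c \<in> pages u v" | (E) s where "y = epoint u v s" "0 \<le> s" "s \<le> 1"
   by (auto simp: book_def)
  then show ?thesis
  proof cases
   case I
   from z(2) show ?thesis
   proof cases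
    case (edge u' v' a b) then show ?thesis using I by simp
   next
    case (face c' z1 z2)
    then have "c' = c" using I by (simp add: in_cell_iff)
    then show ?thesis using face I that_face[of c] by (simp add: in_cell_iff fold_map_Inner)
   qed
  next
   case E
   have s: "0 < s" "s < 1"
   proof -
    have "dist (of_real (?l * s) :: complex) ?o = ?l * \<bar>s - t\<bar>"
     using l by (intro dist_of_real_scaled) simp
    then have *: "?l * \<bar>s - t\<bar> < \<rho>" using y(2) E fold_map_epoint[OF uv] by simp
    then have "?l * \<bar>s - t\<bar> < ?l * t" "?l * \<bar>s - t\<bar> < ?l * (1 - t)" using r by linarith+
    then have "\<bar>s - t\<bar> < t" "\<bar>s - t\<bar> < 1 - t" using l by simp_all
    then show "0 < s" "s < 1" by linarith+
   qed
   from z(2) show ?thesis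
   proof cases
    case (edge u' v' a b)
    have uv': "u' \<noteq> v'" using edge_neq edge by blast
    have "y = epoint u' v' (a v')" "0 \<le> a v'" "a v' \<le> 1" using Skel_on_edge[of a u' v'] edge yM uv' by auto
    then have eq: "{u, v} = {u', v'}" using epoint_eq_iff[of u v u' v' s "a v'"] uv uv' s E by auto
    have A: "b u = 1 - b v" "a u = 1 - a v" "z = epoint u v (b v)" "0 \<le> b v" "b v \<le> 1"
     using Skel_on_edge[of b u v] Skel_on_edge[of a u v] edge uv eq yM z(1) by auto
    have "u' = u \<or> u' = v" using eq by auto
    then have "\<bar>a u' - b u'\<bar> = \<bar>a v - b v\<bar>" using A by auto
    then have m: "m = ?l * \<bar>a v - b v\<bar>" using edge eq by simp
    have "dist (fold_map u v j z) (fold_map u v j y) = ?l * \<bar>a v - b v\<bar>"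
     using l unfolding edge(1,2) fold_map_def point.case
     by (subst dist_of_real_scaled) (simp_all add: abs_minus_commute)
    then show ?thesis using m A by (auto simp: book_def)
   next
    case (face c z1 z2)
    then have ic: "c \<in> cells X" "incell c y" "incell c z" "m = dist (cpos c y) (cpos c z)"
     by (auto simp: in_cell_iff)
    have "y \<noteq> Inner c w" for w using E by (simp add: epoint_def)
    then obtain k' u' v' t' where k': "is_side c k' u' v'" "y = epoint u' v' t'" "0 \<le> t'" "t' \<le> 1"
     using incell_Skel_side[OF ic(1) yM ic(2)] by metis
    have "{u, v} = {u', v'}" using epoint_eq_iff[of u v u' v' s t'] uv is_side_neq[OF ic(1) k'(1)] s E k' by auto
    then have "c \<in> pages u v" using k' ic(1) by (auto simp: pages_def is_side_def)
    then show ?thesis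
     using that_face[of c] ic E page_coord_edge[of c u v s j] fold_map_epoint[OF uv] by simp
   qed
  qed
 qed
 show ?thesis
 proof (rule that[OF r(1) near])
  fix y z assume "y \<in> book u v" "y \<in> M" "z \<in> M" "dist (fold_map u v j y) ?o + d y z < \<rho>"
  then show "z \<in> book u v \<and> dist (fold_map u v j z) (fold_map u v j y) \<le> d y z"
   using chart_dist[where S = "book u v" and \<Phi> = "fold_map u v j" and p = ?o and \<rho> = \<rho>, OF loc] by blast
 qed
qed

subsection \<open>Geodesics in cells and across edges\<close>

text \<open>\<open>side_neighbourhood\<close> for an edge given by its ends, in either direction of
  traversal.\<close>

lemma page_neighbourhood:
 assumes e: "{u, v} \<in> edges X" and t: "0 < t" "t < 1" and c: "c \<in> pages u v"
 obtains s \<rho> :: real where "s = 1 \<or> s = - 1" "0 < \<rho>"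
  "\<And>w. dist w (cpos c (epoint u v t)) < \<rho> ==> 0 \<le> s * crs (vpos c u) (vpos c v) w ==> w \<in> poly c"
proof -
 obtain k where k: "c \<in> cells X" "is_side c k u v" using c by (rule page_side)
 have kl: "k < length (shp c)" using k shape_len by (simp add: is_side_def)
 have uv: "u \<noteq> v" "vpos c u \<noteq> vpos c v" using is_side_neq[OF k] by auto
 have x: "cpos c (epoint u v t) \<in> open_segment (vpos c u) (vpos c v)"
  unfolding cpos_epoint[OF uv(1)] in_segment using t uv by auto
 from k show ?thesis
 proof (rule is_side_cases)
  assume a: "vpos c u = shp c ! k" "vpos c v = nxt (shp c) k"
  show ?thesis
   by (rule side_neighbourhood[OF shape_convex[OF k(1)] shape_ge3[OF k(1)] kl x[unfolded a]])
    (rule that, assumption, assumption, simp add: poly_alt a)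
 next
  assume a: "vpos c v = shp c ! k" "vpos c u = nxt (shp c) k"
  have x': "cpos c (epoint u v t) \<in> open_segment (shp c ! k) (nxt (shp c) k)"
   using x a by (simp add: open_segment_commute)
  obtain s \<rho> where s: "s = (1::real) \<or> s = - 1" "0 < \<rho>"
   "\<And>w. dist w (cpos c (epoint u v t)) < \<rho> ==> 0 \<le> s * crs (shp c ! k) (nxt (shp c) k) w ==> w \<in> convex hull (set (shp c))"
   by (rule side_neighbourhood[OF shape_convex[OF k(1)] shape_ge3[OF k(1)] kl x']) (rule that)
  show ?thesis
  proof (rule that[of "- s" \<rho>])
   fix w assume "dist w (cpos c (epoint u v t)) < \<rho>" "0 \<le> - s * crs (vpos c u) (vpos c v) w"
   then show "w \<in> poly c" using s(3)[of w] unfolding a crs_swap[of "nxt (shp c) k" "shp c ! k"] poly_alt by simp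
  qed (use s in auto)
 qed
qed

text \<open>The last premise says that the segments from b and from y make supplementary angles with
  the edge. With \<open>c1\<close> folded down and \<open>c2\<close> folded up, their images lie on
  a line through the image of the crossing point, on opposite sides of it; as folding does not
  stretch, the path through this point is shortest.\<close>

lemma cross_edge:
 assumes e: "{u, v} \<in> edges X" and t: "0 < t" "t < 1"
  and c: "c1 \<in> pages u v" "c2 \<in> pages u v" "c1 \<noteq> c2"
 obtains \<rho> where "0 < \<rho>"
  "\<And>b y r1 r2. b \<in> M ==> y \<in> M ==> incell c1 b ==> incell c2 y ==>
   r1 = dist (cpos c1 b) (cpos c1 (epoint u v t)) ==> r2 = dist (cpos c2 y) (cpos c2 (epoint u v t)) ==>
   r1 < \<rho> ==> r2 < \<rho> ==>
   r2 * ((cpos c1 b - cpos c1 (epoint u v t)) \<bullet> (vpos c1 v - vpos c1 u)) =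
   - (r1 * ((cpos c2 y - cpos c2 (epoint u v t)) \<bullet> (vpos c2 v - vpos c2 u))) ==>
   d b y = r1 + r2"
proof -
 let ?x = "epoint u v t" and ?l = "elen X {u, v}"
 let ?o = "of_real (?l * t) :: complex" and ?F = "fold_map u v c1"
 have l: "?l > 0" using elen_pos[OF e] .
 obtain \<rho> where r: "0 < \<rho>"
  "\<And>c y. c \<in> pages u v ==> y \<in> M ==> incell c y ==> dist (cpos c y) (cpos c ?x) < \<rho> ==>
    y \<in> book u v \<and> ?F y = page_coord u v c1 c (cpos c y)"
  "\<And>y z. y \<in> book u v ==> y \<in> M ==> z \<in> M ==> dist (?F y) ?o + d y z < \<rho> ==>
    z \<in> book u v \<and> dist (?F z) (?F y) \<le> d y z"
  by (rule book_facts[OF e t, of c1]) (rule that)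
 show ?thesis
 proof (rule that[of "\<rho> / 4"])
  show "0 < \<rho> / 4" using r by simp
  fix b y r1 r2
  assume bym: "b \<in> M" "y \<in> M" "incell c1 b" "incell c2 y"
   and r1: "r1 = dist (cpos c1 b) (cpos c1 ?x)" and r2: "r2 = dist (cpos c2 y) (cpos c2 ?x)"
   and rr: "r1 < \<rho> / 4" "r2 < \<rho> / 4"
   and eq: "r2 * ((cpos c1 b - cpos c1 ?x) \<bullet> (vpos c1 v - vpos c1 u)) =
    - (r1 * ((cpos c2 y - cpos c2 ?x) \<bullet> (vpos c2 v - vpos c2 u)))"
  obtain k1 where k1: "c1 \<in> cells X" "is_side c1 k1 u v" using c(1) by (rule page_side)
  obtain k2 where k2: "c2 \<in> cells X" "is_side c2 k2 u v" using c(2) by (rule page_side)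
  have xM: "?x \<in> M" "incell c1 ?x" "incell c2 ?x" using epoint_in[OF e] t incell_epoint k1 k2 by auto
  note P = cpos_in_poly[OF k1(1) bym(1,3)] cpos_in_poly[OF k1(1) xM(1,2)]
   cpos_in_poly[OF k2(1) bym(2,4)] cpos_in_poly[OF k2(1) xM(1,3)]
  have Fb: "b \<in> book u v" "?F b = page_coord u v c1 c1 (cpos c1 b)"
   using r(2)[OF c(1) bym(1,3)] rr r1 r(1) by auto
  have Fy: "y \<in> book u v" "?F y = page_coord u v c1 c2 (cpos c2 y)"
   using r(2)[OF c(2) bym(2,4)] rr r2 r(1) by auto
  have n1: "dist (?F b) ?o = r1"
   using page_coord_dist[OF c(1) P(1,2), of c1] page_coord_edge[OF c(1), of t c1] t Fb r1 by simp
  have n2: "dist (?F y) ?o = r2"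
   using page_coord_dist[OF c(2) P(3,4), of c1] page_coord_edge[OF c(2), of t c1] t Fy r2 by simp
  define a1 where "a1 = Re (?F b) - ?l * t"
  define a2 where "a2 = Re (?F y) - ?l * t"
  define h1 where "h1 = - Im (?F b)"
  define h2 where "h2 = Im (?F y)"
  have h: "0 \<le> h1" "0 \<le> h2" using c(3) unfolding h1_def h2_def Fb Fy page_coord_def height_def by auto
  have al: "along (vpos c u) (vpos c v) (cpos c ?x) = ?l * t" if "c \<in> pages u v" for c
   using arg_cong[OF page_coord_edge[OF that, of t c1], of Re] t by (simp add: page_coord_def)
  have A: "(w - z) \<bullet> (Q - P) / dist P Q = along P Q w - along P Q z" for w z P Q
   by (simp add: along_def inner_diff_left diff_divide_distrib)
  have "a1 = ((cpos c1 b - cpos c1 ?x) \<bullet> (vpos c1 v - vpos c1 u)) / ?l"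
   using A[of "cpos c1 b" "cpos c1 ?x" "vpos c1 v" "vpos c1 u"] al[OF c(1)] is_side_dist[OF k1]
   unfolding a1_def Fb page_coord_def by simp
  moreover have "a2 = ((cpos c2 y - cpos c2 ?x) \<bullet> (vpos c2 v - vpos c2 u)) / ?l"
   using A[of "cpos c2 y" "cpos c2 ?x" "vpos c2 v" "vpos c2 u"] al[OF c(2)] is_side_dist[OF k2]
   unfolding a2_def Fy page_coord_def by simp
  ultimately have aa: "r2 * a1 = - (r1 * a2)" using eq by (simp add: field_simps)
  have q1: "a1\<^sup>2 + h1\<^sup>2 = r1\<^sup>2" unfolding n1[symmetric] dist_norm cmod_power2 a1_def h1_def by simp
  have q2: "a2\<^sup>2 + h2\<^sup>2 = r2\<^sup>2" unfolding n2[symmetric] dist_norm cmod_power2 a2_def h2_def by simp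
  have rn: "0 \<le> r1" "0 \<le> r2" using r1 r2 by auto
  have "(r2 * h1)\<^sup>2 = r2\<^sup>2 * r1\<^sup>2 - (r2 * a1)\<^sup>2" unfolding q1[symmetric] by (simp add: power_mult_distrib algebra_simps)
  also have "\<dots> = r1\<^sup>2 * r2\<^sup>2 - (r1 * a2)\<^sup>2" unfolding aa by simp
  also have "\<dots> = (r1 * h2)\<^sup>2" unfolding q2[symmetric] by (simp add: power_mult_distrib algebra_simps)
  \<comment> \<open>Both heights are nonnegative, so that they can be compared by their
    squares.\<close>
  finally have hh: "r2 * h1 = r1 * h2" using h rn by (simp add: power2_eq_iff_nonneg)
  have "of_real r2 * (?F b - ?o) = - (of_real r1 * (?F y - ?o))"
   using aa hh unfolding a1_def a2_def h1_def h2_def by (simp add: complex_eq_iff)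
  then have "of_real r2 * (?F y - ?F b) = of_real (r1 + r2) * (?F y - ?o)" by (simp add: algebra_simps)
  then have "norm (of_real r2 * (?F y - ?F b)) = norm (of_real (r1 + r2) * (?F y - ?o))" by simp
  then have n: "r2 * dist (?F y) (?F b) = (r1 + r2) * r2" using rn n2 by (simp add: norm_mult dist_norm del: of_real_add)
  have D: "dist (?F y) (?F b) = r1 + r2"
  proof (cases "r2 = 0")
   case True then show ?thesis using n1 n2 by (simp add: dist_commute)
  next
   case False then show ?thesis using n by simp
  qed
  have "d b ?x \<le> r1" "d ?x y \<le> r2"
   using d_le_cell[OF k1(1) bym(1) xM(1) bym(3) xM(2)] d_le_cell[OF k2(1) xM(1) bym(2) xM(3) bym(4)] r1 r2
   by (simp_all add: dist_commute)
  then have up: "d b y \<le> r1 + r2" using tri[of b ?x y] bym xM by simp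
  have "dist (?F b) ?o + d b y < \<rho>" unfolding n1 using up rr r(1) by linarith
  then have "dist (?F y) (?F b) \<le> d b y" using r(3)[OF Fb(1) bym(1,2)] by blast
  then show "d b y = r1 + r2" using up D by simp
 qed
qed

text \<open>The last bit of a geodesic that ends inside a cell is a straight segment. It is
  prolonged in the polygon, and \<open>convex_extension\<close> joins the pieces. If a is the point
  itself, any direction serves.\<close>

lemma ext_inner:
 assumes c: "c \<in> cells X" and z: "z \<in> interior (poly c)" and a: "a \<in> M" and del: "0 < \<delta>"
 obtains z' where "z' \<in> interior (poly c)" "z' \<noteq> z" "dist z' z < \<delta>" "d a (Inner c z') = d a (Inner c z) + dist z' z"
proof -
 obtain \<rho> where r: "\<rho> > 0" "ball z \<rho> \<subseteq> interior (poly c)"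
  using z open_contains_ball[of "interior (poly c)"] by auto
 have inM: "Inner c w \<in> M" if "dist w z < \<rho>" for w
  using that r c Inner_in by (auto simp: dist_commute)
 have le: "d (Inner c w) (Inner c w') \<le> dist w w'" if "dist w z < \<rho>" "dist w' z < \<rho>" for w w'
  using d_le_cell[OF c inM[OF that(1)] inM[OF that(2)]] by simp
 have dd: "d (Inner c w) (Inner c w') = dist w w'" if "dist w z < \<rho> / 4" "dist w' z < \<rho> / 4" for w w'
 proof -
  have "dist w w' \<le> dist w z + dist w' z" by (metis dist_commute dist_triangle)
  then have "dist w z + d (Inner c w) (Inner c w') < \<rho>" using le[of w w'] that r(1) by linarith
  then have "dist w w' \<le> d (Inner c w) (Inner c w')"
   by (rule inner_chart[OF c r(2) _ inM]) (use that r(1) in auto)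
  then show ?thesis using le[of w w'] that r by simp
 qed
 define x :: "('v, 'c) point" where "x = Inner c z"
 have xM: "x \<in> M" using inM[of z] r by (simp add: x_def)
 define \<tau> where "\<tau> = (if a = x then min (\<rho> / 8) (\<delta> / 2) else min (d a x) (min (\<rho> / 8) (\<delta> / 2)))"
 have tau: "0 < \<tau>" "\<tau> \<le> \<rho> / 8" "\<tau> < \<delta>" "a \<noteq> x ==> \<tau> \<le> d a x"
  using r del zero_iff[OF a xM] nonneg[of a x] unfolding \<tau>_def by (auto simp del: nonneg)
 show ?thesis
 proof (cases "a = x")
  case True
  have dz: "dist (z + of_real \<tau>) z = \<tau>" using tau by (simp add: dist_norm)
  have "z + of_real \<tau> \<in> ball z \<rho>" using dz tau r by (simp add: dist_commute)
  then have int: "z + of_real \<tau> \<in> interior (poly c)" using r(2) by blast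
  show ?thesis
  proof (rule that[OF int])
   show "z + of_real \<tau> \<noteq> z" using tau by simp
   show "dist (z + of_real \<tau>) z < \<delta>" using dz tau by simp
   show "d a (Inner c (z + of_real \<tau>)) = d a (Inner c z) + dist (z + of_real \<tau>) z"
    unfolding True x_def using dd[of z "z + of_real \<tau>"] dz tau r xM[unfolded x_def] by (simp add: dist_commute)
  qed
 next
  case False
  obtain b where b: "b \<in> M" "d a b = d a x - \<tau>" "d b x = \<tau>"
   using geodesic_point[OF a xM, of "d a x - \<tau>"] tau False by auto
  have "dist z z + d (Inner c z) b < \<rho>" using b(3) tau r sym[of b x] by (simp add: x_def)
  then obtain w where w: "b = Inner c w" "dist z w \<le> \<tau>"
   by (rule inner_chart[OF c r(2) _ b(1)]) (use b(3) sym[of b x] in \<open>simp add: x_def that\<close>)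
  have wz: "dist w z = \<tau>" using dd[of w z] w tau b(3) r(1) by (simp add: x_def dist_commute)
  \<comment> \<open>The reflection of w in z prolongs the straight last piece of the
    geodesic.\<close>
  define z' where "z' = 2 * z - w"
  have e1: "z' - z = z - w" and e2: "w - z' = of_real 2 * (w - z)" by (simp_all add: z'_def algebra_simps)
  have z': "dist z' z = \<tau>" "dist w z' = 2 * \<tau>"
   unfolding dist_norm e1 e2 norm_mult using wz by (simp_all add: dist_norm norm_minus_commute)
  have z'r: "z' \<in> ball z \<rho>" using z' tau r by (simp add: dist_commute)
  have x'M: "Inner c z' \<in> M" using inM z'r by (simp add: dist_commute)
  have "d b x = \<tau>" "d x (Inner c z') = \<tau>" "d b (Inner c z') = 2 * \<tau>"
   using b(3) dd[of z z'] dd[of w z'] w wz z' tau r(1) by (auto simp: x_def dist_commute)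
  then have "d a x + d x (Inner c z') = d a (Inner c z')"
   using convex_extension[OF a b(1) xM x'M] b(2) tau(1) zero_iff[OF b(1) xM] by force
  then show ?thesis using that[of z'] z' z'r r(2) tau \<open>d x (Inner c z') = \<tau>\<close> unfolding x_def by auto
 qed
qed

text \<open>A geodesic reaching an inner point of an edge arrives through one page or along the
  edge. It is prolonged into whichever of \<open>c1\<close>, \<open>c2\<close> differs from that
  page, so two pages suffice even if it arrives through a third one.\<close>

lemma ext_edge:
 assumes e: "{u, v} \<in> edges X" and t: "0 < t" "t < 1"
  and c: "c1 \<in> pages u v" "c2 \<in> pages u v" "c1 \<noteq> c2" and a: "a \<in> M" and del: "0 < \<delta>"
 obtains c y where "c = c1 \<or> c = c2" "y \<in> M" "incell c y" "y \<noteq> epoint u v t"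
  "dist (cpos c y) (cpos c (epoint u v t)) < \<delta>"
  "d a y = d a (epoint u v t) + dist (cpos c y) (cpos c (epoint u v t))"
proof -
 define x where "x = epoint u v t"
 let ?l = "elen X {u, v}"
 let ?o = "of_real (?l * t) :: complex" and ?F = "fold_map u v c1"
 have l: "?l > 0" using elen_pos[OF e] .
 have uv: "u \<noteq> v" using edge_neq[OF e] .
 have xM: "x \<in> M" using epoint_in[OF e] t by (simp add: x_def)
 obtain \<rho> where r: "0 < \<rho>"
  "\<And>c y. c \<in> pages u v ==> y \<in> M ==> incell c y ==> dist (cpos c y) (cpos c (epoint u v t)) < \<rho> ==>
    y \<in> book u v \<and> ?F y = page_coord u v c1 c (cpos c y)"
  "\<And>y z. y \<in> book u v ==> y \<in> M ==> z \<in> M ==> dist (?F y) ?o + d y z < \<rho> ==>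
    z \<in> book u v \<and> dist (?F z) (?F y) \<le> d y z"
  by (rule book_facts[OF e t, of c1]) (rule that)
 have xb: "x \<in> book u v" using t by (auto simp: book_def x_def)
 have Fx: "?F x = ?o" using fold_map_epoint[OF uv] by (simp add: x_def)
 have icx: "incell c x" if "c \<in> pages u v" for c
  using that incell_epoint unfolding x_def pages_def by blast
 have ccell: "c \<in> cells X" if "c \<in> pages u v" for c using that by (simp add: pages_def)
 show ?thesis
 proof (cases "a = x")
  case True
  \<comment> \<open>If a is the point itself, a small move along the edge serves.\<close>
  define \<eta> where "\<eta> = min (1 - t) (min (\<rho> / (2 * ?l)) (\<delta> / (2 * ?l)))"
  have eta: "0 < \<eta>" "t + \<eta> \<le> 1" "?l * \<eta> < \<rho>" "?l * \<eta> < \<delta>"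
  proof -
   show "0 < \<eta>" using t r l del by (simp add: \<eta>_def)
   show "t + \<eta> \<le> 1" by (simp add: \<eta>_def)
   have "\<eta> \<le> \<rho> / (2 * ?l)" "\<eta> \<le> \<delta> / (2 * ?l)" by (simp_all add: \<eta>_def)
   then have "2 * (?l * \<eta>) \<le> \<rho>" "2 * (?l * \<eta>) \<le> \<delta>" using l by (simp_all add: field_simps)
   then show "?l * \<eta> < \<rho>" "?l * \<eta> < \<delta>" using r del by linarith+
  qed
  let ?y = "epoint u v (t + \<eta>)"
  have yM: "?y \<in> M" "incell c1 ?y" using epoint_in[OF e] eta t c(1) incell_epoint unfolding pages_def by auto
  have P: "cpos c1 ?y \<in> poly c1" "cpos c1 x \<in> poly c1" using cpos_in_poly[OF ccell[OF c(1)]] yM xM icx[OF c(1)] by auto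
  have dc: "dist (cpos c1 ?y) (cpos c1 x) = ?l * \<eta>"
  proof -
   have "dist (cpos c1 ?y) (cpos c1 x) = dist (of_real (?l * (t + \<eta>))) (of_real (?l * t) :: complex)"
    using page_coord_dist[OF c(1) P, of c1] page_coord_edge[OF c(1), of "t + \<eta>" c1] page_coord_edge[OF c(1), of t c1] t eta
    by (simp add: x_def del: of_real_mult)
   also have "\<dots> = ?l * \<eta>" using l eta by (subst dist_of_real_scaled) auto
   finally show ?thesis .
  qed
  have up: "d x ?y \<le> ?l * \<eta>" using d_le_cell[OF ccell[OF c(1)] xM yM(1) icx[OF c(1)] yM(2)] dc by (simp add: dist_commute)
  have "dist (?F x) ?o + d x ?y < \<rho>" using up eta Fx by simp
  then have "dist (?F ?y) (?F x) \<le> d x ?y" using r(3)[OF xb xM yM(1)] by blast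
  moreover have "dist (?F ?y) (?F x) = ?l * \<eta>"
   using l eta unfolding fold_map_epoint[OF uv] Fx by (subst dist_of_real_scaled) auto
  ultimately have "d x ?y = ?l * \<eta>" using up by simp
  moreover have "?y \<noteq> epoint u v t" using epoint_inj[OF uv] eta by simp
  moreover have "d a (epoint u v t) = 0" using True xM by (simp add: x_def)
  ultimately show ?thesis
   using dc eta True by (intro that[OF _ yM]) (simp_all add: x_def)
 next
  case False
  have Dp: "0 < d a x" using False zero_iff[OF a xM] nonneg[of a x] by linarith
  define \<tau>' where "\<tau>' = min (d a x) (min (\<rho> / 2) (\<delta> / 2))"
  have t': "0 < \<tau>'" "\<tau>' < \<rho>" "\<tau>' \<le> d a x" "\<tau>' < \<delta>"
   using Dp r(1) del unfolding \<tau>'_def by linarith+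
  obtain b' where b': "b' \<in> M" "d a b' = d a x - \<tau>'" "d b' x = \<tau>'"
   using geodesic_point[OF a xM, of "d a x - \<tau>'"] t' by auto
  have page_of: "\<exists>j\<in>pages u v. incell j b \<and> dist (cpos j b) (cpos j x) = d b x" if b: "b \<in> M" "d b x < \<rho>" for b
  proof -
   have "b \<in> book u v" and Db: "dist (?F b) ?o \<le> d b x"
    using r(3)[OF xb xM b(1)] b(2) Fx sym[of b x] by auto
   then consider (I) j w where "b = Inner j w" "j \<in> pages u v" "w \<in> interior (poly j)"
    | (E) s where "b = epoint u v s" "0 \<le> s" "s \<le> 1" by (auto simp: book_def)
   then obtain j where j: "j \<in> pages u v" "incell j b" "?F b = page_coord u v c1 j (cpos j b)"
   proof cases
    case I then show ?thesis using that[of j] fold_map_Inner by auto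
   next
    case E
    have "incell c1 b" using E(1) c(1) incell_epoint unfolding pages_def by blast
    then show ?thesis using that[of c1] c(1) page_coord_edge[OF c(1) E(2,3), of c1] fold_map_epoint[OF uv] E(1) by simp
   qed
   have "dist (cpos j b) (cpos j x) = dist (?F b) ?o"
    using page_coord_dist[OF j(1) cpos_in_poly[OF ccell[OF j(1)] b(1) j(2)] cpos_in_poly[OF ccell[OF j(1)] xM icx[OF j(1)]], of c1]
     page_coord_edge[OF j(1), of t c1] t j(3) by (simp add: x_def)
   then show ?thesis using Db d_le_cell[OF ccell[OF j(1)] b(1) xM j(2) icx[OF j(1)]] j by auto
  qed
  \<comment> \<open>Choose \<open>b\<close> on the geodesic so close to \<open>x\<close> that the crossing lemma applies whatever its page.\<close>
  obtain j0 where j0: "j0 \<in> pages u v" "incell j0 b'" "dist (cpos j0 b') (cpos j0 x) = \<tau>'"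
   using page_of[of b'] b' t' by auto
  define c0 where "c0 = (if j0 = c1 then c2 else c1)"
  have c0: "c0 = c1 \<or> c0 = c2" "c0 \<in> pages u v" "j0 \<noteq> c0" using c by (auto simp: c0_def)
  obtain \<rho>1 where r1: "0 < \<rho>1"
   "\<And>b y r1 r2. b \<in> M ==> y \<in> M ==> incell j0 b ==> incell c0 y ==>
   r1 = dist (cpos j0 b) (cpos j0 x) ==> r2 = dist (cpos c0 y) (cpos c0 x) ==>
   r1 < \<rho>1 ==> r2 < \<rho>1 ==>
   r2 * ((cpos j0 b - cpos j0 x) \<bullet> (vpos j0 v - vpos j0 u)) =
   - (r1 * ((cpos c0 y - cpos c0 x) \<bullet> (vpos c0 v - vpos c0 u))) ==>
   d b y = r1 + r2"
   by (rule cross_edge[OF e t j0(1) c0(2,3), folded x_def]) (rule that)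
  obtain s \<rho>2 where s: "s = (1::real) \<or> s = - 1" "0 < \<rho>2"
   "\<And>w. dist w (cpos c0 x) < \<rho>2 ==> 0 \<le> s * crs (vpos c0 u) (vpos c0 v) w ==> w \<in> poly c0"
   by (rule page_neighbourhood[OF e t c0(2), folded x_def]) (rule that)
  define \<mu> where "\<mu> = min 1 (min (\<rho>1 / (2 * \<tau>')) (\<rho>2 / (2 * \<tau>')))"
  have lam: "0 < \<mu>" "\<mu> \<le> 1" "\<mu> * \<tau>' < \<rho>1" "\<mu> * \<tau>' < \<rho>2"
  proof -
   show "0 < \<mu>" "\<mu> \<le> 1" using t' r1(1) s(2) by (simp_all add: \<mu>_def)
   have "\<mu> \<le> \<rho>1 / (2 * \<tau>')" "\<mu> \<le> \<rho>2 / (2 * \<tau>')" by (simp_all add: \<mu>_def)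
   then have "2 * (\<mu> * \<tau>') \<le> \<rho>1" "2 * (\<mu> * \<tau>') \<le> \<rho>2" using t' by (simp_all add: field_simps)
   then show "\<mu> * \<tau>' < \<rho>1" "\<mu> * \<tau>' < \<rho>2" using r1(1) s(2) by linarith+
  qed
  define \<tau> where "\<tau> = \<mu> * \<tau>'"
  have tau: "0 < \<tau>" "\<tau> \<le> \<tau>'" "\<tau> < \<delta>" "\<tau> \<le> d a x"
  proof -
   show "0 < \<tau>" using lam t' by (simp add: \<tau>_def)
   show "\<tau> \<le> \<tau>'" using lam t' unfolding \<tau>_def by (intro mult_left_le_one_le) auto
   then show "\<tau> < \<delta>" "\<tau> \<le> d a x" using t' by auto
  qed
  have cj: "j0 \<in> cells X" using ccell j0 by blast
  have j0P: "cpos j0 b' \<in> poly j0" "cpos j0 x \<in> poly j0"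
   using cpos_in_poly[OF cj] b' j0 xM icx by auto
  define wb where "wb = (1 - \<mu>) *\<^sub>R cpos j0 x + \<mu> *\<^sub>R cpos j0 b'"
  have wbP: "wb \<in> poly j0" unfolding wb_def using poly_closed(3)[of j0] j0P lam unfolding convex_alt by auto
  define b where "b = cpt j0 wb"
  have b: "b \<in> M" "incell j0 b" "cpos j0 b = wb" using cpt[OF cj wbP] by (simp_all add: b_def)
  have wbx: "wb - cpos j0 x = \<mu> *\<^sub>R (cpos j0 b' - cpos j0 x)" "wb - cpos j0 b' = (1 - \<mu>) *\<^sub>R (cpos j0 x - cpos j0 b')"
   by (simp_all add: wb_def algebra_simps)
  have db: "dist wb (cpos j0 x) = \<tau>" "dist wb (cpos j0 b') = \<tau>' - \<tau>"
   using j0(3) lam unfolding dist_norm wbx norm_scaleR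
   by (simp_all add: \<tau>_def norm_minus_commute left_diff_distrib)
  have dbx: "d b x \<le> \<tau>" "d b b' \<le> \<tau>' - \<tau>"
   using d_le_cell[OF cj b(1) xM b(2) icx[OF j0(1)]] d_le_cell[OF cj b(1) b'(1) b(2) j0(2)] b(3) db by auto
  have bx: "d b x = \<tau>" "d a b = d a x - \<tau>"
   using dbx tri[OF b'(1) b(1) xM] tri[OF a b'(1) b(1)] tri[OF a b(1) xM] b' sym[of b b'] by linarith+
  define P where "P = vpos c0 u"
  define Q where "Q = vpos c0 v"
  define A where "A = (cpos j0 b - cpos j0 x) \<bullet> (vpos j0 v - vpos j0 u)"
  obtain k0 where k0: "c0 \<in> cells X" "is_side c0 k0 u v" using c0(2) by (rule page_side)
  obtain kj where kj: "is_side j0 kj u v" using j0(1) page_side by blast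
  have PQ: "dist P Q = ?l" "norm (Q - P) = ?l" "norm (vpos j0 v - vpos j0 u) = ?l"
   using is_side_dist[OF k0] is_side_dist[OF cj kj] by (simp_all add: P_def Q_def dist_norm norm_minus_commute)
  have "\<bar>A\<bar> \<le> \<tau> * ?l" unfolding A_def using Cauchy_Schwarz_ineq2 db(1) b(3) PQ(3) by (metis dist_norm)
  then have al: "\<bar>A / ?l\<bar> \<le> \<tau>" using l by (simp add: abs_divide divide_le_eq)
  then have "(A / ?l)\<^sup>2 \<le> \<tau>\<^sup>2" using tau(1) abs_le_square_iff[of "A / ?l" \<tau>] by simp
  define h where "h = sqrt (\<tau>\<^sup>2 - (A / ?l)\<^sup>2)"
  have h: "0 \<le> h" "(A / ?l)\<^sup>2 + h\<^sup>2 = \<tau>\<^sup>2" using \<open>(A / ?l)\<^sup>2 \<le> \<tau>\<^sup>2\<close> by (simp_all add: h_def)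
  \<comment> \<open>The place in \<open>c0\<close> at distance \<tau> from x whose component along
    the edge is opposite to that of b; the sign s puts it on the side where the polygon
    lies.\<close>
  define w where "w = cpos c0 x + Complex (- A / ?l) (s * h) * (Q - P) / of_real ?l"
  have wx: "w - cpos c0 x = Complex (- A / ?l) (s * h) * (Q - P) / of_real ?l" by (simp add: w_def)
  have cn: "cnj (Q - P) * (w - cpos c0 x) = of_real ?l * Complex (- A / ?l) (s * h)"
  proof -
   have "cnj (Q - P) * (w - cpos c0 x) = (Q - P) * cnj (Q - P) * Complex (- A / ?l) (s * h) / of_real ?l"
    unfolding wx by (simp add: mult_ac)
   also have "(Q - P) * cnj (Q - P) = of_real (?l\<^sup>2)" unfolding PQ(2)[symmetric] by (rule complex_norm_square[symmetric])
   finally show ?thesis using l by (simp add: power2_eq_square)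
  qed
  have inn: "(w - cpos c0 x) \<bullet> (Q - P) = - A"
  proof -
   have "(w - cpos c0 x) \<bullet> (Q - P) = Re (cnj (Q - P) * (w - cpos c0 x))" by (simp add: inner_complex_def algebra_simps)
   then show ?thesis unfolding cn using l by simp
  qed
  have dw: "dist w (cpos c0 x) = \<tau>"
  proof -
   have "norm (Complex (- A / ?l) (s * h)) = sqrt ((A / ?l)\<^sup>2 + h\<^sup>2)" using s(1) by (auto simp: cmod_def)
   then show ?thesis unfolding dist_norm wx using h(2) tau(1) l PQ(2) by (simp add: norm_mult norm_divide)
  qed
  have "crs P Q w = Im (cnj (Q - P) * (w - cpos c0 x)) + crs P Q (cpos c0 x)"
   by (simp add: crs_def algebra_simps)
  also have "crs P Q (cpos c0 x) = 0"
   unfolding x_def cpos_epoint[OF uv] P_def Q_def crs_alt by (simp add: algebra_simps)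
  finally have "crs P Q w = ?l * (s * h)" unfolding cn by simp
  then have "0 \<le> s * crs P Q w" using s(1) h(1) l by auto
  then have wP: "w \<in> poly c0" using s(3)[of w] dw lam by (simp add: P_def Q_def \<tau>_def)
  define y where "y = cpt c0 w"
  have y: "y \<in> M" "incell c0 y" "cpos c0 y = w" using cpt[OF k0(1) wP] by (simp_all add: y_def)
  have bym: "d b y = \<tau> + \<tau>"
  proof (rule r1(2)[OF b(1) y(1) b(2) y(2)])
   show "\<tau> = dist (cpos j0 b) (cpos j0 x)" "\<tau> = dist (cpos c0 y) (cpos c0 x)" using b(3) y(3) db dw by simp_all
   show "\<tau> < \<rho>1" "\<tau> < \<rho>1" using lam by (simp_all add: \<tau>_def)
   show "\<tau> * ((cpos j0 b - cpos j0 x) \<bullet> (vpos j0 v - vpos j0 u)) = - (\<tau> * ((cpos c0 y - cpos c0 x) \<bullet> (vpos c0 v - vpos c0 u)))"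
    using inn y(3) unfolding A_def P_def Q_def by simp
  qed
  have "d x y \<le> \<tau>" using d_le_cell[OF k0(1) xM y(1) icx[OF c0(2)] y(2)] y(3) dw by (simp add: dist_commute)
  then have xy: "d x y = \<tau>" using tri[OF b(1) xM y(1)] bym bx by linarith
  have "d a x + d x y = d a y"
   by (rule convex_extension[OF a b(1) xM y(1)]) (use bx bym xy tau zero_iff[OF b(1) xM] in auto)
  moreover have "y \<noteq> x" using xy tau xM by auto
  ultimately show ?thesis
   using dw tau xy y(3) by (intro that[OF c0(1) y(1,2)]) (simp_all add: x_def)
 qed
qed

text \<open>At inner places \<open>inner_chart\<close> makes the segment a local geodesic. Only its
  ends may lie on the boundary, where \<open>local_geodesic\<close> asks for nothing.\<close>

lemma cell_geodesic:
 assumes c: "c \<in> cells X" and z: "z \<in> poly c" "w \<in> poly c" and o: "open_segment z w \<subseteq> interior (poly c)"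
 shows "d (cpt c z) (cpt c w) = dist z w"
proof (cases "z = w")
 case True then show ?thesis using cpt[OF c z(1)] by simp
next
 case False
 let ?L = "dist z w"
 have L: "0 < ?L" using False by simp
 define p where "p s = z + (s / ?L) *\<^sub>R (w - z)" for s
 have pd: "dist (p s) (p t) = \<bar>s - t\<bar>" for s t
 proof -
  have "p s - p t = ((s - t) / ?L) *\<^sub>R (w - z)" by (simp add: p_def algebra_simps diff_divide_distrib)
  then show ?thesis using L by (simp add: dist_norm norm_minus_commute)
 qed
 have palt: "p s = (1 - s / ?L) *\<^sub>R z + (s / ?L) *\<^sub>R w" for s by (simp add: p_def algebra_simps)
 have pP: "p s \<in> poly c" if "s \<in> {0..?L}" for s
  unfolding palt using poly_closed(3)[of c] z that L unfolding convex_alt by (auto simp: divide_le_eq)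
 have "d (cpt c (p 0)) (cpt c (p ?L)) = ?L"
 proof (rule local_geodesic)
  show "0 \<le> ?L" by simp
  show "cpt c (p s) \<in> M" if "s \<in> {0..?L}" for s using cpt(1)[OF c pP[OF that]] .
  show "d (cpt c (p s)) (cpt c (p t)) \<le> t - s" if "s \<in> {0..?L}" "t \<in> {0..?L}" "s \<le> t" for s t
   using cpt_lipschitz[OF c pP[OF that(1)] pP[OF that(2)]] pd[of s t] that(3) by simp
  fix t assume t: "0 < t" "t < ?L"
  have "p t \<in> open_segment z w" unfolding palt in_segment using t L False by (auto intro!: exI[of _ "t / ?L"])
  then have "p t \<in> interior (poly c)" using o by blast
  then obtain \<rho> where r: "\<rho> > 0" "ball (p t) \<rho> \<subseteq> interior (poly c)"
   using open_contains_ball[of "interior (poly c)"] by auto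
  show "\<exists>\<epsilon>>0. \<forall>s s'. t - \<epsilon> < s --> s < t --> t < s' --> s' < t + \<epsilon> --> 0 \<le> s --> s' \<le> ?L -->
    s' - s \<le> d (cpt c (p s)) (cpt c (p s'))"
  proof (intro exI[of _ "\<rho> / 4"] conjI allI impI)
   show "0 < \<rho> / 4" using r by simp
   fix s s' assume s: "t - \<rho> / 4 < s" "s < t" "t < s'" "s' < t + \<rho> / 4" "0 \<le> s" "s' \<le> ?L"
   have P: "p s \<in> poly c" "p s' \<in> poly c" using pP s t by auto
   have b: "p s \<in> ball (p t) \<rho>" "p s' \<in> ball (p t) \<rho>" using pd s r(1) by auto
   then have i: "cpt c (p s) = Inner c (p s)" "cpt c (p s') = Inner c (p s')"
    using r(2) cpt_interior[OF c] by blast+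
   have "d (cpt c (p s)) (cpt c (p s')) \<le> \<rho> / 2" using cpt_lipschitz[OF c P] pd[of s s'] s by auto
   moreover have "dist (p s) (p t) < \<rho> / 4" using pd s by auto
   ultimately have "dist (p s) (p t) + d (Inner c (p s)) (cpt c (p s')) < \<rho>" using i r(1) by simp
   then have "dist (p s) (p s') \<le> d (Inner c (p s)) (cpt c (p s'))"
    by (rule inner_chart[OF c r(2) _ cpt(1)[OF c P(2)]]) (use i in simp)
   then show "s' - s \<le> d (cpt c (p s)) (cpt c (p s'))" using i pd[of s s'] s by simp
  qed
 qed
 moreover have "p 0 = z" "p ?L = w" using L by (simp_all add: p_def)
 ultimately show ?thesis by simp
qed

text \<open>Folding keeps lengths along the edge, so the edge is a local geodesic at each of its
  inner points.\<close>

lemma edge_geodesic: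
 assumes e: "{u, v} \<in> edges X" and c: "c \<in> pages u v" and st: "0 \<le> s" "s \<le> t" "t \<le> 1"
 shows "d (epoint u v s) (epoint u v t) = elen X {u, v} * (t - s)"
proof -
 let ?l = "elen X {u, v}" and ?F = "fold_map u v c"
 have l: "?l > 0" using elen_pos[OF e] .
 have uv: "u \<noteq> v" using edge_neq[OF e] .
 have cc: "c \<in> cells X" using c by (simp add: pages_def)
 have ic: "incell c (epoint u v s)" for s using c incell_epoint unfolding pages_def by blast
 define p where "p r = epoint u v (s + r / ?l)" for r
 let ?L = "?l * (t - s)"
 have rng: "0 \<le> s + r / ?l" "s + r / ?l \<le> 1" if "r \<in> {0..?L}" for r
 proof -
  show "0 \<le> s + r / ?l" using that st l by simp
  have "r / ?l \<le> t - s" using that l by (simp add: divide_le_eq mult.commute)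
  then show "s + r / ?l \<le> 1" using st by simp
 qed
 have pM: "p r \<in> M" if "r \<in> {0..?L}" for r using epoint_in[OF e] rng[OF that] by (simp add: p_def)
 have Fd: "dist (?F (p r)) (?F (p r')) = \<bar>r - r'\<bar>" for r r'
 proof -
  have "dist (?F (p r)) (?F (p r')) = ?l * \<bar>(s + r / ?l) - (s + r' / ?l)\<bar>"
   unfolding p_def fold_map_epoint[OF uv] using l by (intro dist_of_real_scaled) simp
  also have "(s + r / ?l) - (s + r' / ?l) = (r - r') / ?l" by (simp add: diff_divide_distrib)
  finally show ?thesis using l by (simp add: abs_divide)
 qed
 have cd: "dist (cpos c (p r)) (cpos c (p r')) = \<bar>r - r'\<bar>" if "r \<in> {0..?L}" "r' \<in> {0..?L}" for r r'
 proof -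
  have "dist (cpos c (p r)) (cpos c (p r')) = dist (?F (p r)) (?F (p r'))"
   using page_coord_dist[OF c cpos_in_poly[OF cc pM[OF that(1)]] cpos_in_poly[OF cc pM[OF that(2)]], of c] ic
    page_coord_edge[OF c rng[OF that(1)], of c] page_coord_edge[OF c rng[OF that(2)], of c] fold_map_epoint[OF uv]
   by (simp add: p_def)
  then show ?thesis using Fd by simp
 qed
 have "d (p 0) (p ?L) = ?L"
 proof (rule local_geodesic)
  show "0 \<le> ?L" using l st by simp
  show "p r \<in> M" if "r \<in> {0..?L}" for r using pM[OF that] .
  show "d (p r) (p r') \<le> r' - r" if "r \<in> {0..?L}" "r' \<in> {0..?L}" "r \<le> r'" for r r'
   using d_le_cell[OF cc pM[OF that(1)] pM[OF that(2)]] cd[OF that(1,2)] ic that(3) by (simp add: p_def)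
  fix r assume r: "0 < r" "r < ?L"
  define q where "q = s + r / ?l"
  have q: "0 < q" "q < 1"
  proof -
   show "0 < q" using r st l by (simp add: q_def add_nonneg_pos)
   have "r / ?l < t - s" using r l by (simp add: divide_less_eq mult.commute)
   then show "q < 1" using st by (simp add: q_def)
  qed
  obtain \<rho> where rr: "0 < \<rho>"
   "\<And>y z. y \<in> book u v ==> y \<in> M ==> z \<in> M ==> dist (?F y) (of_real (?l * q)) + d y z < \<rho> ==>
    z \<in> book u v \<and> dist (?F z) (?F y) \<le> d y z"
   by (rule book_facts[OF e q, of c]) (rule that)
  have Fq: "of_real (?l * q) = ?F (p r)" unfolding p_def fold_map_epoint[OF uv] q_def ..
  show "\<exists>\<epsilon>>0. \<forall>s s'. r - \<epsilon> < s --> s < r --> r < s' --> s' < r + \<epsilon> --> 0 \<le> s --> s' \<le> ?L -->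
    s' - s \<le> d (p s) (p s')"
  proof (intro exI[of _ "\<rho> / 4"] conjI allI impI)
   show "0 < \<rho> / 4" using rr by simp
   fix a b assume ab: "r - \<rho> / 4 < a" "a < r" "r < b" "b < r + \<rho> / 4" "0 \<le> a" "b \<le> ?L"
   have A: "a \<in> {0..?L}" "b \<in> {0..?L}" using ab r by auto
   have "d (p a) (p b) \<le> b - a"
    using d_le_cell[OF cc pM[OF A(1)] pM[OF A(2)]] cd[OF A] ic ab by (simp add: p_def)
   moreover have "dist (?F (p a)) (?F (p r)) < \<rho> / 4" using Fd ab by auto
   ultimately have "dist (?F (p a)) (of_real (?l * q)) + d (p a) (p b) < \<rho>" unfolding Fq using ab rr(1) by linarith
   moreover have "p a \<in> book u v" using rng[OF A(1)] by (auto simp: book_def p_def)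
   ultimately have "dist (?F (p b)) (?F (p a)) \<le> d (p a) (p b)" using rr(2) pM A by blast
   then show "b - a \<le> d (p a) (p b)" using Fd[of b a] ab by simp
  qed
 qed
 moreover have "p 0 = epoint u v s" "p ?L = epoint u v t" using l by (simp_all add: p_def)
 ultimately show ?thesis by simp
qed

end

section \<open>Corners and the extension of geodesics at vertices\<close>

lemma compact_family_max:
 fixes f :: "'i => 'a::topological_space => real"
 assumes I: "finite I" and K: "\<And>i. i \<in> I ==> compact (K i)" "\<And>i. i \<in> I ==> continuous_on (K i) (f i)"
  and ne: "i0 \<in> I" "w0 \<in> K i0"
 obtains i w where "i \<in> I" "w \<in> K i" "\<And>j w'. j \<in> I ==> w' \<in> K j ==> f j w' \<le> f i w"
proof -
 define J where "J = {i \<in> I. K i \<noteq> {}}"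
 have "\<exists>w\<in>K i. \<forall>w'\<in>K i. f i w' \<le> f i w" if "i \<in> J" for i
  using that K continuous_attains_sup[of "K i" "f i"] by (auto simp: J_def)
 then obtain w where w: "\<And>i. i \<in> J ==> w i \<in> K i \<and> (\<forall>w'\<in>K i. f i w' \<le> f i (w i))" by metis
 have J: "finite J" "J \<noteq> {}" using I ne by (auto simp: J_def)
 obtain i where i: "i \<in> J" "f i (w i) = Max ((\<lambda>i. f i (w i)) ` J)"
 proof -
  have "Max ((\<lambda>i. f i (w i)) ` J) \<in> (\<lambda>i. f i (w i)) ` J" using J by (intro Max_in) auto
  then show thesis using that by (metis imageE)
 qed
 show ?thesis
 proof (rule that[of i "w i"])
  show "i \<in> I" "w i \<in> K i" using i w by (auto simp: J_def)
  fix j w' assume j: "j \<in> I" "w' \<in> K j"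
  then have "j \<in> J" by (auto simp: J_def)
  then have "f j w' \<le> f j (w j)" using w j by blast
  also have "\<dots> \<le> f i (w i)" unfolding i(2) using J \<open>j \<in> J\<close> by (intro Max_ge) auto
  finally show "f j w' \<le> f i (w i)" .
 qed
qed

context npc_complex begin

section \<open>Corners of cells and uniform neighbourhoods of vertices\<close>

lemma prv_index: assumes "c \<in> cells X" "k < len c"
 shows "(k + len c - 1) mod len c < len c" "Suc ((k + len c - 1) mod len c) mod len c = k"
  "(k + len c - 1) mod len c \<noteq> k" "(k + len c - 1) mod len c \<noteq> Suc k mod len c"
proof -
 have n: "3 \<le> len c" using cell_len3[OF assms(1)] .
 consider "k = 0" | "0 < k" by auto
 then have "((k + len c - 1) mod len c < len c) \<and> (Suc ((k + len c - 1) mod len c) mod len c = k) \<and>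
  ((k + len c - 1) mod len c \<noteq> k) \<and> ((k + len c - 1) mod len c \<noteq> Suc k mod len c)"
 proof cases
  case 1
  have "(len c - 1) mod len c = len c - 1" using n by simp
  moreover have "Suc (len c - 1) = len c" "Suc 0 mod len c = 1" using n by simp_all
  ultimately show ?thesis using 1 n by simp
 next
  case 2
  then have "(k + len c - 1) mod len c = k - 1" using assms(2) by (simp add: mod_if)
  moreover have "Suc (k - 1) mod len c = k" using 2 assms(2) by simp
  moreover have "Suc k mod len c = (if Suc k = len c then 0 else Suc k)" using assms(2) by simp
  moreover have "k - 1 \<noteq> (if Suc k = len c then 0 else Suc k)" "k - 1 \<noteq> k" "k - 1 < len c"
   using 2 n assms(2) by auto
  ultimately show ?thesis by simp
 qed
 then show "(k + len c - 1) mod len c < len c" "Suc ((k + len c - 1) mod len c) mod len c = k"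
  "(k + len c - 1) mod len c \<noteq> k" "(k + len c - 1) mod len c \<noteq> Suc k mod len c" by auto
qed

lemma corners_iff: "(c, k) \<in> corners X v \<longleftrightarrow> c \<in> cells X \<and> k < len c \<and> bds c ! k = v"
 by (simp add: corners_def)

lemma corner_ends_alt: "corner_ends X (c, k) = {nxt (bds c) k, prv (bds c) k}"
 by (simp add: corner_ends_def)

lemma corner_sides:
 assumes "(c, k) \<in> corners X v"
 shows "is_side c k v (nxt (bds c) k)" "is_side c ((k + len c - 1) mod len c) v (prv (bds c) k)"
  "nxt (bds c) k \<noteq> prv (bds c) k" "vpos c v = shp c ! k"
  "vpos c (nxt (bds c) k) = nxt (shp c) k" "vpos c (prv (bds c) k) = prv (shp c) k"
proof -
 have ck: "c \<in> cells X" "k < len c" "bds c ! k = v" using assms by (auto simp: corners_iff)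
 note p = prv_index[OF ck(1,2)]
 show "is_side c k v (nxt (bds c) k)" using ck by (simp add: is_side_def)
 show "is_side c ((k + len c - 1) mod len c) v (prv (bds c) k)"
  using p(1,2) ck by (auto simp: is_side_def nxt_def prv_def)
 show "nxt (bds c) k \<noteq> prv (bds c) k"
  using p(1,4) Suc_mod[OF ck(1,2)] cell_distinct[OF ck(1)] by (simp add: nxt_def prv_def nth_eq_iff_index_eq)
 show "vpos c v = shp c ! k" using vpos_nth[OF ck(1,2)] ck(3) by simp
 show "vpos c (nxt (bds c) k) = nxt (shp c) k"
  using vpos_nth[OF ck(1) Suc_mod[OF ck(1,2)]] shape_len[OF ck(1)] by (simp add: nxt_def)
 show "vpos c (prv (bds c) k) = prv (shp c) k"
  using vpos_nth[OF ck(1) p(1)] shape_len[OF ck(1)] by (simp add: prv_def)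
qed

lemma corner_end_page:
 assumes "(c, k) \<in> corners X v" "p \<in> corner_ends X (c, k)"
 shows "c \<in> pages v p" "{v, p} \<in> edges X"
proof -
 have c: "c \<in> cells X" using assms by (simp add: corners_iff)
 show "c \<in> pages v p" using corner_sides[OF assms(1)] assms(2) c by (auto simp: pages_def corner_ends_alt)
 then show "{v, p} \<in> edges X" using is_side_edge page_side by blast
qed

lemma page_corner:
 assumes "c \<in> pages v p"
 obtains k where "(c, k) \<in> corners X v" "p \<in> corner_ends X (c, k)"
proof -
 obtain j where j: "c \<in> cells X" "is_side c j v p" using assms by (rule page_side)
 have vp: "v \<noteq> p" using is_side_neq[OF j] by simp
 have jl: "j < len c" and e: "{v, p} = {bds c ! j, nxt (bds c) j}" using j by (auto simp: is_side_def)
 then consider "v = bds c ! j" "p = nxt (bds c) j" | "v = nxt (bds c) j" "p = bds c ! j"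
  by (auto simp: doubleton_eq_iff)
 then show ?thesis
 proof cases
  case 1 then show ?thesis using that[of j] j jl by (simp add: corners_iff corner_ends_alt)
 next
  case 2
  let ?k = "Suc j mod len c"
  have k: "?k < len c" using Suc_mod[OF j(1) jl] .
  have "(?k + len c - 1) mod len c = j"
  proof (cases "Suc j = len c")
   case True then show ?thesis by simp
  next
   case False
   then have "Suc j < len c" using jl by simp
   then show ?thesis by (simp add: mod_if)
  qed
  then show ?thesis using that[of ?k] 2 j k by (simp add: corners_iff corner_ends_alt prv_def nxt_def)
 qed
qed

lemma corner_cell_unique: "(c, k) \<in> corners X v ==> (c, k') \<in> corners X v ==> k = k'"
 using cell_distinct[of c] by (auto simp: corners_iff nth_eq_iff_index_eq)

lemma corner_neq_cell: "q \<in> corners X v ==> q' \<in> corners X v ==> q \<noteq> q' ==> fst q \<noteq> fst q'"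
 using corner_cell_unique by (metis prod.collapse)

text \<open>\<open>uniform_gap\<close> for s = 0 gives one radius for all vertices and cells: a
  point of a cell that is nearer to a vertex does not lie on a side missing this vertex, nor is it
  another vertex.\<close>

lemma near_vertex:
 obtains R where "0 < R"
  "\<And>v c k x. (c, k) \<in> corners X v ==> x \<in> M ==> incell c x ==> dist (cpos c x) (vpos c v) < R ==>
   x = vpoint v \<or> (\<exists>p\<in>corner_ends X (c, k). \<exists>t. 0 < t \<and> t < 1 \<and> x = epoint v p t) \<or> (\<exists>w. x = Inner c w)"
  "\<And>v c k p. (c, k) \<in> corners X v ==> p \<in> corner_ends X (c, k) ==> R \<le> elen X {v, p}"
proof -
 obtain \<rho> where r: "0 < \<rho>" "\<And>c. c \<in> cells X ==> segment_gap 0 (set (shp c)) \<rho>"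
  by (rule uniform_gap[of 0]) auto
 have vv: "\<rho> \<le> dist (shp c ! k) y" if c: "c \<in> cells X" and k: "k < len c" and V: "p' \<in> set (shp c)" "q' \<in> set (shp c)"
   and n: "shp c ! k \<notin> closed_segment p' q'" and y: "y \<in> closed_segment p' q'" for c k p' q' y
 proof -
  have "shp c ! k \<in> set (shp c)" using k shape_len[OF c] by simp
  then show ?thesis using r(2)[OF c, unfolded segment_gap_def, rule_format, of "shp c ! k" "shp c ! k" p' q' y] V n y by simp
 qed
 show ?thesis
 proof (rule that[OF r(1)])
  fix v c k p assume q: "(c, k) \<in> corners X v" and p: "p \<in> corner_ends X (c, k)"
  have c: "c \<in> cells X" "k < len c" using q by (auto simp: corners_iff)
  note s = corner_sides[OF q]
  obtain j where j: "is_side c j v p" using s(1,2) p by (auto simp: corner_ends_alt)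
  have "\<rho> \<le> dist (vpos c v) (vpos c p)"
   unfolding s(4) using is_side_vpos[OF c(1) j] is_side_neq[OF c(1) j] s(4)
   by (intro vv[OF c, of "vpos c p" "vpos c p"]) auto
  then show "\<rho> \<le> elen X {v, p}" using is_side_dist[OF c(1) j] by simp
 next
  fix v c k x assume q: "(c, k) \<in> corners X v" and x: "x \<in> M" "incell c x" "dist (cpos c x) (vpos c v) < \<rho>"
  have c: "c \<in> cells X" "k < len c" using q by (auto simp: corners_iff)
  note s = corner_sides[OF q]
  show "x = vpoint v \<or> (\<exists>p\<in>corner_ends X (c, k). \<exists>t. 0 < t \<and> t < 1 \<and> x = epoint v p t) \<or> (\<exists>w. x = Inner c w)"
  proof (cases "\<exists>w. x = Inner c w")
   case False
   then obtain k' u' v' t' where k': "is_side c k' u' v'" "x = epoint u' v' t'" "0 \<le> t'" "t' \<le> 1"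
    "u' = bds c ! k'" "v' = nxt (bds c) k'" "cpos c x \<in> closed_segment (shp c ! k') (nxt (shp c) k')"
    using incell_Skel_side[OF c(1) x(1,2)] by metis
   have kl: "k' < len c" using k' by (simp add: is_side_def)
   have V: "shp c ! k' \<in> set (shp c)" "nxt (shp c) k' \<in> set (shp c)"
    using is_side_vpos[OF c(1) k'(1)] is_side_cases[OF c(1) k'(1)] by metis+
   have "shp c ! k \<in> closed_segment (shp c ! k') (nxt (shp c) k')"
   proof (rule ccontr)
    assume "\<not> ?thesis"
    then have "\<rho> \<le> dist (shp c ! k) (cpos c x)" by (rule vv[OF c V _ k'(7)])
    then show False using x(3) s(4) by (simp add: dist_commute)
   qed
   then have "k = k' \<or> shp c ! k = shp c ! k' \<or> shp c ! k = nxt (shp c) k'"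
    using closed_segment_sides[OF shape_convex[OF c(1)] shape_ge3[OF c(1)], of k' k "shp c ! k"] c kl shape_len[OF c(1)] by auto
   then have "k = k' \<or> k = Suc k' mod len c"
    using shape_distinct[OF c(1)] c kl Suc_mod[OF c(1) kl] shape_len[OF c(1)] by (auto simp: nxt_def nth_eq_iff_index_eq)
   then obtain p t where p: "p \<in> corner_ends X (c, k)" "x = epoint v p t" "0 \<le> t" "t \<le> 1"
   proof
    assume "k = k'"
    then show ?thesis using that[of "nxt (bds c) k" t'] k' q by (simp add: corner_ends_alt corners_iff)
   next
    assume k: "k = Suc k' mod len c"
    have "k' = (k + len c - 1) mod len c"
    proof (cases "Suc k' = len c")
     case True then show ?thesis using k by simp
    next
     case False
     then have "Suc k' < len c" using kl by simp
     then show ?thesis using k by (simp add: mod_if)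
    qed
    then have "u' = prv (bds c) k" "v' = v" using k' k q by (simp_all add: prv_def nxt_def corners_iff)
    then show ?thesis using that[of "prv (bds c) k" "1 - t'"] k' is_side_neq[OF c(1) k'(1)] epoint_swap[of u' v' t']
     by (simp add: corner_ends_alt)
   qed
   obtain j where j: "is_side c j v p" using s(1,2) p(1) by (auto simp: corner_ends_alt)
   have vp: "v \<noteq> p" using is_side_neq[OF c(1) j] by simp
   have "t \<noteq> 1"
   proof
    assume "t = 1"
    then have "cpos c x = vpos c p" using p(2) epoint_1[OF vp] by (simp add: vpos_def)
    moreover have "\<rho> \<le> dist (vpos c v) (vpos c p)"
     unfolding s(4) using is_side_vpos[OF c(1) j] is_side_neq[OF c(1) j] s(4)
     by (intro vv[OF c, of "vpos c p" "vpos c p"]) auto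
    ultimately show False using x(3) by (simp add: dist_commute)
   qed
   then show ?thesis
   proof (cases "t = 0")
    case True then show ?thesis using p(2) epoint_0[of v p] by simp
   next
    case False
    then have "0 < t" "t < 1" using p(3,4) \<open>t \<noteq> 1\<close> by auto
    then show ?thesis using p(1,2) by blast
   qed
  qed blast
 qed
qed

lemma dist_vpos_epoint:
 assumes "c \<in> pages v p" "0 \<le> t"
 shows "dist (cpos c (epoint v p t)) (vpos c v) = elen X {v, p} * t"
proof -
 obtain j where j: "c \<in> cells X" "is_side c j v p" using assms(1) by (rule page_side)
 have "cpos c (epoint v p t) - vpos c v = t *\<^sub>R (vpos c p - vpos c v)"
  using is_side_neq[OF j] by (simp add: cpos_epoint algebra_simps)
 then show ?thesis using is_side_dist[OF j] assms(2) by (simp add: dist_norm norm_minus_commute)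
qed

lemma d_vertex_le: "(c, k) \<in> corners X v ==> x \<in> M ==> incell c x ==> d (vpoint v) x \<le> dist (cpos c x) (vpos c v)"
 using d_le_cell[of c "vpoint v" x] vpoint_in[of v] incell_vpoint[of c v] edge_verts[OF cell_side[of c k]]
 by (auto simp: corners_iff vpos_def dist_commute)

lemma corner_vertex_in: "(c, k) \<in> corners X v ==> vpoint v \<in> M"
 using vpoint_in[of v] edge_verts[OF cell_side[of c k]] by (auto simp: corners_iff)

text \<open>A finite nonempty subgraph of the link without vertices of degree 1. In the sheet formed
  by its corners, each side at v has two pages, as \<open>ext_edge\<close> requires.\<close>

definition leafless :: "'v => ('c \<times> nat) set => bool" where
 "leafless v Q \<longleftrightarrow> finite Q \<and> Q \<noteq> {} \<and> Q \<subseteq> corners X v \<and>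
   (\<forall>q\<in>Q. \<forall>p\<in>corner_ends X q. \<exists>q'\<in>Q. q' \<noteq> q \<and> p \<in> corner_ends X q')"

lemma continuous_on_cell_dist:
 assumes c: "c \<in> cells X" and a: "a \<in> M" and K: "K \<subseteq> poly c"
 shows "continuous_on K (\<lambda>w. d a (cpt c w))"
proof -
 have "dist (d a (cpt c w)) (d a (cpt c w')) \<le> dist w w'" if "w \<in> K" "w' \<in> K" for w w'
  using tri[of a "cpt c w" "cpt c w'"] tri[of a "cpt c w'" "cpt c w"] a cpt(1)[OF c] K that
   cpt_lipschitz[OF c, of w w'] sym[of "cpt c w" "cpt c w'"] by (auto simp: dist_real_def subset_iff)
 then show ?thesis unfolding continuous_on_iff by (meson le_less_trans)
qed

text \<open>Along a sheet through the vertex \<open>v\<close> the function \<open>d a\<close> grows at unit speed in some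
 direction: maximising \<open>d a - \<kappa> \<bar>r - \<epsilon>\<bar>\<close>, where \<open>r\<close> is the distance
 to \<open>v\<close>, forces the maximum to the boundary of the sheet, as \<open>d a\<close> has no obstruction to growing
 at points other than vertices.\<close>

lemma vertex_extension:
 assumes Q: "leafless v Q" and a: "a \<in> M"
 obtains R where "0 < R" "\<And>r. 0 < r ==> r < R ==> \<exists>(c, k)\<in>Q. \<exists>x\<in>M. incell c x \<and>
   dist (cpos c x) (vpos c v) = r \<and> d a x = d a (vpoint v) + r"
proof -
 obtain R where R: "0 < R"
  "\<And>v c k x. (c, k) \<in> corners X v ==> x \<in> M ==> incell c x ==> dist (cpos c x) (vpos c v) < R ==>
   x = vpoint v \<or> (\<exists>p\<in>corner_ends X (c, k). \<exists>t. 0 < t \<and> t < 1 \<and> x = epoint v p t) \<or> (\<exists>w. x = Inner c w)"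
  "\<And>v c k p. (c, k) \<in> corners X v ==> p \<in> corner_ends X (c, k) ==> R \<le> elen X {v, p}"
  by (rule near_vertex) (rule that)
 have Qc: "finite Q" "Q \<noteq> {}" "Q \<subseteq> corners X v"
  and Ql: "\<And>q p. q \<in> Q ==> p \<in> corner_ends X q ==> \<exists>q'\<in>Q. q' \<noteq> q \<and> p \<in> corner_ends X q'"
  using Q by (auto simp: leafless_def)
 define I where "I = fst ` Q"
 have I: "finite I" using Qc by (simp add: I_def)
 have Icell: "c \<in> cells X" if "c \<in> I" for c using that Qc(3) by (auto simp: I_def corners_iff)
 have Ik: "\<exists>k. (c, k) \<in> Q" if "c \<in> I" for c using that by (auto simp: I_def)
 obtain c0 k0 where q0: "(c0, k0) \<in> Q" using Qc(2) by auto
 define y where "y = vpoint v"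
 have yM: "y \<in> M" using corner_vertex_in q0 Qc(3) unfolding y_def by blast
 define \<rho> where "\<rho> c w = dist w (vpos c v)" for c w
 have rho_lip: "\<bar>\<rho> c w - \<rho> c w'\<bar> \<le> dist w w'" for c w w'
  unfolding \<rho>_def by (metis abs_dist_diff_le dist_commute)
 show ?thesis
 proof (rule that[OF R(1)])
  fix r assume r: "0 < r" "r < R"
  define K where "K c = poly c \<inter> cball (vpos c v) r" for c
  have K: "compact (K c)" if "c \<in> I" for c unfolding K_def using poly_closed(2)[of c] by (simp add: compact_Int_closed)
  have Kp: "K c \<subseteq> poly c" for c by (auto simp: K_def)
  have claim: "\<exists>c\<in>I. \<exists>w\<in>poly c. \<rho> c w = r \<and> d a (cpt c w) \<ge> d a y - \<epsilon> + (1 - \<epsilon>) * (r - \<epsilon>)"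
   if eps: "0 < \<epsilon>" "\<epsilon> < r" "\<epsilon> < 1" for \<epsilon>
  proof -
   have q0c: "(c0, k0) \<in> corners X v" using q0 Qc(3) by blast
   have c0: "c0 \<in> cells X" "c0 \<in> I" using q0c q0 by (auto simp: corners_iff I_def intro: rev_image_eqI)
   define pt where "pt p = epoint v p (\<epsilon> / elen X {v, p})" for p
   have pt: "pt p \<in> M" "incell c0 (pt p)" "\<rho> c0 (cpos c0 (pt p)) = \<epsilon>" if p: "p \<in> corner_ends X (c0, k0)" for p
   proof -
    note e = corner_end_page[OF q0c p]
    have l: "R \<le> elen X {v, p}" using R(3)[OF q0c p] .
    then have "0 \<le> \<epsilon> / elen X {v, p}" "\<epsilon> / elen X {v, p} \<le> 1" using eps r R(1) by (auto simp: divide_le_eq)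
    then show "pt p \<in> M" unfolding pt_def by (intro epoint_in[OF e(2)])
    show "incell c0 (pt p)" unfolding pt_def using e(1) incell_epoint by (auto simp: pages_def)
    show "\<rho> c0 (cpos c0 (pt p)) = \<epsilon>" unfolding \<rho>_def pt_def
     using dist_vpos_epoint[OF e(1)] l eps R(1) by simp
   qed
   have dpt: "d y (pt p) \<le> \<epsilon>" if "p \<in> corner_ends X (c0, k0)" for p
    using d_vertex_le[OF q0c pt(1,2)[OF that]] pt(3)[OF that] by (simp add: y_def \<rho>_def)
   \<comment> \<open>The points at distance \<epsilon> from v on both sides of the corner cannot
     both lie on the geodesic back to a, by uniqueness. So at one of them \<open>d a\<close> has
     dropped by less than \<epsilon>.\<close>
   have "\<exists>p\<in>corner_ends X (c0, k0). d a (pt p) > d a y - \<epsilon>"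
   proof (rule ccontr)
    assume n: "\<not> ?thesis"
    let ?p = "nxt (bds c0) k0" and ?q = "prv (bds c0) k0"
    have pq: "?p \<in> corner_ends X (c0, k0)" "?q \<in> corner_ends X (c0, k0)" by (simp_all add: corner_ends_alt)
    have ex: "d a (pt p) = d a y - \<epsilon> \<and> d (pt p) y = \<epsilon>" if "p \<in> corner_ends X (c0, k0)" for p
     using n that dpt[OF that] tri[OF a pt(1)[OF that] yM] sym[of "pt p" y] by fastforce
    have "pt ?p = pt ?q"
     by (rule geodesic_unique[OF a yM pt(1)[OF pq(1)] pt(1)[OF pq(2)]]) (use ex pq in auto)
    moreover have "v \<noteq> ?p" "v \<noteq> ?q" using corner_end_page(2)[OF q0c] pq edge_neq by blast+
    moreover have "0 < \<epsilon> / elen X {v, ?p}" "\<epsilon> / elen X {v, ?p} < 1" "0 \<le> \<epsilon> / elen X {v, ?q}" "\<epsilon> / elen X {v, ?q} \<le> 1"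
     using R(3)[OF q0c pq(1)] R(3)[OF q0c pq(2)] eps r R(1) by (auto simp: divide_le_eq divide_less_eq)
    ultimately have "{v, ?p} = {v, ?q}" unfolding pt_def by (intro epoint_eq_iff)
    then show False using corner_sides(3)[OF q0c] by (auto simp: doubleton_eq_iff)
   qed
   then obtain p0 where p0: "p0 \<in> corner_ends X (c0, k0)" "d a (pt p0) > d a y - \<epsilon>" by blast
   define x0 where "x0 = pt p0"
   define q where "q = (d a y - d a x0) / \<epsilon>"
   \<comment> \<open>Less than 1, so that prolonging a geodesic gains more than the penalty costs;
     greater than q, so that \<open>x0\<close> beats v itself; at least 1 - \<epsilon>, so that the
     loss disappears as \<epsilon> tends to 0.\<close>
   define \<kappa> where "\<kappa> = max (1 - \<epsilon>) ((1 + q) / 2)"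
   have "q < 1" using p0 eps by (simp add: x0_def q_def divide_less_eq)
   then have kap: "\<kappa> < 1" "1 - \<epsilon> \<le> \<kappa>" "q < \<kappa>" using eps(1) by (auto simp: \<kappa>_def less_max_iff_disj)
   have kap0: "0 < \<kappa>" using kap eps by simp
   have x0: "d a x0 > d a y - \<kappa> * \<epsilon>" using kap(3) eps by (simp add: q_def divide_less_eq)
   define G where "G c w = d a (cpt c w) - \<kappa> * \<bar>\<rho> c w - \<epsilon>\<bar>" for c w
   have x0K: "cpos c0 x0 \<in> K c0" "cpt c0 (cpos c0 x0) = x0"
    using pt[OF p0(1)] cpos_in_poly[OF c0(1)] cpt_unique[OF c0(1)] eps
    by (auto simp: K_def \<rho>_def x0_def dist_commute)
   have cont: "continuous_on (K c) (G c)" if "c \<in> I" for c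
    unfolding G_def \<rho>_def using continuous_on_cell_dist[OF Icell[OF that] a Kp[of c]] by (intro continuous_intros)
   obtain c w where cw: "c \<in> I" "w \<in> K c" "\<And>c' w'. c' \<in> I ==> w' \<in> K c' ==> G c' w' \<le> G c w"
    by (rule compact_family_max[where K = K and f = G, OF I K cont c0(2) x0K(1)]) (assumption | rule that)+
   have wP: "w \<in> poly c" using cw(2) Kp by blast
   have c: "c \<in> cells X" using Icell cw by blast
   define x where "x = cpt c w"
   have x: "x \<in> M" "incell c x" "cpos c x = w" using cpt[OF c wP] by (simp_all add: x_def)
   have G0: "d a x0 \<le> G c w" using cw(3)[OF c0(2) x0K(1)] x0K(2) pt(3)[OF p0(1)] by (simp add: G_def x0_def)
   obtain k where k: "(c, k) \<in> Q" using Ik cw by blast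
   have kc: "(c, k) \<in> corners X v" using k Qc(3) by blast
   have wr: "\<rho> c w \<le> r" using cw(2) by (simp add: K_def \<rho>_def dist_commute)
   have "\<rho> c w = r"
   proof (rule ccontr)
    assume "\<rho> c w \<noteq> r"
    then have wr': "\<rho> c w < r" using wr by simp
    \<comment> \<open>A prolongation of length \<tau> raises \<open>d a\<close> by \<tau> and the
      penalty by at most \<kappa> times \<tau>, against the maximality at w.\<close>
    have no_ext: False if "c' \<in> I" "x' \<in> M" "incell c' x'" "\<rho> c' (cpos c' x) = \<rho> c w" "x' \<noteq> x" "incell c' x"
      "dist (cpos c' x') (cpos c' x) < r - \<rho> c w" "d a x' = d a x + dist (cpos c' x') (cpos c' x)" for c' x'
    proof -
     let ?\<tau> = "dist (cpos c' x') (cpos c' x)"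
     have cc: "c' \<in> cells X" using Icell that by blast
     have tp: "0 < ?\<tau>" using incell_inj[OF cc that(2) x(1) that(3,6)] that(5) by auto
     have l: "\<bar>\<rho> c' (cpos c' x') - \<rho> c w\<bar> \<le> ?\<tau>" using rho_lip[of c' "cpos c' x'" "cpos c' x"] that(4) by simp
     then have "cpos c' x' \<in> K c'" using that(7) cpos_in_poly[OF cc that(2,3)] by (auto simp: K_def \<rho>_def dist_commute)
     then have "G c' (cpos c' x') \<le> G c w" using cw(3) that(1) by blast
     moreover have "\<kappa> * \<bar>\<rho> c' (cpos c' x') - \<epsilon>\<bar> \<le> \<kappa> * (\<bar>\<rho> c w - \<epsilon>\<bar> + ?\<tau>)"
      using l kap0 by (intro mult_left_mono) auto
     ultimately have "d a x' - \<kappa> * (\<bar>\<rho> c w - \<epsilon>\<bar> + ?\<tau>) \<le> d a x - \<kappa> * \<bar>\<rho> c w - \<epsilon>\<bar>"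
      using cpt_unique[OF cc that(2,3)] by (simp add: G_def x_def)
     then have "?\<tau> \<le> \<kappa> * ?\<tau>" using that(8) by (simp add: algebra_simps)
     then show False using tp kap(1) by simp
    qed
    have "dist (cpos c x) (vpos c v) < R" using wr' r x(3) by (simp add: \<rho>_def)
    from R(2)[OF kc x(1,2) this] show False
    proof (elim disjE bexE exE conjE)
     assume "x = vpoint v"
     then have "w = vpos c v" using x(3) by (simp add: vpos_def)
     then have "\<rho> c w = 0" by (simp add: \<rho>_def)
     moreover have "cpt c w = y" using \<open>x = vpoint v\<close> by (simp add: x_def y_def)
     ultimately have "G c w = d a y - \<kappa> * \<epsilon>" using eps by (simp add: G_def)
     then show False using G0 x0 by simp
    next
     fix p t assume p: "p \<in> corner_ends X (c, k)" and t: "0 < t" "t < 1" "x = epoint v p t"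
     obtain q' where q': "q' \<in> Q" "q' \<noteq> (c, k)" "p \<in> corner_ends X q'" using Ql[OF k p] by blast
     obtain c' k' where ck': "q' = (c', k')" by (cases q')
     have q'c: "(c', k') \<in> corners X v" using q' ck' Qc(3) by blast
     have cc': "c \<noteq> c'" using corner_neq_cell[OF kc q'c] q' ck' by auto
     note e = corner_end_page[OF kc p] corner_end_page[OF q'c q'(3)[unfolded ck']]
     have cI: "c' \<in> I" using q' ck' by (auto simp: I_def intro: rev_image_eqI)
     have rr: "\<rho> c1 (cpos c1 x) = elen X {v, p} * t" if "c1 \<in> pages v p" for c1
      unfolding \<rho>_def t(3) using dist_vpos_epoint[OF that] t by simp
     obtain c1 x' where "c1 = c \<or> c1 = c'" "x' \<in> M" "incell c1 x'" "x' \<noteq> epoint v p t"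
       "dist (cpos c1 x') (cpos c1 (epoint v p t)) < r - \<rho> c w"
       "d a x' = d a (epoint v p t) + dist (cpos c1 x') (cpos c1 (epoint v p t))"
      by (rule ext_edge[OF e(2) t(1,2) e(1,3) cc' a, of "r - \<rho> c w"]) (use wr' in simp, rule that)
     moreover have "incell c1 x" if "c1 = c \<or> c1 = c'"
      using that e(1,3) incell_epoint unfolding t(3) pages_def by blast
     ultimately show False
      using no_ext[of c1 x'] cw(1) cI rr[OF e(1)] rr[OF e(3)] x(3) t(3) by auto
    next
     fix w' assume "x = Inner c w'"
     then have xi: "x = Inner c w" "w \<in> interior (poly c)" using x Inner_in by auto
     obtain z' where "z' \<in> interior (poly c)" "z' \<noteq> w" "dist z' w < r - \<rho> c w" "d a (Inner c z') = d a (Inner c w) + dist z' w"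
      by (rule ext_inner[OF c xi(2) a, of "r - \<rho> c w"]) (use wr' in simp, rule that)
     then show False using no_ext[of c "Inner c z'"] cw(1) xi c Inner_in by auto
    qed
   qed
   moreover have "d a (cpt c w) \<ge> d a y - \<epsilon> + (1 - \<epsilon>) * (r - \<epsilon>)"
   proof -
    have "d a (cpt c w) \<ge> d a x0 + \<kappa> * (r - \<epsilon>)" using G0 \<open>\<rho> c w = r\<close> eps by (simp add: G_def)
    moreover have "(1 - \<epsilon>) * (r - \<epsilon>) \<le> \<kappa> * (r - \<epsilon>)" using kap eps by (intro mult_right_mono) auto
    moreover have "d a x0 > d a y - \<epsilon>" using p0 by (simp add: x0_def)
    ultimately show ?thesis by linarith
   qed
   ultimately show ?thesis using cw(1) wP by blast
  qed
  \<comment> \<open>The maximum of \<open>d a\<close> on the compact set of places at distance r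
    beats the value found for every \<epsilon>, hence also their limit.\<close>
  define S where "S c = {w \<in> poly c. \<rho> c w = r}" for c
  have Salt: "S c = poly c \<inter> sphere (vpos c v) r" for c by (auto simp: S_def \<rho>_def sphere_def dist_commute)
  have Sc: "compact (S c)" if "c \<in> I" for c unfolding Salt using poly_closed(2)[of c] by (simp add: compact_Int_closed)
  have Scont: "continuous_on (S c) (\<lambda>w. d a (cpt c w))" if "c \<in> I" for c
   using continuous_on_cell_dist[OF Icell[OF that] a, of "S c"] by (auto simp: S_def)
  define \<epsilon>0 where "\<epsilon>0 = min (r / 2) (1 / 2)"
  have e0: "0 < \<epsilon>0" "\<epsilon>0 < r" "\<epsilon>0 < 1" using r by (auto simp: \<epsilon>0_def)
  obtain c1 w1 where c1: "c1 \<in> I" "w1 \<in> S c1" using claim[OF e0] by (auto simp: S_def)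
  obtain c w where cw: "c \<in> I" "w \<in> S c" "\<And>c' w'. c' \<in> I ==> w' \<in> S c' ==> d a (cpt c' w') \<le> d a (cpt c w)"
   by (rule compact_family_max[where K = S and f = "\<lambda>c w. d a (cpt c w)", OF I Sc Scont c1]) (assumption | rule that)+
  have wP: "w \<in> poly c" "\<rho> c w = r" using cw(2) by (auto simp: S_def)
  have c: "c \<in> cells X" using Icell cw by blast
  obtain k where k: "(c, k) \<in> Q" using Ik cw by blast
  define x where "x = cpt c w"
  have x: "x \<in> M" "incell c x" "cpos c x = w" using cpt[OF c wP(1)] by (simp_all add: x_def)
  have ge: "d a x \<ge> d a y - \<epsilon> + (1 - \<epsilon>) * (r - \<epsilon>)" if "0 < \<epsilon>" "\<epsilon> < \<epsilon>0" for \<epsilon>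
  proof -
   have "\<epsilon> < r" "\<epsilon> < 1" using that e0 by auto
   from claim[OF that(1) this] obtain c' w' where "c' \<in> I" "w' \<in> S c'"
    "d a (cpt c' w') \<ge> d a y - \<epsilon> + (1 - \<epsilon>) * (r - \<epsilon>)" by (auto simp: S_def)
   then show ?thesis using cw(3)[of c' w'] by (simp add: x_def)
  qed
  have "((\<lambda>\<epsilon>. d a y - \<epsilon> + (1 - \<epsilon>) * (r - \<epsilon>)) \<longlongrightarrow> d a y - 0 + (1 - 0) * (r - 0)) (at_right 0)"
   by (intro tendsto_intros)
  moreover have "eventually (\<lambda>\<epsilon>. d a y - \<epsilon> + (1 - \<epsilon>) * (r - \<epsilon>) \<le> d a x) (at_right 0)"
   using ge e0(1) by (auto simp: eventually_at_right_field)
  ultimately have "d a y - 0 + (1 - 0) * (r - 0) \<le> d a x" by (intro tendsto_upperbound) auto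
  moreover have "d a x \<le> d a y + d y x" using tri a yM x by blast
  moreover have "d y x \<le> r" using d_vertex_le[of c k v x] k Qc(3) x wP by (auto simp: y_def \<rho>_def)
  ultimately have "d a x = d a y + r" by simp
  then show "\<exists>(c, k)\<in>Q. \<exists>x\<in>M. incell c x \<and> dist (cpos c x) (vpos c v) = r \<and> d a x = d a (vpoint v) + r"
   using k x wP by (intro bexI[OF _ k]) (auto simp: y_def \<rho>_def)
 qed
qed

end

section \<open>Sectors at a vertex and the link condition\<close>

text \<open>A chord between two rays at an angle below \<pi> stays strictly between them: the inner
  points are strictly to the left of one ray and to the right of the other.\<close>

lemma polar_segment:
 assumes "0 < r1" "0 < r2" "a < b" "b < a + pi" "0 < t" "t < 1"
 obtains r \<phi> where "0 < r" "r \<le> max r1 r2" "a < \<phi>" "\<phi> < b"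
  "(1 - t) *\<^sub>R (of_real r1 * cis a) + t *\<^sub>R (of_real r2 * cis b) = of_real r * cis \<phi>"
proof -
 define P where "P = of_real ((1 - t) * r1) + of_real (t * r2) * cis (b - a)"
 have ImP: "Im P = t * r2 * sin (b - a)" by (simp add: P_def)
 have sp: "0 < sin (b - a)" using assms by (intro sin_gt_zero) auto
 have IP: "0 < Im P" unfolding ImP using assms sp by simp
 then have nz: "P \<noteq> 0" by auto
 define \<theta> where "\<theta> = Arg P"
 have P: "P = of_real (norm P) * cis \<theta>" unfolding \<theta>_def by (metis rcis_cmod_Arg rcis_def)
 have th: "0 < \<theta>" "\<theta> < pi" using IP Arg_lt_pi[of P] nz by (auto simp: \<theta>_def)
 have "P * cis (- (b - a)) = of_real ((1 - t) * r1) * cis (- (b - a)) + of_real (t * r2) * (cis (b - a) * cis (- (b - a)))"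
  unfolding P_def by (simp add: algebra_simps)
 moreover have "sin (a - b) = - sin (b - a)" by (metis minus_diff_eq sin_minus)
 ultimately have "Im (P * cis (- (b - a))) = - ((1 - t) * r1 * sin (b - a))" by (simp add: cis_mult)
 also have "\<dots> < 0" using assms sp by simp
 finally have "Im (P * cis (- (b - a))) < 0" .
 moreover have "Im (P * cis (- (b - a))) = norm P * sin (\<theta> - (b - a))"
 proof -
  have "P * cis (- (b - a)) = of_real (norm P) * (cis \<theta> * cis (- (b - a)))" by (subst P) (simp only: mult.assoc)
  then have X: "Im (P * cis (- (b - a))) = norm P * sin (\<theta> + (a - b))" by (simp add: cis_mult)
  have e: "\<theta> - (b - a) = \<theta> + (a - b)" by simp
  show ?thesis unfolding e by (rule X)
 qed
 ultimately have "sin (\<theta> - (b - a)) < 0" using nz by (simp add: mult_less_0_iff)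
 then have "\<not> 0 \<le> \<theta> - (b - a)" using th assms sin_ge_zero[of "\<theta> - (b - a)"] by linarith
 then have "\<theta> < b - a" by simp
 show ?thesis
 proof (rule that[of "norm P" "a + \<theta>"])
  show "0 < norm P" using nz by simp
  have "norm P \<le> norm (of_real ((1 - t) * r1) :: complex) + norm (of_real (t * r2) * cis (b - a))"
   unfolding P_def by (rule norm_triangle_ineq)
  also have "\<dots> = (1 - t) * r1 + t * r2" using assms by (simp only: norm_mult norm_of_real norm_cis) simp
  also have "\<dots> \<le> (1 - t) * max r1 r2 + t * max r1 r2" using assms by (intro add_mono mult_left_mono) auto
  finally show "norm P \<le> max r1 r2" by (simp add: algebra_simps)
  show "a < a + \<theta>" using th by simp
  show "a + \<theta> < b" using \<open>\<theta> < b - a\<close> by simp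
  have "(1 - t) *\<^sub>R (of_real r1 * cis a) + t *\<^sub>R (of_real r2 * cis b) = P * cis a"
   unfolding P_def by (simp add: scaleR_conv_of_real algebra_simps cis_mult)
  also have "\<dots> = of_real (norm P) * (cis \<theta> * cis a)" by (subst P) (simp only: mult.assoc)
  finally show "(1 - t) *\<^sub>R (of_real r1 * cis a) + t *\<^sub>R (of_real r2 * cis b) = of_real (norm P) * cis (a + \<theta>)"
   by (simp add: cis_mult add.commute)
 qed
qed

lemma ray_crossing:
 assumes "0 < s" "0 < r" "0 < b" "b < c" "c < pi"
 obtains \<rho> t where "0 < \<rho>" "\<rho> \<le> max s r" "0 < t" "t < 1"
  "of_real \<rho> * cis b = (1 - t) *\<^sub>R of_real s + t *\<^sub>R (of_real r * cis c)"
proof -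
 have sp: "0 < sin b" "0 < sin (c - b)" "0 < sin c" using assms by (auto intro!: sin_gt_zero)
 \<comment> \<open>The values come from areas: the middle ray cuts the triangle spanned by the outer
   points into two, whose areas add up and whose ratio is the ratio in which the chord is
   divided.\<close>
 define D where "D = s * sin b + r * sin (c - b)"
 have D: "0 < D" using sp assms by (simp add: D_def add_pos_pos)
 define t where "t = s * sin b / D"
 define \<rho> where "\<rho> = s * r * sin c / D"
 have t1: "1 - t = r * sin (c - b) / D" using D unfolding t_def D_def by (simp add: field_simps)
 have t: "0 < t" "t < 1"
 proof -
  show "0 < t" using D sp assms by (simp add: t_def)
  have "0 < 1 - t" unfolding t1 using D sp assms by simp
  then show "t < 1" by simp
 qed
 have rho: "0 < \<rho>" using D sp assms by (simp add: \<rho>_def)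
 have eq: "of_real \<rho> * cis b = (1 - t) *\<^sub>R of_real s + t *\<^sub>R (of_real r * cis c)"
 proof -
  have "\<rho> * cos b = (1 - t) * s + t * (r * cos c)"
  proof -
   have "s * r * (sin c * cos b) = r * sin (c - b) * s + s * sin b * (r * cos c)"
    by (simp add: sin_diff algebra_simps)
   then have "s * r * sin c * cos b / D = (r * sin (c - b) * s + s * sin b * (r * cos c)) / D" by (simp only: mult.assoc)
   then show ?thesis unfolding t1 by (simp add: \<rho>_def t_def add_divide_distrib)
  qed
  moreover have "\<rho> * sin b = t * (r * sin c)" by (simp add: \<rho>_def t_def)
  ultimately show ?thesis by (simp add: complex_eq_iff)
 qed
 have "\<rho> = norm (of_real \<rho> * cis b)" using rho by (simp add: norm_mult)
 also have "\<dots> \<le> norm ((1 - t) *\<^sub>R (of_real s :: complex)) + norm (t *\<^sub>R (of_real r * cis c))"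
  unfolding eq by (rule norm_triangle_ineq)
 also have "\<dots> = (1 - t) * s + t * r" using t assms by (simp add: norm_mult)
 also have "\<dots> \<le> (1 - t) * max s r + t * max s r" using t by (intro add_mono mult_left_mono) auto
 finally have "\<rho> \<le> max s r" by (simp add: algebra_simps)
 then show ?thesis using that rho t eq by blast
qed

lemma dist_segment_split:
 fixes x y :: complex
 assumes "0 \<le> t" "t \<le> 1" "w = (1 - t) *\<^sub>R x + t *\<^sub>R y"
 shows "dist x w + dist w y = dist x y" "dist x w = t * dist x y" "dist w y = (1 - t) * dist x y"
proof -
 have "x - w = t *\<^sub>R (x - y)" "w - y = (1 - t) *\<^sub>R (x - y)" unfolding assms(3) by (simp_all add: algebra_simps)
 then show "dist x w = t * dist x y" "dist w y = (1 - t) * dist x y" using assms by (simp_all add: dist_norm)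
 then show "dist x w + dist w y = dist x y" by (simp add: algebra_simps)
qed

lemma dist_polar: "(dist (of_real s) (of_real r * cis \<theta>))\<^sup>2 = s\<^sup>2 + r\<^sup>2 - 2 * s * r * cos \<theta>"
proof -
 have "(dist (of_real s) (of_real r * cis \<theta>))\<^sup>2 = (s - r * cos \<theta>)\<^sup>2 + (r * sin \<theta>)\<^sup>2"
  by (simp add: dist_norm cmod_power2)
 also have "\<dots> = s\<^sup>2 + r\<^sup>2 * ((cos \<theta>)\<^sup>2 + (sin \<theta>)\<^sup>2) - 2 * s * r * cos \<theta>"
  by (simp add: power2_eq_square algebra_simps del: sin_cos_squared_add sin_cos_squared_add2 sin_cos_squared_add3)
 finally show ?thesis by simp
qed

context npc_complex begin

section \<open>Isometric polar coordinates on the sectors at a vertex\<close>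

definition crn :: "'c => 'v => 'v => 'v => bool" where
 "crn c v p p' \<longleftrightarrow> (\<exists>k. (c, k) \<in> corners X v \<and> corner_ends X (c, k) = {p, p'})"

lemma crn_swap: "crn c v p p' \<longleftrightarrow> crn c v p' p" by (simp add: crn_def insert_commute)

definition dir :: "'c => 'v => 'v => complex" where
 "dir c v p = (vpos c p - vpos c v) /\<^sub>R elen X {v, p}"

definition cang :: "'c => 'v => 'v => 'v => real" where
 "cang c v p p' = vec_angle (vpos c p - vpos c v) (vpos c p' - vpos c v)"

text \<open>At a corner, the isometry of the plane that takes 0 to v, the positive real axis toward
  p and the ray at angle \<open>cang c v p p'\<close> toward p'. Written in the oblique basis of the
  two unit directions, it reverses orientation when necessary, without a case distinction.\<close>

definition sec :: "'c => 'v => 'v => 'v => complex => complex" where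
 "sec c v p p' w = vpos c v + (Re w - Im w * cos (cang c v p p') / sin (cang c v p p')) *\<^sub>R dir c v p
   + (Im w / sin (cang c v p p')) *\<^sub>R dir c v p'"

lemma cang_swap: "cang c v p p' = cang c v p' p" by (simp add: cang_def vec_angle_commute)

lemma crn_facts:
 assumes "crn c v p p'"
 shows "c \<in> cells X" "c \<in> pages v p" "c \<in> pages v p'" "{v, p} \<in> edges X" "{v, p'} \<in> edges X"
  "p \<noteq> p'" "vpoint v \<in> M" "incell c (vpoint v)" "crs (vpos c v) (vpos c p) (vpos c p') \<noteq> 0"
  "norm (dir c v p) = 1" "norm (dir c v p') = 1"
  "dist (vpos c v) (vpos c p) = elen X {v, p}" "dist (vpos c v) (vpos c p') = elen X {v, p'}"
proof -
 obtain k where k: "(c, k) \<in> corners X v" "corner_ends X (c, k) = {p, p'}" using assms by (auto simp: crn_def)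
 have c: "c \<in> cells X" "k < len c" "bds c ! k = v" using k by (auto simp: corners_iff)
 show "c \<in> cells X" by fact
 show P: "c \<in> pages v p" "c \<in> pages v p'" and E: "{v, p} \<in> edges X" "{v, p'} \<in> edges X"
  using corner_end_page[OF k(1)] k(2) by auto
 note s = corner_sides[OF k(1)]
 have e: "{p, p'} = {nxt (bds c) k, prv (bds c) k}" using k(2) by (simp add: corner_ends_alt)
 then show "p \<noteq> p'" using s(3) by (auto simp: doubleton_eq_iff)
 show "vpoint v \<in> M" using corner_vertex_in[OF k(1)] .
 show "incell c (vpoint v)" using incell_vpoint[OF c(1), of v] c(2,3) by auto
 show D: "dist (vpos c v) (vpos c p) = elen X {v, p}" "dist (vpos c v) (vpos c p') = elen X {v, p'}"
  using P is_side_dist page_side by metis+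
 show "norm (dir c v p) = 1" "norm (dir c v p') = 1"
  using D elen_pos[OF E(1)] elen_pos[OF E(2)] by (simp_all add: dir_def dist_norm norm_minus_commute)
 have "crs (shp c ! k) (nxt (shp c) k) (prv (shp c) k) \<noteq> 0"
 proof -
  note pi = prv_index[OF c(1,2)]
  have kl: "k < length (shp c)" using c shape_len by simp
  obtain s' where "s' = (1::real) \<or> s' = - 1"
   "\<And>j. j < length (shp c) ==> j \<noteq> k ==> j \<noteq> Suc k mod length (shp c) ==> 0 < s' * crs (shp c ! k) (nxt (shp c) k) (shp c ! j)"
   by (rule polygon_side[OF shape_convex[OF c(1)] kl]) (rule that)
  from this(2)[of "(k + len c - 1) mod len c"] show ?thesis
   using pi shape_len[OF c(1)] by (auto simp: prv_def)
 qed
 then have *: "crs (vpos c v) (vpos c (nxt (bds c) k)) (vpos c (prv (bds c) k)) \<noteq> 0" using s by simp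
 have "crs a b c' = - crs a c' b" for a b c' by (simp add: crs_alt algebra_simps)
 then have "crs (vpos c v) (vpos c (prv (bds c) k)) (vpos c (nxt (bds c) k)) \<noteq> 0" using * by (metis neg_equal_0_iff_equal)
 moreover have "p = nxt (bds c) k \<and> p' = prv (bds c) k \<or> p = prv (bds c) k \<and> p' = nxt (bds c) k"
  using e by (auto simp: doubleton_eq_iff)
 ultimately show "crs (vpos c v) (vpos c p) (vpos c p') \<noteq> 0" using * by auto
qed

lemma cang_facts:
 assumes "crn c v p p'"
 shows "0 < cang c v p p'" "cang c v p p' < pi" "0 < sin (cang c v p p')"
  "dir c v p \<bullet> dir c v p' = cos (cang c v p p')"
proof -
 note f = crn_facts[OF assms]
 let ?u = "vpos c p - vpos c v" and ?w = "vpos c p' - vpos c v" and ?a = "cang c v p p'"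
 have nz: "?u \<noteq> 0" "?w \<noteq> 0" using f(9) by auto
 have b: "0 \<le> ?a" "?a \<le> pi" unfolding cang_def using vec_angle_bounds by auto
 have "sin ?a \<noteq> 0"
 proof (cases "0 \<le> Im (cnj ?u * ?w)")
  case True
  obtain r \<theta> where "vec_angle ?u ?w = \<theta>" "Im (cnj ?u * ?w) = norm ?u * norm ?w * sin \<theta>"
   by (rule polar_relative[OF nz True]) (rule that)
  then show ?thesis using f(9) by (auto simp: crs_def cang_def)
 next
  case False
  have im: "Im (cnj ?w * ?u) = - Im (cnj ?u * ?w)" by (simp add: algebra_simps)
  then have le: "0 \<le> Im (cnj ?w * ?u)" using False by linarith
  obtain r \<theta> where "vec_angle ?w ?u = \<theta>" "Im (cnj ?w * ?u) = norm ?w * norm ?u * sin \<theta>"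
   by (rule polar_relative[OF nz(2,1) le]) (rule that)
  then show ?thesis using f(9) im by (auto simp: crs_def cang_def vec_angle_commute)
 qed
 moreover have "0 \<le> sin ?a" using b by (rule sin_ge_zero)
 ultimately show s: "0 < sin ?a" by simp
 show "0 < ?a" "?a < pi" using s b by (auto simp: less_le)
 have "\<bar>?u \<bullet> ?w / (norm ?u * norm ?w)\<bar> \<le> 1"
  using Cauchy_Schwarz_ineq2[of ?u ?w] nz by (auto simp: abs_mult divide_le_eq)
 then have "cos ?a = ?u \<bullet> ?w / (norm ?u * norm ?w)"
  unfolding cang_def vec_angle_def by (intro cos_arccos_abs)
 also have "\<dots> = dir c v p \<bullet> dir c v p'"
  using f(12,13) by (simp add: dir_def dist_norm norm_minus_commute divide_inverse mult_ac)
 finally show "dir c v p \<bullet> dir c v p' = cos ?a" by simp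
qed

text \<open>The two unit directions have inner product C, the cosine of the corner angle; in oblique
  coordinates the denominators cancel because 1 minus the square of C is the square of the sine
  S.\<close>

lemma sec_inner:
 assumes "crn c v p p'"
 shows "(sec c v p p' w - sec c v p p' w0) \<bullet> (sec c v p p' w' - sec c v p p' w0') = (w - w0) \<bullet> (w' - w0')"
proof -
 note f = crn_facts[OF assms] and g = cang_facts[OF assms]
 let ?e = "dir c v p" and ?f = "dir c v p'"
 define C where "C = cos (cang c v p p')"
 define S where "S = sin (cang c v p p')"
 have CS: "C\<^sup>2 + S\<^sup>2 = 1" "S \<noteq> 0" using g(3) by (auto simp: C_def S_def)
 have ip: "?e \<bullet> ?e = 1" "?f \<bullet> ?f = 1" "?e \<bullet> ?f = C" "?f \<bullet> ?e = C"
  using f(10,11) g(4) by (simp_all add: C_def norm_eq_1 inner_commute)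
 have sd: "sec c v p p' a - sec c v p p' b = (Re (a - b) - Im (a - b) * C / S) *\<^sub>R ?e + (Im (a - b) / S) *\<^sub>R ?f" for a b
  unfolding sec_def C_def[symmetric] S_def[symmetric] by (simp add: algebra_simps diff_divide_distrib)
 define x where "x = Re (w - w0)"
 define y where "y = Im (w - w0)"
 define x' where "x' = Re (w' - w0')"
 define y' where "y' = Im (w' - w0')"
 have "(sec c v p p' w - sec c v p p' w0) \<bullet> (sec c v p p' w' - sec c v p p' w0')
   = (x - y * C / S) * (x' - y' * C / S) + (y / S) * (y' / S) + ((x - y * C / S) * (y' / S) + (x' - y' * C / S) * (y / S)) * C"
  unfolding sd x_def[symmetric] y_def[symmetric] x'_def[symmetric] y'_def[symmetric]
  by (simp add: inner_add_left inner_add_right ip algebra_simps)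
 also have "\<dots> = x * x' + y * y' * ((1 - C\<^sup>2) / S\<^sup>2)"
  using CS(2) by (simp add: field_simps power2_eq_square)
 also have "\<dots> = x * x' + y * y'"
 proof -
  have "1 - C\<^sup>2 = S\<^sup>2" using CS(1) by linarith
  then show ?thesis using CS(2) by simp
 qed
 finally show ?thesis by (simp add: x_def y_def x'_def y'_def inner_complex_def)
qed

lemma sec_dist: assumes "crn c v p p'" shows "dist (sec c v p p' w) (sec c v p p' w') = dist w w'"
 using sec_inner[OF assms, of w w' w w'] by (simp add: dist_norm norm_eq_sqrt_inner)

lemma sec_affine: "sec c v p p' ((1 - t) *\<^sub>R w + t *\<^sub>R w') = (1 - t) *\<^sub>R sec c v p p' w + t *\<^sub>R sec c v p p' w'"
 unfolding sec_def by (simp add: algebra_simps add_divide_distrib diff_divide_distrib)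

lemma sec_polar:
 assumes "crn c v p p'"
 shows "sec c v p p' (of_real r * cis \<phi>) = vpos c v + (r * sin (cang c v p p' - \<phi>) / sin (cang c v p p')) *\<^sub>R dir c v p
   + (r * sin \<phi> / sin (cang c v p p')) *\<^sub>R dir c v p'"
proof -
 let ?a = "cang c v p p'"
 have "sin ?a \<noteq> 0" using cang_facts(3)[OF assms] by simp
 then have "r * cos \<phi> - r * sin \<phi> * cos ?a / sin ?a = r * sin (?a - \<phi>) / sin ?a"
  by (simp add: sin_diff field_simps)
 then show ?thesis unfolding sec_def by simp
qed

lemma sec_swap:
 assumes "crn c v p p'"
 shows "sec c v p p' (of_real r * cis \<phi>) = sec c v p' p (of_real r * cis (cang c v p p' - \<phi>))"
 using sec_polar[OF assms] sec_polar[OF assms[unfolded crn_swap[of c v p p']]]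
 by (simp add: cang_swap[of c v p' p])

lemma sec_0 [simp]: "sec c v p p' 0 = vpos c v"
 by (simp add: sec_def)

lemma sec_leg:
 assumes "crn c v p p'"
 shows "sec c v p p' (of_real r) = cpos c (epoint v p (r / elen X {v, p}))"
  "sec c v p p' (of_real r * cis (cang c v p p')) = cpos c (epoint v p' (r / elen X {v, p'}))"
proof -
 note f = crn_facts[OF assms] and g = cang_facts[OF assms]
 have vp: "v \<noteq> p" "v \<noteq> p'" using f(4,5) edge_neq by blast+
 have cp: "cpos c (epoint v x t) = vpos c v + t *\<^sub>R (vpos c x - vpos c v)" if "v \<noteq> x" for x t
  using that by (simp add: cpos_epoint algebra_simps)
 show "sec c v p p' (of_real r) = cpos c (epoint v p (r / elen X {v, p}))"
  unfolding cp[OF vp(1)] by (simp add: sec_def dir_def divide_inverse)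
 show "sec c v p p' (of_real r * cis (cang c v p p')) = cpos c (epoint v p' (r / elen X {v, p'}))"
  unfolding cp[OF vp(2)] sec_polar[OF assms] using g(3) by (simp add: dir_def divide_inverse)
qed

text \<open>The last clause keeps the open sector of radius R off the boundary of the cell, so that
  \<open>cell_geodesic\<close> applies to its chords.\<close>

definition good :: "real => 'c => 'v => 'v => 'v => bool" where
 "good R c v p p' \<longleftrightarrow> R \<le> elen X {v, p} \<and> R \<le> elen X {v, p'} \<and>
   (\<forall>r \<phi>. 0 \<le> r --> r < R --> 0 \<le> \<phi> --> \<phi> \<le> cang c v p p' --> sec c v p p' (of_real r * cis \<phi>) \<in> poly c) \<and>
   (\<forall>r \<phi>. 0 < r --> r < R --> 0 < \<phi> --> \<phi> < cang c v p p' --> sec c v p p' (of_real r * cis \<phi>) \<in> interior (poly c))"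

lemma good_mono: "good R c v p p' ==> R' \<le> R ==> good R' c v p p'"
 unfolding good_def by (meson order_trans less_le_trans)

lemma good_swap:
 assumes "crn c v p p'" "good R c v p p'" shows "good R c v p' p"
proof -
 note sw = crn_swap[of c v p' p, THEN iffD2, OF assms(1)]
 have eq: "sec c v p' p (of_real r * cis \<phi>) = sec c v p p' (of_real r * cis (cang c v p p' - \<phi>))" for r \<phi>
  using sec_swap[OF sw] by (simp add: cang_swap)
 show ?thesis using assms(2) unfolding good_def eq by (simp add: cang_swap[of c v p' p])
qed

lemma good_exists:
 assumes "crn c v p p'"
 shows "\<exists>R>0. good R c v p p'"
proof -
 note f = crn_facts[OF assms] and g = cang_facts[OF assms]
 let ?a = "cang c v p p'"
 obtain k where k: "(c, k) \<in> corners X v" "corner_ends X (c, k) = {p, p'}" using assms by (auto simp: crn_def)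
 obtain R0 where R0: "0 < R0"
  "\<And>v c k x. (c, k) \<in> corners X v ==> x \<in> M ==> incell c x ==> dist (cpos c x) (vpos c v) < R0 ==>
   x = vpoint v \<or> (\<exists>p\<in>corner_ends X (c, k). \<exists>t. 0 < t \<and> t < 1 \<and> x = epoint v p t) \<or> (\<exists>w. x = Inner c w)"
  "\<And>v c k p. (c, k) \<in> corners X v ==> p \<in> corner_ends X (c, k) ==> R0 \<le> elen X {v, p}"
  by (rule near_vertex) (rule that)
 have l: "R0 \<le> elen X {v, p}" "R0 \<le> elen X {v, p'}" using R0(3)[OF k(1)] k(2) by auto
 \<comment> \<open>Makes the oblique coordinates of a point of the sector at most half of the
   corresponding sides, so that the point is a convex combination of the vertices v, p and
   p'.\<close>
 define R where "R = R0 * sin ?a / 2"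
 have R: "0 < R" "R < R0"
 proof -
  show "0 < R" using R0 g by (simp add: R_def)
  have "sin ?a \<le> 1" by simp
  then have "R0 * sin ?a \<le> R0 * 1" using R0(1) by (intro mult_left_mono) auto
  then show "R < R0" unfolding R_def using R0(1) by linarith
 qed
 have inP: "sec c v p p' (of_real r * cis \<phi>) \<in> poly c" if r: "0 \<le> r" "r < R" and ph: "0 \<le> \<phi>" "\<phi> \<le> ?a" for r \<phi>
 proof -
  define A where "A = r * sin (?a - \<phi>) / sin ?a / elen X {v, p}"
  define B where "B = r * sin \<phi> / sin ?a / elen X {v, p'}"
  have s0: "0 \<le> sin (?a - \<phi>)" "0 \<le> sin \<phi>" using ph g by (auto intro!: sin_ge_zero)
  have lp: "0 < elen X {v, p}" "0 < elen X {v, p'}" using f(4,5) elen_pos by auto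
  have half: "r * s / sin ?a / l \<le> 1 / 2" if "0 \<le> s" "s \<le> 1" "R0 \<le> l" for s l
  proof -
   have "r * s \<le> R * 1" using that r by (intro mult_mono) auto
   then have "r * s / sin ?a \<le> R0 / 2" using g(3) by (simp add: R_def divide_le_eq mult_ac)
   then have "r * s / sin ?a \<le> l / 2" using that by simp
   then have "r * s / sin ?a / l \<le> l / 2 / l" using that R0(1) by (intro divide_right_mono) auto
   then show ?thesis using that R0(1) by simp
  qed
  have AB: "0 \<le> A" "0 \<le> B" "A \<le> 1 / 2" "B \<le> 1 / 2"
   using half[OF s0(1) _ l(1)] half[OF s0(2) _ l(2)] s0 r g(3) lp by (auto simp: A_def B_def)
  have e: "sec c v p p' (of_real r * cis \<phi>) = (1 - A - B) *\<^sub>R vpos c v + A *\<^sub>R vpos c p + B *\<^sub>R vpos c p'"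
   unfolding sec_polar[OF assms] A_def B_def dir_def by (simp add: algebra_simps divide_inverse)
  have V: "vpos c v \<in> set (shp c)" "vpos c p \<in> set (shp c)" "vpos c p' \<in> set (shp c)"
   using f(2,3) is_side_vpos page_side by metis+
  have "sec c v p p' (of_real r * cis \<phi>) \<in> convex hull {vpos c v, vpos c p, vpos c p'}"
   unfolding convex_hull_3 e using AB by (intro CollectI exI[of _ "1 - A - B"] exI[of _ A] exI[of _ B]) auto
  also have "\<dots> \<subseteq> poly c" unfolding poly_alt using V by (intro hull_mono) auto
  finally show ?thesis .
 qed
 have inI: "sec c v p p' (of_real r * cis \<phi>) \<in> interior (poly c)" if r: "0 < r" "r < R" and ph: "0 < \<phi>" "\<phi> < ?a" for r \<phi>
 proof -
  let ?z = "sec c v p p' (of_real r * cis \<phi>)"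
  have z: "?z \<in> poly c" using inP r ph by simp
  define x where "x = cpt c ?z"
  have x: "x \<in> M" "incell c x" "cpos c x = ?z" using cpt[OF f(1) z] by (simp_all add: x_def)
  have dv: "dist ?z (vpos c v) = r"
   using sec_dist[OF assms, of "of_real r * cis \<phi>" 0] r by (simp add: norm_mult dist_norm)
  have "dist (cpos c x) (vpos c v) < R0" using x dv r R by simp
  from R0(2)[OF k(1) x(1,2) this] show ?thesis
  proof (elim disjE bexE exE conjE)
   assume "x = vpoint v" then show ?thesis using x(3) dv r by (simp add: vpos_def)
  next
   fix y t assume y: "y \<in> corner_ends X (c, k)" and t: "0 < t" "t < 1" "x = epoint v y t"
   have yp: "c \<in> pages v y" using corner_end_page[OF k(1) y] by simp
   have "r = elen X {v, y} * t" using dist_vpos_epoint[OF yp, of t] t dv x(3) by (metis less_imp_le)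
   then have tt: "t = r / elen X {v, y}" using elen_pos[of "{v,y}"] corner_end_page[OF k(1) y] by simp
   from y have "y = p \<or> y = p'" using k(2) by auto
   then have "?z = sec c v p p' (of_real r * cis 0) \<or> ?z = sec c v p p' (of_real r * cis ?a)"
    using sec_leg[OF assms, of r] x(3) t(3) tt by auto
   then have "dist (of_real r * cis \<phi>) (of_real r * cis 0) = 0 \<or> dist (of_real r * cis \<phi>) (of_real r * cis ?a) = 0"
    using sec_dist[OF assms] by (metis dist_self)
   then have "cis \<phi> = cis 0 \<or> cis \<phi> = cis ?a" using r by simp
   then have "cos \<phi> = cos 0 \<or> cos \<phi> = cos ?a" by (metis cis.sel(1))
   moreover have "cos \<phi> < cos 0" "cos ?a < cos \<phi>"
    using cos_monotone_0_pi[of 0 \<phi>] cos_monotone_0_pi[of \<phi> ?a] ph g by auto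
   ultimately show ?thesis by linarith
  next
   fix w assume "x = Inner c w"
   then show ?thesis using x Inner_in by auto
  qed
 qed
 show ?thesis using R l inP inI unfolding good_def by (intro exI[of _ R]) auto
qed

text \<open>The converse of \<open>good\<close>: a convex polygon lies in the angle at its corner,
  since the lines of the two sides support it and make both oblique coordinates nonnegative.\<close>

lemma sector_cover:
 assumes "crn c v p p'" and x: "x \<in> M" "incell c x" and r: "dist (cpos c x) (vpos c v) = r" "0 < r"
 obtains \<phi> where "0 \<le> \<phi>" "\<phi> \<le> cang c v p p'" "cpos c x = sec c v p p' (of_real r * cis \<phi>)"
proof -
 note f = crn_facts[OF assms(1)] and g = cang_facts[OF assms(1)]
 let ?a = "cang c v p p'"
 let ?u = "vpos c p - vpos c v" and ?w = "vpos c p' - vpos c v" and ?W = "cpos c x - vpos c v"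
 let ?D = "crs (vpos c v) (vpos c p) (vpos c p')"
 have P: "cpos c x \<in> poly c" "vpos c p \<in> poly c" "vpos c p' \<in> poly c"
  using cpos_in_poly[OF f(1) x] is_side_vpos f(2,3) page_side hull_inc unfolding poly_alt by metis+
 define A where "A = - crs (vpos c v) (vpos c p') (cpos c x) / ?D"
 define B where "B = crs (vpos c v) (vpos c p) (cpos c x) / ?D"
 have "0 \<le> crs (vpos c v) (vpos c p) (cpos c x) * ?D" using page_crs[OF f(2) P(1,3)] .
 then have B: "0 \<le> B" by (simp add: B_def zero_le_divide_iff zero_le_mult_iff)
 have sw: "crs (vpos c v) (vpos c p') (vpos c p) = - ?D" by (simp add: crs_alt algebra_simps)
 have "0 \<le> crs (vpos c v) (vpos c p') (cpos c x) * crs (vpos c v) (vpos c p') (vpos c p)" using page_crs[OF f(3) P(1,2)] .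
 then have A: "0 \<le> A" unfolding sw by (simp add: A_def zero_le_divide_iff mult_le_0_iff divide_le_0_iff)
 have "of_real ?D * ?W = of_real (- crs (vpos c v) (vpos c p') (cpos c x)) * ?u + of_real (crs (vpos c v) (vpos c p) (cpos c x)) * ?w"
  by (simp add: complex_eq_iff crs_alt algebra_simps)
 then have "?W = (of_real (- crs (vpos c v) (vpos c p') (cpos c x)) * ?u + of_real (crs (vpos c v) (vpos c p) (cpos c x)) * ?w) / of_real ?D"
  using f(9) by (metis nonzero_mult_div_cancel_left of_real_eq_0_iff)
 then have W: "?W = A *\<^sub>R ?u + B *\<^sub>R ?w"
  by (simp add: A_def B_def scaleR_conv_of_real add_divide_distrib diff_divide_distrib)
 define A' where "A' = A * elen X {v, p}"
 define B' where "B' = B * elen X {v, p'}"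
 have lp: "0 < elen X {v, p}" "0 < elen X {v, p'}" using f(4,5) elen_pos by auto
 have AB: "0 \<le> A'" "0 \<le> B'" using A B lp by (auto simp: A'_def B'_def)
 have W': "cpos c x = vpos c v + A' *\<^sub>R dir c v p + B' *\<^sub>R dir c v p'"
  using W lp by (simp add: A'_def B'_def dir_def algebra_simps)
 define z where "z = Complex (A' + B' * cos ?a) (B' * sin ?a)"
 have zx: "sec c v p p' z = cpos c x" unfolding sec_def W' using g(3) by (simp add: z_def)
 have "norm z = r" using sec_dist[OF assms(1), of z 0] r zx by (simp add: dist_norm)
 then have z: "z = of_real r * cis (Arg z)" by (metis rcis_cmod_Arg rcis_def)
 have "0 \<le> Im z" using AB g(3) by (simp add: z_def)
 then have A0: "0 \<le> Arg z" using Arg_less_0[of z] by linarith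
 have "r * sin (?a - Arg z) = A' * sin ?a"
 proof -
  have "r * cos (Arg z) = A' + B' * cos ?a" "r * sin (Arg z) = B' * sin ?a"
   using arg_cong[OF z, of Re] arg_cong[OF z, of Im] by (simp_all add: z_def)
  then have "r * sin (?a - Arg z) = sin ?a * (A' + B' * cos ?a) - cos ?a * (B' * sin ?a)"
  proof -
   assume e: "r * cos (Arg z) = A' + B' * cos ?a" "r * sin (Arg z) = B' * sin ?a"
   have "r * sin (?a - Arg z) = sin ?a * (r * cos (Arg z)) - cos ?a * (r * sin (Arg z))"
    by (simp add: sin_diff algebra_simps)
   then show ?thesis unfolding e .
  qed
  then show ?thesis by (simp add: algebra_simps)
 qed
 also have "\<dots> \<ge> 0" using AB g(3) by simp
 finally have sn: "0 \<le> sin (?a - Arg z)" using r(2) by (simp add: zero_le_mult_iff)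
 have "Arg z \<le> ?a"
 proof (rule ccontr)
  assume "\<not> Arg z \<le> ?a"
  then have "0 < sin (Arg z - ?a)" using Arg_le_pi[of z] g by (intro sin_gt_zero) auto
  moreover have "sin (?a - Arg z) = - sin (Arg z - ?a)" by (metis minus_diff_eq sin_minus)
  ultimately show False using sn by simp
 qed
 then show ?thesis using that[of "Arg z"] A0 zx z by metis
qed

definition spt :: "'c => 'v => 'v => 'v => complex => ('v, 'c) point" where
 "spt c v p p' w = cpt c (sec c v p p' w)"

lemma spt_leg:
 assumes "crn c v p p'" "0 \<le> r" "r \<le> elen X {v, p}"
 shows "spt c v p p' (of_real r) = epoint v p (r / elen X {v, p})"
proof -
 note f = crn_facts[OF assms(1)]
 have l: "0 < elen X {v, p}" using f(4) elen_pos by blast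
 show ?thesis unfolding spt_def sec_leg(1)[OF assms(1)]
 proof (rule cpt_unique[OF f(1)])
  show "epoint v p (r / elen X {v, p}) \<in> M" using epoint_in[OF f(4)] assms l by simp
  show "incell c (epoint v p (r / elen X {v, p}))" using f(2) incell_epoint by (auto simp: pages_def)
 qed
qed

lemma spt_leg':
 assumes "crn c v p p'" "0 \<le> r" "r \<le> elen X {v, p'}"
 shows "spt c v p p' (of_real r * cis (cang c v p p')) = epoint v p' (r / elen X {v, p'})"
proof -
 have "sec c v p p' (of_real r * cis (cang c v p p')) = sec c v p' p (of_real r)"
  using sec_swap[OF assms(1), of r "cang c v p p'"] by simp
 then have "spt c v p p' (of_real r * cis (cang c v p p')) = spt c v p' p (of_real r)" by (simp add: spt_def)
 then show ?thesis using spt_leg[of c v p' p r] assms crn_swap by simp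
qed

lemma spt_facts:
 assumes "crn c v p p'" "good R c v p p'" "0 \<le> r" "r < R" "0 \<le> \<phi>" "\<phi> \<le> cang c v p p'"
 shows "spt c v p p' (of_real r * cis \<phi>) \<in> M" "incell c (spt c v p p' (of_real r * cis \<phi>))"
  "cpos c (spt c v p p' (of_real r * cis \<phi>)) = sec c v p p' (of_real r * cis \<phi>)"
proof -
 have "sec c v p p' (of_real r * cis \<phi>) \<in> poly c" using assms unfolding good_def by blast
 then show "spt c v p p' (of_real r * cis \<phi>) \<in> M" "incell c (spt c v p p' (of_real r * cis \<phi>))"
  "cpos c (spt c v p p' (of_real r * cis \<phi>)) = sec c v p p' (of_real r * cis \<phi>)"
  using cpt[OF crn_facts(1)[OF assms(1)]] by (simp_all add: spt_def)
qed

lemma spt_dist_le: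
 assumes "crn c v p p'" "good R c v p p'" "0 \<le> r" "r < R" "0 \<le> \<phi>" "\<phi> \<le> cang c v p p'"
  "0 \<le> r'" "r' < R" "0 \<le> \<phi>'" "\<phi>' \<le> cang c v p p'"
 shows "d (spt c v p p' (of_real r * cis \<phi>)) (spt c v p p' (of_real r' * cis \<phi>')) \<le> dist (of_real r * cis \<phi>) (of_real r' * cis \<phi>')"
 using d_le_cell[OF crn_facts(1)[OF assms(1)] spt_facts(1)[OF assms(1-6)] spt_facts(1)[OF assms(1,2,7-10)]
   spt_facts(2)[OF assms(1-6)] spt_facts(2)[OF assms(1,2,7-10)]]
  spt_facts(3)[OF assms(1-6)] spt_facts(3)[OF assms(1,2,7-10)] sec_dist[OF assms(1)] by simp

text \<open>By \<open>polar_segment\<close> the chord between points at different angles runs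
  through the open sector, so that \<open>cell_geodesic\<close> applies.\<close>

lemma spt_dist:
 assumes cr: "crn c v p p'" "good R c v p p'" and r: "0 < r" "r < R" "0 < r'" "r' < R"
  and ph: "0 \<le> \<phi>" "\<phi> < \<phi>'" "\<phi>' \<le> cang c v p p'"
 shows "d (spt c v p p' (of_real r * cis \<phi>)) (spt c v p p' (of_real r' * cis \<phi>')) = dist (of_real r * cis \<phi>) (of_real r' * cis \<phi>')"
proof -
 let ?w = "of_real r * cis \<phi>" and ?w' = "of_real r' * cis \<phi>'"
 have g: "cang c v p p' < pi" using cang_facts[OF cr(1)] by simp
 have P: "sec c v p p' ?w \<in> poly c" "sec c v p p' ?w' \<in> poly c"
  using cr(2) r ph unfolding good_def by (meson less_imp_le order_trans less_le_trans)+
 have "open_segment (sec c v p p' ?w) (sec c v p p' ?w') \<subseteq> interior (poly c)"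
 proof
  fix z assume "z \<in> open_segment (sec c v p p' ?w) (sec c v p p' ?w')"
  then obtain t where t: "0 < t" "t < 1" "z = (1 - t) *\<^sub>R sec c v p p' ?w + t *\<^sub>R sec c v p p' ?w'"
   unfolding in_segment by auto
  obtain q \<psi> where q: "0 < q" "q \<le> max r r'" "\<phi> < \<psi>" "\<psi> < \<phi>'" "(1 - t) *\<^sub>R ?w + t *\<^sub>R ?w' = of_real q * cis \<psi>"
   by (rule polar_segment[OF r(1,3) ph(2) _ t(1,2)]) (use ph g in simp, rule that)
  have "z = sec c v p p' (of_real q * cis \<psi>)" unfolding t(3) sec_affine[symmetric] q(5) ..
  moreover have "q < R" "0 < \<psi>" "\<psi> < cang c v p p'" using q r ph by auto
  ultimately show "z \<in> interior (poly c)" using cr(2) q(1) unfolding good_def by blast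
 qed
 then show ?thesis using cell_geodesic[OF crn_facts(1)[OF cr(1)] P] sec_dist[OF cr(1)] by (simp add: spt_def)
qed

section \<open>Walks in a link and chords across several sectors\<close>

definition lwalk :: "'v => (nat => 'v) => (nat => 'c) => nat => bool" where
 "lwalk v p c n \<longleftrightarrow> (\<forall>i<n. crn (c i) v (p i) (p (Suc i)))"

definition wang :: "'v => (nat => 'v) => (nat => 'c) => nat => real" where
 "wang v p c n = (\<Sum>i<n. cang (c i) v (p i) (p (Suc i)))"

text \<open>The sectors of the walk are developed side by side around 0 in the plane. The point has
  radius r and total angle \<open>wang v p c n + \<phi>\<close> in this picture.\<close>

definition wpt :: "'v => (nat => 'v) => (nat => 'c) => nat => real => real => ('v, 'c) point" where
 "wpt v p c n r \<phi> = spt (c n) v (p n) (p (Suc n)) (of_real r * cis \<phi>)"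

lemma wang_0 [simp]: "wang v p c 0 = 0" and wang_Suc: "wang v p c (Suc n) = wang v p c n + cang (c n) v (p n) (p (Suc n))"
 by (simp_all add: wang_def)

lemma wang_pos: "lwalk v p c N ==> n \<le> N ==> 0 < n ==> 0 < wang v p c n"
 unfolding wang_def lwalk_def using cang_facts(1) by (intro sum_pos) auto

lemma wang_nonneg: "lwalk v p c N ==> n \<le> N ==> 0 \<le> wang v p c n"
 using wang_pos[of v p c N n] by (cases "n = 0") auto

lemma dist_rotate: "dist (z * cis a) (w * cis a) = dist z w"
 by (simp add: dist_norm norm_mult flip: left_diff_distrib)

lemma wpt_step:
 assumes "crn (c n) v (p n) (p (Suc n))" "crn (c (Suc n)) v (p (Suc n)) (p (Suc (Suc n)))"
  "good R (c n) v (p n) (p (Suc n))" "0 \<le> r" "r < R"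
 shows "wpt v p c n r (cang (c n) v (p n) (p (Suc n))) = wpt v p c (Suc n) r 0"
proof -
 have "r \<le> elen X {v, p (Suc n)}" using assms(3-5) unfolding good_def by linarith
 then show ?thesis unfolding wpt_def using spt_leg'[OF assms(1,4)] spt_leg[OF assms(2,4)] by simp
qed

text \<open>Below angle \<pi> the chord in the developed sectors crosses all rays in between, which
  cut it into segments lying in single sectors. So it can be drawn in the complex with its Euclidean
  length.\<close>

lemma chord_upper:
 assumes w: "lwalk v p c N" and g: "\<forall>i<N. good R (c i) v (p i) (p (Suc i))"
  and s: "0 < s" "s < R" and n: "n < N"
  and ph: "0 \<le> \<phi>" "\<phi> \<le> cang (c n) v (p n) (p (Suc n))" "wang v p c n + \<phi> < pi" and r: "0 < r" "r < R"
 shows "d (epoint v (p 0) (s / elen X {v, p 0})) (wpt v p c n r \<phi>) \<le> dist (of_real s) (of_real r * cis (wang v p c n + \<phi>))"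
 using n ph r
proof (induction n arbitrary: \<phi> r)
 case 0
 have cr: "crn (c 0) v (p 0) (p (Suc 0))" using w 0 by (simp add: lwalk_def)
 have gd: "good R (c 0) v (p 0) (p (Suc 0))" using g 0 by simp
 have "s \<le> elen X {v, p 0}" using gd s unfolding good_def by linarith
 then have a: "epoint v (p 0) (s / elen X {v, p 0}) = spt (c 0) v (p 0) (p (Suc 0)) (of_real s * cis 0)"
  using spt_leg[OF cr] s by simp
 have "d (spt (c 0) v (p 0) (p (Suc 0)) (of_real s * cis 0)) (wpt v p c 0 r \<phi>) \<le> dist (of_real s * cis 0) (of_real r * cis \<phi>)"
  unfolding wpt_def by (rule spt_dist_le[OF cr gd]) (use 0 s cang_facts[OF cr] in auto)
 then show ?case unfolding a by simp
next
 case (Suc n)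
 let ?al = "cang (c n) v (p n) (p (Suc n))" and ?T = "wang v p c (Suc n)"
 have cr: "crn (c n) v (p n) (p (Suc n))" "crn (c (Suc n)) v (p (Suc n)) (p (Suc (Suc n)))"
  using w Suc.prems by (auto simp: lwalk_def)
 have gd: "good R (c n) v (p n) (p (Suc n))" "good R (c (Suc n)) v (p (Suc n)) (p (Suc (Suc n)))" using g Suc.prems by auto
 have T: "?T = wang v p c n + ?al" "0 < ?T"
 proof -
  show "?T = wang v p c n + ?al" by (rule wang_Suc)
  show "0 < ?T" by (rule wang_pos[OF w]) (use Suc.prems in auto)
 qed
 have al: "0 < ?al" using cang_facts[OF cr(1)] by simp
 let ?a = "epoint v (p 0) (s / elen X {v, p 0})"
 have IH: "d ?a (wpt v p c (Suc n) \<rho> 0) \<le> dist (of_real s) (of_real \<rho> * cis ?T)" if "0 < \<rho>" "\<rho> < R" for \<rho>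
  using Suc.IH[of ?al \<rho>] Suc.prems al that T wpt_step[OF cr gd(1), of \<rho>] by simp
 show ?case
 proof (cases "\<phi> = 0")
  case True then show ?thesis using IH Suc.prems by simp
 next
  case False
  then have ph: "0 < \<phi>" using Suc.prems by simp
  obtain \<rho> t where rho: "0 < \<rho>" "\<rho> \<le> max s r" "0 < t" "t < 1"
   "of_real \<rho> * cis ?T = (1 - t) *\<^sub>R of_real s + t *\<^sub>R (of_real r * cis (?T + \<phi>))"
   by (rule ray_crossing[OF s(1) Suc.prems(5) T(2), of "?T + \<phi>"]) (use ph Suc.prems in simp, use Suc.prems in simp, rule that)
  have rR: "\<rho> < R" using rho s Suc.prems by auto
  let ?y = "wpt v p c (Suc n) \<rho> 0" and ?x = "wpt v p c (Suc n) r \<phi>"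
  have yx: "d ?y ?x \<le> dist (of_real \<rho> * cis 0) (of_real r * cis \<phi>)"
   unfolding wpt_def by (rule spt_dist_le[OF cr(2) gd(2)]) (use rho rR Suc.prems ph in auto)
  also have "\<dots> = dist (of_real \<rho> * cis ?T) (of_real r * cis (?T + \<phi>))"
   using dist_rotate[of "of_real \<rho> * cis 0" ?T "of_real r * cis \<phi>"] by (simp add: cis_mult mult.assoc add.commute)
  finally have yx: "d ?y ?x \<le> dist (of_real \<rho> * cis ?T) (of_real r * cis (?T + \<phi>))" .
  have M: "?y \<in> M" "?x \<in> M"
   unfolding wpt_def by (rule spt_facts(1)[OF cr(2) gd(2)]; use rho rR Suc.prems ph in simp)+
  have aM: "?a \<in> M"
  proof -
   have c0: "crn (c 0) v (p 0) (p (Suc 0))" "good R (c 0) v (p 0) (p (Suc 0))" using w g Suc.prems by (auto simp: lwalk_def)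
   then have "s \<le> elen X {v, p 0}" using s unfolding good_def by linarith
   then show ?thesis using epoint_in[OF crn_facts(4)[OF c0(1)]] s elen_pos[OF crn_facts(4)[OF c0(1)]] by simp
  qed
  have "d ?a ?x \<le> d ?a ?y + d ?y ?x" using tri aM M by blast
  also have "\<dots> \<le> dist (of_real s) (of_real \<rho> * cis ?T) + dist (of_real \<rho> * cis ?T) (of_real r * cis (?T + \<phi>))"
   using IH[OF rho(1) rR] yx by simp
  also have "\<dots> = dist (of_real s) (of_real r * cis (?T + \<phi>))"
   using dist_segment_split(1)[of t "of_real \<rho> * cis ?T" "of_real s" "of_real r * cis (?T + \<phi>)"] rho by simp
  finally show ?thesis .
 qed
qed

text \<open>As consecutive cells are distinct, the chord crosses the edges of \<open>X\<close> straight; so it is a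
 local geodesic.\<close>

lemma chord_exact:
 assumes w: "lwalk v p c N" and ne: "\<And>i. Suc i < N ==> c i \<noteq> c (Suc i)"
  and g: "\<forall>i<N. good R (c i) v (p i) (p (Suc i))"
  and s: "0 < s" "s < R" and n: "n < N"
  and ph: "0 < \<phi>" "\<phi> \<le> cang (c n) v (p n) (p (Suc n))" "wang v p c n + \<phi> < pi" and r: "0 < r" "r < R"
 shows "d (epoint v (p 0) (s / elen X {v, p 0})) (wpt v p c n r \<phi>) = dist (of_real s) (of_real r * cis (wang v p c n + \<phi>))"
 using n ph r
proof (induction n arbitrary: \<phi> r)
 case 0
 have cr: "crn (c 0) v (p 0) (p (Suc 0))" using w 0 by (simp add: lwalk_def)
 have gd: "good R (c 0) v (p 0) (p (Suc 0))" using g 0 by simp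
 have "s \<le> elen X {v, p 0}" using gd s unfolding good_def by linarith
 then have a: "epoint v (p 0) (s / elen X {v, p 0}) = spt (c 0) v (p 0) (p (Suc 0)) (of_real s * cis 0)"
  using spt_leg[OF cr] s by simp
 have "d (spt (c 0) v (p 0) (p (Suc 0)) (of_real s * cis 0)) (wpt v p c 0 r \<phi>) = dist (of_real s * cis 0) (of_real r * cis \<phi>)"
  unfolding wpt_def by (rule spt_dist[OF cr gd]) (use 0 s in auto)
 then show ?case unfolding a by simp
next
 case (Suc n)
 let ?al = "cang (c n) v (p n) (p (Suc n))" and ?T = "wang v p c (Suc n)" and ?U = "wang v p c n"
 have cr: "crn (c n) v (p n) (p (Suc n))" "crn (c (Suc n)) v (p (Suc n)) (p (Suc (Suc n)))"
  using w Suc.prems by (auto simp: lwalk_def)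
 have gd: "good R (c n) v (p n) (p (Suc n))" "good R (c (Suc n)) v (p (Suc n)) (p (Suc (Suc n)))" using g Suc.prems by auto
 have T: "?T = ?U + ?al" "0 < ?T"
 proof -
  show "?T = ?U + ?al" by (rule wang_Suc)
  show "0 < ?T" by (rule wang_pos[OF w]) (use Suc.prems in auto)
 qed
 have T0: "0 \<le> ?U" using wang_nonneg[OF w, of n] Suc.prems by simp
 have al: "0 < ?al" "?al < pi" using cang_facts[OF cr(1)] by auto
 have ph: "0 < \<phi>" "\<phi> \<le> cang (c (Suc n)) v (p (Suc n)) (p (Suc (Suc n)))" "?T + \<phi> < pi" and r: "0 < r" "r < R"
  using Suc.prems by auto
 let ?a = "epoint v (p 0) (s / elen X {v, p 0})"
 have aM: "?a \<in> M"
 proof -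
  have c0: "crn (c 0) v (p 0) (p (Suc 0))" "good R (c 0) v (p 0) (p (Suc 0))" using w g Suc.prems by (auto simp: lwalk_def)
  then have "s \<le> elen X {v, p 0}" using s unfolding good_def by linarith
  then show ?thesis using epoint_in[OF crn_facts(4)[OF c0(1)]] s elen_pos[OF crn_facts(4)[OF c0(1)]] by simp
 qed
 have IH: "d ?a (wpt v p c n \<rho> \<psi>) = dist (of_real s) (of_real \<rho> * cis (?U + \<psi>))"
  if "0 < \<rho>" "\<rho> < R" "0 < \<psi>" "\<psi> \<le> ?al" for \<rho> \<psi>
  using Suc.IH[of \<psi> \<rho>] Suc.prems that T by simp
 define A :: complex where "A = of_real s"
 define C where "C = of_real r * cis (?T + \<phi>)"
 obtain \<rho> t where rho: "0 < \<rho>" "\<rho> \<le> max s r" "0 < t" "t < 1" "of_real \<rho> * cis ?T = (1 - t) *\<^sub>R A + t *\<^sub>R C"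
  by (rule ray_crossing[OF s(1) r(1) T(2), of "?T + \<phi>", folded A_def C_def]) (use ph in simp, use ph in simp, rule that)
 have rR: "\<rho> < R" using rho s r by auto
 define Y where "Y = of_real \<rho> * cis ?T"
 \<comment> \<open>The point where the chord enters the sector \<open>n\<close>.\<close>
 obtain \<sigma> u where sig: "0 < \<sigma>" "\<sigma> < R" "0 \<le> u" "u < 1" "of_real \<sigma> * cis ?U = (1 - u) *\<^sub>R A + u *\<^sub>R Y"
 proof (cases "?U = 0")
  case True
  show ?thesis by (rule that[of s 0]) (use s True in \<open>auto simp: A_def\<close>)
 next
  case False
  have "0 < ?U" "?U < ?T" "?T < pi" using False T0 T al ph by auto
  from ray_crossing[OF s(1) rho(1) this]
  obtain \<rho>' t' where "0 < \<rho>'" "\<rho>' \<le> max s \<rho>" "0 < t'" "t' < 1"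
   "of_real \<rho>' * cis ?U = (1 - t') *\<^sub>R of_real s + t' *\<^sub>R (of_real \<rho> * cis ?T)" by metis
  then show ?thesis using that[of \<rho>' t'] s rR by (simp add: A_def Y_def)
 qed
 define Z where "Z = of_real \<sigma> * cis ?U"
 let ?y = "wpt v p c (Suc n) \<rho> 0"
 have ystep: "?y = wpt v p c n \<rho> ?al" using wpt_step[OF cr gd(1)] rho rR by simp
 have leg: "\<rho> \<le> elen X {v, p (Suc n)}" using gd(2) rR unfolding good_def by linarith
 have lp: "0 < elen X {v, p (Suc n)}" using elen_pos[OF crn_facts(4)[OF cr(2)]] .
 define \<tau> where "\<tau> = \<rho> / elen X {v, p (Suc n)}"
 have tau: "0 < \<tau>" "\<tau> < 1"
 proof -
  show "0 < \<tau>" using rho lp by (simp add: \<tau>_def)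
  have "\<rho> < elen X {v, p (Suc n)}" using gd(2) rR unfolding good_def by linarith
  then show "\<tau> < 1" using lp by (simp add: \<tau>_def)
 qed
 have yE: "?y = epoint v (p (Suc n)) \<tau>" unfolding wpt_def \<tau>_def using spt_leg[OF cr(2)] rho leg by simp
 note E = crn_facts(3,4,2)[OF cr(2)] crn_facts(3)[OF cr(1)]
 have eE: "{v, p (Suc n)} \<in> edges X" using crn_facts(4)[OF cr(2)] .
 have cc: "c n \<noteq> c (Suc n)" using ne Suc.prems by simp
 obtain \<delta> where del: "0 < \<delta>"
  "\<And>b y r1 r2. b \<in> M ==> y \<in> M ==> incell (c n) b ==> incell (c (Suc n)) y ==>
   r1 = dist (cpos (c n) b) (cpos (c n) ?y) ==> r2 = dist (cpos (c (Suc n)) y) (cpos (c (Suc n)) ?y) ==>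
   r1 < \<delta> ==> r2 < \<delta> ==>
   r2 * ((cpos (c n) b - cpos (c n) ?y) \<bullet> (vpos (c n) (p (Suc n)) - vpos (c n) v)) =
   - (r1 * ((cpos (c (Suc n)) y - cpos (c (Suc n)) ?y) \<bullet> (vpos (c (Suc n)) (p (Suc n)) - vpos (c (Suc n)) v))) ==>
   d b y = r1 + r2"
  by (rule cross_edge[OF eE tau crn_facts(3)[OF cr(1)] crn_facts(2)[OF cr(2)] cc, folded yE]) (rule that)
 \<comment> \<open>Nearby points \<open>B\<close> and \<open>D\<close> of the chord on both sides of the edge.\<close>
 have ZY: "dist Z Y > 0"
 proof -
  have "Im (Z * cis (- ?U)) = 0" by (simp add: Z_def cis_mult mult.assoc)
  moreover have "Im (Y * cis (- ?U)) = \<rho> * sin ?al" using T by (simp add: Y_def cis_mult mult.assoc)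
  moreover have "0 < \<rho> * sin ?al" using rho al by (simp add: sin_gt_zero)
  ultimately show ?thesis by auto
 qed
 have YC: "dist Y C > 0"
 proof -
  have "Im (Y * cis (- ?T)) = 0" by (simp add: Y_def cis_mult mult.assoc)
  moreover have "Im (C * cis (- ?T)) = r * sin \<phi>" by (simp add: C_def cis_mult mult.assoc)
  moreover have "0 < r * sin \<phi>" using r ph T by (simp add: sin_gt_zero)
  ultimately show ?thesis by auto
 qed
 define e1 where "e1 = min (1 / 2) (\<delta> / (2 * dist Z Y))"
 have e1: "0 < e1" "e1 < 1" "e1 * dist Z Y < \<delta>"
 proof -
  show "0 < e1" "e1 < 1" using ZY del by (auto simp: e1_def)
  have "e1 \<le> \<delta> / (2 * dist Z Y)" by (simp add: e1_def)
  then have "2 * (e1 * dist Z Y) \<le> \<delta>" using ZY by (simp add: field_simps)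
  then show "e1 * dist Z Y < \<delta>" using del by linarith
 qed
 define e2 where "e2 = min (1 / 2) (\<delta> / (2 * dist Y C))"
 have e2: "0 < e2" "e2 < 1" "e2 * dist Y C < \<delta>"
 proof -
  show "0 < e2" "e2 < 1" using YC del by (auto simp: e2_def)
  have "e2 \<le> \<delta> / (2 * dist Y C)" by (simp add: e2_def)
  then have "2 * (e2 * dist Y C) \<le> \<delta>" using YC by (simp add: field_simps)
  then show "e2 * dist Y C < \<delta>" using del by linarith
 qed
 define B where "B = (1 - (1 - e1)) *\<^sub>R Z + (1 - e1) *\<^sub>R Y"
 define D where "D = (1 - e2) *\<^sub>R Y + e2 *\<^sub>R C"
 obtain rb \<psi>b where b: "0 < rb" "rb \<le> max \<sigma> \<rho>" "?U < \<psi>b" "\<psi>b < ?T" "B = of_real rb * cis \<psi>b"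
 proof -
  have 1: "?U < ?T" "?T < ?U + pi" "0 < 1 - e1" "1 - e1 < 1" using T al e1 by auto
  show thesis
   by (rule polar_segment[OF sig(1) rho(1) 1, folded Z_def Y_def, folded B_def]) (rule that)
 qed
 obtain rd \<psi>d where dd: "0 < rd" "rd \<le> max \<rho> r" "?T < \<psi>d" "\<psi>d < ?T + \<phi>" "D = of_real rd * cis \<psi>d"
 proof -
  have 1: "?T < ?T + \<phi>" "?T + \<phi> < ?T + pi" using ph T by auto
  show thesis
   by (rule polar_segment[OF rho(1) r(1) 1 e2(1,2), folded C_def Y_def, folded D_def]) (rule that)
 qed
 have bR: "rb < R" "rd < R" using b dd sig rR r by auto
 let ?b = "wpt v p c n rb (\<psi>b - ?U)" and ?d = "wpt v p c (Suc n) rd (\<psi>d - ?T)" and ?x = "wpt v p c (Suc n) r \<phi>"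
 let ?z = "wpt v p c n \<sigma> 0"
 have pb: "0 \<le> \<psi>b - ?U" "0 < \<psi>b - ?U" "\<psi>b - ?U \<le> ?al" "\<psi>b - ?U < ?al" using b T by auto
 have pd: "0 \<le> \<psi>d - ?T" "0 < \<psi>d - ?T" "\<psi>d - ?T < \<phi>" "\<psi>d - ?T \<le> cang (c (Suc n)) v (p (Suc n)) (p (Suc (Suc n)))" using dd ph by auto
 note fb = spt_facts[OF cr(1) gd(1) less_imp_le[OF b(1)] bR(1) pb(1,3), folded wpt_def]
 note fd = spt_facts[OF cr(2) gd(2) less_imp_le[OF dd(1)] bR(2) pd(1,4), folded wpt_def]
 note fx = spt_facts[OF cr(2) gd(2) less_imp_le[OF r(1)] r(2) less_imp_le[OF ph(1)] ph(2), folded wpt_def]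
 have z0: "(0::real) \<le> 0" "0 \<le> cang (c (Suc n)) v (p (Suc n)) (p (Suc (Suc n)))" using ph by auto
 note fy = spt_facts[OF cr(2) gd(2) less_imp_le[OF rho(1)] rR z0, folded wpt_def]
 note fy' = spt_facts[OF cr(1) gd(1) less_imp_le[OF rho(1)] rR less_imp_le[OF al(1)] order_refl, folded wpt_def, folded ystep]
 have rot: "dist (of_real a * cis (x - th)) (of_real a' * cis (x' - th)) = dist (of_real a * cis x) (of_real a' * cis x')" for a a' x x' th
  using dist_rotate[of "of_real a * cis (x - th)" th "of_real a' * cis (x' - th)"] by (simp add: cis_mult mult.assoc)
 have dab: "d ?a ?b = dist A B" using IH[OF b(1) bR(1) pb(2,3)] b(5) by (simp add: A_def)
 have day: "d ?a ?y = dist A Y" using IH[OF rho(1) rR al(1) order_refl] T by (simp add: A_def Y_def ystep)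
 have dby: "d ?b ?y = dist B Y"
 proof -
  have "d ?b ?y = dist (of_real rb * cis (\<psi>b - ?U)) (of_real \<rho> * cis ?al)"
   unfolding ystep unfolding wpt_def by (rule spt_dist[OF cr(1) gd(1) b(1) bR(1) rho(1) rR pb(1,4) order_refl])
  then show ?thesis using rot[of rb \<psi>b ?U \<rho> ?T] T b(5) by (simp add: Y_def)
 qed
 have dyx: "d ?y ?x = dist Y C"
 proof -
  have "d ?y ?x = dist (of_real \<rho> * cis 0) (of_real r * cis \<phi>)"
   unfolding wpt_def by (rule spt_dist[OF cr(2) gd(2) rho(1) rR r order_refl ph(1,2)])
  then show ?thesis using rot[of \<rho> ?T ?T r "?T + \<phi>"] by (simp add: Y_def C_def)
 qed
 have dyd: "d ?y ?d = dist Y D"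
 proof -
  have "d ?y ?d = dist (of_real \<rho> * cis 0) (of_real rd * cis (\<psi>d - ?T))"
   unfolding wpt_def by (rule spt_dist[OF cr(2) gd(2) rho(1) rR dd(1) bR(2) order_refl pd(2,4)])
  then show ?thesis using rot[of \<rho> ?T ?T rd \<psi>d] dd(5) by (simp add: Y_def)
 qed
 have ddx: "d ?d ?x = dist D C"
 proof -
  have "d ?d ?x = dist (of_real rd * cis (\<psi>d - ?T)) (of_real r * cis \<phi>)"
   unfolding wpt_def by (rule spt_dist[OF cr(2) gd(2) dd(1) bR(2) r pd(1,3) ph(2)])
  then show ?thesis using rot[of rd \<psi>d ?T r "?T + \<phi>"] dd(5) by (simp add: C_def)
 qed
 have c1: "dist (cpos (c n) ?b) (cpos (c n) ?y) = dist B Y"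
 proof -
  have "dist (cpos (c n) ?b) (cpos (c n) ?y) = dist (of_real rb * cis (\<psi>b - ?U)) (of_real \<rho> * cis ?al)"
   unfolding fb(3) fy'(3) sec_dist[OF cr(1)] ..
  then show ?thesis using rot[of rb \<psi>b ?U \<rho> ?T] T b(5) by (simp add: Y_def)
 qed
 have c2: "dist (cpos (c (Suc n)) ?d) (cpos (c (Suc n)) ?y) = dist D Y"
 proof -
  have "dist (cpos (c (Suc n)) ?d) (cpos (c (Suc n)) ?y) = dist (of_real rd * cis (\<psi>d - ?T)) (of_real \<rho> * cis 0)"
   unfolding fd(3) fy(3) sec_dist[OF cr(2)] ..
  then show ?thesis using rot[of rd \<psi>d ?T \<rho> ?T] dd(5) by (simp add: Y_def)
 qed
 let ?l = "elen X {v, p (Suc n)}"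
 have inner_rot: "(z * cis a) \<bullet> (w * cis a) = z \<bullet> w" for z w a
 proof -
  have "(z * cis a) \<bullet> (w * cis a) = (cos a * cos a + sin a * sin a) * (z \<bullet> w)"
   by (simp add: inner_complex_def algebra_simps del: sin_cos_squared_add sin_cos_squared_add2 sin_cos_squared_add3)
  then show ?thesis unfolding sin_cos_squared_add3 by simp
 qed
 have i1: "(cpos (c n) ?b - cpos (c n) ?y) \<bullet> (vpos (c n) (p (Suc n)) - vpos (c n) v) = (B - Y) \<bullet> (of_real ?l * cis ?T)"
 proof -
  have p1: "vpos (c n) (p (Suc n)) = sec (c n) v (p n) (p (Suc n)) (of_real ?l * cis ?al)"
   using sec_leg(2)[OF cr(1), of ?l] lp epoint_1 edge_neq[OF eE] by (simp add: vpos_def)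
  have p0: "vpos (c n) v = sec (c n) v (p n) (p (Suc n)) 0" by simp
  have "(cpos (c n) ?b - cpos (c n) ?y) \<bullet> (vpos (c n) (p (Suc n)) - vpos (c n) v)
    = (of_real rb * cis (\<psi>b - ?U) - of_real \<rho> * cis ?al) \<bullet> (of_real ?l * cis ?al - 0)"
   unfolding fb(3) fy'(3) p1 p0 by (rule sec_inner[OF cr(1)])
  also have "\<dots> = ((of_real rb * cis (\<psi>b - ?U) - of_real \<rho> * cis ?al) * cis ?U) \<bullet> ((of_real ?l * cis ?al) * cis ?U)"
   unfolding inner_rot by simp
  also have "\<dots> = (B - Y) \<bullet> (of_real ?l * cis ?T)"
   unfolding b(5) Y_def T(1) by (simp add: left_diff_distrib mult.assoc cis_mult add.commute)
  finally show ?thesis .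
 qed
 have i2: "(cpos (c (Suc n)) ?d - cpos (c (Suc n)) ?y) \<bullet> (vpos (c (Suc n)) (p (Suc n)) - vpos (c (Suc n)) v) = (D - Y) \<bullet> (of_real ?l * cis ?T)"
 proof -
  have p1: "vpos (c (Suc n)) (p (Suc n)) = sec (c (Suc n)) v (p (Suc n)) (p (Suc (Suc n))) (of_real ?l)"
   using sec_leg(1)[OF cr(2), of ?l] lp epoint_1 edge_neq[OF eE] by (simp add: vpos_def)
  have p0: "vpos (c (Suc n)) v = sec (c (Suc n)) v (p (Suc n)) (p (Suc (Suc n))) 0" by simp
  have "(cpos (c (Suc n)) ?d - cpos (c (Suc n)) ?y) \<bullet> (vpos (c (Suc n)) (p (Suc n)) - vpos (c (Suc n)) v)
    = (of_real rd * cis (\<psi>d - ?T) - of_real \<rho> * cis 0) \<bullet> (of_real ?l - 0)"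
   unfolding fd(3) fy(3) p1 p0 by (rule sec_inner[OF cr(2)])
  also have "\<dots> = ((of_real rd * cis (\<psi>d - ?T) - of_real \<rho> * cis 0) * cis ?T) \<bullet> (of_real ?l * cis ?T)"
   unfolding inner_rot by simp
  also have "\<dots> = (D - Y) \<bullet> (of_real ?l * cis ?T)"
   unfolding dd(5) Y_def by (simp add: left_diff_distrib mult.assoc cis_mult)
  finally show ?thesis .
 qed
 have BY: "B - Y = e1 *\<^sub>R (Z - Y)" and DY: "D - Y = e2 *\<^sub>R (C - Y)"
  unfolding B_def D_def by (simp_all add: algebra_simps)
 have nBY: "dist B Y = e1 * dist Z Y" "dist D Y = e2 * dist Y C"
  unfolding dist_norm BY DY using e1 e2 by (simp_all add: norm_minus_commute)
 have YA: "Y - A = t *\<^sub>R (C - A)" "C - Y = (1 - t) *\<^sub>R (C - A)" "Z - Y = - ((1 - u) *\<^sub>R (Y - A))"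
  using rho(5) sig(5) unfolding Y_def Z_def by (simp_all add: algebra_simps)
 have "Z - Y = - ((1 - u) * t) *\<^sub>R (C - A)" unfolding YA(3) YA(1) by simp
 then have ZYv: "Z - Y = - ((1 - u) * t / (1 - t)) *\<^sub>R (C - Y)" unfolding YA(2) using rho(4) by simp
 \<comment> \<open>Z, Y and C lie on one chord, so their directions from Y are opposite; this is the
   angle condition of \<open>cross_edge\<close>.\<close>
 define m where "m = (1 - u) * t / (1 - t)"
 have m: "0 < m" using sig rho by (simp add: m_def)
 have ZYm: "Z - Y = - m *\<^sub>R (C - Y)" using ZYv by (simp add: m_def)
 have dZY: "dist Z Y = m * dist Y C" unfolding dist_norm ZYm using m by (simp add: norm_minus_commute)
 have dbd: "d ?b ?d = dist B Y + dist D Y"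
 proof (rule del(2)[OF fb(1) fd(1) fb(2) fd(2) c1[symmetric] c2[symmetric]])
  show "dist B Y < \<delta>" "dist D Y < \<delta>" using nBY e1 e2 by simp_all
  show "dist D Y * ((cpos (c n) ?b - cpos (c n) ?y) \<bullet> (vpos (c n) (p (Suc n)) - vpos (c n) v)) =
   - (dist B Y * ((cpos (c (Suc n)) ?d - cpos (c (Suc n)) ?y) \<bullet> (vpos (c (Suc n)) (p (Suc n)) - vpos (c (Suc n)) v)))"
   unfolding i1 i2 nBY BY DY ZYm dZY by (simp add: algebra_simps)
 qed
 \<comment> \<open>The geodesic from a is extended twice: across the edge, by its overlap from b to
   y, and then within the sector to x, by its overlap from y to the point of D.\<close>
 have "d ?a ?b + d ?b ?y = d ?a ?y"
 proof -
  have "dist A B + dist B Y = dist A Y"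
  proof -
   have "B = (1 - (1 - e1 * (1 - u))) *\<^sub>R A + (1 - e1 * (1 - u)) *\<^sub>R Y"
    unfolding B_def Z_def sig(5) by (simp add: algebra_simps)
   moreover have "0 \<le> 1 - e1 * (1 - u)" "1 - e1 * (1 - u) \<le> 1"
    using e1 sig mult_le_one[of e1 "1 - u"] by auto
   ultimately show ?thesis using dist_segment_split(1) by blast
  qed
  then show ?thesis using dab dby day by simp
 qed
 moreover have "?b \<noteq> ?y" using dby nBY e1 ZY fy(1) by auto
 moreover have "d ?b ?y + d ?y ?d = d ?b ?d" using dby dyd dbd by (simp add: dist_commute)
 ultimately have ayd: "d ?a ?y + d ?y ?d = d ?a ?d" using convex_extension[OF aM fb(1) fy(1) fd(1)] by blast
 have "dist Y D + dist D C = dist Y C" using dist_segment_split(1)[of e2 D Y C] e2 by (simp add: D_def)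
 then have "d ?y ?d + d ?d ?x = d ?y ?x" using dyd ddx dyx by simp
 moreover have "?y \<noteq> ?d" using dyd nBY e2 YC fy(1) by (auto simp: dist_commute)
 ultimately have "d ?a ?d + d ?d ?x = d ?a ?x" using convex_extension[OF aM fy(1) fd(1) fx(1) ayd] by blast
 then have "d ?a ?x = dist A Y + dist Y C" using ayd \<open>d ?y ?d + d ?d ?x = d ?y ?x\<close> day dyx by linarith
 also have "\<dots> = dist A C" using dist_segment_split(1)[of t Y A C] rho by (simp add: Y_def)
 finally show ?case by (simp add: A_def C_def)
qed

lemma wpt_in:
 assumes "lwalk v p c N" "\<forall>i<N. good R (c i) v (p i) (p (Suc i))" "n < N"
  "0 \<le> \<phi>" "\<phi> \<le> cang (c n) v (p n) (p (Suc n))" "0 \<le> r" "r < R"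
 shows "wpt v p c n r \<phi> \<in> M" "incell (c n) (wpt v p c n r \<phi>)"
  "dist (cpos (c n) (wpt v p c n r \<phi>)) (vpos (c n) v) = r"
proof -
 have cr: "crn (c n) v (p n) (p (Suc n))" and g: "good R (c n) v (p n) (p (Suc n))"
  using assms by (auto simp: lwalk_def)
 note f = spt_facts[OF cr g assms(6,7,4,5), folded wpt_def]
 show "wpt v p c n r \<phi> \<in> M" "incell (c n) (wpt v p c n r \<phi>)" using f by auto
 show "dist (cpos (c n) (wpt v p c n r \<phi>)) (vpos (c n) v) = r"
  unfolding f(3) using sec_dist[OF cr, of "of_real r * cis \<phi>" 0] assms(6) by (simp add: norm_mult)
qed

text \<open>The limit of \<open>chord_exact\<close> for angles tending to \<pi> from below: the
  chord becomes two opposite radii.\<close>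

lemma chord_pi:
 assumes w: "lwalk v p c N" and ne: "\<And>i. Suc i < N ==> c i \<noteq> c (Suc i)"
  and g: "\<forall>i<N. good R (c i) v (p i) (p (Suc i))"
  and s: "0 < s" "s < R" and n: "n < N"
  and ph: "0 < \<phi>" "\<phi> \<le> cang (c n) v (p n) (p (Suc n))" "wang v p c n + \<phi> = pi" and r: "0 < r" "r < R"
 shows "s + r \<le> d (epoint v (p 0) (s / elen X {v, p 0})) (wpt v p c n r \<phi>)"
proof -
 let ?a = "epoint v (p 0) (s / elen X {v, p 0})" and ?x = "wpt v p c n r \<phi>"
 have cr: "crn (c n) v (p n) (p (Suc n))" and gd: "good R (c n) v (p n) (p (Suc n))" using w g n by (auto simp: lwalk_def)
 have c0: "crn (c 0) v (p 0) (p (Suc 0))" "good R (c 0) v (p 0) (p (Suc 0))" using w g n by (auto simp: lwalk_def)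
 have aM: "?a \<in> M"
 proof -
  have "s \<le> elen X {v, p 0}" using c0 s unfolding good_def by linarith
  then show ?thesis using epoint_in[OF crn_facts(4)[OF c0(1)]] s elen_pos[OF crn_facts(4)[OF c0(1)]] by simp
 qed
 have le: "dist (of_real s) (of_real r * cis (wang v p c n + \<psi>)) - dist (of_real r * cis \<psi>) (of_real r * cis \<phi>) \<le> d ?a ?x"
  if "0 < \<psi>" "\<psi> < \<phi>" for \<psi>
 proof -
  let ?y = "wpt v p c n r \<psi>"
  have e: "d ?a ?y = dist (of_real s) (of_real r * cis (wang v p c n + \<psi>))"
   by (rule chord_exact[OF w ne g s n]) (use that ph r in auto)
  have "d ?y ?x \<le> dist (of_real r * cis \<psi>) (of_real r * cis \<phi>)"
   unfolding wpt_def by (rule spt_dist_le[OF cr gd]) (use that ph r in auto)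
  moreover have "?y \<in> M" "?x \<in> M" using wpt_in(1)[OF w g n] that ph r by auto
  ultimately show ?thesis using tri[OF aM, of ?x ?y] sym[of ?x ?y] e by simp
 qed
 have "((\<lambda>\<psi>. dist (of_real s) (of_real r * cis (wang v p c n + \<psi>)) - dist (of_real r * cis \<psi>) (of_real r * cis \<phi>)) \<longlongrightarrow>
   dist (of_real s) (of_real r * cis (wang v p c n + \<phi>)) - dist (of_real r * cis \<phi>) (of_real r * cis \<phi>)) (at_left \<phi>)"
  by (intro tendsto_intros tendsto_cis)
 moreover have "eventually (\<lambda>\<psi>. dist (of_real s) (of_real r * cis (wang v p c n + \<psi>)) - dist (of_real r * cis \<psi>) (of_real r * cis \<phi>) \<le> d ?a ?x) (at_left \<phi>)"
  using le ph(1) by (auto simp: eventually_at_left_field intro!: exI[of _ 0])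
 ultimately have "dist (of_real s) (of_real r * cis (wang v p c n + \<phi>)) - dist (of_real r * cis \<phi>) (of_real r * cis \<phi>) \<le> d ?a ?x"
  by (intro tendsto_upperbound) auto
 moreover have "dist (of_real s) (of_real r * cis pi :: complex) = s + r"
  using s r by (simp add: dist_norm flip: of_real_add)
 ultimately show ?thesis using ph(3) by simp
qed

lemma uniform_good:
 assumes "lwalk v p c N" obtains R where "0 < R" "\<forall>i<N. good R (c i) v (p i) (p (Suc i))"
proof -
 have "\<exists>R>0. \<forall>i\<in>{..<N}. good R (c i) v (p i) (p (Suc i))"
  by (rule finite_uniform_radius) (use assms good_exists good_mono in \<open>auto simp: lwalk_def\<close>)
 then show ?thesis using that by auto
qed

lemma corner_angle_cang:
 assumes "(c, k) \<in> corners X v" "corner_ends X (c, k) = {p, p'}"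
 shows "corner_angle X (c, k) = cang c v p p'"
proof -
 note s = corner_sides[OF assms(1)]
 have "corner_angle X (c, k) = cang c v (nxt (bds c) k) (prv (bds c) k)"
  unfolding corner_angle_def cang_def s(4-6) by simp
 moreover have "{p, p'} = {nxt (bds c) k, prv (bds c) k}" using assms(2) by (simp add: corner_ends_alt)
 ultimately show ?thesis by (auto simp: doubleton_eq_iff cang_swap)
qed

text \<open>The vertices are continued by \<open>p n = p 0\<close>, so that a loop becomes a closed
  walk without indices modulo n.\<close>

lemma loop_sequences:
 assumes "link_loop X v Q"
 obtains n p q where "2 \<le> n" "Q = q ` {..<n}" "inj_on q {..<n}" "inj_on p {..<n}" "p n = p (0::nat)"
  "\<And>i. i < n ==> q i \<in> corners X v \<and> corner_ends X (q i) = {p i, p (Suc i)}"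
proof -
 obtain us qs where l: "length us = length qs" "2 \<le> length qs" "distinct us" "distinct qs" "set qs = Q" "Q \<subseteq> corners X v"
   "\<And>i. i < length qs ==> corner_ends X (qs ! i) = {us ! i, nxt us i}"
  using assms unfolding link_loop_def by blast
 let ?n = "length qs"
 show ?thesis
 proof (rule that[of ?n "\<lambda>i. qs ! i" "\<lambda>i. us ! (i mod ?n)"])
  show "Q = (!) qs ` {..<?n}" using l(5) by (metis set_conv_nth image_Collect lessThan_def)
  show "inj_on ((!) qs) {..<?n}" using l(4) by (auto simp: inj_on_def nth_eq_iff_index_eq)
  show "inj_on (\<lambda>i. us ! (i mod ?n)) {..<?n}" using l(1,3) by (auto simp: inj_on_def nth_eq_iff_index_eq)
  show "us ! (?n mod ?n) = us ! (0 mod ?n)" by simp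
  fix i assume i: "i < ?n"
  have "qs ! i \<in> set qs" using i by simp
  then show "qs ! i \<in> corners X v \<and> corner_ends X (qs ! i) = {us ! (i mod ?n), us ! (Suc i mod ?n)}"
   using l(7)[OF i] l(1,5,6) i by (auto simp: nxt_def)
 qed (use l in auto)
qed

end

section \<open>Cocycles on a CAT(0) complex are coboundaries\<close>

text \<open>In a group of exponent 2 the sum around a cell is taken over its sides without choosing
  orientations. Edges on no cell may be arbitrarily short and admit no uniform radius; among them
  only the finitely many of \<open>E0\<close> may carry a nonzero value.\<close>

locale cocycle = npc_complex X for X :: "('v, 'c) pe_complex" +
 fixes \<omega> :: "'v set => 'b :: ab_group_add" and E0 :: "'v set set"
 assumes two: "\<And>x :: 'b. x + x = 0"
  and E0: "finite E0" "E0 \<subseteq> edges X"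
  and coc: "\<And>c. c \<in> cells X ==> (\<Sum>k<length (bd X c). \<omega> {bd X c ! k, nxt (bd X c) k}) = 0"
  and free0: "\<And>u v. {u, v} \<in> edges X ==> pages u v = {} ==> {u, v} \<notin> E0 ==> \<omega> {u, v} = 0"
begin

lemma two': "x + (x + y) = (y :: 'b)"
 by (metis add.assoc add_0 two)

lemmas mod2 = two two' add.assoc add.commute add.left_commute

lemma telescope2: "(\<Sum>i<n. f i + f (Suc i)) = (f 0 + f n :: 'b)"
proof (induction n)
 case 0 show ?case by (simp add: two)
next
 case (Suc n) then show ?case by (simp add: mod2)
qed

section \<open>Potentials on cells and sums of the cocycle along chains\<close>

definition cpot :: "'c => 'v => 'b" where
 "cpot c = (SOME f. \<forall>k<len c. f (bds c ! k) + f (nxt (bds c) k) = \<omega> {bds c ! k, nxt (bds c) k})"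

lemma cpot_nth: assumes c: "c \<in> cells X" and k: "k < len c"
 shows "cpot c (bds c ! k) + cpot c (nxt (bds c) k) = \<omega> {bds c ! k, nxt (bds c) k}"
proof -
 let ?s = "\<lambda>k. \<omega> {bds c ! k, nxt (bds c) k}"
 define g where "g k = (\<Sum>i<k. ?s i)" for k
 define f where "f v = g (THE k. k < len c \<and> bds c ! k = v)" for v
 have f: "f (bds c ! k) = g k" if "k < len c" for k
 proof -
  have "(THE j. j < len c \<and> bds c ! j = bds c ! k) = k"
   using that cell_distinct[OF c] by (intro the_equality) (auto simp: nth_eq_iff_index_eq)
  then show ?thesis by (simp add: f_def)
 qed
 have "\<forall>k<len c. f (bds c ! k) + f (nxt (bds c) k) = ?s k"
 proof (intro allI impI)
  fix k assume k: "k < len c"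
  have "f (nxt (bds c) k) = g (Suc k mod len c)" using f[OF Suc_mod[OF c k]] by (simp add: nxt_def)
  \<comment> \<open>At the last vertex the partial sums close up by the cocycle condition.\<close>
  also have "\<dots> = g (Suc k)"
  proof (cases "Suc k = len c")
   case True then show ?thesis using coc[OF c] by (simp add: g_def)
  next
   case False then show ?thesis using k by simp
  qed
  also have "\<dots> = g k + ?s k" by (simp add: g_def)
  finally show "f (bds c ! k) + f (nxt (bds c) k) = ?s k" using f[OF k] by (simp add: two')
 qed
 then have "\<exists>f. \<forall>k<len c. f (bds c ! k) + f (nxt (bds c) k) = ?s k" by blast
 from someI_ex[OF this, folded cpot_def] show ?thesis using k by blast
qed

lemma cpot_side: assumes "c \<in> cells X" "is_side c k u v" shows "cpot c u + cpot c v = \<omega> {u, v}"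
proof -
 have k: "k < len c" using assms by (simp add: is_side_def)
 from assms show ?thesis
  by (rule is_side_cases) (use cpot_nth[OF assms(1) k] in \<open>simp_all add: add.commute insert_commute\<close>)
qed

text \<open>A vertex to which a point is attached, so that potentials given at vertices can be read
  off at all points. Inside an edge it is one of the two ends, chosen arbitrarily;
  \<open>ediff\<close> accounts for the choice.\<close>

definition base :: "('v, 'c) point => 'v" where
 "base x = (case x of Skel b => SOME v. b v \<noteq> 0 | Inner c z => bds c ! 0)"

lemma base_Inner [simp]: "base (Inner c z) = bds c ! 0" by (simp add: base_def)

lemma base_vpoint [simp]: "base (vpoint v) = v"
 by (auto simp: base_def vpoint_def)

lemma base_epoint: assumes "u \<noteq> v" "0 \<le> t" "t \<le> 1" shows "base (epoint u v t) = u \<or> base (epoint u v t) = v"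
proof -
 let ?b = "\<lambda>w. if w = u then 1 - t else if w = v then t else 0"
 have "?b (SOME w. ?b w \<noteq> 0) \<noteq> 0"
  by (rule someI_ex[of "\<lambda>w. ?b w \<noteq> 0"]) (use assms in \<open>cases "t = 0"; auto\<close>)
 moreover have "base (epoint u v t) = (SOME w. ?b w \<noteq> 0)" by (simp only: base_def epoint_def point.case)
 ultimately have "?b (base (epoint u v t)) \<noteq> 0" by (simp only: not_False_eq_True)
 then show ?thesis by (simp split: if_splits)
qed

definition ediff :: "'v => 'v => 'b" where
 "ediff p q = (if p = q then 0 else \<omega> {p, q})"

lemma ediff_comm: "ediff p q = ediff q p" and ediff_self [simp]: "ediff p p = 0"
 by (auto simp: ediff_def insert_commute)

lemma ediff_trans: "p \<in> {u, v} ==> q \<in> {u, v} ==> r \<in> {u, v} ==> ediff p q + ediff q r = ediff p r"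
 by (auto simp: ediff_def insert_commute two)

lemma cpot_ediff: "c \<in> pages u v ==> p \<in> {u, v} ==> q \<in> {u, v} ==> cpot c p + cpot c q = ediff p q"
 using cpot_side page_side by (auto simp: ediff_def two add.commute insert_commute) (metis add.commute)+

text \<open>A chain with its length and the sum of \<omega> along it, the sum being taken between
  base vertices. Edge steps occur only on edges that lie on no cell; along other edges a step is
  made in a page.\<close>

inductive wchain :: "('v, 'c) point => ('v, 'c) point => real => 'b => bool" where
 refl: "x \<in> M ==> wchain x x 0 0"
| face: "[| wchain x y l b; z \<in> M; c \<in> cells X; incell c y; incell c z |]
  ==> wchain x z (l + dist (cpos c y) (cpos c z)) (b + (cpot c (base y) + cpot c (base z)))"
| edge: "[| wchain x (epoint p q s) l b; {p, q} \<in> edges X; pages p q = {}; 0 \<le> s; s \<le> 1; 0 \<le> t; t \<le> 1 |]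
  ==> wchain x (epoint p q t) (l + elen X {p, q} * \<bar>s - t\<bar>) (b + ediff (base (epoint p q s)) (base (epoint p q t)))"

lemma wchain_points: "wchain x y l b ==> x \<in> M \<and> y \<in> M \<and> 0 \<le> l"
 by (induction rule: wchain.induct) (auto intro!: epoint_in add_nonneg_nonneg mult_nonneg_nonneg less_imp_le[OF elen_pos])

lemma wchain_trans: "wchain y z l' b' ==> wchain x y l b ==> wchain x z (l + l') (b + b')"
proof (induction rule: wchain.induct)
 case (refl x) then show ?case by simp
next
 case (face x y l b z c)
 from wchain.face[OF face.IH[OF face.prems] face.hyps(2-5)] show ?case by (simp only: add.assoc)
next
 case (edge x p q s l b t)
 from wchain.edge[OF edge.IH[OF edge.prems] edge.hyps(2-7)] show ?case by (simp only: add.assoc)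
qed

lemma page_dist_edge: assumes "c \<in> pages p q" "0 \<le> s" "s \<le> 1" "0 \<le> t" "t \<le> 1"
 shows "dist (cpos c (epoint p q s)) (cpos c (epoint p q t)) = elen X {p, q} * \<bar>s - t\<bar>"
proof -
 obtain k where k: "c \<in> cells X" "is_side c k p q" using assms(1) by (rule page_side)
 have "cpos c (epoint p q s) - cpos c (epoint p q t) = (t - s) *\<^sub>R (vpos c p - vpos c q)"
  using is_side_neq[OF k] by (simp add: cpos_epoint algebra_simps)
 then show ?thesis using is_side_dist[OF k] by (simp add: dist_norm abs_minus_commute)
qed

lemma wchain_edge_step:
 assumes w: "wchain x (epoint p q s) l b" and e: "{p, q} \<in> edges X" and st: "0 \<le> s" "s \<le> 1" "0 \<le> t" "t \<le> 1"
 shows "wchain x (epoint p q t) (l + elen X {p, q} * \<bar>s - t\<bar>) (b + ediff (base (epoint p q s)) (base (epoint p q t)))"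
proof (cases "pages p q = {}")
 case True then show ?thesis using wchain.edge assms by blast
next
 case False
 then obtain c where c: "c \<in> pages p q" by blast
 have pq: "p \<noteq> q" using edge_neq[OF e] .
 have "incell c (epoint p q s)" "incell c (epoint p q t)" "c \<in> cells X" using c incell_epoint by (auto simp: pages_def)
 from wchain.face[OF w epoint_in[OF e st(3,4)] this(3,1,2)] show ?thesis
  using page_dist_edge[OF c st] cpot_ediff[OF c] base_epoint[OF pq st(1,2)] base_epoint[OF pq st(3,4)] by auto
qed

lemma chain_wchain: "chain X x y l ==> \<exists>b. wchain x y l b"
proof (induction rule: chain.induct)
 case (refl x) then show ?case using wchain.refl by blast
next
 case (step x y l z m)
 then obtain b where b: "wchain x y l b" by blast
 have yM: "y \<in> M" using wchain_points[OF b] by simp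
 from step.hyps(3) show ?case
 proof cases
  case (edge u v a a')
  have uv: "u \<noteq> v" using edge_neq edge by blast
  note A = Skel_on_edge[of a u v] Skel_on_edge[of a' u v]
  have a: "y = epoint u v (a v)" "0 \<le> a v" "a v \<le> 1" "z = epoint u v (a' v)" "0 \<le> a' v" "a' v \<le> 1"
    "a u = 1 - a v" "a' u = 1 - a' v" using A edge yM step.hyps(2) uv by auto
  have "\<bar>a u - a' u\<bar> = \<bar>a v - a' v\<bar>" using a by auto
  then show ?thesis using wchain_edge_step[of x u v "a v" l b "a' v"] b edge a by metis
 next
  case (face c z1 z2)
  then show ?thesis using wchain.face[OF b step.hyps(2), of c] by (auto simp: in_cell_iff)
 qed
qed

lemma ex_wchain: assumes "x \<in> M" "y \<in> M" "0 < e" obtains l b where "wchain x y l b" "l < d x y + e"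
 using ex_chain[OF assms] chain_wchain by metis

subsection \<open>Local potentials\<close>

text \<open>Along short chains from x the sum depends only on the end point: \<omega> is a
  coboundary locally.\<close>

definition local_pot :: "('v, 'c) point => bool" where
 "local_pot x \<longleftrightarrow> (\<exists>\<rho>>0. \<exists>\<phi>. \<forall>y l b. wchain x y l b --> l < \<rho> --> b = \<phi> y)"

text \<open>The scheme for all three kinds of points: \<open>I\<close> is an invariant of short
  chains from x that determines the sum from the end point alone.\<close>

lemma local_potI:
 assumes "0 < \<rho>" and inv: "\<And>y l b. wchain x y l b ==> l < \<rho> ==> I y l b"
  and det: "\<And>y l b l' b'. I y l b ==> I y l' b' ==> l < \<rho> ==> l' < \<rho> ==> b = b'"
 shows "local_pot x"
proof -
 define \<phi> where "\<phi> y = (SOME b. \<exists>l<\<rho>. I y l b)" for y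
 have "b = \<phi> y" if "wchain x y l b" "l < \<rho>" for y l b
 proof -
  have "\<exists>l<\<rho>. I y l (\<phi> y)" unfolding \<phi>_def by (rule someI_ex) (use inv[OF that] that in blast)
  then show ?thesis using det inv[OF that] that by blast
 qed
 then show ?thesis unfolding local_pot_def using assms(1) by (intro exI[of _ \<rho>] conjI exI[of _ \<phi>]) auto
qed

lemma local_pot_inner: assumes c: "c \<in> cells X" and z: "z \<in> interior (poly c)" shows "local_pot (Inner c z)"
proof -
 obtain \<rho> where r: "\<rho> > 0" "ball z \<rho> \<subseteq> interior (poly c)"
  using z open_contains_ball[of "interior (poly c)"] by auto
 show ?thesis
 proof (rule local_potI[OF r(1), of _ "\<lambda>y l b. (\<exists>w. y = Inner c w \<and> dist w z \<le> l) \<and> b = 0"])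
  fix y l b assume "wchain (Inner c z) y l b" "l < \<rho>"
  then show "(\<exists>w. y = Inner c w \<and> dist w z \<le> l) \<and> b = 0"
  proof (induction "Inner c z :: ('v, 'c) point" y l b rule: wchain.induct)
   case refl then show ?case by simp
  next
   case (face y l b z' c')
   have "l < \<rho>" using face.prems zero_le_dist[of "cpos c' y" "cpos c' z'"] by linarith
   then obtain w where w: "y = Inner c w" "dist w z \<le> l" "b = 0" using face by auto
   then have c': "c' = c" using face by simp
   have "dist (cpos c z') z \<le> l + dist (cpos c' y) (cpos c' z')"
    using w c' dist_triangle[of "cpos c z'" z w] by (simp add: dist_commute)
   moreover from this have "cpos c z' \<in> ball z \<rho>" using face.prems by (simp add: dist_commute)
   then have "z' = Inner c (cpos c z')" using incell_interior[OF c face.hyps(3)] face.hyps c' r(2) by blast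
   ultimately show ?case using w c' two by (metis add_0 base_Inner)
  next
   case (edge p q s l b t)
   have "0 \<le> elen X {p, q} * \<bar>s - t\<bar>" using elen_pos[OF edge.hyps(3)] by simp
   then have "l < \<rho>" using edge.prems by linarith
   then obtain w where "epoint p q s = Inner c w" using edge by blast
   then show ?case by (simp add: epoint_def)
  qed
 qed auto
qed

lemma local_pot_edge: assumes e: "{u, v} \<in> edges X" and t: "0 < t" "t < 1" shows "local_pot (epoint u v t)"
proof -
 let ?x = "epoint u v t" and ?l = "elen X {u, v}"
 have uv: "u \<noteq> v" using edge_neq[OF e] .
 have lp: "0 < ?l" using elen_pos[OF e] .
 obtain \<rho>0 where r0: "0 < \<rho>0"
  "\<And>c y. c \<in> pages u v ==> y \<in> M ==> incell c y ==> dist (cpos c y) (cpos c ?x) < \<rho>0 ==> y \<in> book u v"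
  by (rule book_facts[OF e t]) (rule that, assumption, blast)
 define \<rho> where "\<rho> = min \<rho>0 (min (?l * t) (?l * (1 - t)))"
 have r: "0 < \<rho>" "\<rho> \<le> \<rho>0" "\<rho> \<le> ?l * t" "\<rho> \<le> ?l * (1 - t)" using r0 lp t by (auto simp: \<rho>_def)
 have strict: "0 < s \<and> s < 1" if "?l * \<bar>s - t\<bar> < \<rho>" for s
 proof -
  have "?l * \<bar>s - t\<bar> < ?l * t" "?l * \<bar>s - t\<bar> < ?l * (1 - t)" using that r by linarith+
  then have "\<bar>s - t\<bar> < t" "\<bar>s - t\<bar> < 1 - t" using lp by simp_all
  then show ?thesis by linarith
 qed
 \<comment> \<open>All pages have the same difference of potentials between u and v, namely \<omega>
   on the edge. So it does not matter through which pages a short chain has run.\<close>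
 define I where "I y l b \<longleftrightarrow> (\<exists>s. y = epoint u v s \<and> ?l * \<bar>s - t\<bar> \<le> l \<and> b = ediff (base ?x) (base y)) \<or>
   (\<exists>c w. y = Inner c w \<and> c \<in> pages u v \<and> dist w (cpos c ?x) \<le> l \<and> b = cpot c (base ?x) + cpot c (base y))" for y l b
 have bx: "base ?x \<in> {u, v}" using base_epoint[OF uv, of t] t by auto
 show ?thesis
 proof (rule local_potI[OF r(1), of _ I])
  fix y l b assume "wchain ?x y l b" "l < \<rho>"
  then show "I y l b"
  proof (induction ?x y l b rule: wchain.induct)
   case refl then show ?case unfolding I_def by (intro disjI1 exI[of _ t]) simp
  next
   case (face y l b z c)
   let ?m = "dist (cpos c y) (cpos c z)"
   have l: "l < \<rho>" using face.prems zero_le_dist[of "cpos c y" "cpos c z"] by linarith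
   have yM: "y \<in> M" using wchain_points[OF face.hyps(1)] by simp
   have *: "c \<in> pages u v \<and> dist (cpos c y) (cpos c ?x) \<le> l \<and> b = cpot c (base ?x) + cpot c (base y)"
    using face.hyps(2)[OF l] unfolding I_def
   proof (elim disjE exE conjE)
    fix s assume s: "y = epoint u v s" "?l * \<bar>s - t\<bar> \<le> l" "b = ediff (base ?x) (base y)"
    then have st: "0 < s" "s < 1" using strict[of s] l by auto
    have "y \<noteq> Inner c w" for w using s by (simp add: epoint_def)
    then obtain k' u' v' t' where k': "is_side c k' u' v'" "y = epoint u' v' t'" "0 \<le> t'" "t' \<le> 1"
     using incell_Skel_side[OF face.hyps(4) yM face.hyps(5)] by metis
    have "{u, v} = {u', v'}" using epoint_eq_iff[of u v u' v' s t'] uv is_side_neq[OF face.hyps(4) k'(1)] st s k' by auto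
    then have cp: "c \<in> pages u v" using k' face.hyps(4) by (auto simp: pages_def is_side_def)
    have by': "base y \<in> {u, v}" using base_epoint[OF uv, of s] st s by auto
    show ?thesis using cp s page_dist_edge[OF cp, of s t] st t cpot_ediff[OF cp bx by'] by simp
   next
    fix c' w assume "y = Inner c' w" "c' \<in> pages u v" "dist w (cpos c' ?x) \<le> l" "b = cpot c' (base ?x) + cpot c' (base y)"
    then show ?thesis using face.hyps(5) by simp
   qed
   have zd: "dist (cpos c z) (cpos c ?x) \<le> l + ?m"
    using * dist_triangle[of "cpos c z" "cpos c ?x" "cpos c y"] by (simp add: dist_commute)
   have zb: "z \<in> book u v" using r0(2)[of c z] * face zd r by auto
   have b': "b + (cpot c (base y) + cpot c (base z)) = cpot c (base ?x) + cpot c (base z)" using * by (simp add: mod2)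
   from zb consider (I) w where "z = Inner c w" | (E) s where "z = epoint u v s" "0 \<le> s" "s \<le> 1"
    using face.hyps(6) by (auto simp: book_def)
   then show ?case
   proof cases
    case I then show ?thesis using zd * b' unfolding I_def by (intro disjI2 exI[of _ c] exI[of _ w]) auto
   next
    case E
    have "?l * \<bar>s - t\<bar> \<le> l + ?m" using zd page_dist_edge[of c u v s t] * E t by simp
    moreover have "base z \<in> {u, v}" using base_epoint[OF uv E(2,3)] E by auto
    then have "cpot c (base ?x) + cpot c (base z) = ediff (base ?x) (base z)" using cpot_ediff[of c u v] * bx by blast
    ultimately show ?thesis using b' E unfolding I_def by (intro disjI1 exI[of _ s]) auto
   qed
  next
   case (edge p q s l b s')
   let ?m = "elen X {p, q} * \<bar>s - s'\<bar>"
   have mp: "0 \<le> ?m" using elen_pos[OF edge.hyps(3)] by simp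
   then have l: "l < \<rho>" using edge.prems by linarith
   have pq: "p \<noteq> q" using edge_neq edge by blast
   have "\<exists>r. epoint p q s = epoint u v r \<and> ?l * \<bar>r - t\<bar> \<le> l \<and> b = ediff (base ?x) (base (epoint p q s))"
    using edge.hyps(2)[OF l] unfolding I_def by (auto simp: epoint_def)
   then obtain r where r': "epoint p q s = epoint u v r" "?l * \<bar>r - t\<bar> \<le> l" "b = ediff (base ?x) (base (epoint p q s))" by blast
   have st: "0 < r" "r < 1" using strict[of r] r' l by auto
   have eq: "{u, v} = {p, q}" using epoint_eq_iff[of u v p q r s] uv pq st r' edge by simp
   then consider "p = u" "q = v" | "p = v" "q = u" by (auto simp: doubleton_eq_iff)
   then obtain r2 where r2: "epoint p q s' = epoint u v r2" "0 \<le> r2" "r2 \<le> 1" "\<bar>s - s'\<bar> = \<bar>r - r2\<bar>"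
   proof cases
    case 1 then show ?thesis using that[of s'] edge r'(1) epoint_inj[OF uv] by simp
   next
    case 2
    have "r = 1 - s" using r'(1) epoint_swap[of p q s] 2 epoint_inj[OF uv] pq by simp
    then show ?thesis using that[of "1 - s'"] 2 edge epoint_swap[of p q s'] pq by simp
   qed
   have "?l * \<bar>r2 - t\<bar> \<le> ?l * (\<bar>r - t\<bar> + \<bar>r - r2\<bar>)" using lp by (intro mult_left_mono) auto
   also have "\<dots> \<le> l + ?m" using r'(2) r2(4) eq by (simp add: distrib_left)
   finally have d1: "?l * \<bar>r2 - t\<bar> \<le> l + ?m" .
   have B: "base (epoint p q s) \<in> {u, v}" "base (epoint p q s') \<in> {u, v}"
    using base_epoint[OF pq, of s] base_epoint[OF pq, of s'] edge eq by auto
   show ?case unfolding I_def using d1 r2 r'(3) ediff_trans[OF bx B] by (intro disjI1 exI[of _ r2]) auto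
  qed
 next
  fix y l b l' b' assume "I y l b" "I y l' b'"
  then show "b = b'" unfolding I_def by (elim disjE exE conjE) (auto simp: epoint_def)
 qed
qed

text \<open>The sum predicted on the way from v to x inside one cell or edge that contains
  both.\<close>

definition vpot :: "'v => ('v, 'c) point => 'b" where
 "vpot v x = (case x of Skel _ => ediff v (base x) | Inner c w => cpot c v + cpot c (base x))"

lemma vpot_simps: "vpot v (vpoint p) = ediff v p" "vpot v (epoint p q t) = ediff v (base (epoint p q t))"
 "vpot v (Inner c w) = cpot c v + cpot c (bds c ! 0)"
 using base_vpoint[of p] by (auto simp: vpot_def vpoint_def epoint_def base_Inner)

text \<open>\<open>v\<close> serves as the base point for the potential at the points \<open>x\<close> with
 \<open>anchor v x l\<close>. Edges on no cell can be arbitrarily short, so that \<open>v\<close> may be the wrong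
 one of the two vertices; this does no harm where \<open>\<omega>\<close> vanishes.\<close>

definition anchor :: "'v => ('v, 'c) point => real => bool" where
 "anchor v x l \<longleftrightarrow> x = vpoint v \<or>
   (\<exists>p t. {v, p} \<in> edges X \<and> 0 < t \<and> t < 1 \<and> x = epoint v p t \<and>
    (l < elen X {v, p} * t --> pages v p = {} \<and> \<omega> {v, p} = 0)) \<or>
   (\<exists>c w. x = Inner c w \<and> c \<in> cells X \<and> v \<in> set (bds c) \<and> dist w (vpos c v) \<le> l)"

text \<open>Edges on cells are bounded below in length by \<open>near_vertex\<close>, and those of
  \<open>E0\<close> by finiteness; so edges below the scale \<open>2 * \<kappa>\<close> are on no
  cell, and \<omega> vanishes on them.\<close>

lemma vertex_scale:
 obtains \<kappa> where "0 < \<kappa>"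
  "\<And>v c k x. (c, k) \<in> corners X v ==> x \<in> M ==> incell c x ==> dist (cpos c x) (vpos c v) < \<kappa> ==>
   x = vpoint v \<or> (\<exists>p\<in>corner_ends X (c, k). \<exists>t. 0 < t \<and> t < 1 \<and> x = epoint v p t) \<or> (\<exists>w. x = Inner c w)"
  "\<And>u v. {u, v} \<in> edges X ==> elen X {u, v} < 2 * \<kappa> ==> pages u v = {} \<and> \<omega> {u, v} = 0"
  "\<And>c u v. c \<in> cells X ==> u \<in> set (bds c) ==> v \<in> set (bds c) ==> dist (vpos c u) (vpos c v) < 2 * \<kappa> ==> u = v"
proof -
 obtain R where R: "0 < R"
  "\<And>v c k x. (c, k) \<in> corners X v ==> x \<in> M ==> incell c x ==> dist (cpos c x) (vpos c v) < R ==>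
   x = vpoint v \<or> (\<exists>p\<in>corner_ends X (c, k). \<exists>t. 0 < t \<and> t < 1 \<and> x = epoint v p t) \<or> (\<exists>w. x = Inner c w)"
  "\<And>v c k p. (c, k) \<in> corners X v ==> p \<in> corner_ends X (c, k) ==> R \<le> elen X {v, p}"
  by (rule near_vertex) (rule that)
 obtain \<rho> where r: "0 < \<rho>" "\<And>c. c \<in> cells X ==> segment_gap 0 (set (shp c)) \<rho>"
  by (rule uniform_gap[OF order_refl zero_le_one]) (rule that)
 have "\<exists>\<mu>>0. \<forall>e\<in>E0. \<mu> \<le> elen X e"
  by (rule finite_uniform_radius) (use E0 elen_pos in auto)
 then obtain \<mu> where m: "0 < \<mu>" "\<And>e. e \<in> E0 ==> \<mu> \<le> elen X e" by blast
 define \<kappa> where "\<kappa> = min R (min \<rho> \<mu>) / 2"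
 have k: "0 < \<kappa>" "\<kappa> \<le> R" "2 * \<kappa> \<le> R" "2 * \<kappa> \<le> \<rho>" "2 * \<kappa> \<le> \<mu>" using R r m by (auto simp: \<kappa>_def)
 show ?thesis
 proof (rule that[of \<kappa>])
  show "0 < \<kappa>" by (rule k)
  show "x = vpoint v \<or> (\<exists>p\<in>corner_ends X (c, k'). \<exists>t. 0 < t \<and> t < 1 \<and> x = epoint v p t) \<or> (\<exists>w. x = Inner c w)"
   if "(c, k') \<in> corners X v" "x \<in> M" "incell c x" "dist (cpos c x) (vpos c v) < \<kappa>" for v c k' x
   using R(2)[OF that(1-3)] that(4) k by simp
  show "pages u v = {} \<and> \<omega> {u, v} = 0" if e: "{u, v} \<in> edges X" "elen X {u, v} < 2 * \<kappa>" for u v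
  proof -
   have p: "pages u v = {}"
   proof (rule ccontr)
    assume "pages u v \<noteq> {}"
    then obtain c where "c \<in> pages u v" by blast
    then obtain k' where "(c, k') \<in> corners X u" "v \<in> corner_ends X (c, k')" by (rule page_corner) (rule that)
    from R(3)[OF this] show False using e k by simp
   qed
   moreover have "{u, v} \<notin> E0" using m(2) e k by fastforce
   ultimately show ?thesis using free0[OF e(1)] by simp
  qed
  show "u = v" if c: "c \<in> cells X" and uv: "u \<in> set (bds c)" "v \<in> set (bds c)" "dist (vpos c u) (vpos c v) < 2 * \<kappa>" for c u v
  proof -
   obtain i j where ij: "i < len c" "u = bds c ! i" "j < len c" "v = bds c ! j" using uv by (auto simp: in_set_conv_nth)
   have P: "vpos c u = shp c ! i" "vpos c v = shp c ! j" using vpos_nth[OF c] ij by simp_all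
   have S: "shp c ! i \<in> set (shp c)" "shp c ! j \<in> set (shp c)" using ij shape_len[OF c] by auto
   have "shp c ! i = shp c ! j"
   proof (rule ccontr)
    assume "shp c ! i \<noteq> shp c ! j"
    then have "\<rho> \<le> dist (shp c ! i) (shp c ! j)"
     using r(2)[OF c, unfolded segment_gap_def, rule_format, OF S(1) S(1) S(2) S(2), of "shp c ! j"] by simp
    then show False using uv(3) P k by simp
   qed
   then show ?thesis using ij shape_distinct[OF c] shape_len[OF c] by (simp add: nth_eq_iff_index_eq)
  qed
 qed
qed

lemma epoint_vpoint_neq: "0 < t ==> t < 1 ==> u \<noteq> v ==> epoint u v t \<noteq> vpoint p"
 by (auto simp: epoint_def vpoint_def fun_eq_iff dest!: spec[of _ u] split: if_splits)

lemma local_pot_vertex: assumes v: "v \<in> verts X" shows "local_pot (vpoint v)"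
proof -
 obtain \<kappa> where k: "0 < \<kappa>"
  "\<And>v c k x. (c, k) \<in> corners X v ==> x \<in> M ==> incell c x ==> dist (cpos c x) (vpos c v) < \<kappa> ==>
   x = vpoint v \<or> (\<exists>p\<in>corner_ends X (c, k). \<exists>t. 0 < t \<and> t < 1 \<and> x = epoint v p t) \<or> (\<exists>w. x = Inner c w)"
  "\<And>u v. {u, v} \<in> edges X ==> elen X {u, v} < 2 * \<kappa> ==> pages u v = {} \<and> \<omega> {u, v} = 0"
  "\<And>c u v. c \<in> cells X ==> u \<in> set (bds c) ==> v \<in> set (bds c) ==> dist (vpos c u) (vpos c v) < 2 * \<kappa> ==> u = v"
  by (rule vertex_scale) (rule that)
 \<comment> \<open>The anchor v' need not be v: a chain can run over a whole short edge, whose other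
   end then takes over. The sum does not change, because \<omega> vanishes on that edge.\<close>
 define I where "I y l b \<longleftrightarrow> (\<exists>v'. anchor v' y l \<and> b = vpot v' y)" for y l b
 show ?thesis
 proof (rule local_potI[OF k(1), of _ I])
  fix y l b assume "wchain (vpoint v) y l b" "l < \<kappa>"
  then show "I y l b"
  proof (induction "vpoint v :: ('v, 'c) point" y l b rule: wchain.induct)
   case refl then show ?case unfolding I_def anchor_def by (intro exI[of _ v]) (simp add: vpot_simps)
  next
   case (face y l b z c)
   let ?m = "dist (cpos c y) (cpos c z)"
   have l: "l < \<kappa>" "0 \<le> l" using face.prems zero_le_dist[of "cpos c y" "cpos c z"] wchain_points[OF face.hyps(1)] by linarith+
   have yM: "y \<in> M" using wchain_points[OF face.hyps(1)] by simp
   obtain v' where v': "anchor v' y l" "b = vpot v' y" using face.hyps(2)[OF l(1)] unfolding I_def by blast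
   have *: "v' \<in> set (bds c) \<and> dist (cpos c y) (vpos c v') \<le> l \<and> b = cpot c v' + cpot c (base y)"
    using v'(1) unfolding anchor_def
   proof (elim disjE exE conjE)
    assume y: "y = vpoint v'"
    then show ?thesis using incell_vpoint_iff[OF face.hyps(4)] face.hyps(5) l v'(2) by (simp add: vpos_def vpot_simps two)
   next
    fix p t assume e: "{v', p} \<in> edges X" "0 < t" "t < 1" "y = epoint v' p t"
     "l < elen X {v', p} * t --> pages v' p = {} \<and> \<omega> {v', p} = 0"
    have "y \<noteq> Inner c w" for w using e by (simp add: epoint_def)
    then obtain k' u' w' t' where k': "is_side c k' u' w'" "y = epoint u' w' t'" "0 \<le> t'" "t' \<le> 1"
     using incell_Skel_side[OF face.hyps(4) yM face.hyps(5)] by metis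
    have "{v', p} = {u', w'}" using epoint_eq_iff[of v' p u' w' t t'] edge_neq[OF e(1)] is_side_neq[OF face.hyps(4) k'(1)] e k' by auto
    then have cp: "c \<in> pages v' p" using k' face.hyps(4) by (auto simp: pages_def is_side_def)
    then have "v' \<in> set (bds c)" using page_corner[OF cp] corners_iff nth_mem by metis
    moreover have "base y \<in> {v', p}" using base_epoint[OF edge_neq[OF e(1)], of t] e by auto
    ultimately show ?thesis using cp e dist_vpos_epoint[OF cp, of t] cpot_ediff[OF cp, of v' "base y"] v'(2) by (auto simp: vpot_simps)
   next
    fix c' w assume "y = Inner c' w" "c' \<in> cells X" "v' \<in> set (bds c')" "dist w (vpos c' v') \<le> l"
    then show ?thesis using face.hyps(5) v'(2) by (simp add: vpot_simps)
   qed
   have zd: "dist (cpos c z) (vpos c v') \<le> l + ?m"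
    using * dist_triangle[of "cpos c z" "vpos c v'" "cpos c y"] by (simp add: dist_commute)
   obtain j where j: "(c, j) \<in> corners X v'" using * face.hyps(4) by (auto simp: in_set_conv_nth corners_iff)
   have b': "b + (cpot c (base y) + cpot c (base z)) = cpot c v' + cpot c (base z)" using * by (simp add: mod2)
   have "dist (cpos c z) (vpos c v') < \<kappa>" using zd face.prems by simp
   from k(2)[OF j face.hyps(3,6) this]
   have "anchor v' z (l + ?m) \<and> cpot c v' + cpot c (base z) = vpot v' z"
   proof (elim disjE bexE exE conjE)
    assume "z = vpoint v'" then show ?thesis by (simp add: anchor_def vpot_simps two)
   next
    fix p t assume p: "p \<in> corner_ends X (c, j)" "0 < t" "t < 1" "z = epoint v' p t"
    have cp: "c \<in> pages v' p" "{v', p} \<in> edges X" using corner_end_page[OF j p(1)] by auto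
    have "elen X {v', p} * t \<le> l + ?m" using zd dist_vpos_epoint[OF cp(1), of t] p by simp
    then have "\<not> l + ?m < elen X {v', p} * t" by simp
    then have "anchor v' z (l + ?m)" unfolding anchor_def using p cp by blast
    moreover have "base z \<in> {v', p}" using base_epoint[OF edge_neq[OF cp(2)], of t] p by auto
    ultimately show ?thesis using cpot_ediff[OF cp(1), of v' "base z"] p by (simp add: vpot_simps)
   next
    fix w assume "z = Inner c w"
    then show ?thesis using zd * face.hyps(4) by (simp add: anchor_def vpot_simps)
   qed
   then show ?case unfolding I_def b' by blast
  next
   case (edge p q s l b s')
   let ?m = "elen X {p, q} * \<bar>s - s'\<bar>" and ?y = "epoint p q s" and ?z = "epoint p q s'"
   have lp: "0 < elen X {p, q}" using elen_pos[OF edge.hyps(3)] .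
   have pq: "p \<noteq> q" using edge_neq edge by blast
   have mp: "0 \<le> ?m" using lp by simp
   then have l: "l < \<kappa>" using edge.prems by linarith
   have l0: "0 \<le> l" using wchain_points[OF edge.hyps(1)] by simp
   obtain v' where v': "anchor v' ?y l" "b = vpot v' ?y" using edge.hyps(2)[OF l] unfolding I_def by blast
   define fr where "fr \<longleftrightarrow> \<omega> {p, q} = 0"
   have E: "\<exists>w r0. {v', w} = {p, q} \<and> ?y = epoint v' w r0 \<and> 0 \<le> r0 \<and> r0 \<le> 1 \<and> (elen X {p, q} * r0 \<le> l \<or> fr)"
    using v'(1) unfolding anchor_def
   proof (elim disjE exE conjE)
    assume y: "?y = vpoint v'"
    have "s = 0 \<or> s = 1" using epoint_vpoint_neq[of s p q v'] y pq edge.hyps by force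
    then show ?thesis
    proof
     assume s: "s = 0"
     then have "v' = p" using y epoint_0[of p q] vpoint_inj by auto
     then show ?thesis using s l0 by (intro exI[of _ q] exI[of _ 0]) auto
    next
     assume s: "s = 1"
     then have "v' = q" using y epoint_1[OF pq] vpoint_inj by auto
     then show ?thesis using s l0 epoint_1[OF pq] epoint_0[of q p] by (intro exI[of _ p] exI[of _ 0]) auto
    qed
   next
    fix w t assume e: "{v', w} \<in> edges X" "0 < t" "t < 1" "?y = epoint v' w t"
     "l < elen X {v', w} * t --> pages v' w = {} \<and> \<omega> {v', w} = 0"
    have eq: "{v', w} = {p, q}" using epoint_eq_iff[of v' w p q t s] edge_neq[OF e(1)] pq e edge.hyps by auto
    show ?thesis by (rule exI[of _ w], rule exI[of _ t]) (use e eq in \<open>auto simp: fr_def\<close>)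
   qed (simp add: epoint_def)
   then obtain w r0 where w: "{v', w} = {p, q}" "?y = epoint v' w r0" "0 \<le> r0" "r0 \<le> 1" "elen X {p, q} * r0 \<le> l \<or> fr" by blast
   have vw: "v' \<noteq> w" using w(1) pq by (auto simp: doubleton_eq_iff)
   from w(1) consider "p = v'" "q = w" | "p = w" "q = v'" by (auto simp: doubleton_eq_iff)
   then obtain r where r: "?z = epoint v' w r" "0 \<le> r" "r \<le> 1" "\<bar>s - s'\<bar> = \<bar>r0 - r\<bar>"
   proof cases
    case 1
    then have "s = r0" using w(2) epoint_inj[OF vw] by simp
    then show ?thesis using that[of s'] edge.hyps 1 by simp
   next
    case 2
    then have "1 - s = r0" using w(2) epoint_swap[of w v' s] epoint_inj[OF vw] vw by simp
    then show ?thesis using that[of "1 - s'"] edge.hyps 2 epoint_swap[of w v' s'] vw by simp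
   qed
   have ln: "elen X {p, q} * r \<le> l + ?m \<or> fr"
   proof (cases fr)
    case False
    have "elen X {p, q} * r \<le> elen X {p, q} * (r0 + \<bar>r0 - r\<bar>)" using lp by (intro mult_left_mono) auto
    then show ?thesis using w(5) False r(4) by (simp add: distrib_left)
   qed simp
   have B: "base ?y \<in> {v', w}" "base ?z \<in> {v', w}"
    using base_epoint[OF vw w(3,4)] base_epoint[OF vw r(2,3)] w(2) r(1) by auto
   have b': "b + ediff (base ?y) (base ?z) = ediff v' (base ?z)"
    using ediff_trans[of v' v' w, OF _ B] v'(2) w(2) by (simp add: vpot_simps)
   consider "r = 0" | "0 < r" "r < 1" | "r = 1" using r by linarith
   then show ?case
   proof cases
    case 1
    then have "?z = vpoint v'" using r epoint_0 by simp
    then show ?thesis unfolding I_def anchor_def b' by (intro exI[of _ v']) (simp add: vpot_simps)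
   next
    case 2
    have "anchor v' ?z (l + ?m)" unfolding anchor_def
    proof (rule disjI2, rule disjI1, rule exI[of _ w], rule exI[of _ r], intro conjI)
     have "pages v' w = {}" using edge.hyps(4) w(1) by (simp add: pages_def is_side_def)
     then show "l + ?m < elen X {v', w} * r --> pages v' w = {} \<and> \<omega> {v', w} = 0" using ln w(1) by (auto simp: fr_def)
    qed (use 2 r w edge.hyps in auto)
    then show ?thesis unfolding I_def b' by (intro exI[of _ v'] conjI) (simp_all add: vpot_simps)
   next
    case 3
    then have z: "?z = vpoint w" using r epoint_1[OF vw] by simp
    have "\<omega> {p, q} = 0"
    proof (cases fr)
     case False
     then have "elen X {p, q} < 2 * \<kappa>" using ln 3 edge.prems k(1) by simp
     then show ?thesis using k(3)[OF edge.hyps(3)] by simp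
    qed (simp add: fr_def)
    then have "ediff v' w = 0" using vw w(1) by (simp add: ediff_def)
    with b' z show ?thesis unfolding I_def by (intro exI[of _ w] conjI) (simp_all add: anchor_def vpot_simps)
   qed
  qed
 next
  fix y l b l' b' assume I: "I y l b" "I y l' b'" "l < \<kappa>" "l' < \<kappa>"
  then obtain p p' where p: "anchor p y l" "b = vpot p y" "anchor p' y l'" "b' = vpot p' y" unfolding I_def by blast
  show "b = b'"
  proof (cases "p = p'")
   case False
   consider (V) "y = vpoint p" | (E) q t where "{p, q} \<in> edges X" "0 < t" "t < 1" "y = epoint p q t"
    "l < elen X {p, q} * t --> \<omega> {p, q} = 0"
    | (I) c w where "y = Inner c w" "c \<in> cells X" "p \<in> set (bds c)" "dist w (vpos c p) \<le> l"
    using p(1) unfolding anchor_def by blast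
   then show ?thesis
   proof cases
    case V
    then show ?thesis using p(3) False epoint_vpoint_neq[of _ p' _ p] edge_neq
     by (auto simp: anchor_def vpoint_inj) (auto simp: vpoint_def)
   next
    case E
    note pq = edge_neq[OF E(1)]
    obtain q' t' where e': "{p', q'} \<in> edges X" "0 < t'" "t' < 1" "y = epoint p' q' t'" "l' < elen X {p', q'} * t' --> \<omega> {p', q'} = 0"
     using p(3) E epoint_vpoint_neq[of t p q p'] pq unfolding anchor_def by (auto simp: epoint_def)
    have "{p, q} = {p', q'}" using epoint_eq_iff[of p q p' q' t t'] edge_neq[OF e'(1)] pq E e' by auto
    then have q: "p' = q" "q' = p" using False by (auto simp: doubleton_eq_iff)
    have t': "t' = 1 - t" using E(4) e'(4) epoint_swap[OF pq, of t] epoint_inj[of q p] pq q by simp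
    \<comment> \<open>The point is anchored at both ends of the edge. If \<omega> did not vanish
      there, the two length bounds would add up to an edge shorter than
      \<open>2 * \<kappa>\<close>.\<close>
    have "\<omega> {p, q} = 0"
    proof (rule ccontr)
     assume "\<omega> {p, q} \<noteq> 0"
     then have "elen X {p, q} * t \<le> l" "elen X {p, q} * (1 - t) \<le> l'" using E(5) e'(5) q t' by (auto simp: insert_commute)
     then have "elen X {p, q} < 2 * \<kappa>" using I by (simp add: algebra_simps)
     then show False using k(3)[OF E(1)] \<open>\<omega> {p, q} \<noteq> 0\<close> by simp
    qed
    then have "ediff a c = 0" if "a \<in> {p, q}" "c \<in> {p, q}" for a c
     using that by (auto simp: ediff_def insert_commute)
    moreover have "base y \<in> {p, q}" using base_epoint[OF pq, of t] E by auto
    ultimately show ?thesis using p q E by (simp add: vpot_simps)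
   next
    case I': I
    then have "p' \<in> set (bds c)" "dist w (vpos c p') \<le> l'" using p(3) unfolding anchor_def by (auto simp: vpoint_def epoint_def)
    then have "p = p'" using k(4)[OF I'(2,3)] I' I(3,4) dist_triangle3[of "vpos c p" "vpos c p'" w] by force
    then show ?thesis using False by simp
   qed
  qed (use p in simp)
 qed
qed

lemma local_pot: assumes "x \<in> M" shows "local_pot x"
 using assms by (cases rule: points_cases) (auto intro: local_pot_vertex local_pot_edge local_pot_inner)

text \<open>A short chain starting near x is prefixed by a chain from x; in exponent 2 the
  contribution of the prefix is removed by adding it.\<close>

lemma local_pot_diff: assumes x: "x \<in> M"
 shows "\<exists>\<epsilon>>0. \<exists>\<phi>. \<forall>p q l b. d x p < \<epsilon> --> wchain p q l b --> l < \<epsilon> --> b = \<phi> p + \<phi> q"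
proof -
 obtain \<rho> \<phi> where r: "0 < \<rho>" "\<And>y l b. wchain x y l b ==> l < \<rho> ==> b = \<phi> y"
  using local_pot[OF x] unfolding local_pot_def by blast
 have "b = \<phi> p + \<phi> q" if h: "d x p < \<rho> / 2" "wchain p q l b" "l < \<rho> / 2" for p q l b
 proof -
  have pM: "p \<in> M" using wchain_points[OF h(2)] by simp
  obtain l1 b1 where w: "wchain x p l1 b1" "l1 < d x p + (\<rho> / 2 - d x p)"
   by (rule ex_wchain[OF x pM, of "\<rho> / 2 - d x p"]) (use h(1) in simp, rule that)
  have "b1 = \<phi> p" using r(2)[OF w(1)] w(2) r(1) by simp
  moreover have "b1 + b = \<phi> q" using r(2)[OF wchain_trans[OF h(2) w(1)]] w(2) h(3) by simp
  ultimately show ?thesis using two' by metis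
 qed
 then show ?thesis using r(1) by (intro exI[of _ "\<rho> / 2"] conjI exI[of _ \<phi>]) auto
qed

text \<open>The sum along some chain shorter than \<open>2 * d p q\<close>. Wherever a local
  potential applies, it does not depend on the chosen chain.\<close>

definition wt :: "('v, 'c) point => ('v, 'c) point => 'b" where
 "wt p q = (if p = q then 0 else SOME b. \<exists>l<2 * d p q. wchain p q l b)"

lemma wt: assumes "p \<in> M" "q \<in> M" "p \<noteq> q" obtains l where "l < 2 * d p q" "wchain p q l (wt p q)"
proof -
 have "0 < d p q" using zero_iff[OF assms(1,2)] assms(3) nonneg[of p q] by linarith
 then obtain l b where "wchain p q l b" "l < 2 * d p q" using ex_wchain[OF assms(1,2), of "d p q"] by auto
 then have "\<exists>b. \<exists>l<2 * d p q. wchain p q l b" by blast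
 from someI_ex[OF this] show ?thesis using that assms(3) unfolding wt_def by auto
qed

lemma wt_pot: assumes x: "x \<in> M"
 shows "\<exists>\<epsilon> \<phi>. 0 < \<epsilon> \<and> (\<forall>p q l b. d x p < \<epsilon> --> wchain p q l b --> l < \<epsilon> --> b = \<phi> p + \<phi> q) \<and>
  (\<forall>p\<in>M. \<forall>q\<in>M. d x p < \<epsilon> --> 2 * d p q < \<epsilon> --> wt p q = \<phi> p + \<phi> q)"
proof -
 obtain \<epsilon> \<phi> where e: "0 < \<epsilon>" "\<And>p q l b. d x p < \<epsilon> ==> wchain p q l b ==> l < \<epsilon> ==> b = \<phi> p + \<phi> q"
  using local_pot_diff[OF x] by blast
 have "wt p q = \<phi> p + \<phi> q" if pq: "p \<in> M" "q \<in> M" "d x p < \<epsilon>" "2 * d p q < \<epsilon>" for p q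
 proof (cases "p = q")
  case True then show ?thesis by (simp add: wt_def two)
 next
  case False
  obtain l where l: "l < 2 * d p q" "wchain p q l (wt p q)" by (rule wt[OF pq(1,2) False]) (rule that)
  then show ?thesis using e(2)[OF pq(3) l(2)] pq(4) by simp
 qed
 then show ?thesis using e by blast
qed

section \<open>Contraction along geodesics\<close>

definition gray :: "('v, 'c) point => ('v, 'c) point => real => ('v, 'c) point" where
 "gray a x = (SOME \<gamma>. \<gamma> 0 = a \<and> \<gamma> (d a x) = x \<and> \<gamma> ` {0..d a x} \<subseteq> M \<and>
   (\<forall>s\<in>{0..d a x}. \<forall>t\<in>{0..d a x}. d (\<gamma> s) (\<gamma> t) = \<bar>s - t\<bar>))"

text \<open>The homotopy contracting the complex to a, with time rescaled to run from 0 at a to 1 at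
  x.\<close>

definition hpt :: "('v, 'c) point => ('v, 'c) point => real => ('v, 'c) point" where
 "hpt a x s = gray a x (s * d a x)"

lemma hpt:
 assumes "a \<in> M" "x \<in> M"
 shows "hpt a x 0 = a" "hpt a x 1 = x" "\<And>s. 0 \<le> s ==> s \<le> 1 ==> hpt a x s \<in> M"
  "\<And>s s'. 0 \<le> s ==> s \<le> 1 ==> 0 \<le> s' ==> s' \<le> 1 ==> d (hpt a x s) (hpt a x s') = \<bar>s - s'\<bar> * d a x"
proof -
 have "\<exists>\<gamma>. \<gamma> 0 = a \<and> \<gamma> (d a x) = x \<and> \<gamma> ` {0..d a x} \<subseteq> M \<and>
   (\<forall>s\<in>{0..d a x}. \<forall>t\<in>{0..d a x}. d (\<gamma> s) (\<gamma> t) = \<bar>s - t\<bar>)"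
  using geodesic_ex[OF assms] unfolding geodesic_segment_def by blast
 from someI_ex[OF this, folded gray_def]
 have g: "gray a x 0 = a" "gray a x (d a x) = x" "gray a x ` {0..d a x} \<subseteq> M"
   "\<And>s t. s \<in> {0..d a x} ==> t \<in> {0..d a x} ==> d (gray a x s) (gray a x t) = \<bar>s - t\<bar>" by blast+
 have i: "s * d a x \<in> {0..d a x}" if "0 \<le> s" "s \<le> 1" for s using that by (simp add: mult_left_le_one_le)
 show "hpt a x 0 = a" "hpt a x 1 = x" using g by (simp_all add: hpt_def)
 show "hpt a x s \<in> M" if "0 \<le> s" "s \<le> 1" for s using i[OF that] g(3) by (auto simp: hpt_def)
 show "d (hpt a x s) (hpt a x s') = \<bar>s - s'\<bar> * d a x" if "0 \<le> s" "s \<le> 1" "0 \<le> s'" "s' \<le> 1" for s s'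
 proof -
  have "d (hpt a x s) (hpt a x s') = \<bar>s * d a x - s' * d a x\<bar>"
   unfolding hpt_def by (rule g(4)) (use i that in blast)+
  also have "\<dots> = \<bar>(s - s') * d a x\<bar>" by (simp add: left_diff_distrib)
  finally show ?thesis by (simp add: abs_mult)
 qed
qed

lemma hpt_contract:
 assumes "a \<in> M" "x \<in> M" "y \<in> M" "0 \<le> s" "s \<le> 1"
 shows "d (hpt a x s) (hpt a y s) \<le> s * d x y"
proof (rule contraction[of a x y])
 note X = hpt[OF assms(1,2)] and Y = hpt[OF assms(1,3)]
 show "hpt a x s \<in> M" "hpt a y s \<in> M" using X Y assms by blast+
 show "d a (hpt a x s) = s * d a x" using X(4)[of 0 s] X(1) assms by simp
 show "d a (hpt a y s) = s * d a y" using Y(4)[of 0 s] Y(1) assms by simp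
 show "d (hpt a x s) x = (1 - s) * d a x" using X(4)[of s 1] X(2) assms by simp
 show "d (hpt a y s) y = (1 - s) * d a y" using Y(4)[of s 1] Y(2) assms by simp
qed (use assms in auto)

lemma d_epoint_le:
 assumes e: "{p, q} \<in> edges X" and st: "0 \<le> s" "s \<le> 1" "0 \<le> t" "t \<le> 1"
 shows "d (epoint p q s) (epoint p q t) \<le> elen X {p, q} * \<bar>s - t\<bar>"
proof -
 let ?a = "\<lambda>s w. if w = p then 1 - s else if w = q then s else (0::real)"
 have "cell_dist X (epoint p q s) (epoint p q t) (elen X {p, q} * \<bar>?a s p - ?a t p\<bar>)"
  unfolding epoint_def by (rule cell_dist.edge[OF e]) (auto simp: supp_def)
 from d_le_cell_dist[OF epoint_in[OF e st(1,2)] epoint_in[OF e st(3,4)] this] show ?thesis by (simp add: abs_minus_commute)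
qed

definition vsum :: "('v, 'c) point => ('v, 'c) point => nat => 'b" where
 "vsum a x N = (\<Sum>i<N. wt (hpt a x (real i / real N)) (hpt a x (real (Suc i) / real N)))"

text \<open>The geodesics from \<open>a\<close> to the points of the edge sweep out a triangle, which is cut by a fine
 grid into quadrilaterals, each in the domain of a local potential.\<close>

lemma rectangle:
 assumes a: "a \<in> M" and e: "{p, q} \<in> edges X"
 shows "\<exists>N0. \<forall>N\<ge>N0. \<omega> {p, q} = vsum a (vpoint p) N + vsum a (vpoint q) N"
proof -
 let ?l = "elen X {p, q}"
 have lp: "0 < ?l" using elen_pos[OF e] .
 have pq: "p \<noteq> q" using edge_neq[OF e] .
 define f where "f z = hpt a (epoint p q (snd z)) (fst z)" for z :: "real \<times> real"
 define K where "K = {0..1::real} \<times> {0..1::real}"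
 define D where "D = d a (vpoint p) + ?l"
 have em: "epoint p q t \<in> M" if "0 \<le> t" "t \<le> 1" for t using epoint_in[OF e that] .
 have Db: "d a (epoint p q t) \<le> D" if "0 \<le> t" "t \<le> 1" for t
 proof -
  have "d a (epoint p q t) \<le> d a (epoint p q 0) + d (epoint p q 0) (epoint p q t)" by (rule tri) (use a em that in auto)
  also have "d (epoint p q 0) (epoint p q t) \<le> ?l * \<bar>0 - t\<bar>" by (rule d_epoint_le[OF e]) (use that in auto)
  also have "\<dots> \<le> ?l" using that lp by simp
  finally show ?thesis by (simp add: D_def epoint_0)
 qed
 define L where "L = D + ?l"
 have L: "0 < L" "?l \<le> L" using lp nonneg[of a "vpoint p"] by (simp_all add: L_def D_def del: nonneg)
 have fM: "f z \<in> M" if "z \<in> K" for z using hpt(3)[OF a em] that by (auto simp: f_def K_def)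
 \<comment> \<open>Lipschitz in the first parameter because the geodesics have bounded length, in
   the second by \<open>hpt_contract\<close>.\<close>
 have lip: "d (f z) (f z') \<le> L * dist z z'" if z: "z \<in> K" "z' \<in> K" for z z'
 proof -
  obtain s t s' t' where [simp]: "z = (s, t)" "z' = (s', t')" by (cases z, cases z') auto
  have r: "0 \<le> s" "s \<le> 1" "0 \<le> t" "t \<le> 1" "0 \<le> s'" "s' \<le> 1" "0 \<le> t'" "t' \<le> 1" using z by (auto simp: K_def)
  have "d (f z) (f z') \<le> d (f z) (f (s', t)) + d (f (s', t)) (f z')" by (rule tri) (use fM z r in \<open>auto simp: K_def\<close>)
  also have "d (f z) (f (s', t)) = \<bar>s - s'\<bar> * d a (epoint p q t)" using hpt(4)[OF a em] r by (simp add: f_def)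
  also have "\<dots> \<le> \<bar>s - s'\<bar> * D" using Db r by (intro mult_left_mono) auto
  also have "d (f (s', t)) (f z') \<le> s' * d (epoint p q t) (epoint p q t')" using hpt_contract[OF a em em] r by (simp add: f_def)
  also have "\<dots> \<le> d (epoint p q t) (epoint p q t')" using r by (simp add: mult_left_le_one_le)
  also have "\<dots> \<le> ?l * \<bar>t - t'\<bar>" using d_epoint_le[OF e] r by simp
  also have "\<bar>s - s'\<bar> * D \<le> dist z z' * D"
   using dist_fst_le[of z z'] nonneg[of a "vpoint p"] lp by (intro mult_right_mono) (simp_all add: dist_real_def D_def del: nonneg)
  also have "?l * \<bar>t - t'\<bar> \<le> ?l * dist z z'" using dist_snd_le[of z z'] lp by (intro mult_left_mono) (simp_all add: dist_real_def)
  finally show ?thesis by (simp add: L_def algebra_simps)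
 qed
 have "\<forall>x\<in>K. \<exists>\<epsilon> \<phi>. 0 < \<epsilon> \<and> (\<forall>p q l b. d (f x) p < \<epsilon> --> wchain p q l b --> l < \<epsilon> --> b = \<phi> p + \<phi> q) \<and>
  (\<forall>p\<in>M. \<forall>q\<in>M. d (f x) p < \<epsilon> --> 2 * d p q < \<epsilon> --> wt p q = \<phi> p + \<phi> q)" using wt_pot fM by blast
 then obtain \<epsilon> where "\<forall>x\<in>K. \<exists>\<phi>. 0 < \<epsilon> x \<and> (\<forall>p q l b. d (f x) p < \<epsilon> x --> wchain p q l b --> l < \<epsilon> x --> b = \<phi> p + \<phi> q) \<and>
  (\<forall>p\<in>M. \<forall>q\<in>M. d (f x) p < \<epsilon> x --> 2 * d p q < \<epsilon> x --> wt p q = \<phi> p + \<phi> q)" by (rule bchoice[THEN exE])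
 then obtain \<phi> where ph: "\<forall>x\<in>K. 0 < \<epsilon> x \<and> (\<forall>p q l b. d (f x) p < \<epsilon> x --> wchain p q l b --> l < \<epsilon> x --> b = \<phi> x p + \<phi> x q) \<and>
  (\<forall>p\<in>M. \<forall>q\<in>M. d (f x) p < \<epsilon> x --> 2 * d p q < \<epsilon> x --> wt p q = \<phi> x p + \<phi> x q)" by (rule bchoice[THEN exE])
 have ph1: "\<epsilon> x > 0" if "x \<in> K" for x using ph that by blast
 have ph2: "b = \<phi> x p + \<phi> x q" if "x \<in> K" "d (f x) p < \<epsilon> x" "wchain p q l b" "l < \<epsilon> x" for x p q l b using ph that by blast
 have ph3: "wt p q = \<phi> x p + \<phi> x q" if "x \<in> K" "p \<in> M" "q \<in> M" "d (f x) p < \<epsilon> x" "2 * d p q < \<epsilon> x" for x p q using ph that by blast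
 define r where "r x = \<epsilon> x / (4 * L)" for x
 have rp: "0 < r x" if "x \<in> K" for x using ph1[OF that] L by (simp add: r_def)
 have Lr: "L * r x = \<epsilon> x / 4" for x using L by (simp add: r_def)
 have cK: "compact K" by (simp add: K_def compact_Times)
 have cov: "K \<subseteq> \<Union>((\<lambda>x. ball x (r x)) ` K)" using rp by auto
 \<comment> \<open>A Lebesgue number for the cover of the parameter square by domains of local
   potentials.\<close>
 obtain \<delta> where del: "0 < \<delta>" "\<And>x. x \<in> K ==> \<exists>B\<in>(\<lambda>x. ball x (r x)) ` K. ball x \<delta> \<subseteq> B"
  by (rule Heine_Borel_lemma[OF cK cov]) (force, rule that)
 \<comment> \<open>The second clause concerns chains up to the length of a piece of the edge; it
   serves to evaluate the row of the grid that runs along the edge.\<close>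
 have key: "\<exists>\<psi>. (\<forall>y\<in>K. \<forall>y'\<in>K. dist x y < \<delta> --> dist x y' < \<delta> --> wt (f y) (f y') = \<psi> (f y) + \<psi> (f y')) \<and>
   (\<forall>y q l b. y \<in> K --> dist x y < \<delta> --> wchain (f y) q l b --> l \<le> ?l * \<delta> --> b = \<psi> (f y) + \<psi> q)" if x: "x \<in> K" for x
 proof -
  obtain x0 where x0: "x0 \<in> K" "ball x \<delta> \<subseteq> ball x0 (r x0)" using del(2)[OF x] by blast
  have dr: "\<delta> \<le> r x0" using x0(2) del(1) zero_le_dist[of x x0] unfolding ball_subset_ball_iff by linarith
  have near: "d (f x0) (f y) < \<epsilon> x0 / 4" if "y \<in> K" "dist x y < \<delta>" for y
  proof -
   have "dist x0 y < r x0" using x0(2) that(2) by (meson mem_ball subsetD)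
   then have "L * dist x0 y < \<epsilon> x0 / 4" using L(1) unfolding Lr[symmetric] by simp
   then show ?thesis using lip[OF x0(1) that(1)] by linarith
  qed
  have e0: "0 < \<epsilon> x0" using ph1[OF x0(1)] .
  show ?thesis
  proof (intro exI[of _ "\<phi> x0"] conjI ballI allI impI)
   fix y y' assume y: "y \<in> K" "y' \<in> K" "dist x y < \<delta>" "dist x y' < \<delta>"
   have "d (f y) (f y') \<le> d (f y) (f x0) + d (f x0) (f y')" by (rule tri) (use fM y x0 in auto)
   then have "2 * d (f y) (f y') < \<epsilon> x0" using near[OF y(1,3)] near[OF y(2,4)] sym[of "f y" "f x0"] by linarith
   then show "wt (f y) (f y') = \<phi> x0 (f y) + \<phi> x0 (f y')"
    using ph3[OF x0(1) fM[OF y(1)] fM[OF y(2)]] near[OF y(1,3)] e0 by simp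
  next
   fix y q l b assume y: "y \<in> K" "dist x y < \<delta>" "wchain (f y) q l b" "l \<le> ?l * \<delta>"
   have "?l * \<delta> \<le> L * r x0" using dr L(2) lp del(1) by (intro mult_mono) auto
   then have "l < \<epsilon> x0" using y(4) Lr[of x0] e0 by simp
   then show "b = \<phi> x0 (f y) + \<phi> x0 q" using ph2[OF x0(1) _ y(3)] near[OF y(1,2)] e0 by simp
  qed
 qed
 show ?thesis
 \<comment> \<open>With more than \<open>2 / \<delta>\<close> subdivisions the four corners of a
   grid square are within \<delta> of each other.\<close>
 proof (intro exI[of _ "nat \<lceil>2 / \<delta>\<rceil> + 1"] allI impI)
  fix N assume N0: "N \<ge> nat \<lceil>2 / \<delta>\<rceil> + 1"
  have N: "0 < N" "2 / \<delta> < real N" using N0 by linarith+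
  then have Nd: "2 / real N < \<delta>" using del(1) by (simp add: field_simps)
  define y where "y i j = (real i / real N, real j / real N)" for i j :: nat
  have yK: "y i j \<in> K" if "i \<le> N" "j \<le> N" for i j using that N(1) by (simp add: y_def K_def)
  have yd: "dist (y i j) (y i' j') < \<delta>" if "i' = i \<or> i' = Suc i" "j' = j \<or> j' = Suc j" for i j i' j'
  proof -
   have "\<bar>real i / real N - real i' / real N\<bar> \<le> 1 / real N" "\<bar>real j / real N - real j' / real N\<bar> \<le> 1 / real N"
    using that by (auto simp: diff_divide_distrib[symmetric])
   moreover have "dist (y i j) (y i' j') \<le> \<bar>real i / real N - real i' / real N\<bar> + \<bar>real j / real N - real j' / real N\<bar>"
    unfolding y_def dist_Pair_Pair dist_real_def by (rule order_trans[OF sqrt_sum_squares_le_sum_abs]) simp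
   ultimately show ?thesis using Nd by linarith
  qed
  define w where "w i j = f (y i j)" for i j
  \<comment> \<open>Within the domain of one potential the two ways across a grid square give the
    same sum.\<close>
  have sq: "wt (w i j) (w i (Suc j)) + wt (w (Suc i) j) (w (Suc i) (Suc j)) = wt (w i j) (w (Suc i) j) + wt (w i (Suc j)) (w (Suc i) (Suc j))"
   if ij: "i < N" "j < N" for i j
  proof -
   from key[OF yK[of i j]] ij obtain \<psi> where "\<forall>z\<in>K. \<forall>z'\<in>K. dist (y i j) z < \<delta> --> dist (y i j) z' < \<delta> --> wt (f z) (f z') = \<psi> (f z) + \<psi> (f z')"
    by auto
   then have "wt (w i1 j1) (w i2 j2) = \<psi> (w i1 j1) + \<psi> (w i2 j2)"
    if "i1 = i \<or> i1 = Suc i" "j1 = j \<or> j1 = Suc j" "i2 = i \<or> i2 = Suc i" "j2 = j \<or> j2 = Suc j" for i1 i2 j1 j2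
    unfolding w_def using yK[of i1 j1] yK[of i2 j2] yd[of i1 i j1 j] yd[of i2 i j2 j] that ij by auto
   then show ?thesis by (simp add: add.assoc add.left_commute)
  qed
  define h where "h i = (\<Sum>j<N. wt (w i j) (w i (Suc j)))" for i
  define vv where "vv i j = wt (w i j) (w (Suc i) j)" for i j
  have row: "h i + h (Suc i) = vv i 0 + vv i N" if "i < N" for i
  proof -
   have "h i + h (Suc i) = (\<Sum>j<N. vv i j + vv i (Suc j))"
    unfolding h_def sum.distrib[symmetric] by (rule sum.cong[OF HOL.refl]) (use sq that in \<open>simp add: vv_def\<close>)
   then show ?thesis unfolding telescope2 .
  qed
  have tot: "h 0 + h N = (\<Sum>i<N. vv i 0) + (\<Sum>i<N. vv i N)"
  proof -
   have "h 0 + h N = (\<Sum>i<N. h i + h (Suc i))" by (rule telescope2[symmetric])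
   also have "\<dots> = (\<Sum>i<N. vv i 0 + vv i N)" by (rule sum.cong[OF HOL.refl]) (use row in simp)
   finally show ?thesis unfolding sum.distrib .
  qed
  \<comment> \<open>The first row is constant at a and contributes nothing, so the last row, which
    runs along the edge, equals the sum of the two outer columns.\<close>
  have "w 0 j = a" if "j \<le> N" for j using hpt(1)[OF a em] that N(1) by (simp add: w_def f_def y_def)
  then have h0: "h 0 = 0" unfolding h_def by (intro sum.neutral) (auto simp: wt_def)
  have wN: "w N j = epoint p q (real j / real N)" if "j \<le> N" for j using hpt(2)[OF a em] that N(1) by (simp add: w_def f_def y_def)
  have hN: "h N = \<omega> {p, q}"
  proof -
   let ?b = "\<lambda>j. base (w N j)"
   have b: "?b j \<in> {p, q}" if "j \<le> N" for j using base_epoint[OF pq, of "real j / real N"] wN[OF that] that N(1) by auto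
   have "h N = (\<Sum>j<N. ediff p (?b j) + ediff p (?b (Suc j)))" unfolding h_def
   proof (rule sum.cong[OF HOL.refl])
    fix j assume "j \<in> {..<N}"
    then have j: "j < N" by simp
    from key[OF yK[of N j]] j obtain \<psi> where psi: "\<forall>z\<in>K. \<forall>z'\<in>K. dist (y N j) z < \<delta> --> dist (y N j) z' < \<delta> --> wt (f z) (f z') = \<psi> (f z) + \<psi> (f z')"
     "\<forall>z q l b. z \<in> K --> dist (y N j) z < \<delta> --> wchain (f z) q l b --> l \<le> ?l * \<delta> --> b = \<psi> (f z) + \<psi> q" by auto
    have W: "wt (w N j) (w N (Suc j)) = \<psi> (w N j) + \<psi> (w N (Suc j))"
     using psi(1) yK[of N j] yK[of N "Suc j"] yd[of N N j j] yd[of N N "Suc j" j] j by (simp add: w_def)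
    have "wchain (w N j) (epoint p q (real (Suc j) / real N)) (0 + ?l * \<bar>real j / real N - real (Suc j) / real N\<bar>)
      (0 + ediff (base (epoint p q (real j / real N))) (base (epoint p q (real (Suc j) / real N))))"
     using wchain.refl[of "w N j"] wN[of j] em[of "real j / real N"] j N(1) by (intro wchain_edge_step[OF _ e]) auto
    then have WC: "wchain (f (y N j)) (w N (Suc j)) (0 + ?l * \<bar>real j / real N - real (Suc j) / real N\<bar>) (0 + ediff (?b j) (?b (Suc j)))"
     using wN[of j] wN[of "Suc j"] j unfolding w_def by simp
    have le: "0 + ?l * \<bar>real j / real N - real (Suc j) / real N\<bar> \<le> ?l * \<delta>"
     using Nd lp N(1) by (simp add: diff_divide_distrib[symmetric] field_simps)
    have "0 + ediff (?b j) (?b (Suc j)) = \<psi> (f (y N j)) + \<psi> (w N (Suc j))"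
     by (rule psi(2)[rule_format, OF _ _ WC le]) (use yK[of N j] yd[of N N j j] j in auto)
    then have "0 + ediff (?b j) (?b (Suc j)) = \<psi> (w N j) + \<psi> (w N (Suc j))" unfolding w_def .
    then have "wt (w N j) (w N (Suc j)) = ediff (?b j) (?b (Suc j))" using W by simp
    also have "\<dots> = ediff p (?b j) + ediff p (?b (Suc j))"
     using ediff_trans[of "?b j" p q p "?b (Suc j)"] b[of j] b[of "Suc j"] j by (simp add: ediff_comm)
    finally show "wt (w N j) (w N (Suc j)) = ediff p (?b j) + ediff p (?b (Suc j))" .
   qed
   also have "\<dots> = ediff p (?b 0) + ediff p (?b N)" by (rule telescope2)
   also have "\<dots> = \<omega> {p, q}" using wN[of 0] wN[of N] N(1) epoint_0[of p q] epoint_1[OF pq] pq by (simp add: ediff_def)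
   finally show ?thesis .
  qed
  have "(\<Sum>i<N. vv i 0) = vsum a (vpoint p) N" "(\<Sum>i<N. vv i N) = vsum a (vpoint q) N"
   unfolding vsum_def vv_def w_def f_def y_def using N(1) epoint_0[of p q] epoint_1[OF pq] by simp_all
  then show "\<omega> {p, q} = vsum a (vpoint p) N + vsum a (vpoint q) N" using tot h0 hN by simp
 qed
qed

text \<open>By \<open>rectangle\<close>, \<omega> is the coboundary of \<open>vsum\<close> on each
  of the three edges, and every vertex occurs twice. A common number of subdivisions makes the two
  terms at a vertex equal.\<close>

theorem triangle_vanishes:
 assumes "{u, v} \<in> edges X" "{v, w} \<in> edges X" "{w, u} \<in> edges X"
 shows "\<omega> {u, v} + \<omega> {v, w} + \<omega> {w, u} = 0"
proof -
 have a: "vpoint u \<in> M" using vpoint_in edge_verts[OF assms(1)] by simp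
 obtain A B C where N: "\<forall>N\<ge>A. \<omega> {u, v} = vsum (vpoint u) (vpoint u) N + vsum (vpoint u) (vpoint v) N"
  "\<forall>N\<ge>B. \<omega> {v, w} = vsum (vpoint u) (vpoint v) N + vsum (vpoint u) (vpoint w) N"
  "\<forall>N\<ge>C. \<omega> {w, u} = vsum (vpoint u) (vpoint w) N + vsum (vpoint u) (vpoint u) N"
  using rectangle[OF a assms(1)] rectangle[OF a assms(2)] rectangle[OF a assms(3)] by blast
 let ?N = "max A (max B C)"
 have "\<omega> {u, v} = vsum (vpoint u) (vpoint u) ?N + vsum (vpoint u) (vpoint v) ?N"
  "\<omega> {v, w} = vsum (vpoint u) (vpoint v) ?N + vsum (vpoint u) (vpoint w) ?N"
  "\<omega> {w, u} = vsum (vpoint u) (vpoint w) ?N + vsum (vpoint u) (vpoint u) ?N" using N by simp_all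
 then show ?thesis by (simp add: mod2)
qed

end

section \<open>Fillings of graph triangles\<close>

subsection \<open>Fillings modulo 2\<close>

lemma bit_add_self: "x + x = (0 :: bit)"
proof -
 have "x = 0 \<or> x = 1" by (cases "x = 0") simp_all
 then show ?thesis by auto
qed

lemma of_nat_bit: "(of_nat n :: bit) = (if odd n then 1 else 0)"
 by (induction n) (auto simp del: add_bit_eq_xor simp: bit_add_self)

lemma sum_fun_apply: "(\<Sum>a\<in>A. f a) x = (\<Sum>a\<in>A. f a x)"
 by (induction A rule: infinite_finite_induct) (auto simp del: add_bit_eq_xor)

text \<open>Over the field of two elements, linear combinations are finite sums of distinct members,
  so \<tau> lies outside the span of S. A basis of the span stays independent when \<tau> is added,
  and a functional can be prescribed on it.\<close>

lemma separating_functional: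
 fixes S :: "('a => bit) set"
 assumes "\<And>t. finite t ==> t \<subseteq> S ==> \<tau> \<noteq> \<Sum>t"
 obtains g :: "('a => bit) => bit" where "\<And>x y. g (x + y) = g x + g y" "g \<tau> = 1" "\<And>s. s \<in> S ==> g s = 0"
proof -
 define scale where "scale a f = (\<lambda>x. a * f x)" for a :: bit and f :: "'a => bit"
 interpret V: vector_space scale
  by unfold_locales (simp_all add: scale_def fun_eq_iff ring_distribs mult.assoc del: add_bit_eq_xor mult_bit_eq_and)
 interpret F: vector_space "(*) :: bit => bit => bit"
  by unfold_locales (simp_all add: ring_distribs mult.assoc del: add_bit_eq_xor mult_bit_eq_and)
 interpret P: vector_space_pair scale "(*) :: bit => bit => bit" ..
 have "\<tau> \<notin> V.span S"
 proof
  assume "\<tau> \<in> V.span S"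
  then obtain t r where t: "finite t" "t \<subseteq> S" "\<tau> = (\<Sum>a\<in>t. scale (r a) a)" unfolding V.span_explicit by blast
  have "(\<Sum>a\<in>t. scale (r a) a) = (\<Sum>a\<in>t. if r a = 1 then a else 0)"
   by (rule sum.cong[OF HOL.refl]) (auto simp: scale_def fun_eq_iff)
  also have "\<dots> = \<Sum>{a \<in> t. r a = 1}" using t(1) by (simp add: sum.inter_filter)
  finally show False using assms[of "{a \<in> t. r a = 1}"] t by auto
 qed
 moreover obtain B where B: "B \<subseteq> S" "V.independent B" "S \<subseteq> V.span B" by (rule V.maximal_independent_subset)
 moreover have "V.span B = V.span S" using B by (meson V.span_eq V.span_superset order_trans)
 ultimately have "V.independent (insert \<tau> B)" "\<tau> \<notin> B" using V.independent_insertI[of \<tau> B] V.span_base[of \<tau> B] by auto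
 from P.linear_independent_extend[OF this(1), of "\<lambda>x. if x = \<tau> then 1 else 0"] this(2)
 obtain g where g': "Vector_Spaces.linear scale (*) g" "\<forall>x\<in>insert \<tau> B. g x = (if x = \<tau> then 1 else 0)" by blast
 note g = g'(1)
 have g\<tau>: "g \<tau> = 1" and gB: "\<And>b. b \<in> B ==> g b = 0" using g'(2) \<open>\<tau> \<notin> B\<close> by auto
 have "g s = 0" if "s \<in> S" for s
  by (rule P.linear_eq_0_on_span[OF g, of B]) (use gB that B in auto)
 then show ?thesis by (intro that[of g] P.linear_add[OF g] g\<tau>)
qed

context npc_complex begin

definition sides :: "'c => 'v set set" where
 "sides c = (\<lambda>k. {bds c ! k, nxt (bds c) k}) ` {..<len c}"

text \<open>Two sides could have the same ends only if each followed the other, in a cycle of length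
  2.\<close>

lemma sides_inj: assumes c: "c \<in> cells X" shows "inj_on (\<lambda>k. {bds c ! k, nxt (bds c) k}) {..<len c}"
proof (rule inj_onI)
 fix i j assume ij: "i \<in> {..<len c}" "j \<in> {..<len c}" "{bds c ! i, nxt (bds c) i} = {bds c ! j, nxt (bds c) j}"
 have d: "distinct (bds c)" by (rule cell_distinct[OF c])
 have "i = j \<or> (i = Suc j mod len c \<and> j = Suc i mod len c)"
 proof -
  have E: "bds c ! a = bds c ! b ==> a = b" if "a < len c" "b < len c" for a b
   using that d by (simp add: nth_eq_iff_index_eq)
  have l: "i < len c" "j < len c" "Suc i mod len c < len c" "Suc j mod len c < len c" using ij(1,2) Suc_mod[OF c] by auto
  from ij(3) show ?thesis unfolding nxt_def doubleton_eq_iff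
   using E[OF l(1,2)] E[OF l(1,4)] E[OF l(3,2)] by metis
 qed
 moreover have "\<not> (i = Suc j mod len c \<and> j = Suc i mod len c)"
 proof
  assume m: "i = Suc j mod len c \<and> j = Suc i mod len c"
  from cell_len[OF c] show False
  proof
   assume l: "len c = 3"
   have "j < 3" using ij(2) l by simp
   moreover have "i = Suc j mod 3 \<and> j = Suc i mod 3" using m unfolding l .
   ultimately show False by presburger
  next
   assume l: "len c = 5"
   have "j < 5" using ij(2) l by simp
   moreover have "i = Suc j mod 5 \<and> j = Suc i mod 5" using m unfolding l .
   ultimately show False by presburger
  qed
 qed
 ultimately show "i = j" by blast
qed

lemma pages_sides: "c \<in> pages u v \<longleftrightarrow> c \<in> cells X \<and> {u, v} \<in> sides c"
 by (auto simp: pages_def is_side_def sides_def)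

text \<open>If the triangle were not a finite sum of cell boundaries, a functional vanishing on
  these but not on the triangle would give, by its values on edges, a cocycle contradicting
  \<open>triangle_vanishes\<close>.\<close>

theorem mod2_filling:
 assumes e: "{u, v} \<in> edges X" "{v, w} \<in> edges X" "{w, u} \<in> edges X"
 obtains D where "finite D" "D \<subseteq> cells X" "\<And>e. odd (card {c \<in> D. e \<in> sides c}) \<longleftrightarrow> e \<in> {{u, v}, {v, w}, {w, u}}"
proof -
 define ch where "ch e = (\<lambda>e'. if e' = e then 1 else 0 :: bit)" for e :: "'v set"
 define E0 where "E0 = {{u, v}, {v, w}, {w, u}}"
 have dist: "{u, v} \<noteq> {v, w}" "{v, w} \<noteq> {w, u}" "{w, u} \<noteq> {u, v}" using edge_neq[OF e(1)] edge_neq[OF e(2)] edge_neq[OF e(3)]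
  by (auto simp: doubleton_eq_iff)
 define bvec where "bvec c = (\<Sum>e\<in>sides c. ch e)" for c
 \<comment> \<open>Edges on no cell and outside the triangle are added as generators to make the
   functional vanish on them, as \<open>free0\<close> demands. They are dropped at the end, since
   they do not affect the coefficient of any other edge.\<close>
 define S where "S = bvec ` cells X \<union> ch ` {{p, q} | p q. {p, q} \<in> edges X \<and> pages p q = {} \<and> {p, q} \<notin> E0}"
 define \<tau> where "\<tau> = (\<Sum>e\<in>E0. ch e)"
 have ch_sum: "(\<Sum>e\<in>A. ch e) x = (if x \<in> A then 1 else 0)" if "finite A" for A x
  using that unfolding sum_fun_apply ch_def by (simp add: sum.delta)
 have "\<exists>t. finite t \<and> t \<subseteq> S \<and> \<tau> = \<Sum>t"
 proof (rule ccontr)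
  assume "\<not> ?thesis"
  then obtain g :: "('v set => bit) => bit" where g: "\<And>x y. g (x + y) = g x + g y" "g \<tau> = 1" "\<And>s. s \<in> S ==> g s = 0"
   using separating_functional[of S \<tau>] by (metis (no_types, lifting))
  have g0: "g 0 = 0" using g(1)[of 0 0] bit_add_self by (simp del: add_bit_eq_xor)
  have gs: "g (\<Sum>e\<in>A. ch e) = (\<Sum>e\<in>A. g (ch e))" for A
   by (induction A rule: infinite_finite_induct) (simp_all only: sum.infinite sum.empty sum.insert g0 g(1) not_False_eq_True)
  interpret cocycle X "\<lambda>e. g (ch e)" E0
  proof
   show "x + x = 0" for x :: bit by (rule bit_add_self)
   show "finite E0" "E0 \<subseteq> edges X" using e by (auto simp: E0_def)
   show "(\<Sum>k<len c. g (ch {bds c ! k, nxt (bds c) k})) = 0" if c: "c \<in> cells X" for c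
   proof -
    have "(\<Sum>k<len c. g (ch {bds c ! k, nxt (bds c) k})) = (\<Sum>e\<in>sides c. g (ch e))"
     unfolding sides_def by (subst sum.reindex[OF sides_inj[OF c]]) simp
    also have "\<dots> = g (bvec c)" by (simp add: bvec_def gs)
    finally show ?thesis using g(3)[of "bvec c"] c by (simp add: S_def)
   qed
   show "g (ch {p, q}) = 0" if "{p, q} \<in> edges X" "pages p q = {}" "{p, q} \<notin> E0" for p q
    by (rule g(3), unfold S_def, intro UnI2 imageI) (use that in blast)
  qed
  have "g \<tau> = g (ch {u, v}) + g (ch {v, w}) + g (ch {w, u})"
   unfolding \<tau>_def gs E0_def using dist by (simp add: add.assoc del: add_bit_eq_xor)
  then show False using triangle_vanishes[OF e] g(2) by (simp del: add_bit_eq_xor)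
 qed
 then obtain t where t: "finite t" "t \<subseteq> S" "\<tau> = \<Sum>t" by blast
 \<comment> \<open>Cells with equal boundaries give the same generator; one cell is chosen for each
   generator in use.\<close>
 define D where "D = inv_into (cells X) bvec ` (t \<inter> bvec ` cells X)"
 have Dc: "D \<subseteq> cells X" "finite D" using t(1) by (auto simp: D_def intro: inv_into_into)
 have bD: "(\<Sum>c\<in>D. bvec c) = \<Sum>(t \<inter> bvec ` cells X)"
  unfolding D_def by (subst sum.reindex) (auto simp: inj_on_inv_into f_inv_into_f)
 have "odd (card {c \<in> D. x \<in> sides c}) \<longleftrightarrow> x \<in> E0" for x
 proof (cases "\<exists>p q. x = {p, q} \<and> pages p q = {} \<and> x \<notin> E0")
  case True
  then have "{c \<in> D. x \<in> sides c} = {}" using Dc(1) pages_sides by fastforce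
  moreover have "x \<notin> E0" using True by blast
  ultimately show ?thesis by (simp only: card.empty even_zero simp_thms)
 next
  case False
  have F0: "(\<Sum>f\<in>t - bvec ` cells X. f x) = 0"
  proof (rule sum.neutral, rule ballI)
   fix f assume "f \<in> t - bvec ` cells X"
   then obtain p q where "f = ch {p, q}" "pages p q = {}" "{p, q} \<notin> E0" using t(2) unfolding S_def by auto
   then show "f x = 0" using False by (auto simp: ch_def)
  qed
  have fs: "finite (sides c)" for c by (simp add: sides_def)
  have "(if x \<in> E0 then 1 else 0) = \<tau> x" unfolding \<tau>_def by (subst ch_sum) (auto simp: E0_def)
  also have "\<dots> = (\<Sum>f\<in>t. f x)" unfolding t(3) sum_fun_apply ..
  also have "\<dots> = (\<Sum>f\<in>t \<inter> bvec ` cells X. f x) + (\<Sum>f\<in>t - bvec ` cells X. f x)" by (rule sum.Int_Diff[OF t(1)])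
  also have "\<dots> = (\<Sum>c\<in>D. bvec c x)" unfolding F0 using bD[THEN fun_cong, of x] by (simp add: sum_fun_apply del: add_bit_eq_xor)
  also have "\<dots> = (\<Sum>c\<in>D. if x \<in> sides c then 1 else 0)" unfolding bvec_def ch_sum[OF fs] ..
  also have "\<dots> = of_nat (card {c \<in> D. x \<in> sides c})" using Dc(2) by (simp add: sum.If_cases Int_def)
  finally show ?thesis unfolding of_nat_bit by (auto split: if_splits)
 qed
 then show ?thesis using that[OF Dc(2,1)] by (simp add: E0_def)
qed

subsection \<open>Subgraphs of links\<close>

definition degree_in :: "('c \<times> nat) set => 'v => nat" where
 "degree_in A p = card {q \<in> A. p \<in> corner_ends X q}"

definition lpath :: "('c \<times> nat) set => (nat => 'v) => (nat => 'c \<times> nat) => nat => bool" where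
 "lpath A u q n \<longleftrightarrow> inj_on u {..n} \<and> (\<forall>i<n. q i \<in> A \<and> corner_ends X (q i) = {u i, u (Suc i)})"

lemma corner_ends_card: assumes "q \<in> corners X v" shows "card (corner_ends X q) = 2"
proof -
 obtain c k where q: "q = (c, k)" by (cases q)
 show ?thesis using corner_sides(3)[of c k v] assms unfolding q corner_ends_alt by simp
qed

lemma corner_ends_other:
 assumes "q \<in> corners X v" "p \<in> corner_ends X q" obtains w where "w \<noteq> p" "corner_ends X q = {p, w}"
proof -
 obtain a b where "corner_ends X q = {a, b}" "a \<noteq> b" using corner_ends_card[OF assms(1)] unfolding card_2_iff by blast
 then show ?thesis using that[of a] that[of b] assms(2) by (auto simp: insert_commute)
qed

lemma walk_parity:
 assumes "\<And>i. i < n ==> u i \<noteq> u (Suc i)"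
 shows "odd (card {i. i < n \<and> p \<in> {u i, u (Suc i)}}) \<longleftrightarrow> (p = u 0) \<noteq> (p = u n)"
 using assms
proof (induction n)
 case (Suc n)
 have *: "{i. i < Suc n \<and> p \<in> {u i, u (Suc i)}} = {i. i < n \<and> p \<in> {u i, u (Suc i)}} \<union> (if p \<in> {u n, u (Suc n)} then {n} else {})"
  by (auto simp: less_Suc_eq)
 have c: "card {i. i < Suc n \<and> p \<in> {u i, u (Suc i)}} = card {i. i < n \<and> p \<in> {u i, u (Suc i)}} + (if p \<in> {u n, u (Suc n)} then 1 else 0)"
  unfolding * by (subst card_Un_disjoint) auto
 have ne: "u n \<noteq> u (Suc n)" using Suc.prems by blast
 have IH: "odd (card {i. i < n \<and> p \<in> {u i, u (Suc i)}}) \<longleftrightarrow> (p = u 0) \<noteq> (p = u n)"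
  by (rule Suc.IH) (use Suc.prems in simp)
 have "odd (card {i. i < n \<and> p \<in> {u i, u (Suc i)}} + (if p \<in> {u n, u (Suc n)} then 1 else 0)) \<longleftrightarrow> (p = u 0) \<noteq> (p = u (Suc n))"
 proof (cases "p \<in> {u n, u (Suc n)}")
  case True
  then have "(p = u n) \<noteq> (p = u (Suc n))" using ne by blast
  then show ?thesis using IH True by (simp only: if_True odd_add odd_one simp_thms)
 next
  case False then show ?thesis using IH by simp
 qed
 then show ?case unfolding c .
qed simp

text \<open>Each passage of the walk through p uses two corners; only the two ends of the walk
  contribute a single one.\<close>

lemma walk_degree:
 assumes "inj_on q {..<n}" "\<And>i. i < n ==> q i \<in> corners X v \<and> corner_ends X (q i) = {u i, u (Suc i)}"
 shows "odd (degree_in (q ` {..<n}) p) \<longleftrightarrow> (p = u 0) \<noteq> (p = u n)"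
proof -
 have "{x \<in> q ` {..<n}. p \<in> corner_ends X x} = q ` {i. i < n \<and> p \<in> {u i, u (Suc i)}}" using assms(2) by auto
 then have "degree_in (q ` {..<n}) p = card {i. i < n \<and> p \<in> {u i, u (Suc i)}}"
  unfolding degree_in_def by (simp, subst card_image) (auto intro: inj_on_subset[OF assms(1)])
 moreover have "u i \<noteq> u (Suc i)" if "i < n" for i
  using corner_ends_card[of "q i" v] assms(2)[OF that] by (auto simp: card_insert_if split: if_splits)
 ultimately show ?thesis using walk_parity[of n u p] by simp
qed

lemma degree_diff: assumes "finite A" "B \<subseteq> A" shows "degree_in A p = degree_in B p + degree_in (A - B) p"
proof -
 have "{q \<in> A. p \<in> corner_ends X q} = {q \<in> B. p \<in> corner_ends X q} \<union> {q \<in> A - B. p \<in> corner_ends X q}" using assms by auto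
 then show ?thesis unfolding degree_in_def using assms by (simp, subst card_Un_disjoint) (auto intro: finite_subset)
qed

lemma degree_other:
 assumes "finite A" "q \<in> A" "p \<in> corner_ends X q" "even (degree_in A p)"
 obtains q' where "q' \<in> A" "q' \<noteq> q" "p \<in> corner_ends X q'"
proof -
 have "{q \<in> A. p \<in> corner_ends X q} \<noteq> {q}"
 proof
  assume "{q \<in> A. p \<in> corner_ends X q} = {q}"
  then have "degree_in A p = 1" by (simp add: degree_in_def)
  then show False using assms(4) by simp
 qed
 then show ?thesis using that assms(2,3) by blast
qed

lemma even_leafless:
 assumes "finite A" "A \<noteq> {}" "A \<subseteq> corners X v" "\<And>p. even (degree_in A p)" shows "leafless v A"
 unfolding leafless_def using assms degree_other[OF assms(1) _ _ assms(4)] by metis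

lemma loop_degree: assumes "link_loop X v Q" shows "even (degree_in Q p)"
proof -
 obtain n u q where l: "2 \<le> n" "Q = q ` {..<n}" "inj_on q {..<n}" "inj_on u {..<n}" "u n = u (0::nat)"
  "\<And>i. i < n ==> q i \<in> corners X v \<and> corner_ends X (q i) = {u i, u (Suc i)}"
  by (rule loop_sequences[OF assms]) (rule that)
 show ?thesis using walk_degree[OF l(3,6), of p] l(2,5) by simp
qed

lemma loop_finite: assumes "link_loop X v Q" shows "finite Q" "Q \<noteq> {}" "Q \<subseteq> corners X v"
 using assms unfolding link_loop_def by (auto simp: length_greater_0_conv[symmetric] simp del: length_greater_0_conv)

text \<open>A path visits distinct vertices among the finitely many ends of corners in A and its
  start, so its length is bounded.\<close>

lemma maximal_path:
 assumes A: "finite A" "A \<subseteq> corners X v"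
 obtains u q n where "u 0 = s" "lpath A u q n" "\<And>q'. q' \<in> A ==> u n \<in> corner_ends X q' ==> corner_ends X q' \<subseteq> u ` {..n}"
proof -
 define P where "P n \<longleftrightarrow> (\<exists>u q. u 0 = s \<and> lpath A u q n)" for n
 have fin: "finite (insert s (\<Union>q\<in>A. corner_ends X q))" using A(1) by (auto simp: corner_ends_def split: prod.splits)
 have bound: "n \<le> card (insert s (\<Union>q\<in>A. corner_ends X q))" if "P n" for n
 proof -
  obtain u q where u: "u 0 = s" "lpath A u q n" using \<open>P n\<close> unfolding P_def by blast
  have "u i \<in> insert s (\<Union>q\<in>A. corner_ends X q)" if "i \<le> n" for i
  proof (cases i)
   case (Suc j)
   then have "q j \<in> A" "u i \<in> corner_ends X (q j)" using u(2) that unfolding lpath_def by auto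
   then show ?thesis by blast
  qed (use u in simp)
  then have "card (u ` {..n}) \<le> card (insert s (\<Union>q\<in>A. corner_ends X q))" by (intro card_mono[OF fin]) auto
  then show ?thesis using u(2) by (simp add: lpath_def card_image)
 qed
 have P0: "P 0" unfolding P_def by (intro exI[of _ "\<lambda>_. s"]) (auto simp: lpath_def)
 have "\<exists>n. P n \<and> (\<forall>m. P m --> m \<le> n)" by (rule Nat.ex_has_greatest_nat[of P, OF P0]) (use bound in blast)
 then obtain n where n: "P n" "\<And>m. P m ==> m \<le> n" by blast
 from n(1) obtain u q where u: "u 0 = s" "lpath A u q n" unfolding P_def by blast
 show ?thesis
 proof (rule that[OF u])
  fix q' assume q': "q' \<in> A" "u n \<in> corner_ends X q'"
  show "corner_ends X q' \<subseteq> u ` {..n}"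
  proof (rule ccontr)
   assume "\<not> ?thesis"
   then obtain w where w: "w \<in> corner_ends X q'" "w \<notin> u ` {..n}" by blast
   have q'v: "q' \<in> corners X v" using q'(1) A(2) by blast
   have "w \<noteq> u n" using w(2) by auto
   then have ew: "corner_ends X q' = {u n, w}" using corner_ends_other[OF q'v q'(2)] w(1) by blast
   have i1: "inj_on (u(Suc n := w)) {..n}"
    by (rule inj_on_cong[THEN iffD1, of _ u]) (use u(2) in \<open>auto simp: lpath_def\<close>)
   have im: "(u(Suc n := w)) ` {..n} = u ` {..n}" by (rule image_cong) auto
   have "inj_on (u(Suc n := w)) {..Suc n}" unfolding atMost_Suc inj_on_insert using i1 im w(2) by auto
   moreover have "(q(n := q')) i \<in> A \<and> corner_ends X ((q(n := q')) i) = {(u(Suc n := w)) i, (u(Suc n := w)) (Suc i)}" if "i < Suc n" for i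
    using u(2) that ew q'(1) by (cases "i = n") (auto simp: lpath_def)
   ultimately have "lpath A (u(Suc n := w)) (q(n := q')) (Suc n)" unfolding lpath_def by blast
   moreover have "(u(Suc n := w)) 0 = s" using u(1) by simp
   ultimately have "P (Suc n)" unfolding P_def by blast
   then show False using n(2) by fastforce
  qed
 qed
qed

text \<open>A further corner at the end of the path returns to an earlier vertex, and the path from
  there on closes to a loop. It may consist of two corners only, as the link can have multiple
  edges.\<close>

lemma close_path:
 assumes A: "A \<subseteq> corners X v" and p: "lpath A u q n" "0 < n"
  and q': "q' \<in> A" "q' \<noteq> q (n - 1)" "u n \<in> corner_ends X q'" "corner_ends X q' \<subseteq> u ` {..n}"
 obtains Q where "Q \<subseteq> A" "link_loop X v Q"
proof -
 have inj: "u a = u b \<longleftrightarrow> a = b" if "a \<le> n" "b \<le> n" for a b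
  using p(1) that unfolding lpath_def by (auto simp: inj_on_eq_iff)
 have qe: "q i \<in> A" "corner_ends X (q i) = {u i, u (Suc i)}" if "i < n" for i using p(1) that by (auto simp: lpath_def)
 obtain j where j: "j < n" "corner_ends X q' = {u n, u j}"
 proof -
  obtain w where w: "w \<noteq> u n" "corner_ends X q' = {u n, w}"
   by (rule corner_ends_other[of q' v "u n"]) (use q' A in blast, rule q', rule that)
  then obtain j where "j \<le> n" "w = u j" using q'(4) by auto
  then show ?thesis using that[of j] w by (cases "j = n") auto
 qed
 have qd: "q a \<noteq> q b" if "a < n" "b < n" "a \<noteq> b" for a b
 proof
  assume "q a = q b"
  then have "{u a, u (Suc a)} = {u b, u (Suc b)}" using qe that by metis
  then show False using inj[of a b] inj[of a "Suc b"] inj[of "Suc a" b] that by (auto simp: doubleton_eq_iff)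
 qed
 have q'd: "q' \<noteq> q i" if "j \<le> i" "i < n" for i
 proof
  assume e: "q' = q i"
  then have "{u n, u j} = {u i, u (Suc i)}" using qe(2)[OF that(2)] j(2) by simp
  then have "n = Suc i" using inj[of n i] inj[of n "Suc i"] that by (auto simp: doubleton_eq_iff)
  then show False using q'(2) e by simp
 qed
 define us where "us = map u [j..<Suc n]"
 define qs where "qs = map q [j..<n] @ [q']"
 have l: "length us = Suc n - j" "length qs = Suc n - j" using j by (auto simp: us_def qs_def)
 have "link_loop X v (set qs)"
  unfolding link_loop_def
 proof (intro exI[of _ us] exI[of _ qs] conjI refl allI impI)
  show "length us = length qs" "2 \<le> length qs" using l j by auto
  show "distinct us" unfolding us_def using inj by (auto simp: distinct_map inj_on_def simp del: upt_Suc)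
  have "inj_on q {j..<n}" by (rule inj_onI) (metis qd atLeastLessThan_iff)
  moreover have "q' \<notin> q ` {j..<n}" using q'd by (metis imageE atLeastLessThan_iff)
  ultimately show "distinct qs" unfolding qs_def by (simp add: distinct_map)
  show "set qs \<subseteq> corners X v" using A qe q' by (auto simp: qs_def)
  fix i assume i: "i < length qs"
  have un: "us ! i = u (j + i)" if "i < Suc n - j" for i unfolding us_def using that j by (subst nth_map) (auto simp del: upt_Suc)
  show "corner_ends X (qs ! i) = {us ! i, nxt us i}"
  proof (cases "i = n - j")
   case True
   then have "qs ! i = q'" by (simp add: qs_def nth_append)
   moreover have "Suc i mod length us = 0" using True l j by (simp add: Suc_diff_le)
   ultimately show ?thesis using j True un[of i] un[of 0] by (simp add: nxt_def)
  next
   case False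
   then have i': "i < n - j" using i l by auto
   then have "qs ! i = q (j + i)" by (simp add: qs_def nth_append)
   moreover have "Suc i mod length us = Suc i" using i' l by simp
   ultimately show ?thesis using i' un[of i] un[of "Suc i"] qe(2)[of "j + i"] by (simp add: nxt_def)
  qed
 qed simp
 then show ?thesis using that[of "set qs"] qe q' by (force simp: qs_def)
qed

lemma leafless_loop: assumes L: "leafless v A" obtains Q where "Q \<subseteq> A" "link_loop X v Q"
proof -
 have A: "finite A" "A \<subseteq> corners X v" "A \<noteq> {}" using L by (auto simp: leafless_def)
 then obtain q0 where q0: "q0 \<in> A" by blast
 then have "card (corner_ends X q0) = 2" using corner_ends_card A(2) by blast
 then obtain s s' where s: "corner_ends X q0 = {s, s'}" "s \<noteq> s'" unfolding card_2_iff by blast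
 obtain u q n where u: "u 0 = s" "lpath A u q n" "\<And>q'. q' \<in> A ==> u n \<in> corner_ends X q' ==> corner_ends X q' \<subseteq> u ` {..n}"
  by (rule maximal_path[OF A(1,2)]) (rule that)
 have n: "0 < n" using u(3)[OF q0] u(1) s by (cases n) auto
 then have "q (n - 1) \<in> A" "u n \<in> corner_ends X (q (n - 1))" using u(2) unfolding lpath_def by auto
 then obtain q' where q': "q' \<in> A" "q' \<noteq> q (n - 1)" "u n \<in> corner_ends X q'" using L unfolding leafless_def by metis
 show ?thesis by (rule close_path[OF A(2) u(2) n q' u(3)[OF q'(1,3)]]) (rule that)
qed

text \<open>A subgraph with all degrees even is an edge-disjoint union of loops, which are removed
  one by one.\<close>

lemma even_sum:
 fixes f g :: "'c \<times> nat => real"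
 assumes loops: "\<And>Q. link_loop X v Q ==> sum f Q = sum g Q"
  and A: "finite A" "A \<subseteq> corners X v" "\<And>p. even (degree_in A p)"
 shows "sum f A = sum g A"
 using A
proof (induction "card A" arbitrary: A rule: less_induct)
 case less
 show ?case
 proof (cases "A = {}")
  case False
  obtain Q where Q: "Q \<subseteq> A" "link_loop X v Q"
   by (rule leafless_loop[OF even_leafless[OF less.prems(1) False less.prems(2,3)]]) (rule that)
  have "sum f (A - Q) = sum g (A - Q)"
  proof (rule less.hyps)
   have "A - Q \<subset> A" using Q(1) loop_finite(2)[OF Q(2)] by blast
   then show "card (A - Q) < card A" using psubset_card_mono less.prems(1) by blast
   show "even (degree_in (A - Q) p)" for p
    using degree_diff[OF less.prems(1) Q(1), of p] loop_degree[OF Q(2), of p] less.prems(3)[of p] by simp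
  qed (use less.prems in auto)
  then show ?thesis using sum.subset_diff[OF Q(1) less.prems(1), of f] sum.subset_diff[OF Q(1) less.prems(1), of g] loops[OF Q(2)] by simp
 qed simp
qed

text \<open>A maximal path from a can stop only at b, since at any other vertex the degree is even
  and a loop would close. What remains off the path has even degrees, so it would be leafless if it
  were not empty.\<close>

lemma two_odd_path:
 assumes A: "finite A" "A \<subseteq> corners X z" and odd: "\<And>p. odd (degree_in A p) \<longleftrightarrow> p = a \<or> p = b" and ab: "a \<noteq> b"
  and no: "\<And>Q. Q \<subseteq> A ==> \<not> leafless z Q"
 obtains u q n where "0 < n" "u 0 = a" "u n = b" "inj_on q {..<n}" "A = q ` {..<n}"
  "\<And>i. i < n ==> q i \<in> corners X z \<and> corner_ends X (q i) = {u i, u (Suc i)}"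
proof -
 have nl: "\<not> link_loop X z Q" if "Q \<subseteq> A" for Q
  using no[OF that] even_leafless[of Q z] loop_finite[of z Q] loop_degree[of z Q] by blast
 obtain u q n where u: "u 0 = a" "lpath A u q n" "\<And>q'. q' \<in> A ==> u n \<in> corner_ends X q' ==> corner_ends X q' \<subseteq> u ` {..n}"
  by (rule maximal_path[OF A]) (rule that)
 have qe: "q i \<in> A" "corner_ends X (q i) = {u i, u (Suc i)}" if "i < n" for i using u(2) that by (auto simp: lpath_def)
 have "{q \<in> A. a \<in> corner_ends X q} \<noteq> {}" using odd[of a] unfolding degree_in_def by (metis card.empty even_zero)
 then obtain q0 where q0: "q0 \<in> A" "a \<in> corner_ends X q0" by blast
 have n: "0 < n"
 proof (rule ccontr)
  assume "\<not> 0 < n"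
  then have "corner_ends X q0 \<subseteq> {a}" using u(3)[OF q0(1)] q0(2) u(1) by simp
  then show False using corner_ends_card[of q0 z] q0 A(2) by (auto simp: subset_singleton_iff)
 qed
 have na: "u n \<noteq> a" using u(1,2) n unfolding lpath_def by (auto simp: inj_on_def)
 have l: "q (n - 1) \<in> A" "u n \<in> corner_ends X (q (n - 1))" using qe[of "n - 1"] n by auto
 have "u n = b"
 proof (rule ccontr)
  assume "u n \<noteq> b"
  then have "even (degree_in A (u n))" using odd na by blast
  then obtain q' where q': "q' \<in> A" "q' \<noteq> q (n - 1)" "u n \<in> corner_ends X q'"
   by (rule degree_other[OF A(1) l]) (rule that)
  obtain Q where "Q \<subseteq> A" "link_loop X z Q"
   by (rule close_path[OF A(2) u(2) n q' u(3)[OF q'(1,3)]]) (rule that)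
  then show False using nl by blast
 qed
 have iq: "inj_on q {..<n}"
 proof (rule inj_onI)
  fix i j assume ij: "i \<in> {..<n}" "j \<in> {..<n}" "q i = q j"
  then have "{u i, u (Suc i)} = {u j, u (Suc j)}" using qe[of i] qe[of j] by simp
  moreover have "u s = u t \<longleftrightarrow> s = t" if "s \<le> n" "t \<le> n" for s t using u(2) that unfolding lpath_def by (auto simp: inj_on_eq_iff)
  ultimately show "i = j" using ij(1,2) by (auto simp: doubleton_eq_iff)
 qed
 have f: "q i \<in> corners X z \<and> corner_ends X (q i) = {u i, u (Suc i)}" if "i < n" for i using qe[OF that] A(2) by blast
 have sub: "q ` {..<n} \<subseteq> A" using qe by auto
 have "A - q ` {..<n} = {}"
 proof (rule ccontr)
  assume "A - q ` {..<n} \<noteq> {}"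
  moreover have "even (degree_in (A - q ` {..<n}) p)" for p
   using degree_diff[OF A(1) sub, of p] walk_degree[OF iq f, of p] odd[of p] ab u(1) \<open>u n = b\<close> by auto
  ultimately have "leafless z (A - q ` {..<n})" using A by (intro even_leafless) auto
  then show False using no by blast
 qed
 then have "A = q ` {..<n}" using sub by blast
 then show ?thesis by (intro that[OF n u(1) \<open>u n = b\<close> iq _ f])
qed

lemma incell_epoint_page:
 assumes "c \<in> cells X" "epoint p q t \<in> M" "incell c (epoint p q t)" "0 < t" "t < 1" "p \<noteq> q"
 shows "c \<in> pages p q"
proof -
 have "epoint p q t \<noteq> Inner c w" for w by (simp add: epoint_def)
 then obtain k u v t' where k: "is_side c k u v" "epoint p q t = epoint u v t'" "0 \<le> t'" "t' \<le> 1"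
  using incell_Skel_side[OF assms(1-3)] by metis
 have "{p, q} = {u, v}" using epoint_eq_iff[OF assms(6) _ assms(4,5) k(2-4)] is_side_neq[OF assms(1) k(1)] by simp
 then show ?thesis using k assms(1) by (auto simp: pages_def is_side_def)
qed

text \<open>Take a near v on a side of the loop. By \<open>vertex_extension\<close> some geodesic
  from a runs through v to a point x in a corner of the loop. If the loop were shorter than 2 \<pi>,
  one of the two ways around from a to x would have an angle below \<pi>, and its chord would be a
  strict shortcut.\<close>

theorem link_condition:
 assumes L: "link_loop X v Q"
 shows "2 * pi \<le> angular_length X Q"
proof (rule ccontr)
 assume neg: "\<not> ?thesis"
 obtain n p q where l: "2 \<le> n" "Q = q ` {..<n}" "inj_on q {..<n}" "inj_on p {..<n}" "p n = p (0::nat)"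
  "\<And>i. i < n ==> q i \<in> corners X v \<and> corner_ends X (q i) = {p i, p (Suc i)}"
  by (rule loop_sequences[OF L]) (rule that)
 define c where "c i = fst (q i)" for i
 have cq: "(c i, snd (q i)) = q i" for i by (simp add: c_def)
 have w: "lwalk v p c n" unfolding lwalk_def crn_def using l(6) cq by metis
 have ang: "corner_angle X (q i) = cang (c i) v (p i) (p (Suc i))" if "i < n" for i
  using corner_angle_cang[of "c i" "snd (q i)" v "p i" "p (Suc i)"] l(6)[OF that] cq by simp
 have total: "angular_length X Q = wang v p c n"
  unfolding angular_length_def l(2) wang_def using ang by (subst sum.reindex[OF l(3)]) simp
 have small: "wang v p c n < 2 * pi" using neg total by simp
 have leaf: "leafless v Q" by (rule even_leafless[OF loop_finite[OF L] loop_degree[OF L]])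
 obtain R where R: "0 < R" "\<forall>i<n. good R (c i) v (p i) (p (Suc i))" by (rule uniform_good[OF w]) (rule that)
 define s where "s = R / 2"
 have s: "0 < s" "s < R" using R by (auto simp: s_def)
 have c0: "crn (c 0) v (p 0) (p (Suc 0))" "good R (c 0) v (p 0) (p (Suc 0))" using w R l(1) by (auto simp: lwalk_def)
 let ?l = "elen X {v, p 0}"
 have sl: "s \<le> ?l" "0 < ?l" using c0(2) s elen_pos[OF crn_facts(4)[OF c0(1)]] unfolding good_def by auto
 define a where "a = epoint v (p 0) (s / ?l)"
 have aM: "a \<in> M" using epoint_in[OF crn_facts(4)[OF c0(1)]] s sl by (simp add: a_def)
 have dav: "d a (vpoint v) = s"
  using edge_geodesic[OF crn_facts(4,2)[OF c0(1)], of 0 "s / ?l"] s sl sym[of a] by (simp add: a_def epoint_0)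
 obtain R1 where R1: "0 < R1" "\<And>r. 0 < r ==> r < R1 ==> \<exists>(c, k)\<in>Q. \<exists>x\<in>M. incell c x \<and>
   dist (cpos c x) (vpos c v) = r \<and> d a x = d a (vpoint v) + r"
  by (rule vertex_extension[OF leaf aM]) (rule that)
 define r where "r = min R R1 / 2"
 have r: "0 < r" "r < R" "r < R1" using R R1 by (auto simp: r_def)
 from R1(2)[OF r(1,3)] obtain c' k x where x: "(c', k) \<in> Q" "x \<in> M" "incell c' x"
  "dist (cpos c' x) (vpos c' v) = r" "d a x = s + r" using dav by auto
 then obtain i where i: "i < n" "q i = (c', k)" using l(2) by auto
 then have ci: "c' = c i" by (simp add: c_def)
 have cri: "crn (c i) v (p i) (p (Suc i))" using w i by (simp add: lwalk_def)
 obtain \<phi> where ph: "0 \<le> \<phi>" "\<phi> \<le> cang (c i) v (p i) (p (Suc i))" "cpos (c i) x = sec (c i) v (p i) (p (Suc i)) (of_real r * cis \<phi>)"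
  by (rule sector_cover[OF cri x(2) x(3,4)[unfolded ci] r(1)]) (rule that)
 have xw: "x = wpt v p c i r \<phi>"
  unfolding wpt_def spt_def ph(3)[symmetric] using cpt_unique[OF crn_facts(1)[OF cri] x(2) x(3)[unfolded ci]] by simp
 have strict: "dist (of_real s) (of_real r * cis \<theta>) < s + r" if "0 \<le> \<theta>" "\<theta> < pi" for \<theta>
 proof -
  have "(dist (of_real s) (of_real r * cis \<theta>))\<^sup>2 = s\<^sup>2 + r\<^sup>2 - 2 * s * r * cos \<theta>" by (rule dist_polar)
  also have "\<dots> < (s + r)\<^sup>2"
  proof -
   have "cos pi < cos \<theta>" using that by (intro cos_monotone_0_pi) auto
   then have "0 < (2 * s * r) * (1 + cos \<theta>)" using s r by simp
   then show ?thesis by (simp add: power2_eq_square algebra_simps)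
  qed
  finally show ?thesis by (rule power2_less_imp_less) (use s r in simp)
 qed
 have Wn: "0 \<le> wang v p c i" using wang_nonneg[OF w] i by simp
 show False
 proof (cases "wang v p c i + \<phi> < pi")
  case True
  have "d a x \<le> dist (of_real s) (of_real r * cis (wang v p c i + \<phi>))"
   unfolding a_def xw by (rule chord_upper[OF w R(2) s i(1) ph(1,2) True r(1,2)])
  then show False using strict[of "wang v p c i + \<phi>"] True Wn ph(1) x(5) by simp
 next
  case False
  \<comment> \<open>The loop traversed backwards, along which x has the complementary angle.\<close>
  define p' where "p' j = p (n - j)" for j
  define e where "e j = c (n - Suc j)" for j
  have w': "lwalk v p' e n" unfolding lwalk_def
  proof (intro allI impI)
   fix j assume j: "j < n"
   have "crn (c (n - Suc j)) v (p (n - Suc j)) (p (Suc (n - Suc j)))" using w j by (simp add: lwalk_def)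
   moreover have "Suc (n - Suc j) = n - j" using j by simp
   ultimately show "crn (e j) v (p' j) (p' (Suc j))" by (simp add: p'_def e_def crn_swap)
  qed
  have R': "\<forall>j<n. good R (e j) v (p' j) (p' (Suc j))"
  proof (intro allI impI)
   fix j assume j: "j < n"
   have "crn (c (n - Suc j)) v (p (n - Suc j)) (p (Suc (n - Suc j)))" "good R (c (n - Suc j)) v (p (n - Suc j)) (p (Suc (n - Suc j)))"
    using w R(2) j by (simp_all add: lwalk_def)
   moreover have "Suc (n - Suc j) = n - j" using j by simp
   ultimately show "good R (e j) v (p' j) (p' (Suc j))" using good_swap by (simp add: p'_def e_def)
  qed
  define j where "j = n - Suc i"
  have j: "j < n" "n - Suc j = i" "n - j = Suc i" using i by (auto simp: j_def)
  have wj: "wang v p' e j = wang v p c n - wang v p c (Suc i)"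
  proof -
   have "wang v p' e j = (\<Sum>t<j. cang (c (n - Suc t)) v (p (n - Suc t)) (p (Suc (n - Suc t))))"
    unfolding wang_def
   proof (rule sum.cong[OF HOL.refl])
    fix t assume "t \<in> {..<j}"
    then have "Suc (n - Suc t) = n - t" using j by auto
    then show "cang (e t) v (p' t) (p' (Suc t)) = cang (c (n - Suc t)) v (p (n - Suc t)) (p (Suc (n - Suc t)))"
     by (simp add: p'_def e_def cang_swap)
   qed
   also have "\<dots> = (\<Sum>t\<in>{Suc i..<n}. cang (c t) v (p t) (p (Suc t)))"
    by (rule sum.reindex_bij_witness[of _ "\<lambda>t. n - Suc t" "\<lambda>t. n - Suc t"]) (use j in auto)
   also have "\<dots> = wang v p c n - wang v p c (Suc i)"
   proof -
    have "(\<Sum>t\<in>{0..<Suc i}. cang (c t) v (p t) (p (Suc t))) + (\<Sum>t\<in>{Suc i..<n}. cang (c t) v (p t) (p (Suc t)))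
      = (\<Sum>t\<in>{0..<n}. cang (c t) v (p t) (p (Suc t)))"
     by (rule sum.atLeastLessThan_concat) (use i in auto)
    then show ?thesis unfolding wang_def lessThan_atLeast0 by linarith
   qed
   finally show ?thesis .
  qed
  define \<psi> where "\<psi> = cang (c i) v (p i) (p (Suc i)) - \<phi>"
  have psi: "0 \<le> \<psi>" "\<psi> \<le> cang (e j) v (p' j) (p' (Suc j))"
   using ph j by (auto simp: \<psi>_def e_def p'_def cang_swap)
  have sum: "wang v p' e j + \<psi> = wang v p c n - (wang v p c i + \<phi>)" unfolding wj wang_Suc \<psi>_def by simp
  then have lt: "wang v p' e j + \<psi> < pi" using small False by simp
  have xw': "x = wpt v p' e j r \<psi>"
  proof -
   have "sec (c i) v (p i) (p (Suc i)) (of_real r * cis \<phi>) = sec (c i) v (p (Suc i)) (p i) (of_real r * cis \<psi>)"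
    unfolding \<psi>_def by (rule sec_swap[OF cri])
   then show ?thesis unfolding xw wpt_def spt_def p'_def e_def using j by simp
  qed
  have a': "a = epoint v (p' 0) (s / elen X {v, p' 0})" unfolding a_def p'_def using l(5) by simp
  have "d a x \<le> dist (of_real s) (of_real r * cis (wang v p' e j + \<psi>))"
   unfolding a' xw' by (rule chord_upper[OF w' R' s j(1) psi lt r(1,2)])
  then show False using strict[OF _ lt] wang_nonneg[OF w' less_imp_le[OF j(1)]] psi(1) x(5) by simp
 qed
qed

subsection \<open>Angles of a filling\<close>

definition corners_of :: "'c set => 'v => ('c \<times> nat) set" where
 "corners_of D z = {q \<in> corners X z. fst q \<in> D}"

definition filling :: "'v => 'v => 'v => 'c set => bool" where
 "filling u v w D \<longleftrightarrow> {u, v} \<in> edges X \<and> {v, w} \<in> edges X \<and> {w, u} \<in> edges X \<and> finite D \<and> D \<subseteq> cells X \<and>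
   (\<forall>e. odd (card {c \<in> D. e \<in> sides c}) \<longleftrightarrow> e \<in> {{u, v}, {v, w}, {w, u}})"

lemma filling_rotate: "filling u v w D ==> filling v w u D"
 and filling_swap: "filling u v w D ==> filling v u w D"
 unfolding filling_def by (auto simp: insert_commute)

lemma fillingD:
 assumes "filling u v w D"
 shows "{u, v} \<in> edges X" "{v, w} \<in> edges X" "{w, u} \<in> edges X" "finite D" "D \<subseteq> cells X"
  "odd (card {c \<in> D. e \<in> sides c}) \<longleftrightarrow> e \<in> {{u, v}, {v, w}, {w, u}}"
  "u \<noteq> v" "v \<noteq> w" "w \<noteq> u" "vpoint u \<in> M" "vpoint v \<in> M" "vpoint w \<in> M"
proof -
 show e: "{u, v} \<in> edges X" "{v, w} \<in> edges X" "{w, u} \<in> edges X" "finite D" "D \<subseteq> cells X"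
  "odd (card {c \<in> D. e \<in> sides c}) \<longleftrightarrow> e \<in> {{u, v}, {v, w}, {w, u}}"
  using assms unfolding filling_def by blast+
 show "u \<noteq> v" "v \<noteq> w" "w \<noteq> u" using edge_neq e by blast+
 show "vpoint u \<in> M" "vpoint v \<in> M" "vpoint w \<in> M" using vpoint_in edge_verts[OF e(1)] edge_verts[OF e(2)] by auto
qed

lemma filling_page: assumes "filling u v w D" obtains c where "c \<in> D" "c \<in> pages u v"
proof -
 have "{c \<in> D. {u, v} \<in> sides c} \<noteq> {}"
  using fillingD(6)[OF assms, of "{u, v}"] by (metis card.empty even_zero insertI1)
 then show ?thesis using that fillingD(5)[OF assms] pages_sides by blast
qed

lemma filling_edge_dist:
 assumes "filling u v w D" "0 \<le> s" "s \<le> t" "t \<le> 1"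
 shows "d (epoint u v s) (epoint u v t) = elen X {u, v} * (t - s)"
 by (rule filling_page[OF assms(1)]) (rule edge_geodesic[OF fillingD(1)[OF assms(1)] _ assms(2-4)])

lemma filling_vdist: assumes "filling u v w D" shows "d (vpoint u) (vpoint v) = elen X {u, v}"
 using filling_edge_dist[OF assms, of 0 1] epoint_0[of u v] epoint_1[OF fillingD(7)[OF assms]] by simp

lemma fst_inj_corners: "inj_on fst (corners X z)"
 by (rule inj_onI) (metis corner_neq_cell)

lemma corners_of_finite: "finite D ==> finite (corners_of D z)"
proof -
 assume D: "finite D"
 have "inj_on fst (corners_of D z)" by (rule inj_on_subset[OF fst_inj_corners[of z]]) (auto simp: corners_of_def)
 moreover have "fst ` corners_of D z \<subseteq> D" by (auto simp: corners_of_def)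
 ultimately show ?thesis using D finite_subset finite_imageD by blast
qed

text \<open>A cell has at most one corner at z, so corners at z with end p correspond to cells with
  the side from z to p. This turns the parity of a filling at edges into the parity of degrees in
  links.\<close>

lemma corners_of_degree: assumes D: "D \<subseteq> cells X"
 shows "degree_in (corners_of D z) p = card {c \<in> D. {z, p} \<in> sides c}"
 unfolding degree_in_def
proof (rule bij_betw_same_card[of fst], rule bij_betw_imageI)
 show "inj_on fst {q \<in> corners_of D z. p \<in> corner_ends X q}"
  by (rule inj_on_subset[OF fst_inj_corners[of z]]) (auto simp: corners_of_def)
 show "fst ` {q \<in> corners_of D z. p \<in> corner_ends X q} = {c \<in> D. {z, p} \<in> sides c}"
 proof (intro equalityI subsetI)
  fix c assume "c \<in> fst ` {q \<in> corners_of D z. p \<in> corner_ends X q}"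
  then obtain k where "(c, k) \<in> corners X z" "c \<in> D" "p \<in> corner_ends X (c, k)" by (auto simp: corners_of_def)
  then show "c \<in> {c \<in> D. {z, p} \<in> sides c}" using corner_end_page(1) pages_sides by blast
 next
  fix c assume "c \<in> {c \<in> D. {z, p} \<in> sides c}"
  then have c: "c \<in> D" "c \<in> pages z p" using D pages_sides by auto
  obtain k where "(c, k) \<in> corners X z" "p \<in> corner_ends X (c, k)" by (rule page_corner[OF c(2)]) (rule that)
  then show "c \<in> fst ` {q \<in> corners_of D z. p \<in> corner_ends X q}" using c(1)
   by (intro image_eqI[of _ _ "(c, k)"]) (auto simp: corners_of_def)
 qed
qed

lemma corners_of_even:
 assumes f: "filling u v w D" and z: "z \<notin> {u, v, w}" shows "even (degree_in (corners_of D z) p)"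
proof -
 have "{z, p} \<notin> {{u, v}, {v, w}, {w, u}}" using z by (auto simp: doubleton_eq_iff)
 then show ?thesis using fillingD(6)[OF f, of "{z, p}"] corners_of_degree[OF fillingD(5)[OF f]] by simp
qed

lemma corners_of_odd:
 assumes f: "filling u v w D" shows "odd (degree_in (corners_of D u) p) \<longleftrightarrow> p = v \<or> p = w"
proof -
 have "{u, p} \<in> {{u, v}, {v, w}, {w, u}} \<longleftrightarrow> p = v \<or> p = w" using fillingD(7-9)[OF f] by (auto simp: doubleton_eq_iff)
 then show ?thesis using fillingD(6)[OF f, of "{u, p}"] corners_of_degree[OF fillingD(5)[OF f]] by simp
qed

section \<open>Geodesics inside a filling\<close>

lemma d_pos: "x \<in> M ==> y \<in> M ==> x \<noteq> y ==> 0 < d x y"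
 using zero_iff[of x y] nonneg[of x y] by (simp add: less_le del: nonneg)

lemma step_exact:
 assumes "a \<in> M" "y \<in> M" "y' \<in> M" "d y y' \<le> m" "d a y' = d a y + m"
 shows "d y y' = m"
 using tri[OF assms(1-3)] assms(4,5) by linarith

text \<open>Off the triangle the filling has no boundary modulo 2: an edge on one of its cells is on
  a second one, and its corners at a vertex form a leafless graph. So each local prolongation can be
  made inside \<open>D\<close>.\<close>

lemma filling_extension:
 assumes f: "filling u v w D" and a: "a \<in> M" and y: "y \<in> M" "c \<in> D" "incell c y"
  and off: "\<And>t. 0 \<le> t ==> t \<le> 1 ==> y \<noteq> epoint u v t \<and> y \<noteq> epoint v w t \<and> y \<noteq> epoint w u t"
 obtains c' y' where "y' \<in> M" "c' \<in> D" "incell c' y'" "y' \<noteq> y" "d a y' = d a y + d y y'"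
proof -
 note F = fillingD[OF f]
 have cX: "c \<in> cells X" using y(2) F(5) by blast
 from y(1) show ?thesis
 proof (cases rule: points_cases)
  case (vertex p)
  have p: "p \<notin> {u, v, w}" using off[of 0] vertex epoint_0 by auto
  have "p \<in> set (bds c)" using y(3) incell_vpoint_iff[OF cX] vertex by simp
  then obtain k where "(c, k) \<in> corners X p" using cX by (auto simp: in_set_conv_nth corners_iff)
  then have ne: "corners_of D p \<noteq> {}" using y(2) by (auto simp: corners_of_def)
  have L: "leafless p (corners_of D p)"
   by (rule even_leafless[OF corners_of_finite[OF F(4)] ne]) (use corners_of_even[OF f p] in \<open>auto simp: corners_of_def\<close>)
  obtain R where R: "0 < R" "\<And>r. 0 < r ==> r < R ==> \<exists>(c, k)\<in>corners_of D p. \<exists>x\<in>M. incell c x \<and>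
    dist (cpos c x) (vpos c p) = r \<and> d a x = d a (vpoint p) + r"
   by (rule vertex_extension[OF L a]) (rule that)
  from R(2)[of "R / 2"] R(1) obtain c' k' x where x: "(c', k') \<in> corners X p" "c' \<in> D" "x \<in> M" "incell c' x"
   "dist (cpos c' x) (vpos c' p) = R / 2" "d a x = d a (vpoint p) + R / 2" by (auto simp: corners_of_def)
  have "d y x = R / 2"
   by (rule step_exact[OF a y(1) x(3)]) (use d_vertex_le[OF x(1,3,4)] x(5,6) vertex in auto)
  then have "0 < d y x" "d a x = d a y + d y x" using x(6) R(1) vertex by simp_all
  moreover from this(1) have "x \<noteq> y" using self_zero[OF y(1)] by auto
  ultimately show ?thesis by (intro that[OF x(3,2,4)])
 next
  case (edge p q t)
  have yM: "epoint p q t \<in> M" "incell c (epoint p q t)" using y edge by auto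
  have cp: "c \<in> pages p q" by (rule incell_epoint_page[OF cX yM edge(3,4,2)])
  have "{p, q} \<notin> {{u, v}, {v, w}, {w, u}}"
  proof
   assume "{p, q} \<in> {{u, v}, {v, w}, {w, u}}"
   then show False using off[of t] off[of "1 - t"] edge epoint_swap[of p q t] by (auto simp: doubleton_eq_iff)
  qed
  with F(6)[of "{p, q}"] have ev: "even (card {c \<in> D. {p, q} \<in> sides c})" by (simp only: simp_thms)
  have "{c \<in> D. {p, q} \<in> sides c} \<noteq> {c}"
  proof
   assume "{c \<in> D. {p, q} \<in> sides c} = {c}"
   with ev show False by simp
  qed
  moreover have "c \<in> {c \<in> D. {p, q} \<in> sides c}" using cp y(2) pages_sides by simp
  ultimately obtain c2 where c2: "c2 \<in> D" "c2 \<in> pages p q" "c \<noteq> c2" using F(5) pages_sides by blast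
  obtain c' y' where y': "c' = c \<or> c' = c2" "y' \<in> M" "incell c' y'" "y' \<noteq> epoint p q t"
   "d a y' = d a (epoint p q t) + dist (cpos c' y') (cpos c' (epoint p q t))"
   by (rule ext_edge[OF edge(1,3,4) cp c2(2,3) a zero_less_one]) (rule that)
  have c': "c' \<in> D" "c' \<in> cells X" "c' \<in> pages p q" using y' c2 y(2) F(5) cp by auto
  obtain k' where "is_side c' k' p q" by (rule page_side[OF c'(3)]) (rule that)
  then have "incell c' y" using incell_epoint edge(5) by simp
  then have "d y y' \<le> dist (cpos c' y') (cpos c' (epoint p q t))"
   using d_le_cell[OF c'(2) y(1) y'(2) _ y'(3)] edge(5) by (simp add: dist_commute)
  then have "d y y' = dist (cpos c' y') (cpos c' (epoint p q t))"
   by (rule step_exact[OF a y(1) y'(2)]) (use y'(5) edge(5) in simp)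
  then show ?thesis using that[of y' c'] y' c' edge(5) by simp
 next
  case (inner c0 z)
  then have [simp]: "c0 = c" using y(3) by simp
  obtain z' where z': "z' \<in> interior (poly c)" "z' \<noteq> z" "d a (Inner c z') = d a (Inner c z) + dist z' z"
   by (rule ext_inner[OF inner(1,2)[unfolded \<open>c0 = c\<close>] a zero_less_one]) (rule that)
  have zM: "Inner c z' \<in> M" using z' cX Inner_in by blast
  have "d y (Inner c z') \<le> dist z' z"
   using d_le_cell[OF cX y(1) zM y(3)] inner by (simp add: dist_commute)
  then have "d y (Inner c z') = dist z' z" by (rule step_exact[OF a y(1) zM]) (use z' inner in simp)
  then show ?thesis using that[of "Inner c z'" c] zM y z' inner by simp
 qed
qed

text \<open>Equality would put u on a geodesic from v to w, which by uniqueness is the edge; but u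
  is not a point of that edge.\<close>

lemma triangle_strict:
 assumes f: "filling u v w D" shows "d (vpoint v) (vpoint w) < d (vpoint v) (vpoint u) + d (vpoint u) (vpoint w)"
proof (rule ccontr)
 assume neg: "\<not> ?thesis"
 note F = fillingD[OF f]
 have eq: "d (vpoint v) (vpoint u) + d (vpoint u) (vpoint w) = d (vpoint v) (vpoint w)"
  using neg tri[OF F(11,10,12)] by linarith
 note g = filling_rotate[OF f]
 let ?l = "elen X {v, w}"
 have lp: "0 < ?l" using elen_pos[OF F(2)] .
 have dvw: "d (vpoint v) (vpoint w) = ?l" by (rule filling_vdist[OF g])
 define t where "t = d (vpoint v) (vpoint u) / ?l"
 have "d (vpoint v) (vpoint u) \<le> ?l" using eq dvw nonneg[of "vpoint u" "vpoint w"] by linarith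
 then have t: "0 \<le> t" "t \<le> 1" "?l * t = d (vpoint v) (vpoint u)" using lp by (simp_all add: t_def)
 let ?y = "epoint v w t"
 have yM: "?y \<in> M" using epoint_in[OF F(2) t(1,2)] .
 have d1: "d (vpoint v) ?y = ?l * t" using filling_edge_dist[OF g order_refl t(1,2)] epoint_0[of v w] by simp
 have d2: "d ?y (vpoint w) = ?l * (1 - t)" using filling_edge_dist[OF g t(1,2) order_refl] epoint_1[OF F(8)] by simp
 have "vpoint u = ?y"
  by (rule geodesic_unique[OF F(11,12,10) yM]) (use d1 d2 t eq dvw in \<open>simp_all add: algebra_simps\<close>)
 then have "?y = vpoint u" by simp
 moreover have "?y \<noteq> vpoint u"
  using F(7,9) by (auto simp: epoint_def vpoint_def fun_eq_iff dest: spec[of _ u])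
 ultimately show False by blast
qed

text \<open>Among the points of the filling that prolong the geodesic from \<open>v\<close> to \<open>u\<close>, take one
 farthest from \<open>u\<close>. It can be prolonged further unless it lies on the boundary triangle, where
 uniqueness of geodesics excludes it.\<close>

lemma no_straight_extension:
 assumes f: "filling u v w D" and x: "x \<in> M" "c \<in> D" "incell c x" "x \<noteq> vpoint u"
  and al: "d (vpoint v) x = d (vpoint v) (vpoint u) + d (vpoint u) x"
 shows False
proof -
 note F = fillingD[OF f]
 let ?v = "vpoint v" and ?u = "vpoint u"
 \<comment> \<open>The places of points that a geodesic from v reaches through u.\<close>
 define K where "K c = {z \<in> poly c. d ?v (cpt c z) - d ?u (cpt c z) = d ?v ?u}" for c
 have cK: "compact (K c)" if "c \<in> D" for c
 proof -
  have cX: "c \<in> cells X" using that F(5) by blast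
  have "continuous_on (poly c) (\<lambda>z. d ?v (cpt c z) - d ?u (cpt c z))"
   using continuous_on_cell_dist[OF cX F(11)] continuous_on_cell_dist[OF cX F(10)] by (intro continuous_intros) auto
  then have "closed (K c)"
   unfolding K_def by (rule continuous_closed_preimage_constant[OF _ poly_closed(1)])
  moreover have "K c \<subseteq> poly c" by (auto simp: K_def)
  ultimately show ?thesis using poly_closed(2)[of c] by (metis compact_Int_closed inf.absorb_iff2)
 qed
 have fK: "continuous_on (K c) (\<lambda>z. d ?u (cpt c z))" if "c \<in> D" for c
  by (rule continuous_on_cell_dist[OF _ F(10)]) (use that F(5) in \<open>auto simp: K_def\<close>)
 have inK: "cpos c y \<in> K c \<and> cpt c (cpos c y) = y"
  if "y \<in> M" "c \<in> D" "incell c y" "d ?v y = d ?v ?u + d ?u y" for c y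
  using cpt_unique[of c y] cpos_in_poly[of c y] that F(5) by (auto simp: K_def)
 obtain c1 z1 where m: "c1 \<in> D" "z1 \<in> K c1" "\<And>c' z'. c' \<in> D ==> z' \<in> K c' ==> d ?u (cpt c' z') \<le> d ?u (cpt c1 z1)"
  by (rule compact_family_max[where K = K and f = "\<lambda>c z. d ?u (cpt c z)", OF F(4) cK fK x(2) conjunct1[OF inK[OF x(1-3) al]]]) (assumption+, rule that)
 define y where "y = cpt c1 z1"
 have c1: "c1 \<in> cells X" using m(1) F(5) by blast
 have y: "y \<in> M" "incell c1 y" "d ?v y = d ?v ?u + d ?u y"
  using cpt(1,2)[OF c1, of z1] m(2) by (auto simp: y_def K_def)
 have max: "d ?u y' \<le> d ?u y" if "y' \<in> M" "c' \<in> D" "incell c' y'" "d ?v y' = d ?v ?u + d ?u y'" for c' y'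
  using m(3)[OF that(2) conjunct1[OF inK[OF that]]] inK[OF that] by (simp add: y_def)
 have "0 < d ?u x" using d_pos[OF F(10) x(1)] x(4) by metis
 then have yu: "0 < d ?u y" using max[OF x(1-3) al] by linarith
 then have yne: "?u \<noteq> y" using self_zero[OF F(10)] by auto
 have strict: "d ?v (vpoint w) < d ?v ?u + d ?u (vpoint w)" by (rule triangle_strict[OF f])
 \<comment> \<open>On the edge from u to v, y would be nearer to v than u is. On the edge from v to
   w it contradicts the strict triangle inequality directly; on the edge from w to u it does so
   after prolonging the geodesic to w.\<close>
 have off: "y \<noteq> epoint u v t \<and> y \<noteq> epoint v w t \<and> y \<noteq> epoint w u t" if t: "0 \<le> t" "t \<le> 1" for t
 proof (intro conjI notI)
  assume e: "y = epoint u v t"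
  have "d ?u y = elen X {u, v} * t" using filling_edge_dist[OF f order_refl t] epoint_0[of u v] e by simp
  moreover have "d y ?v = elen X {u, v} * (1 - t)" using filling_edge_dist[OF f t order_refl] epoint_1[OF F(7)] e by simp
  moreover have "d ?v ?u = elen X {u, v}" using filling_vdist[OF f] sym[of ?u ?v] by simp
  ultimately show False using y(3) yu sym[of y ?v] unfolding right_diff_distrib by linarith
 next
  assume e: "y = epoint v w t"
  note g = filling_rotate[OF f]
  have "d ?v y = elen X {v, w} * t" using filling_edge_dist[OF g order_refl t] epoint_0[of v w] e by simp
  moreover have "d y (vpoint w) = elen X {v, w} * (1 - t)" using filling_edge_dist[OF g t order_refl] epoint_1[OF F(8)] e by simp
  ultimately have "d ?v y + d y (vpoint w) = d ?v (vpoint w)" using filling_vdist[OF g] by (simp add: algebra_simps)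
  then show False using y(3) strict tri[OF F(10) y(1) F(12)] by linarith
 next
  assume e: "y = epoint w u t"
  note g = filling_rotate[OF filling_rotate[OF f]]
  have "d (vpoint w) y = elen X {w, u} * t" using filling_edge_dist[OF g order_refl t] epoint_0[of w u] e by simp
  moreover have "d y ?u = elen X {w, u} * (1 - t)" using filling_edge_dist[OF g t order_refl] epoint_1[OF F(9)] e by simp
  ultimately have "d ?u y + d y (vpoint w) = d ?u (vpoint w)"
   using filling_vdist[OF g] sym[of y ?u] sym[of y "vpoint w"] sym[of ?u "vpoint w"] by (simp add: algebra_simps)
  from convex_extension[OF F(11,10) y(1) F(12) y(3)[symmetric] this yne]
  have "d ?v y + d y (vpoint w) = d ?v (vpoint w)" .
  then show False using y(3) \<open>d ?u y + d y (vpoint w) = d ?u (vpoint w)\<close> strict by linarith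
 qed
 have "\<exists>y'\<in>M. \<exists>c'\<in>D. incell c' y' \<and> y' \<noteq> y \<and> d ?v y' = d ?v y + d y y'"
  by (rule filling_extension[OF f F(11) y(1) m(1) y(2)]) (rule off, assumption, assumption, blast)
 then obtain c' y' where y': "y' \<in> M" "c' \<in> D" "incell c' y'" "y' \<noteq> y" "d ?v y' = d ?v y + d y y'"
  by blast
 have "0 < d y y'" using d_pos[OF y(1) y'(1)] y'(4) by metis
 moreover have "d ?u y' \<le> d ?u y + d y y'" "d ?v y' \<le> d ?v ?u + d ?u y'" using tri F(10,11) y(1) y'(1) by blast+
 ultimately show False using max[OF y'(1-3)] y(3) y'(5) by linarith
qed

text \<open>Otherwise \<open>vertex_extension\<close> would prolong the geodesic from v to u into
  the filling.\<close>

lemma filling_no_leafless: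
 assumes f: "filling u v w D" and Q: "Q \<subseteq> corners_of D u" shows "\<not> leafless u Q"
proof
 assume L: "leafless u Q"
 note F = fillingD[OF f]
 obtain R where R: "0 < R" "\<And>r. 0 < r ==> r < R ==> \<exists>(c, k)\<in>Q. \<exists>x\<in>M. incell c x \<and>
   dist (cpos c x) (vpos c u) = r \<and> d (vpoint v) x = d (vpoint v) (vpoint u) + r"
  by (rule vertex_extension[OF L F(11)]) (rule that)
 from R(2)[of "R / 2"] R(1) obtain c k x where x: "(c, k) \<in> Q" "x \<in> M" "incell c x"
  "dist (cpos c x) (vpos c u) = R / 2" "d (vpoint v) x = d (vpoint v) (vpoint u) + R / 2" by auto
 have c: "(c, k) \<in> corners X u" "c \<in> D" using x(1) Q by (auto simp: corners_of_def)
 have "d (vpoint u) x = R / 2"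
  by (rule step_exact[OF F(11,10) x(2)]) (use d_vertex_le[OF c(1) x(2,3)] x(4,5) in auto)
 moreover from this have "x \<noteq> vpoint u" using self_zero[OF F(10)] R(1) by auto
 ultimately show False using no_straight_extension[OF f x(2) c(2) x(3)] x(5) by simp
qed

text \<open>In the link of u the filling has odd degree exactly at v and w and contains no leafless
  part, so it is a single path from v to w.\<close>

lemma filling_path:
 assumes f: "filling u v w D"
 obtains p c n R where "0 < n" "p 0 = v" "p n = w" "lwalk u p c n" "\<And>i. Suc i < n ==> c i \<noteq> c (Suc i)"
  "\<And>i. i < n ==> c i \<in> D" "(\<Sum>q\<in>corners_of D u. corner_angle X q) = wang u p c n"
  "0 < R" "\<forall>i<n. good R (c i) u (p i) (p (Suc i))"
proof -
 note F = fillingD[OF f]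
 have sub: "corners_of D u \<subseteq> corners X u" by (auto simp: corners_of_def)
 have vw: "v \<noteq> w" using F by blast
 obtain p q n where p: "0 < n" "p 0 = v" "p n = w" "inj_on q {..<n}" "corners_of D u = q ` {..<n}"
  "\<And>i. i < n ==> q i \<in> corners X u \<and> corner_ends X (q i) = {p i, p (Suc i)}"
  by (rule two_odd_path[OF corners_of_finite[OF F(4)] sub corners_of_odd[OF f] vw filling_no_leafless[OF f]]) (assumption, rule that)
 define c where "c i = fst (q i)" for i
 have q: "q i = (c i, snd (q i))" for i by (simp add: c_def)
 have w: "lwalk u p c n" unfolding lwalk_def crn_def using p(6) q by metis
 have ne: "c i \<noteq> c (Suc i)" if "Suc i < n" for i
 proof -
  have "q i \<noteq> q (Suc i)" using inj_onD[OF p(4), of i "Suc i"] that by auto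
  then show ?thesis unfolding c_def using corner_neq_cell[of "q i" u "q (Suc i)"] p(6)[of i] p(6)[of "Suc i"] that by simp
 qed
 have cD: "c i \<in> D" if "i < n" for i
 proof -
  have "q i \<in> corners_of D u" using p(5) that by blast
  then show ?thesis by (simp add: c_def corners_of_def)
 qed
 have s: "(\<Sum>q\<in>corners_of D u. corner_angle X q) = wang u p c n"
  unfolding p(5) wang_def sum.reindex[OF p(4)]
 proof (rule sum.cong[OF HOL.refl])
  fix i assume "i \<in> {..<n}"
  then show "(corner_angle X \<circ> q) i = cang (c i) u (p i) (p (Suc i))"
   using corner_angle_cang[of "c i" "snd (q i)" u "p i" "p (Suc i)"] p(6)[of i] q[of i] by simp
 qed
 obtain R where R: "0 < R" "\<forall>i<n. good R (c i) u (p i) (p (Suc i))" by (rule uniform_good[OF w]) (rule that)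
 show ?thesis by (rule that[OF p(1-3) w ne cD s R])
qed

text \<open>If the fan at u reached the angle \<pi>, a straight chord would prolong the geodesic
  from v through u into the filling. Below \<pi> the chord between the two edges at u is a true
  distance, which \<open>contraction\<close> bounds by the scaled third side; the law of cosines
  then compares the angles.\<close>

lemma filling_angle:
 assumes f: "filling u v w D" and P: "dist a b = elen X {u, v}" "dist a c = elen X {u, w}" "dist b c = elen X {v, w}"
 shows "(\<Sum>q\<in>corners_of D u. corner_angle X q) \<le> vec_angle (b - a) (c - a)"
proof -
 note F = fillingD[OF f]
 have g: "filling u w v D" using filling_swap[OF filling_rotate[OF filling_rotate[OF f]]] .
 let ?v = "vpoint v" and ?u = "vpoint u" and ?w = "vpoint w"
 define e1 where "e1 = elen X {u, v}"
 define e2 where "e2 = elen X {u, w}"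
 have ep: "0 < e1" "0 < e2" using elen_pos fillingD(1)[OF f] fillingD(1)[OF g] by (simp_all add: e1_def e2_def)
 obtain p c' n R where p: "0 < n" "p 0 = v" "p n = w" "lwalk u p c' n" "\<And>i. Suc i < n ==> c' i \<noteq> c' (Suc i)"
  "\<And>i. i < n ==> c' i \<in> D" "(\<Sum>q\<in>corners_of D u. corner_angle X q) = wang u p c' n"
  "0 < R" "\<forall>i<n. good R (c' i) u (p i) (p (Suc i))" by (rule filling_path[OF f]) (rule that)
 have Rle: "R \<le> e1" "R \<le> e2"
 proof -
  have "good R (c' 0) u (p 0) (p (Suc 0))" using p(9,1) by blast
  then show "R \<le> e1" unfolding good_def p(2) e1_def by blast
  have "good R (c' (n - 1)) u (p (n - 1)) (p (Suc (n - 1)))" by (rule p(9)[rule_format]) (use p(1) in simp)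
  then show "R \<le> e2" unfolding good_def e2_def using p(1,3) by simp
 qed
 have pi: "wang u p c' n < pi"
 proof (rule ccontr)
  assume neg: "\<not> ?thesis"
  \<comment> \<open>The sector in which the accumulated angle first reaches \<pi> is the one before
    this index.\<close>
  define j where "j = (LEAST j. pi \<le> wang u p c' j)"
  have j: "pi \<le> wang u p c' j" "j \<le> n" unfolding j_def
   by (rule LeastI[of _ n], use neg in simp) (rule Least_le, use neg in simp)
  have "j \<noteq> 0"
  proof
   assume "j = 0"
   then have "wang u p c' j = 0" by simp
   then show False using j(1) pi_gt_zero by linarith
  qed
  then obtain i where i: "j = Suc i" by (cases j) auto
  have "\<not> pi \<le> wang u p c' i" using not_less_Least[of i "\<lambda>j. pi \<le> wang u p c' j"] i by (simp add: j_def)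
  define \<phi> where "\<phi> = pi - wang u p c' i"
  have ph: "0 < \<phi>" "\<phi> \<le> cang (c' i) u (p i) (p (Suc i))" "wang u p c' i + \<phi> = pi"
   using \<open>\<not> pi \<le> wang u p c' i\<close> j(1) unfolding i wang_Suc \<phi>_def by simp_all
  have iN: "i < n" using j i by simp
  define s where "s = R / 2"
  have s: "0 < s" "s < R" using p(8) by (auto simp: s_def)
  let ?a = "epoint u v (s / e1)" and ?x = "wpt u p c' i s \<phi>"
  have x1: "s + s \<le> d ?a ?x" using chord_pi[OF p(4,5,9) s iN ph s] unfolding p(2) e1_def .
  have x2: "?x \<in> M" "incell (c' i) ?x" "dist (cpos (c' i) ?x) (vpos (c' i) u) = s"
   using wpt_in[OF p(4,9) iN less_imp_le[OF ph(1)] ph(2) less_imp_le[OF s(1)] s(2)] by blast+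
  obtain k where k: "(c' i, k) \<in> corners X u" using p(4) iN unfolding lwalk_def crn_def by blast
  have x3: "d ?u ?x \<le> s" using d_vertex_le[OF k x2(1,2)] x2(3) by simp
  have t: "0 \<le> s / e1" "s / e1 \<le> 1" using s Rle ep by simp_all
  have aM: "?a \<in> M" using epoint_in[OF F(1) t] .
  have a1: "d ?a ?u = s" using filling_edge_dist[OF f order_refl t] epoint_0[of u v] sym[of ?a ?u] ep by (simp add: e1_def)
  have "d ?a ?v = e1 * (1 - s / e1)" using filling_edge_dist[OF f t order_refl] epoint_1[OF F(7)] by (simp add: e1_def)
  then have a2: "d ?v ?a = e1 - s" using sym[of ?a ?v] ep by (simp add: right_diff_distrib)
  have vu: "d ?v ?u = e1" using filling_vdist[OF f] sym[of ?u ?v] by (simp add: e1_def)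
  have x4: "d ?a ?u + d ?u ?x = d ?a ?x" "d ?u ?x = s" using tri[OF aM F(10) x2(1)] x1 x3 a1 by linarith+
  have "?a \<noteq> ?u" using a1 s(1) self_zero[OF F(10)] by auto
  then have "d ?v ?u + d ?u ?x = d ?v ?x"
   using convex_extension[OF F(11) aM F(10) x2(1) _ x4(1)] a1 a2 vu by simp
  moreover have "?x \<noteq> ?u" using x4(2) s(1) self_zero[OF F(10)] by auto
  ultimately show False using no_straight_extension[OF f x2(1) p(6)[OF iN] x2(2)] by simp
 qed
 define m where "m = n - 1"
 have m: "m < n" "Suc m = n" using p(1) by (auto simp: m_def)
 have cr: "crn (c' m) u (p m) w" using p(4) m p(3) unfolding lwalk_def by metis
 define \<phi> where "\<phi> = cang (c' m) u (p m) w"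
 define \<Theta> where "\<Theta> = wang u p c' n"
 have sum: "wang u p c' m + \<phi> = \<Theta>" using wang_Suc[of u p c' m] m(2) p(3) by (simp add: \<phi>_def \<Theta>_def)
 have ph: "0 < \<phi>" using cang_facts(1)[OF cr] by (simp add: \<phi>_def)
 \<comment> \<open>Small enough for the points at ratio t on both edges from u to lie within the
   radius of the sectors.\<close>
 define t where "t = R / (2 * (e1 + e2))"
 have t: "0 < t" "t \<le> 1" "t * e1 < R" "t * e2 < R" "0 < t * e1" "0 < t * e2"
  using p(8) Rle ep by (auto simp: t_def field_simps) (auto intro: mult_pos_pos add_pos_pos)
 have X: "d (epoint u v (t * e1 / e1)) (wpt u p c' m (t * e2) \<phi>) = dist (of_real (t * e1)) (of_real (t * e2) * cis \<Theta>)"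
  using chord_exact[OF p(4,5,9) t(5,3) m(1), of \<phi> "t * e2"] ph pi t sum p(2,3) m(2) by (simp add: e1_def \<phi>_def \<Theta>_def)
 have Y: "wpt u p c' m (t * e2) \<phi> = epoint u w (t * e2 / e2)"
  unfolding wpt_def m(2) p(3) \<phi>_def e2_def[symmetric]
  by (subst spt_leg'[OF cr]) (use t Rle in \<open>simp_all add: e2_def[symmetric]\<close>)
 have X': "d (epoint u v t) (epoint u w t) = dist (of_real (t * e1)) (of_real (t * e2) * cis \<Theta>)"
  using X Y ep by simp
 have "d (epoint u v t) (epoint u w t) \<le> t * d ?v ?w"
 proof (rule contraction[OF F(10-12) epoint_in[OF F(1)] epoint_in[OF fillingD(1)[OF g]]])
  show "d ?u (epoint u v t) = t * d ?u ?v" "d (epoint u v t) ?v = (1 - t) * d ?u ?v"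
   using filling_edge_dist[OF f, of 0 t] filling_edge_dist[OF f, of t 1] t epoint_0[of u v] epoint_1[OF F(7)] filling_vdist[OF f] by simp_all
  show "d ?u (epoint u w t) = t * d ?u ?w" "d (epoint u w t) ?w = (1 - t) * d ?u ?w"
   using filling_edge_dist[OF g, of 0 t] filling_edge_dist[OF g, of t 1] t epoint_0[of u w] epoint_1[OF fillingD(7)[OF g]] filling_vdist[OF g] by simp_all
 qed (use t in auto)
 then have "dist (of_real (t * e1)) (of_real (t * e2) * cis \<Theta>) \<le> t * dist b c"
  using X' P(3) filling_vdist[OF filling_rotate[OF f]] by simp
 then have "(dist (of_real (t * e1)) (of_real (t * e2) * cis \<Theta>))\<^sup>2 \<le> (t * dist b c)\<^sup>2" by (rule power_mono) simp
 then have "t\<^sup>2 * (e1\<^sup>2 + e2\<^sup>2 - 2 * e1 * e2 * cos \<Theta>) \<le> t\<^sup>2 * (dist b c)\<^sup>2"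
  unfolding dist_polar by (simp add: power2_eq_square algebra_simps)
 then have "e1\<^sup>2 + e2\<^sup>2 - 2 * e1 * e2 * cos \<Theta> \<le> (dist b c)\<^sup>2" using t(1) by simp
 then have "e1\<^sup>2 + e2\<^sup>2 - (dist b c)\<^sup>2 \<le> cos \<Theta> * (2 * e1 * e2)" by (simp add: algebra_simps)
 then have "(e1\<^sup>2 + e2\<^sup>2 - (dist b c)\<^sup>2) / (2 * e1 * e2) \<le> cos \<Theta>" using ep by (simp add: pos_divide_le_eq)
 moreover have "cos (vec_angle (b - a) (c - a)) = (e1\<^sup>2 + e2\<^sup>2 - (dist b c)\<^sup>2) / (2 * e1 * e2)"
  using vec_angle_law_of_cosines[of a b c] P ep unfolding e1_def[symmetric] e2_def[symmetric] by force
 ultimately have "cos (vec_angle (b - a) (c - a)) \<le> cos \<Theta>" by simp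
 moreover have "0 \<le> \<Theta>" using wang_nonneg[OF p(4) order_refl] by (simp add: \<Theta>_def)
 ultimately have "\<Theta> \<le> vec_angle (b - a) (c - a)"
  using cos_mono_le_eq[of "vec_angle (b - a) (c - a)" \<Theta>] vec_angle_bounds[of "b - a" "c - a"] pi by (simp add: \<Theta>_def)
 then show ?thesis unfolding p(7) \<Theta>_def .
qed

text \<open>The three bounds refer to one comparison triangle, whose angles add up to \<pi>.\<close>

lemma filling_angle_sum:
 assumes f: "filling u v w D"
 shows "(\<Sum>q\<in>corners_of D u. corner_angle X q) + (\<Sum>q\<in>corners_of D v. corner_angle X q) + (\<Sum>q\<in>corners_of D w. corner_angle X q) \<le> pi"
proof -
 note F = fillingD[OF f] and f2 = filling_rotate[OF f]
 note f3 = filling_rotate[OF f2]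
 have e: "d (vpoint u) (vpoint v) = elen X {u, v}" "d (vpoint v) (vpoint w) = elen X {v, w}" "d (vpoint w) (vpoint u) = elen X {w, u}"
  using filling_vdist f f2 f3 by blast+
 obtain a b c :: complex where abc: "dist a b = elen X {u, v}" "dist b c = elen X {v, w}" "dist c a = elen X {w, u}"
  by (rule comparison_triangle_exists[of "elen X {u, v}" "elen X {v, w}" "elen X {w, u}"])
   (use tri[OF F(10,12,11)] tri[OF F(11,10,12)] tri[OF F(12,11,10)] e sym in \<open>auto simp: add.commute\<close>)
 have ne: "a \<noteq> b" "b \<noteq> c" "c \<noteq> a" using abc elen_pos[OF F(1)] elen_pos[OF F(2)] elen_pos[OF F(3)] by auto
 have "(\<Sum>q\<in>corners_of D u. corner_angle X q) \<le> vec_angle (b - a) (c - a)"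
  by (rule filling_angle[OF f]) (use abc in \<open>simp_all add: dist_commute insert_commute\<close>)
 moreover have "(\<Sum>q\<in>corners_of D v. corner_angle X q) \<le> vec_angle (c - b) (a - b)"
  by (rule filling_angle[OF f2]) (use abc in \<open>simp_all add: dist_commute insert_commute\<close>)
 moreover have "(\<Sum>q\<in>corners_of D w. corner_angle X q) \<le> vec_angle (a - c) (b - c)"
  by (rule filling_angle[OF f3]) (use abc in \<open>simp_all add: dist_commute insert_commute\<close>)
 ultimately show ?thesis using triangle_angle_sum[OF ne] by linarith
qed

text \<open>The angle of a corner in the equilateral triangle and in the regular pentagon, that is,
  for the metric of the coned complex.\<close>

definition std_angle :: "'c \<times> nat => real" where
 "std_angle q = (if len (fst q) = 3 then pi / 3 else 3 * pi / 5)"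

text \<open>Both angle functions give every cell the same angle sum and agree at the interior vertices of the
 filling. So the standard angles at \<open>u\<close>, \<open>v\<close>, \<open>w\<close> add up to at most
 \<open>\<pi>\<close>, while each corner contributes at least \<open>\<pi> / 3\<close>.\<close>

theorem triangle_cell:
 assumes agree: "\<And>v Q. link_loop X v Q ==> (\<Sum>q\<in>Q. corner_angle X q) = (\<Sum>q\<in>Q. std_angle q)"
  and e: "{u, v} \<in> edges X" "{v, w} \<in> edges X" "{w, u} \<in> edges X"
 obtains c where "c \<in> triangles X" "set (bds c) = {u, v, w}"
proof -
 obtain D where D: "finite D" "D \<subseteq> cells X" "\<And>e. odd (card {c \<in> D. e \<in> sides c}) \<longleftrightarrow> e \<in> {{u, v}, {v, w}, {w, u}}"
  by (rule mod2_filling[OF e]) (rule that)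
 have f: "filling u v w D" unfolding filling_def using D e by blast
 note F = fillingD[OF f]
 define AC where "AC = Sigma D (\<lambda>c. {..<len c})"
 have fAC: "finite AC" using D(1) by (simp add: AC_def)
 define g where "g q = bds (fst q) ! snd q" for q
 have co: "corners_of D z = {q \<in> AC. g q = z}" for z
  using D(2) by (auto simp: corners_of_def AC_def g_def corners_iff)
 \<comment> \<open>The excess over the standard angle sums to 0 over each cell, and also over the
   corners at each vertex outside the triangle.\<close>
 define h where "h q = corner_angle X q - std_angle q" for q
 have h0: "sum h AC = 0"
 proof -
  have "(\<Sum>k<len c. h (c, k)) = 0" if "c \<in> D" for c
  proof -
   have c: "c \<in> cells X" using that D(2) by blast
   have "(\<Sum>k<len c. corner_angle X (c, k)) = (real (len c) - 2) * pi"
    using polygon_angle_sum[OF shape_convex[OF c]] shape_len[OF c] cell_len[OF c] by (simp add: corner_angle_def)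
   moreover have "(\<Sum>k<len c. std_angle (c, k)) = (real (len c) - 2) * pi"
    using cell_len[OF c] by (auto simp: std_angle_def)
   ultimately show ?thesis by (simp add: h_def sum_subtractf)
  qed
  then have "(\<Sum>c\<in>D. \<Sum>k<len c. h (c, k)) = 0" by simp
  then show ?thesis unfolding AC_def using sum.Sigma[of D "\<lambda>c. {..<len c}" "\<lambda>c k. h (c, k)"] D(1) by simp
 qed
 have "(\<Sum>z\<in>g ` AC \<union> {u, v, w}. sum h {q \<in> AC. g q = z}) = sum h AC" by (rule sum.group) (use fAC in auto)
 also have "(\<Sum>z\<in>g ` AC \<union> {u, v, w}. sum h {q \<in> AC. g q = z}) = (\<Sum>z\<in>{u, v, w}. sum h {q \<in> AC. g q = z})"
 proof (rule sum.mono_neutral_right)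
  show "\<forall>z\<in>g ` AC \<union> {u, v, w} - {u, v, w}. sum h {q \<in> AC. g q = z} = 0"
  proof
   fix z assume "z \<in> g ` AC \<union> {u, v, w} - {u, v, w}"
   then have z: "z \<notin> {u, v, w}" by blast
   have "(\<Sum>q\<in>corners_of D z. corner_angle X q) = (\<Sum>q\<in>corners_of D z. std_angle q)"
    by (rule even_sum[OF agree corners_of_finite[OF D(1)] _ corners_of_even[OF f z]]) (assumption, auto simp: corners_of_def)
   then show "sum h {q \<in> AC. g q = z} = 0" unfolding h_def co[symmetric] sum_subtractf by simp
  qed
 qed (use fAC in auto)
 finally have "sum h (corners_of D u) + sum h (corners_of D v) + sum h (corners_of D w) = 0"
  unfolding co[symmetric] h0 using F(7-9) by (simp add: add.assoc)
 then have std: "sum std_angle (corners_of D u) + sum std_angle (corners_of D v) + sum std_angle (corners_of D w) \<le> pi"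
  using filling_angle_sum[OF f] unfolding h_def sum_subtractf by linarith
 have ge: "pi / 3 \<le> std_angle q" for q by (simp add: std_angle_def)
 have low: "real (card A) * (pi / 3) \<le> sum std_angle A" for A
  using sum_bounded_below[of A "pi / 3" std_angle] ge by simp
 have pos: "1 \<le> card (corners_of D z)" if "filling z z' z'' D" for z z' z''
 proof -
  have "corners_of D z \<noteq> {}" using corners_of_odd[OF that, of z'] by (auto simp: degree_in_def)
  then show ?thesis using corners_of_finite[OF D(1), of z] by (simp add: Suc_le_eq card_gt_0_iff)
 qed
 have third: "pi / 3 \<le> sum std_angle (corners_of D z)" if "filling z z' z'' D" for z z' z''
 proof -
  have "1 * (pi / 3) \<le> real (card (corners_of D z)) * (pi / 3)" using pos[OF that] by (intro mult_right_mono) auto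
  then show ?thesis using low[of "corners_of D z"] by linarith
 qed
 \<comment> \<open>The other two vertices take at least 2 \<pi> / 3 of the total.\<close>
 have su: "sum std_angle (corners_of D u) \<le> pi / 3"
  using std third[OF filling_rotate[OF f]] third[OF filling_rotate[OF filling_rotate[OF f]]] by linarith
 have "real (card (corners_of D u)) * (pi / 3) \<le> 1 * (pi / 3)" using su low[of "corners_of D u"] by linarith
 then have "card (corners_of D u) = 1" using pos[OF f] by (simp add: mult_le_cancel_right)
 then obtain q where q: "corners_of D u = {q}" by (auto simp: card_1_singleton_iff)
 obtain c k where ck: "q = (c, k)" by (cases q)
 have l3: "len c = 3"
 proof (rule ccontr)
  assume "len c \<noteq> 3"
  then have "3 * pi / 5 \<le> pi / 3" using su unfolding q ck by (simp add: std_angle_def)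
  then show False using pi_gt_zero by linarith
 qed
 have cu: "(c, k) \<in> corners X u" using q ck by (auto simp: corners_of_def)
 have "p \<in> corner_ends X q \<longleftrightarrow> p = v \<or> p = w" for p
 proof -
  have "degree_in {q} p = (if p \<in> corner_ends X q then 1 else 0)" by (auto simp: degree_in_def Collect_conv_if)
  then show ?thesis using corners_of_odd[OF f, of p] unfolding q by (auto split: if_splits)
 qed
 then have "corner_ends X (c, k) = {v, w}" unfolding ck by blast
 moreover have "set (bds c) = insert u (corner_ends X (c, k))"
 proof -
  obtain x y z where b: "bds c = [x, y, z]" using l3 by (rule length_3E)
  have "k < 3" "u = bds c ! k" using cu l3 by (auto simp: corners_iff)
  then have "k = 0 \<or> k = 1 \<or> k = 2" by arith
  then show ?thesis unfolding corner_ends_alt \<open>u = bds c ! k\<close>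
   by (elim disjE) (auto simp: b nxt_def prv_def)
 qed
 ultimately show ?thesis using that[of c] cu l3 unfolding corners_iff triangles_def by auto
qed

end

section \<open>The coned complex\<close>

text \<open>The law of cosines gives both base angles the same cosine, so they share what the apex
  leaves of \<pi>.\<close>

lemma isosceles_angles:
 assumes "0 < \<rho>" "0 < \<alpha>" "\<alpha> < pi"
 defines "b \<equiv> complex_of_real \<rho>" and "c \<equiv> complex_of_real \<rho> * cis \<alpha>"
 shows "vec_angle b c = \<alpha>" "vec_angle (c - b) (- b) = (pi - \<alpha>) / 2" "vec_angle (- c) (b - c) = (pi - \<alpha>) / 2"
proof -
 show A: "vec_angle b c = \<alpha>"
  using vec_angle_cis[of b 1 \<alpha>] assms by (simp add: b_def c_def)
 have s: "0 < sin \<alpha>" using assms by (simp add: sin_gt_zero)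
 have "cis \<alpha> \<noteq> 1" using s by (auto simp: complex_eq_iff)
 then have ne: "b \<noteq> c" "c \<noteq> 0" "b \<noteq> 0" using assms(1) by (auto simp: b_def c_def)
 have n: "dist b 0 = \<rho>" "dist 0 b = \<rho>" "dist 0 c = \<rho>" "dist c 0 = \<rho>" using assms by (simp_all add: b_def c_def norm_mult)
 have "cos (vec_angle (c - b) (0 - b)) = cos (vec_angle (0 - c) (b - c))"
  using vec_angle_law_of_cosines[of b c 0] vec_angle_law_of_cosines[of c 0 b] ne n
  by (simp add: dist_commute mult.commute)
 then have "vec_angle (c - b) (0 - b) = vec_angle (0 - c) (b - c)"
  by (rule cos_inj_pi[rotated 4]) (rule vec_angle_bounds)+
 moreover have "vec_angle (b - 0) (c - 0) + vec_angle (c - b) (0 - b) + vec_angle (0 - c) (b - c) = pi"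
  by (rule triangle_angle_sum) (use ne in auto)
 ultimately show "vec_angle (c - b) (- b) = (pi - \<alpha>) / 2" "vec_angle (- c) (b - c) = (pi - \<alpha>) / 2"
  using A by simp_all
qed

locale agreeing_complex = npc_complex X for X :: "('v, 'c) pe_complex" +
 assumes metrics_agree: "v \<in> verts X ==> metrics_agree_at X v"
begin

lemma triangle_iff: "c \<in> triangles X \<longleftrightarrow> c \<in> cells X \<and> len c = 3"
 and pentagon_iff: "c \<in> pentagons X \<longleftrightarrow> c \<in> cells X \<and> len c = 5"
 by (auto simp: triangles_def pentagons_def)

lemma star_cells: "cells (star X) = Inl ` triangles X \<union> Inr ` (pentagons X \<times> {..<5})"
 and star_bd_Inl: "bd (star X) (Inl c) = map Inl (bds c)"
 and star_bd_Inr: "bd (star X) (Inr (p, i)) = [Inr p, Inl (bds p ! i), Inl (nxt (bds p) i)]"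
 and star_shape_Inl: "shape (star X) (Inl c) = [0, 1, cis (pi / 3)]"
 and star_shape_Inr: "shape (star X) (Inr (p, i)) =
   [0, of_real pentagon_radius, of_real pentagon_radius * cis (2 * pi / 5)]"
 by (simp_all add: star_def)

lemma pentagon_radius_pos: "0 < pentagon_radius"
proof -
 have "0 < sin (pi / 5)" by (rule sin_gt_zero) (use pi_gt_zero in simp_all)
 then show ?thesis by (simp add: pentagon_radius_def)
qed

lemma star_angle_triangle: assumes "k < 3" shows "corner_angle (star X) (Inl c, k) = pi / 3"
proof -
 note I = isosceles_angles[of 1 "pi / 3"]
 have "k = 0 \<or> k = 1 \<or> k = 2" using assms by arith
 then show ?thesis using I pi_gt_zero
  by (elim disjE) (simp_all add: corner_angle_def star_shape_Inl nxt_def prv_def)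
qed

lemma star_angle_pentagon:
 "corner_angle (star X) (Inr (p, i), 1) = 3 * pi / 10" "corner_angle (star X) (Inr (p, i), 2) = 3 * pi / 10"
 using isosceles_angles[of pentagon_radius "2 * pi / 5"] pentagon_radius_pos pi_gt_zero
 by (simp_all add: corner_angle_def star_shape_Inr nxt_def prv_def)

lemma subdivided_triangle:
 assumes c: "c \<in> triangles X" "k < 3" shows "subdivided_corner X (c, k) = {(Inl c, k)}"
proof -
 have cX: "c \<in> cells X" "len c = 3" using c(1) by (auto simp: triangle_iff)
 have "m = k" if "m < 3" "bds c ! m = bds c ! k" for m
  using that cell_distinct[OF cX(1)] cX(2) c(2) by (simp add: nth_eq_iff_index_eq)
 then show ?thesis
  using c cX by (auto simp: subdivided_corner_def corners_def star_cells star_bd_Inl star_bd_Inr parent_cell_def pentagon_iff split: sum.splits)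
qed

text \<open>Vertex k lies on the central triangle of side k, in position 1, and on that of the
  preceding side \<open>(k + 4) mod 5\<close>, in position 2; position 0 is the center.\<close>

lemma subdivided_pentagon:
 assumes c: "c \<in> pentagons X" "k < 5"
 shows "subdivided_corner X (c, k) = {(Inr (c, k), 1), (Inr (c, (k + 4) mod 5), 2)}"
proof (intro equalityI subsetI)
 have cX: "c \<in> cells X" "len c = 5" using c(1) by (auto simp: pentagon_iff)
 have ix: "bds c ! i = bds c ! j \<longleftrightarrow> i = j" if "i < 5" "j < 5" for i j
  using that cell_distinct[OF cX(1)] cX(2) by (simp add: nth_eq_iff_index_eq)
 fix x assume "x \<in> subdivided_corner X (c, k)"
 then obtain t m where x: "x = (t, m)" "(t, m) \<in> corners (star X) (Inl (bds c ! k))" "parent_cell t = c"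
  by (auto simp: subdivided_corner_def)
 then obtain i where t: "t = Inr (c, i)" "i < 5"
  using cX(2) by (auto simp: corners_def star_cells parent_cell_def triangle_iff)
 have m: "m < 3" "[Inr c, Inl (bds c ! i), Inl (nxt (bds c) i)] ! m = Inl (bds c ! k)"
  using x(2) by (auto simp: corners_def t(1) star_bd_Inr)
 then have "m = 0 \<or> m = 1 \<or> m = 2" by arith
 then consider "m = 1" "i = k" | "m = 2" "Suc i mod 5 = k"
  using m(2) ix[OF t(2) c(2)] ix[of "Suc i mod 5" k] c(2) by (auto simp: nxt_def cX(2))
 then show "x \<in> {(Inr (c, k), 1), (Inr (c, (k + 4) mod 5), 2)}"
 proof cases
  case 2
  have "i = 0 \<or> i = 1 \<or> i = 2 \<or> i = 3 \<or> i = 4" using t(2) by arith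
  then have "i = (k + 4) mod 5" using 2(2) by (elim disjE) auto
  then show ?thesis using 2 x t by simp
 qed (use x t in simp)
next
 have cX: "c \<in> cells X" "len c = 5" using c(1) by (auto simp: pentagon_iff)
 fix x assume "x \<in> {(Inr (c, k) :: 'c + 'c \<times> nat, 1 :: nat), (Inr (c, (k + 4) mod 5), 2)}"
 moreover have "k = 0 \<or> k = 1 \<or> k = 2 \<or> k = 3 \<or> k = 4" using c(2) by arith
 then have "Suc ((k + 4) mod 5) mod 5 = k" by (elim disjE) auto
 ultimately show "x \<in> subdivided_corner X (c, k)"
  using c cX by (auto simp: subdivided_corner_def corners_def star_cells star_bd_Inr parent_cell_def nxt_def)
qed

lemma subdivided_angle:
 assumes q: "q \<in> corners X v" shows "sum (corner_angle (star X)) (subdivided_corner X q) = std_angle q"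
proof -
 obtain c k where ck: "q = (c, k)" "c \<in> cells X" "k < len c" using q by (cases q) (auto simp: corners_iff)
 show ?thesis
 proof (cases "len c = 3")
  case True
  then show ?thesis using subdivided_triangle[of c k] star_angle_triangle[of k c] ck by (simp add: triangle_iff std_angle_def)
 next
  case False
  then have l5: "len c = 5" using cell_len[OF ck(2)] by simp
  then have "subdivided_corner X (c, k) = {(Inr (c, k), 1), (Inr (c, (k + 4) mod 5), 2)}"
   using subdivided_pentagon[of c k] ck by (simp add: pentagon_iff)
  moreover have "(Inr (c, k) :: 'c + 'c \<times> nat, 1 :: nat) \<noteq> (Inr (c, (k + 4) mod 5), 2)" by simp
  ultimately show ?thesis using l5 ck(1) by (simp add: std_angle_def star_angle_pentagon[unfolded One_nat_def])
 qed
qed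

lemma subdivided_finite: assumes q: "q \<in> corners X v" shows "finite (subdivided_corner X q)"
proof -
 obtain c k where ck: "q = (c, k)" "c \<in> cells X" "k < len c" using q by (cases q) (auto simp: corners_iff)
 then consider "c \<in> triangles X" "k < 3" | "c \<in> pentagons X" "k < 5"
  using cell_len[OF ck(2)] by (auto simp: triangle_iff pentagon_iff)
 then show ?thesis using subdivided_triangle[of c k] subdivided_pentagon[of c k] ck(1) by cases auto
qed

text \<open>Here the agreement of the metrics enters: it turns the link condition, proved for the
  given metric, into one for the standard angles.\<close>

lemma loop_angles:
 assumes L: "link_loop X v Q"
 shows "sum (corner_angle X) Q = sum std_angle Q" "2 * pi \<le> sum std_angle Q"
proof -
 note F = loop_finite[OF L]
 obtain c k where ck: "(c, k) \<in> Q" using F(2) by (metis all_not_in_conv surj_pair)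
 then have "c \<in> cells X" "k < len c" "bds c ! k = v" using F(3) corners_iff by blast+
 then have "v \<in> verts X" using cell_side[of c k] edge_verts by blast
 then have "angular_length X Q = angular_length (star X) (\<Union>q\<in>Q. subdivided_corner X q)"
  using metrics_agree L unfolding metrics_agree_at_def by blast
 also have "\<dots> = (\<Sum>q\<in>Q. sum (corner_angle (star X)) (subdivided_corner X q))"
  unfolding angular_length_def
 proof (rule sum.UNION_disjoint[OF F(1)])
  show "\<forall>q\<in>Q. finite (subdivided_corner X q)" using F(3) subdivided_finite by blast
  show "\<forall>q\<in>Q. \<forall>q'\<in>Q. q \<noteq> q' --> subdivided_corner X q \<inter> subdivided_corner X q' = {}"
  proof (intro ballI impI)
   fix q q' assume q: "q \<in> Q" "q' \<in> Q" "q \<noteq> q'"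
   then have "fst q \<noteq> fst q'" using corner_neq_cell[of q v q'] F(3) by blast
   then show "subdivided_corner X q \<inter> subdivided_corner X q' = {}"
    by (cases q, cases q') (auto simp: subdivided_corner_def)
  qed
 qed
 also have "\<dots> = sum std_angle Q" by (rule sum.cong[OF HOL.refl]) (use F(3) subdivided_angle in blast)
 finally show "sum (corner_angle X) Q = sum std_angle Q" by (simp add: angular_length_def)
 then show "2 * pi \<le> sum std_angle Q" using link_condition[OF L] by (simp add: angular_length_def)
qed

text \<open>A leafless graph contains a loop, and standard angles are nonnegative.\<close>

lemma leafless_angle: assumes L: "leafless v Q" shows "2 * pi \<le> sum std_angle Q"
proof -
 obtain Q' where Q: "Q' \<subseteq> Q" "link_loop X v Q'" by (rule leafless_loop[OF L]) (rule that)
 have "sum std_angle Q' \<le> sum std_angle Q"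
  by (rule sum_mono2[OF _ Q(1)]) (use L in \<open>auto simp: leafless_def std_angle_def\<close>)
 then show ?thesis using loop_angles(2)[OF Q(2)] by linarith
qed

lemma graph_triangle:
 assumes "{u, v} \<in> edges X" "{v, w} \<in> edges X" "{w, u} \<in> edges X"
 obtains c where "c \<in> triangles X" "set (bds c) = {u, v, w}"
 by (rule triangle_cell[OF loop_angles(1) assms]) (assumption, rule that)

end

subsection \<open>Short cycles in the links of the coned complex\<close>

text \<open>For graphs given by their edge sets, what \<open>leafless\<close> is for sets of
  corners: every edge is continued at both of its ends.\<close>

definition leafless_edges :: "'a set set => bool" where
 "leafless_edges E \<longleftrightarrow> finite E \<and> E \<noteq> {} \<and> (\<forall>e\<in>E. card e = 2 \<and> (\<forall>x\<in>e. \<exists>e'\<in>E. e' \<noteq> e \<and> x \<in> e'))"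

lemma cycle_leafless:
 assumes j: "3 \<le> j" and f: "inj_on f {..<j}"
 shows "leafless_edges ((\<lambda>i. {f i, f (Suc i mod j)}) ` {..<j})"
proof -
 let ?e = "\<lambda>i. {f i, f (Suc i mod j)}"
 have S: "Suc i mod j = (if Suc i = j then 0 else Suc i)" if "i < j" for i using that by auto
 have inj: "f a = f b \<longleftrightarrow> a = b" if "a < j" "b < j" for a b using f that by (auto simp: inj_on_eq_iff)
 have "card (?e i) = 2 \<and> (\<forall>x\<in>?e i. \<exists>e'\<in>?e ` {..<j}. e' \<noteq> ?e i \<and> x \<in> e')" if i: "i < j" for i
 proof -
  \<comment> \<open>n and m are the next two indices and p is the previous one; for j at least 3 the
    two adjacent edges differ from edge i.\<close>
  define n where "n = Suc i mod j"
  define m where "m = Suc n mod j"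
  define p where "p = (if i = 0 then j - 1 else i - 1)"
  have b: "n < j" "m < j" "p < j" using i j by (auto simp: n_def m_def p_def)
  have ne: "n \<noteq> i" "m \<noteq> i" "m \<noteq> n" "p \<noteq> i" "p \<noteq> n"
  proof -
   have n: "n = (if Suc i = j then 0 else Suc i)" and m: "m = (if Suc n = j then 0 else Suc n)"
    using S[OF i] S[OF b(1)] by (simp_all only: n_def m_def)
   show "n \<noteq> i" "m \<noteq> i" "m \<noteq> n" "p \<noteq> i" "p \<noteq> n"
    unfolding m unfolding n p_def using i j by (auto split: if_splits)
  qed
  have "Suc p mod j = i" using S[OF b(3)] i j by (auto simp: p_def split: if_splits)
  then have E: "{f n, f m} \<in> ?e ` {..<j}" "{f p, f i} \<in> ?e ` {..<j}"
   using b by (auto simp: m_def)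
  have D: "{f n, f m} \<noteq> {f i, f n}" "{f p, f i} \<noteq> {f i, f n}"
   using ne inj i b by (auto simp: doubleton_eq_iff)
  show ?thesis unfolding n_def[symmetric]
  proof (intro conjI ballI)
   show "card {f i, f n} = 2" using inj i b ne by simp
   fix x assume "x \<in> {f i, f n}"
   then consider "x = f i" | "x = f n" by blast
   then show "\<exists>e'\<in>?e ` {..<j}. e' \<noteq> {f i, f n} \<and> x \<in> e'"
   proof cases
    case 1 show ?thesis by (rule bexI[OF _ E(2)]) (use 1 D in simp)
   next
    case 2 show ?thesis by (rule bexI[OF _ E(1)]) (use 2 D in simp)
   qed
  qed
 qed
 moreover have "0 \<in> {..<j}" using j by simp
 then have "?e ` {..<j} \<noteq> {}" by blast
 ultimately show ?thesis unfolding leafless_edges_def by simp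
qed

lemma link_cycle:
 assumes "has_full_cycle j (link Y \<sigma>)"
 obtains E where "3 \<le> j" "leafless_edges E" "card E \<le> j" "\<And>e. e \<in> E ==> e \<inter> \<sigma> = {} \<and> e \<union> \<sigma> \<in> Y"
proof -
 from assms obtain K where K: "cycle_of_length j K" "full_subcomplex K (link Y \<sigma>)" unfolding has_full_cycle_def by (elim exE conjE)
 from K(1) obtain f where f': "3 \<le> j" "inj_on f {..<j}" "K = (`) f ` circle j" unfolding cycle_of_length_def by (elim exE conjE)
 from K(2) have "K \<subseteq> link Y \<sigma>" unfolding full_subcomplex_def subcomplex_def by (elim conjE)
 note f = f' this
 define E where "E = (\<lambda>i. {f i, f (Suc i mod j)}) ` {..<j}"
 have "leafless_edges E" unfolding E_def by (rule cycle_leafless[OF f(1,2)])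
 moreover have "card E \<le> j" unfolding E_def using card_image_le[of "{..<j}" "\<lambda>i. {f i, f (Suc i mod j)}"] by simp
 moreover have "e \<inter> \<sigma> = {} \<and> e \<union> \<sigma> \<in> Y" if e: "e \<in> E" for e
 proof -
  obtain i where i: "i < j" "e = f ` {i, Suc i mod j}" using e by (auto simp: E_def)
  then have "{i, Suc i mod j} \<in> circle j" unfolding circle_def by blast
  then have "e \<in> K" unfolding f(3) i(2) by (rule imageI)
  then have "e \<in> link Y \<sigma>" using f(4) by blast
  then show ?thesis by (simp add: link_def)
 qed
 ultimately show ?thesis using that f(1) by blast
qed

text \<open>A clique of the link together with \<sigma> is a clique of the complex, hence a
  simplex.\<close>

lemma link_flag:
 assumes Y: "flag Y" and down: "\<And>\<sigma> \<tau>. \<sigma> \<in> Y ==> \<tau> \<noteq> {} ==> \<tau> \<subseteq> \<sigma> ==> \<tau> \<in> Y"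
  and s: "\<sigma> \<in> Y" "finite \<sigma>"
 shows "flag (link Y \<sigma>)"
 unfolding flag_def
proof (intro allI impI)
 fix S assume "finite S \<and> S \<noteq> {} \<and> S \<subseteq> \<Union>(link Y \<sigma>) \<and> (\<forall>x\<in>S. \<forall>y\<in>S. x \<noteq> y --> {x, y} \<in> link Y \<sigma>)"
 then have S: "finite S" "S \<noteq> {}" "S \<subseteq> \<Union>(link Y \<sigma>)" "\<And>x y. x \<in> S ==> y \<in> S ==> x \<noteq> y ==> {x, y} \<in> link Y \<sigma>" by blast+
 have x: "insert x \<sigma> \<in> Y \<and> x \<notin> \<sigma>" if x: "x \<in> S" for x
 proof -
  obtain \<tau> where "\<tau> \<in> link Y \<sigma>" "x \<in> \<tau>" using S(3) x by blast
  then have "\<tau> \<union> \<sigma> \<in> Y" "\<tau> \<inter> \<sigma> = {}" "insert x \<sigma> \<subseteq> \<tau> \<union> \<sigma>" by (auto simp: link_def)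
  then show ?thesis using down[of "\<tau> \<union> \<sigma>" "insert x \<sigma>"] \<open>x \<in> \<tau>\<close> by blast
 qed
 have pair: "{a, b} \<in> Y" if ab: "a \<in> S \<union> \<sigma>" "b \<in> S \<union> \<sigma>" "a \<noteq> b" for a b
 proof -
  consider "a \<in> S" "b \<in> S" | "a \<in> S" "b \<in> \<sigma>" | "a \<in> \<sigma>" "b \<in> S" | "a \<in> \<sigma>" "b \<in> \<sigma>" using ab by blast
  then show ?thesis
  proof cases
   case 1 then show ?thesis using S(4)[of a b] ab by (simp add: link_def)
  next
   case 2 then show ?thesis using x[of a] down[of "insert a \<sigma>" "{a, b}"] by blast
  next
   case 3 then show ?thesis using x[of b] down[of "insert b \<sigma>" "{a, b}"] by blast
  next
   case 4 then show ?thesis using s(1) down[of \<sigma> "{a, b}"] by blast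
  qed
 qed
 have "S \<union> \<sigma> \<subseteq> \<Union>Y" using x s(1) by blast
 then have u: "S \<union> \<sigma> \<in> Y" using Y[unfolded flag_def, rule_format, of "S \<union> \<sigma>"] S(1,2) s(2) pair by simp
 then have "S \<in> Y" using down[of "S \<union> \<sigma>" S] S(2) by blast
 moreover have "S \<inter> \<sigma> = {}" using x by blast
 ultimately show "S \<in> link Y \<sigma>" using u by (simp add: link_def)
qed

section \<open>Simplices of the coned complex\<close>

context agreeing_complex begin

abbreviation Y where "Y \<equiv> simplices (star X)"

text \<open>The vertex sets of simplices that contain no center.\<close>

definition flat :: "'v set => bool" where
 "flat A \<longleftrightarrow> (\<exists>v\<in>verts X. A = {v}) \<or> A \<in> edges X \<or> (\<exists>c\<in>triangles X. A = set (bds c))"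

text \<open>The sets of old vertices that span a simplex with the center of p: the faces of the
  boundary pentagon, the empty one included.\<close>

definition coned :: "'c => 'v set => bool" where
 "coned p A \<longleftrightarrow> p \<in> pentagons X \<and> (A = {} \<or> (\<exists>a\<in>set (bds p). A = {a}) \<or> (\<exists>i<5. A = {bds p ! i, nxt (bds p) i}))"

lemma Y_alt: "Y = {Inl ` A | A. flat A} \<union> {insert (Inr p) (Inl ` A) | p A. coned p A}"
proof -
 have v: "graph_complex (star X) = {Inl ` A | A. (\<exists>v\<in>verts X. A = {v}) \<or> A \<in> edges X}
   \<union> {insert (Inr p) (Inl ` A) | p A. p \<in> pentagons X \<and> (A = {} \<or> (\<exists>a\<in>set (bds p). A = {a}))}"
  unfolding graph_complex_def by (simp add: star_def) (auto simp: image_iff; force)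
 have c: "(\<lambda>c. set (bd (star X) c)) ` cells (star X) = {Inl ` set (bds c) | c. c \<in> triangles X}
   \<union> {insert (Inr p) (Inl ` {bds p ! i, nxt (bds p) i}) | p i. p \<in> pentagons X \<and> i < 5}"
 proof -
  have 1: "(\<lambda>c. set (bd (star X) (Inl c))) ` triangles X = {Inl ` set (bds c) | c. c \<in> triangles X}"
   by (auto simp: star_bd_Inl)
  have 2: "(\<lambda>c. set (bd (star X) (Inr c))) ` (pentagons X \<times> {..<5}) =
    {insert (Inr p) (Inl ` {bds p ! i, nxt (bds p) i}) | p i. p \<in> pentagons X \<and> i < 5}"
  proof (intro equalityI subsetI)
   fix x assume "x \<in> (\<lambda>c. set (bd (star X) (Inr c))) ` (pentagons X \<times> {..<5})"
   then obtain p i where "p \<in> pentagons X" "i < 5" "x = set (bd (star X) (Inr (p, i)))" by auto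
   then show "x \<in> {insert (Inr p) (Inl ` {bds p ! i, nxt (bds p) i}) | p i. p \<in> pentagons X \<and> i < 5}"
    by (auto simp: star_bd_Inr)
  next
   fix x assume "x \<in> {insert (Inr p) (Inl ` {bds p ! i, nxt (bds p) i}) | p i. p \<in> pentagons X \<and> i < 5}"
   then obtain p i where "p \<in> pentagons X" "i < 5" "x = insert (Inr p) (Inl ` {bds p ! i, nxt (bds p) i})" by auto
   then show "x \<in> (\<lambda>c. set (bd (star X) (Inr c))) ` (pentagons X \<times> {..<5})"
    by (intro image_eqI[of _ _ "(p, i)"]) (auto simp: star_bd_Inr)
  qed
  show ?thesis unfolding star_cells image_Un image_image 1 2 ..
 qed
 have s1: "{Inl ` A | A. flat A} = {Inl ` A | A. (\<exists>v\<in>verts X. A = {v}) \<or> A \<in> edges X} \<union>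
  ({Inl ` set (bds c) | c. c \<in> triangles X} :: ('v + 'c) set set)" (is "?L = ?R1 \<union> ?R2")
 proof (intro equalityI subsetI)
  fix \<sigma> assume "\<sigma> \<in> ?L"
  then obtain A where A: "\<sigma> = Inl ` A" "flat A" by (elim CollectE exE conjE)
  from A(2) consider "(\<exists>v\<in>verts X. A = {v}) \<or> A \<in> edges X" | c where "c \<in> triangles X" "A = set (bds c)"
   unfolding flat_def by blast
  then show "\<sigma> \<in> ?R1 \<union> ?R2"
  proof cases
   case 1 show ?thesis by (rule UnI1, rule CollectI, rule exI[of _ A]) (use A(1) 1 in simp)
  next
   case 2 show ?thesis by (rule UnI2, rule CollectI, rule exI[of _ c]) (use A(1) 2 in simp)
  qed
 next
  fix \<sigma> assume "\<sigma> \<in> ?R1 \<union> ?R2"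
  then obtain A where "\<sigma> = Inl ` A" "flat A"
  proof (elim UnE CollectE exE conjE)
   fix A assume A: "\<sigma> = Inl ` A" "(\<exists>v\<in>verts X. A = {v}) \<or> A \<in> edges X"
   show ?thesis by (rule that[OF A(1)]) (unfold flat_def, use A(2) in blast)
  next
   fix c assume c: "\<sigma> = Inl ` set (bds c)" "c \<in> triangles X"
   show ?thesis by (rule that[OF c(1)]) (use c(2) in \<open>auto simp: flat_def\<close>)
  qed
  then show "\<sigma> \<in> ?L" by (intro CollectI exI[of _ A] conjI)
 qed
 have s2: "{insert (Inr p) (Inl ` A) | p A. coned p A} =
  {insert (Inr p) (Inl ` A) | p A. p \<in> pentagons X \<and> (A = {} \<or> (\<exists>a\<in>set (bds p). A = {a}))} \<union>
  ({insert (Inr p) (Inl ` {bds p ! i, nxt (bds p) i}) | p i. p \<in> pentagons X \<and> i < 5} :: ('v + 'c) set set)" (is "?L = ?R1 \<union> ?R2")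
 proof (intro equalityI subsetI)
  fix \<sigma> assume "\<sigma> \<in> ?L"
  then obtain p A where A: "\<sigma> = insert (Inr p) (Inl ` A)" "coned p A" by (elim CollectE exE conjE)
  from A(2) have p: "p \<in> pentagons X" by (simp add: coned_def)
  from A(2) consider "A = {} \<or> (\<exists>a\<in>set (bds p). A = {a})" | i where "i < 5" "A = {bds p ! i, nxt (bds p) i}"
   unfolding coned_def by blast
  then show "\<sigma> \<in> ?R1 \<union> ?R2"
  proof cases
   case 1 show ?thesis by (rule UnI1, rule CollectI, rule exI[of _ p], rule exI[of _ A]) (use A(1) 1 p in simp)
  next
   case 2 show ?thesis by (rule UnI2, rule CollectI, rule exI[of _ p], rule exI[of _ i]) (use A(1) 2 p in simp)
  qed
 next
  fix \<sigma> assume "\<sigma> \<in> ?R1 \<union> ?R2"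
  then obtain p A where "\<sigma> = insert (Inr p) (Inl ` A)" "coned p A"
  proof (elim UnE CollectE exE conjE)
   fix p A assume A: "\<sigma> = insert (Inr p) (Inl ` A)" "p \<in> pentagons X" "A = {} \<or> (\<exists>a\<in>set (bds p). A = {a})"
   show ?thesis by (rule that[OF A(1)]) (use A(2,3) in \<open>auto simp: coned_def\<close>)
  next
   fix p i assume c: "\<sigma> = insert (Inr p) (Inl ` {bds p ! i, nxt (bds p) i})" "p \<in> pentagons X" "i < 5"
   show ?thesis by (rule that[OF c(1)]) (use c(2,3) in \<open>auto simp: coned_def\<close>)
  qed
  then show "\<sigma> \<in> ?L" by (intro CollectI exI[of _ p] exI[of _ A] conjI)
 qed
 show ?thesis unfolding simplices_def v c s1 s2 by (simp only: Un_ac)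
qed

lemma insert_Inr_iff: "insert (Inr p) (Inl ` A) = insert (Inr q) (Inl ` B) \<longleftrightarrow> p = q \<and> A = B"
proof
 assume e: "insert (Inr p) (Inl ` A) = insert (Inr q) (Inl ` B)"
 have "Inr p \<in> insert (Inr q) (Inl ` B)" unfolding e[symmetric] by simp
 then have "p = q" by auto
 moreover have "x \<in> A \<longleftrightarrow> x \<in> B" for x
 proof -
  have "Inl x \<in> insert (Inr p) (Inl ` A) \<longleftrightarrow> Inl x \<in> insert (Inr q) (Inl ` B)" unfolding e ..
  then show ?thesis by auto
 qed
 ultimately show "p = q \<and> A = B" by blast
qed simp

lemma Y_Inl: "Inl ` A \<in> Y \<longleftrightarrow> flat A"
proof -
 have "Inl ` A \<noteq> insert (Inr p) (Inl ` B)" for p B by blast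
 then show ?thesis unfolding Y_alt by (auto simp: inj_image_eq_iff)
qed

lemma Y_Inr: "insert (Inr p) (Inl ` A) \<in> Y \<longleftrightarrow> coned p A"
proof -
 have "insert (Inr p) (Inl ` A) \<noteq> Inl ` B" for B by blast
 then show ?thesis unfolding Y_alt by (auto simp: insert_Inr_iff)
qed

lemma Y_cases:
 assumes "\<sigma> \<in> Y" obtains A where "flat A" "\<sigma> = Inl ` A" | p A where "coned p A" "\<sigma> = insert (Inr p) (Inl ` A)"
 using assms unfolding Y_alt by blast

lemma triangle_pairs:
 assumes c: "c \<in> triangles X" and ab: "a \<in> set (bds c)" "b \<in> set (bds c)" "a \<noteq> b" shows "{a, b} \<in> edges X"
proof -
 have cX: "c \<in> cells X" "len c = 3" using c by (auto simp: triangle_iff)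
 obtain x y z where b: "bds c = [x, y, z]" using cX(2) by (rule length_3E)
 have "{x, y} \<in> edges X" "{y, z} \<in> edges X" "{z, x} \<in> edges X"
  using cell_side[OF cX(1), of 0] cell_side[OF cX(1), of 1] cell_side[OF cX(1), of 2] by (simp_all add: b nxt_def)
 then show ?thesis using ab by (auto simp: b insert_commute)
qed

lemma cell_verts: assumes "c \<in> cells X" "a \<in> set (bds c)" shows "a \<in> verts X"
proof -
 obtain k where "k < len c" "bds c ! k = a" using assms(2) by (auto simp: in_set_conv_nth)
 then show ?thesis using cell_side[OF assms(1), of k] edge_verts by blast
qed

lemma flat_finite: assumes "flat A" shows "finite A" "A \<noteq> {}" "card A \<le> 3" "A \<subseteq> verts X"
proof -
 have "card (set (bds c)) = 3 \<and> set (bds c) \<noteq> {} \<and> set (bds c) \<subseteq> verts X" if "c \<in> triangles X" for c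
  using that cell_distinct[of c] cell_verts[of c] distinct_card[of "bds c"] by (auto simp: triangle_iff)
 moreover have "finite e \<and> e \<noteq> {} \<and> card e \<le> 3 \<and> e \<subseteq> verts X" if "e \<in> edges X" for e
  using edge_card[OF that] edge_verts[OF that] by (auto intro: card_ge_0_finite)
 ultimately show "finite A" "A \<noteq> {}" "card A \<le> 3" "A \<subseteq> verts X" using assms unfolding flat_def by (elim disjE bexE; simp)+
qed

lemma flat_subset: assumes "flat A" "B \<subseteq> A" "B \<noteq> {}" shows "flat B"
proof -
 note F = flat_finite[OF assms(1)]
 have fB: "finite B" using finite_subset[OF assms(2) F(1)] .
 have pairs: "{a, b} \<in> edges X" if "a \<in> A" "b \<in> A" "a \<noteq> b" for a b
  using assms(1) unfolding flat_def
 proof (elim disjE bexE)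
  assume e: "A \<in> edges X"
  then have "card A = 2" by (rule edge_card)
  then have "A = {a, b}" using that by (auto simp: card_2_iff)
  then show ?thesis using e by simp
 next
  fix c assume "c \<in> triangles X" "A = set (bds c)"
  then show ?thesis using triangle_pairs[of c a b] that by simp
 qed (use that in auto)
 show ?thesis
 proof (cases "B = A")
  case False
  then have "card B < card A" using psubset_card_mono[OF F(1)] assms(2) by blast
  moreover have "card B \<noteq> 0" using fB assms(3) by simp
  ultimately have "card B = 1 \<or> card B = 2" using F(3) by linarith
  then show ?thesis
  proof
   assume "card B = 1"
   then obtain b where "B = {b}" by (auto simp: card_1_singleton_iff)
   then show ?thesis using F(4) assms(2) by (auto simp: flat_def)
  next
   assume "card B = 2"
   then obtain a b where "B = {a, b}" "a \<noteq> b" unfolding card_2_iff by blast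
   then show ?thesis using pairs[of a b] assms(2) by (auto simp: flat_def)
  qed
 qed (use assms in simp)
qed

lemma coned_finite: assumes "coned p A" shows "finite A" "card A \<le> 2" "A \<subseteq> set (bds p)" "p \<in> pentagons X"
proof -
 have "bds p ! i \<in> set (bds p) \<and> nxt (bds p) i \<in> set (bds p)" if "p \<in> pentagons X" "i < 5" for i
  using that Suc_mod[of p i] by (auto simp: pentagon_iff nxt_def)
 then show "finite A" "card A \<le> 2" "A \<subseteq> set (bds p)" "p \<in> pentagons X"
  using assms unfolding coned_def by (auto simp: card_insert_if)
qed

lemma coned_subset: assumes "coned p A" "B \<subseteq> A" shows "coned p B"
proof -
 note F = coned_finite[OF assms(1)]
 have fB: "finite B" using finite_subset[OF assms(2) F(1)] .
 show ?thesis
 proof (cases "B = A")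
  case False
  then have "card B < card A" using psubset_card_mono[OF F(1)] assms(2) by blast
  then have "card B = 0 \<or> card B = 1" using F(2) by linarith
  then show ?thesis using fB F(3,4) assms(2) unfolding coned_def by (auto simp: card_1_singleton_iff)
 qed (use assms in simp)
qed

lemma coned_flat: assumes "coned p A" "A \<noteq> {}" shows "flat A"
proof -
 have p: "p \<in> cells X" "len p = 5" using coned_finite(4)[OF assms(1)] by (auto simp: pentagon_iff)
 show ?thesis using assms cell_side[OF p(1)] cell_verts[OF p(1)] p(2) unfolding coned_def flat_def by auto
qed

lemma Y_finite: assumes "\<sigma> \<in> Y" shows "finite \<sigma>" "\<sigma> \<noteq> {}" "card \<sigma> \<le> 3"
proof -
 have "finite \<sigma> \<and> \<sigma> \<noteq> {} \<and> card \<sigma> \<le> 3" using assms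
 proof (cases rule: Y_cases)
  case (1 A)
  then show ?thesis using flat_finite[OF 1(1)] by (simp add: card_image)
 next
  case (2 p A)
  have "Inr p \<notin> Inl ` A" by blast
  then show ?thesis using 2(2) coned_finite(1,2)[OF 2(1)] by (simp add: card_image)
 qed
 then show "finite \<sigma>" "\<sigma> \<noteq> {}" "card \<sigma> \<le> 3" by blast+
qed

lemma Y_subset: assumes s: "\<sigma> \<in> Y" "\<tau> \<noteq> {}" "\<tau> \<subseteq> \<sigma>" shows "\<tau> \<in> Y"
 using s(1)
proof (cases rule: Y_cases)
 case (1 A)
 then obtain B where "B \<subseteq> A" "\<tau> = Inl ` B" using s(3) by (auto simp: subset_image_iff)
 then show ?thesis using flat_subset[OF 1(1), of B] s(2) Y_Inl by auto
next
 case (2 p A)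
 show ?thesis
 proof (cases "Inr p \<in> \<tau>")
  case True
  have "\<tau> - {Inr p} \<subseteq> Inl ` A" using s(3) 2(2) by blast
  then obtain B where B: "B \<subseteq> A" "\<tau> - {Inr p} = Inl ` B" by (auto simp: subset_image_iff)
  then have "\<tau> = insert (Inr p) (Inl ` B)" using True by blast
  then show ?thesis using coned_subset[OF 2(1) B(1)] Y_Inr by simp
 next
  case False
  then have "\<tau> \<subseteq> Inl ` A" using s(3) 2(2) by blast
  then obtain B where B: "B \<subseteq> A" "\<tau> = Inl ` B" by (auto simp: subset_image_iff)
  then have "flat B" using coned_flat[OF coned_subset[OF 2(1) B(1)]] s(2) by auto
  then show ?thesis using B Y_Inl by simp
 qed
qed

text \<open>An edge of the link of an old vertex is a whole corner of a triangle, or half of a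
  pentagon corner, joining the center to one of the two neighbours.\<close>

lemma link_edge:
 assumes "Inl v \<notin> e" "card e = 2" "insert (Inl v) e \<in> Y"
 shows "(\<exists>c k. (c, k) \<in> corners X v \<and> c \<in> triangles X \<and> e = Inl ` corner_ends X (c, k)) \<or>
  (\<exists>p k a. (p, k) \<in> corners X v \<and> p \<in> pentagons X \<and> a \<in> corner_ends X (p, k) \<and> e = {Inr p, Inl a})"
proof -
 have fe: "finite e" using assms(2) by (simp add: card_ge_0_finite)
 have c3: "card (insert (Inl v) e) = 3" using assms(1,2) fe by simp
 from assms(3) show ?thesis
 proof (cases rule: Y_cases)
  case (1 A)
  have A3: "card A = 3" using c3 unfolding 1(2) by (simp add: card_image)
  then obtain c where c: "c \<in> triangles X" "A = set (bds c)" using 1(1) edge_card unfolding flat_def by fastforce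
  have cX: "c \<in> cells X" "len c = 3" using c(1) by (auto simp: triangle_iff)
  have "Inl v \<in> Inl ` A" using 1(2) by blast
  then obtain k where k: "k < 3" "bds c ! k = v" using c(2) cX(2) by (auto simp: in_set_conv_nth)
  then have co: "(c, k) \<in> corners X v" using cX by (simp add: corners_iff)
  obtain x y z where b: "bds c = [x, y, z]" using cX(2) by (rule length_3E)
  have "k = 0 \<or> k = 1 \<or> k = 2" using k(1) by arith
  then have "corner_ends X (c, k) = A - {v}"
   unfolding corner_ends_alt k(2)[symmetric] c(2) using cell_distinct[OF cX(1)]
   by (elim disjE) (auto simp: b nxt_def prv_def)
  moreover have "e = Inl ` (A - {v})"
  proof -
   have "e = insert (Inl v) e - {Inl v}" using assms(1) by simp
   also have "\<dots> = Inl ` (A - {v})" unfolding 1(2) by (auto simp: image_iff)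
   finally show ?thesis .
  qed
  ultimately show ?thesis using co c(1) by metis
 next
  case (2 p A)
  note F = coned_finite[OF 2(1)]
  have "card A = 2" using c3 F(1) unfolding 2(2) by (simp add: card_image image_iff)
  then obtain i where i: "i < 5" "A = {bds p ! i, nxt (bds p) i}" using 2(1) unfolding coned_def by auto
  have pX: "p \<in> cells X" "len p = 5" using F(4) by (auto simp: pentagon_iff)
  have "Inl v \<in> insert (Inr p) (Inl ` A)" unfolding 2(2)[symmetric] by simp
  then have vA: "v \<in> A" by auto
  then obtain a where a: "A = {v, a}" "a \<noteq> v" using \<open>card A = 2\<close> by (auto simp: card_2_iff)
  have "p \<in> pages v a" using i a pX by (auto simp: pages_def is_side_def)
  then obtain k where k: "(p, k) \<in> corners X v" "a \<in> corner_ends X (p, k)" by (rule page_corner) (rule that)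
  have "e = insert (Inl v) e - {Inl v}" using assms(1) by simp
  also have "\<dots> = {Inr p, Inl a}" unfolding 2(2) a(1) using a(2) by auto
  finally show ?thesis using k F(4) by blast
 qed
qed

text \<open>Each edge of the link of an old vertex accounts for an angle of at most \<open>\<pi> / 3\<close>; a short
 cycle would thus come from a loop in the link in \<open>X\<close> of length less than \<open>2 \<pi>\<close>.\<close>

lemma long_cycles_Inl:
 assumes E: "leafless_edges E" and Ev: "\<And>e. e \<in> E ==> Inl v \<notin> e \<and> insert (Inl v) e \<in> Y"
 shows "6 \<le> card E"
proof -
 have fE: "finite E" "E \<noteq> {}" and E2: "\<And>e. e \<in> E ==> card e = 2"
  and other: "\<And>e x. e \<in> E ==> x \<in> e ==> \<exists>e'\<in>E. e' \<noteq> e \<and> x \<in> e'" using E unfolding leafless_edges_def by blast+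
 have le: "(\<exists>c k. (c, k) \<in> corners X v \<and> c \<in> triangles X \<and> e = Inl ` corner_ends X (c, k)) \<or>
  (\<exists>p k a. (p, k) \<in> corners X v \<and> p \<in> pentagons X \<and> a \<in> corner_ends X (p, k) \<and> e = {Inr p, Inl a})" if "e \<in> E" for e
  using link_edge[of v e] Ev[OF that] E2[OF that] by blast
 have tp: "c \<notin> pentagons X" if "c \<in> triangles X" for c using that by (simp add: triangle_iff pentagon_iff)
 \<comment> \<open>The link edges that subdivide the corner q: one for a triangle, and two meeting
   at the center for a pentagon.\<close>
 define ch where "ch q = (if fst q \<in> triangles X then {Inl ` corner_ends X q} else (\<lambda>a. {Inr (fst q), Inl a}) ` corner_ends X q)" for q
 define Q where "Q = {q \<in> corners X v. ch q \<subseteq> E}"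
 have Qc: "q \<in> corners X v" "ch q \<subseteq> E" "fst q \<in> triangles X \<or> fst q \<in> pentagons X" if "q \<in> Q" for q
 proof -
  show "q \<in> corners X v" "ch q \<subseteq> E" using that by (auto simp: Q_def)
  then have "fst q \<in> cells X" by (cases q) (auto simp: corners_iff)
  then show "fst q \<in> triangles X \<or> fst q \<in> pentagons X" using cell_len by (simp add: triangle_iff pentagon_iff)
 qed
 \<comment> \<open>In the link of v a center has only two neighbours, so a graph without leaves that
   reaches it uses both halves of the corner.\<close>
 have cover: "\<exists>q\<in>Q. a \<in> corner_ends X q \<and> e \<in> ch q" if e: "e \<in> E" "Inl a \<in> e" for e a
  using le[OF e(1)]
 proof (elim disjE exE conjE)
  fix c k assume "(c, k) \<in> corners X v" "c \<in> triangles X" "e = Inl ` corner_ends X (c, k)"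
  then show ?thesis using e by (intro bexI[of _ "(c, k)"]) (auto simp: Q_def ch_def)
 next
  fix p k a' assume p: "(p, k) \<in> corners X v" "p \<in> pentagons X" "a' \<in> corner_ends X (p, k)" "e = {Inr p, Inl a'}"
  then have [simp]: "a' = a" using e(2) by simp
  obtain e' where e': "e' \<in> E" "e' \<noteq> e" "Inr p \<in> e'" using other[OF e(1), of "Inr p"] p(4) by blast
  from le[OF e'(1)] e'(3) obtain k' b where b: "(p, k') \<in> corners X v" "b \<in> corner_ends X (p, k')" "e' = {Inr p, Inl b}"
   by auto
  have "k' = k" using corner_cell_unique[OF b(1) p(1)] .
  moreover have "b \<noteq> a" using e'(2) b(3) p(4) by auto
  ultimately have "corner_ends X (p, k) = {a, b}" using corner_ends_card[OF p(1)] p(3) b(2) by (auto simp: card_2_iff)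
  moreover have "p \<notin> triangles X" using tp p(2) by blast
  ultimately show ?thesis using p e(1) e'(1) b(3) by (intro bexI[of _ "(p, k)"]) (auto simp: Q_def ch_def)
 qed
 \<comment> \<open>Different corners share an edge only if they belong to triangles with the same
   two neighbours of v; these would form a loop of angle 2 \<pi> / 3, which is too short.\<close>
 have same: "q = q'" if q: "q \<in> Q" "q' \<in> Q" "e \<in> ch q" "e \<in> ch q'" for q q' e
 proof (rule ccontr)
  assume ne: "q \<noteq> q'"
  then have f: "fst q \<noteq> fst q'" using corner_neq_cell Qc(1) q(1,2) by blast
  have "fst q \<in> triangles X \<and> fst q' \<in> triangles X \<and> corner_ends X q = corner_ends X q'"
   using q(3,4) f by (auto simp: ch_def inj_image_eq_iff split: if_splits)
  then have t: "fst q \<in> triangles X" "fst q' \<in> triangles X" "corner_ends X q = corner_ends X q'" by blast+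
  have "leafless v {q, q'}" unfolding leafless_def using Qc(1) q(1,2) ne t(3) by auto
  from leafless_angle[OF this] have "2 * pi \<le> std_angle q + std_angle q'" using ne by simp
  then show False using t(1,2) pi_gt_zero by (simp add: std_angle_def triangle_iff)
 qed
 have ends: "corner_ends X q \<noteq> {}" "card (corner_ends X q) = 2" if "q \<in> Q" for q
  using corner_ends_card[OF Qc(1)[OF that]] by auto
 have chne: "ch q \<noteq> {}" if "q \<in> Q" for q using ends(1)[OF that] by (simp add: ch_def)
 have fch: "finite (ch q)" if "q \<in> Q" for q using finite_subset[OF Qc(2)[OF that] fE(1)] .
 have "inj_on ch Q" using same chne by (intro inj_onI) blast
 moreover have "ch ` Q \<subseteq> Pow E" using Qc(2) by blast
 ultimately have fQ: "finite Q" using fE(1) by (meson finite_Pow_iff finite_imageD finite_subset)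
 have "leafless v Q" unfolding leafless_def
 proof (intro conjI ballI)
  show "finite Q" by (rule fQ)
  show "Q \<subseteq> corners X v" using Qc(1) by blast
  obtain e where e: "e \<in> E" using fE(2) by blast
  have "\<exists>a. Inl a \<in> e" using le[OF e]
  proof (elim disjE exE conjE)
   fix c k assume "(c, k) \<in> corners X v" "e = Inl ` corner_ends X (c, k)"
   then show ?thesis by (simp add: corner_ends_alt) blast
  qed blast
  then show "Q \<noteq> {}" using cover[OF e] by blast
  fix q a assume q: "q \<in> Q" "a \<in> corner_ends X q"
  obtain e0 where e0: "e0 \<in> ch q" "Inl a \<in> e0" "\<And>e'. e' \<in> ch q ==> Inl a \<in> e' ==> e' = e0"
  proof (cases "fst q \<in> triangles X")
   case True show ?thesis by (rule that[of "Inl ` corner_ends X q"]) (use True q in \<open>auto simp: ch_def\<close>)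
  next
   case False show ?thesis by (rule that[of "{Inr (fst q), Inl a}"]) (use False q in \<open>auto simp: ch_def\<close>)
  qed
  obtain e' where e': "e' \<in> E" "e' \<noteq> e0" "Inl a \<in> e'" using other[of e0 "Inl a"] e0 Qc(2)[OF q(1)] by blast
  obtain q' where q': "q' \<in> Q" "a \<in> corner_ends X q'" "e' \<in> ch q'" using cover[OF e'(1,3)] by blast
  have "q' \<noteq> q" using e0(3) e' q' by blast
  then show "\<exists>q'\<in>Q. q' \<noteq> q \<and> a \<in> corner_ends X q'" using q' by blast
 qed
 then have "2 * pi \<le> sum std_angle Q" by (rule leafless_angle)
 \<comment> \<open>A pentagon corner of 3 \<pi> / 5 stays below the 2 \<pi> / 3 allotted to its two
   edges. So at least six edges are needed for 2 \<pi>.\<close>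
 also have "\<dots> \<le> (\<Sum>q\<in>Q. real (card (ch q)) * (pi / 3))"
 proof (rule sum_mono)
  fix q assume q: "q \<in> Q"
  show "std_angle q \<le> real (card (ch q)) * (pi / 3)"
  proof (cases "fst q \<in> triangles X")
   case True then show ?thesis by (simp add: ch_def std_angle_def triangle_iff)
  next
   case False
   then have "fst q \<in> pentagons X" using Qc(3)[OF q] by blast
   moreover have "card (ch q) = 2"
    using False ends(2)[OF q] by (simp add: ch_def card_image inj_on_def doubleton_eq_iff)
   ultimately show ?thesis using pi_gt_zero by (simp add: std_angle_def pentagon_iff)
  qed
 qed
 also have "\<dots> = real (card (\<Union>q\<in>Q. ch q)) * (pi / 3)"
 proof -
  have disj: "\<forall>i\<in>Q. \<forall>j\<in>Q. i \<noteq> j --> ch i \<inter> ch j = {}" using same by blast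
  have "card (\<Union>q\<in>Q. ch q) = (\<Sum>q\<in>Q. card (ch q))" by (rule card_UN_disjoint[OF fQ _ disj]) (use fch in blast)
  then show ?thesis by (simp only: of_nat_sum sum_distrib_right)
 qed
 also have "\<dots> \<le> real (card E) * (pi / 3)"
 proof (rule mult_right_mono)
  have "card (\<Union>q\<in>Q. ch q) \<le> card E" by (rule card_mono[OF fE(1)]) (use Qc(2) in blast)
  then show "real (card (\<Union>q\<in>Q. ch q)) \<le> real (card E)" by simp
 qed simp
 finally have "2 * pi \<le> real (card E) * (pi / 3)" .
 then have "6 * (pi / 3) \<le> real (card E) * (pi / 3)" by simp
 then have "6 \<le> real (card E)" by (rule mult_right_le_imp_le) (use pi_gt_zero in simp)
 then show ?thesis by simp
qed

text \<open>In the link of a center, which is the boundary pentagon, each edge of a leafless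
  subgraph forces the next one, so the subgraph is the whole pentagon.\<close>

lemma long_cycles_Inr:
 assumes E: "leafless_edges E" and Ep: "\<And>e. e \<in> E ==> Inr p \<notin> e \<and> insert (Inr p) e \<in> Y"
 shows "5 \<le> card E"
proof -
 have fE: "finite E" "E \<noteq> {}" and E2: "\<And>e. e \<in> E ==> card e = 2"
  and other: "\<And>e x. e \<in> E ==> x \<in> e ==> \<exists>e'\<in>E. e' \<noteq> e \<and> x \<in> e'" using E unfolding leafless_edges_def by blast+
 define s where "s i = (Inl ` {bds p ! i, nxt (bds p) i} :: ('v + 'c) set)" for i
 have es: "p \<in> pentagons X \<and> (\<exists>i<5. e = s i)" if e: "e \<in> E" for e
 proof -
  have Yp: "insert (Inr p) e \<in> Y" "Inr p \<notin> e" using Ep[OF e] by blast+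
  from Yp(1) show ?thesis
  proof (cases rule: Y_cases)
   case (1 A) then show ?thesis by blast
  next
   case (2 q A)
   have "Inr p \<in> insert (Inr q) (Inl ` A)" using 2(2) by blast
   then have [simp]: "q = p" by auto
   have "e = Inl ` A" using 2(2) Yp(2) insert_ident[of "Inr p" e "Inl ` A"] by auto
   moreover from this have "card A = 2" using E2[OF e] by (simp add: card_image)
   ultimately show ?thesis using 2(1) unfolding coned_def s_def by auto
  qed
 qed
 then have p: "p \<in> pentagons X" using fE(2) by blast
 then have pX: "p \<in> cells X" "len p = 5" by (auto simp: pentagon_iff)
 have ix: "bds p ! i = bds p ! j \<longleftrightarrow> i = j" if "i < 5" "j < 5" for i j
  using that cell_distinct[OF pX(1)] pX(2) by (simp add: nth_eq_iff_index_eq)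
 have step: "s (Suc i mod 5) \<in> E" if i: "i < 5" "s i \<in> E" for i
 proof -
  have m: "Inl (nxt (bds p) i) \<in> s i" by (simp add: s_def)
  obtain e' where e': "e' \<in> E" "e' \<noteq> s i" "Inl (nxt (bds p) i) \<in> e'" using other[OF i(2) m] by blast
  then obtain j where j: "j < 5" "e' = s j" using es by blast
  have "bds p ! (Suc i mod 5) = bds p ! j \<or> bds p ! (Suc i mod 5) = bds p ! (Suc j mod 5)"
   using e'(3) unfolding j(2) s_def nxt_def pX(2) by auto
  then have "Suc i mod 5 = j \<or> Suc i mod 5 = Suc j mod 5" using ix[of "Suc i mod 5" j] ix[of "Suc i mod 5" "Suc j mod 5"] j(1) by simp
  moreover have "Suc i mod 5 \<noteq> Suc j mod 5"
  proof
   assume "Suc i mod 5 = Suc j mod 5"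
   then have "i = j" using i(1) j(1) by (simp add: mod_Suc split: if_splits)
   then show False using e'(2) j(2) by simp
  qed
  ultimately show ?thesis using e'(1) j(2) by simp
 qed
 obtain i0 where i0: "i0 < 5" "s i0 \<in> E" using es fE(2) by blast
 have all: "s ((i0 + k) mod 5) \<in> E" for k
 proof (induction k)
  case (Suc k) then show ?case using step[of "(i0 + k) mod 5"] by (simp add: mod_Suc_eq)
 qed (use i0 in simp)
 have "s ` {..<5} \<subseteq> E"
 proof
  fix x assume "x \<in> s ` {..<5}"
  then obtain j where j: "j < 5" "x = s j" by auto
  have "(i0 + (j + 5 - i0)) mod 5 = j" using i0(1) j(1) by simp
  then show "x \<in> E" using all[of "j + 5 - i0"] j(2) by simp
 qed
 moreover have "inj_on s {..<5}"
  using sides_inj[OF pX(1)] unfolding s_def pX(2) inj_on_def by (simp only: inj_image_eq_iff[OF inj_Inl])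
 ultimately show ?thesis using card_mono[OF fE(1), of "s ` {..<5}"] by (simp add: card_image)
qed

section \<open>Flagness\<close>

lemma Y_pair_Inl: "a \<noteq> b ==> {Inl a, Inl b} \<in> Y \<longleftrightarrow> {a, b} \<in> edges X"
proof -
 assume ab: "a \<noteq> b"
 have "{a, b} \<noteq> set (bds c)" if "c \<in> triangles X" for c
 proof
  assume e: "{a, b} = set (bds c)"
  have "card (set (bds c)) = 3" using that cell_distinct[of c] distinct_card[of "bds c"] by (simp add: triangle_iff)
  then show False using ab unfolding e[symmetric] by simp
 qed
 then have "flat {a, b} \<longleftrightarrow> {a, b} \<in> edges X" using ab by (auto simp: flat_def)
 then show ?thesis using Y_Inl[of "{a, b}"] by simp
qed

text \<open>All triangles of the clique are filled, so the link of a contains the 3-cycle on b, c,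
  e, which is too short by \<open>long_cycles_Inl\<close>.\<close>

lemma no_four_clique:
 assumes "\<And>x y. x \<in> {a, b, c, e} ==> y \<in> {a, b, c, e} ==> x \<noteq> y ==> {x, y} \<in> edges X"
  and "distinct [a, b, c, e]"
 shows False
proof -
 define E where "E = {{Inl b, Inl c}, {Inl c, Inl e}, {Inl e, Inl b} :: ('v + 'c) set}"
 have "leafless_edges E" using assms(2) unfolding leafless_edges_def E_def by (auto simp: doubleton_eq_iff)
 moreover have "Inl a \<notin> x \<and> insert (Inl a) x \<in> Y" if x: "x \<in> E" for x
 proof -
  obtain y z where yz: "x = {Inl y, Inl z}" "y \<in> {b, c, e}" "z \<in> {b, c, e}" "y \<noteq> z" using x assms(2) by (auto simp: E_def)
  then have "{a, y} \<in> edges X" "{y, z} \<in> edges X" "{z, a} \<in> edges X" using assms by auto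
  then obtain t where "t \<in> triangles X" "set (bds t) = {a, y, z}" by (rule graph_triangle) (rule that)
  then have "flat {a, y, z}" by (auto simp: flat_def)
  then show ?thesis using Y_Inl[of "{a, y, z}"] yz assms(2) by auto
 qed
 ultimately have "6 \<le> card E" by (rule long_cycles_Inl)
 moreover have "card E \<le> 3" unfolding E_def by (simp add: card_insert_if)
 ultimately show False by simp
qed

lemma clique_flat:
 assumes A: "finite A" "A \<noteq> {}" "A \<subseteq> verts X" "\<And>x y. x \<in> A ==> y \<in> A ==> x \<noteq> y ==> {x, y} \<in> edges X"
 shows "flat A"
proof -
 have "card A \<noteq> 0" using A by simp
 then consider "card A = 1" | "card A = 2" | "3 \<le> card A" by linarith
 then show ?thesis
 proof cases
  case 1 then show ?thesis using A(3) by (auto simp: flat_def card_1_singleton_iff)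
 next
  case 2 then show ?thesis using A(4) by (auto simp: flat_def card_2_iff)
 next
  case 3
  then obtain B where "B \<subseteq> A" "card B = 3" by (rule obtain_subset_with_card_n) blast
  then obtain x y z where B: "B = {x, y, z}" "x \<noteq> y" "y \<noteq> z" "z \<noteq> x" by (auto simp: card_3_iff)
  have "A = {x, y, z}"
  proof (rule ccontr)
   assume "A \<noteq> {x, y, z}"
   then obtain t where "t \<in> A" "t \<notin> {x, y, z}" using \<open>B \<subseteq> A\<close> B(1) by blast
   then show False using no_four_clique[of x y z t] A(4) \<open>B \<subseteq> A\<close> B by auto
  qed
  moreover obtain t where "t \<in> triangles X" "set (bds t) = {x, y, z}"
   by (rule graph_triangle[of x y z]) (use A(4) \<open>B \<subseteq> A\<close> B in auto)
  ultimately show ?thesis by (auto simp: flat_def)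
 qed
qed

text \<open>Pentagons have no diagonals, so adjacent vertices of p are consecutive; three vertices
  of a pentagon are never pairwise consecutive.\<close>

lemma clique_coned:
 assumes p: "p \<in> pentagons X" and A: "A \<subseteq> set (bds p)" "\<And>x y. x \<in> A ==> y \<in> A ==> x \<noteq> y ==> {x, y} \<in> edges X"
 shows "coned p A"
proof -
 have pX: "len p = 5" using p by (simp add: pentagon_iff)
 have diag: "l = Suc k mod 5 \<or> k = Suc l mod 5" if "k < 5" "l < 5" "{bds p ! k, bds p ! l} \<in> edges X" for k l
  using tpc p that unfolding triangle_pentagon_complex_def by blast
 define I where "I = {k. k < 5 \<and> bds p ! k \<in> A}"
 have AI: "A = (!) (bds p) ` I"
 proof (intro equalityI subsetI)
  fix x assume x: "x \<in> A"
  then obtain k where "k < 5" "bds p ! k = x" using A(1) pX by (auto simp: in_set_conv_nth subset_iff)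
  then show "x \<in> (!) (bds p) ` I" using x by (auto simp: I_def)
 qed (auto simp: I_def)
 have adj: "l = Suc k mod 5 \<or> k = Suc l mod 5" if "k \<in> I" "l \<in> I" "k \<noteq> l" for k l
 proof -
  have "bds p ! k \<noteq> bds p ! l" using that cell_distinct[of p] p pX by (auto simp: I_def pentagon_iff nth_eq_iff_index_eq)
  then show ?thesis using diag[of k l] A(2) that by (auto simp: I_def)
 qed
 show ?thesis
 proof (cases "\<exists>k\<in>I. \<exists>l\<in>I. k \<noteq> l")
  case False
  then have "I = {} \<or> (\<exists>k\<in>I. I = {k})" by blast
  then show ?thesis using p A(1) unfolding coned_def AI by auto
 next
  case True
  then obtain k where k: "k \<in> I" "Suc k mod 5 \<in> I" "Suc k mod 5 \<noteq> k" using adj by metis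
  have k5: "k < 5" using k(1) by (simp add: I_def)
  have "I = {k, Suc k mod 5}"
  proof (rule ccontr)
   assume "I \<noteq> {k, Suc k mod 5}"
   then obtain l where l: "l \<in> I" "l \<noteq> k" "l \<noteq> Suc k mod 5" using k by blast
   have l5: "l < 5" using l(1) by (simp add: I_def)
   have "k = Suc l mod 5" using adj[OF k(1) l(1)] l by auto
   moreover have "l = Suc (Suc k mod 5) mod 5 \<or> Suc k mod 5 = Suc l mod 5" using adj[OF k(2) l(1)] l by auto
   moreover have "k = 0 \<or> k = 1 \<or> k = 2 \<or> k = 3 \<or> k = 4" using k5 by arith
   moreover have "l = 0 \<or> l = 1 \<or> l = 2 \<or> l = 3 \<or> l = 4" using l5 by arith
   ultimately show False by (elim disjE) simp_all
  qed
  then have "A = {bds p ! k, nxt (bds p) k}" unfolding AI nxt_def pX by simp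
  then show ?thesis using p k5 unfolding coned_def by blast
 qed
qed

text \<open>No simplex contains two centers, so a clique has at most one. With a center it is
  settled by \<open>clique_coned\<close>, otherwise by \<open>clique_flat\<close>.\<close>

lemma star_flag: "flag Y"
 unfolding flag_def
proof (intro allI impI)
 fix S assume "finite S \<and> S \<noteq> {} \<and> S \<subseteq> \<Union>Y \<and> (\<forall>x\<in>S. \<forall>y\<in>S. x \<noteq> y --> {x, y} \<in> Y)"
 then have S: "finite S" "S \<noteq> {}" "S \<subseteq> \<Union>Y" "\<And>x y. x \<in> S ==> y \<in> S ==> x \<noteq> y ==> {x, y} \<in> Y" by blast+
 define A where "A = {a. Inl a \<in> S}"
 have sing: "{x} \<in> Y" if "x \<in> S" for x
 proof -
  obtain \<sigma> where "\<sigma> \<in> Y" "x \<in> \<sigma>" using S(3) \<open>x \<in> S\<close> by blast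
  then show ?thesis using Y_subset[of \<sigma> "{x}"] by simp
 qed
 have Ap: "{x, y} \<in> edges X" if "x \<in> A" "y \<in> A" "x \<noteq> y" for x y
  using S(4)[of "Inl x" "Inl y"] that Y_pair_Inl[of x y] by (simp add: A_def)
 show "S \<in> Y"
 proof (cases "\<exists>p. Inr p \<in> S")
  case False
  have SA: "S = Inl ` A"
  proof (intro equalityI subsetI)
   fix x assume "x \<in> S" then show "x \<in> Inl ` A" using False by (cases x) (auto simp: A_def)
  qed (auto simp: A_def)
  have "finite A" using S(1) unfolding SA by (rule finite_imageD) simp
  moreover have "A \<noteq> {}" using S(2) SA by blast
  moreover have "A \<subseteq> verts X"
  proof
   fix a assume "a \<in> A"
   then have "Inl ` {a} \<in> Y" using sing[of "Inl a"] by (simp add: A_def)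
   then show "a \<in> verts X" using flat_finite(4)[of "{a}"] unfolding Y_Inl by blast
  qed
  ultimately have "flat A" using Ap by (rule clique_flat)
  then show ?thesis using SA Y_Inl by simp
 next
  case True
  then obtain p where p: "Inr p \<in> S" by blast
  have uq: "q = p" if "Inr q \<in> S" for q
  proof (rule ccontr)
   assume "q \<noteq> p"
   then have "{Inr q, Inr p} \<in> Y" using S(4)[OF that p] by simp
   then show False
   proof (cases rule: Y_cases)
    case (1 A) then show ?thesis by blast
   next
    case (2 r A)
    have "Inr q \<in> insert (Inr r) (Inl ` A)" "Inr p \<in> insert (Inr r) (Inl ` A)" unfolding 2(2)[symmetric] by blast+
    then show ?thesis using \<open>q \<noteq> p\<close> by blast
   qed
  qed
  have SA: "S = insert (Inr p) (Inl ` A)"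
  proof (intro equalityI subsetI)
   fix x assume "x \<in> S"
   then show "x \<in> insert (Inr p) (Inl ` A)" by (cases x) (auto simp: A_def dest: uq)
  qed (use p in \<open>auto simp: A_def\<close>)
  have c1: "coned p {a}" if "a \<in> A" for a
   using S(4)[OF p, of "Inl a"] that Y_Inr[of p "{a}"] by (simp add: A_def)
  have "coned p {}" using sing[OF p] Y_Inr[of p "{}"] by simp
  then have "p \<in> pentagons X" by (simp add: coned_def)
  moreover have "A \<subseteq> set (bds p)" using coned_finite(3)[OF c1] by blast
  ultimately have "coned p A" using Ap by (rule clique_coned)
  then show ?thesis unfolding SA Y_Inr .
 qed
qed

section \<open>Largeness of links\<close>

lemma star_link_flag: "\<sigma> \<in> Y ==> flag (link Y \<sigma>)"
 by (rule link_flag[OF star_flag Y_subset _ Y_finite(1)])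

lemma no_cycle_Inl: assumes "has_full_cycle j (link Y {Inl v})" shows "6 \<le> j"
proof -
 obtain E where E: "leafless_edges E" "card E \<le> j" "\<And>e. e \<in> E ==> e \<inter> {Inl v} = {} \<and> e \<union> {Inl v} \<in> Y"
  by (rule link_cycle[OF assms]) (rule that)
 have "6 \<le> card E" by (rule long_cycles_Inl[OF E(1), of v]) (use E(3) in simp)
 then show ?thesis using E(2) by simp
qed

lemma no_cycle_Inr: assumes "has_full_cycle j (link Y {Inr p})" shows "5 \<le> j"
proof -
 obtain E where E: "leafless_edges E" "card E \<le> j" "\<And>e. e \<in> E ==> e \<inter> {Inr p} = {} \<and> e \<union> {Inr p} \<in> Y"
  by (rule link_cycle[OF assms]) (rule that)
 have "5 \<le> card E" by (rule long_cycles_Inr[OF E(1), of p]) (use E(3) in simp)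
 then show ?thesis using E(2) by simp
qed

text \<open>An edge in the link of a simplex with two or more vertices would span with it a simplex
  of at least four vertices, but simplices have at most three. So only links of vertices can contain
  cycles.\<close>

lemma no_cycle: assumes s: "\<sigma> \<in> Y" and c: "has_full_cycle j (link Y \<sigma>)" shows "5 \<le> j"
proof -
 note F = Y_finite[OF s]
 obtain x where x: "x \<in> \<sigma>" using F(2) by blast
 show ?thesis
 proof (cases "\<sigma> = {x}")
  case True
  then show ?thesis using c no_cycle_Inl[of j] no_cycle_Inr[of j] by (cases x) fastforce+
 next
  case False
  obtain E where E: "leafless_edges E" "\<And>e. e \<in> E ==> e \<inter> \<sigma> = {} \<and> e \<union> \<sigma> \<in> Y"
   by (rule link_cycle[OF c]) (rule that)
  then obtain e where e: "e \<in> E" "card e = 2" unfolding leafless_edges_def by blast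
  have "{x} \<subset> \<sigma>" using x False by blast
  then have "card {x} < card \<sigma>" by (rule psubset_card_mono[OF F(1)])
  moreover have "card (e \<union> \<sigma>) = card e + card \<sigma>"
   using E(2)[OF e(1)] e(2) F(1) by (intro card_Un_disjoint) (auto intro: card_ge_0_finite)
  ultimately show ?thesis using Y_finite(3)[of "e \<union> \<sigma>"] E(2)[OF e(1)] e(2) by simp
 qed
qed

lemma star_vertex: "x \<in> verts (star X) ==> {x} \<in> Y"
 by (simp add: simplices_def graph_complex_def)

end

theorem lemma3p2:
  fixes X :: "('v, 'c) pe_complex"
  assumes "triangle_pentagon_complex X"
    and "cat0_complex X"
    and "\<forall>v\<in>verts X. metrics_agree_at X v"
  shows "(\<forall>v\<in>verts (star X). \<forall>j\<in>{3, 4}. \<not> has_full_cycle j (link (simplices (star X)) {v})) \<and>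
    (flag (simplices (star X)) \<and> locally_large 5 (simplices (star X))) \<and>
    (\<forall>v\<in>verts (star X).
       large_vertex 5 (simplices (star X)) v \<and> \<not> large_vertex 6 (simplices (star X)) v \<longrightarrow>
       v \<in> Inr ` pentagons X)"
proof -
 interpret agreeing_complex X by unfold_locales (use assms in auto)
 have "\<not> has_full_cycle j (link Y {v})" if "v \<in> verts (star X)" "j \<in> {3, 4}" for v j
  using no_cycle[OF star_vertex[OF that(1)], of j] that(2) by auto
 moreover have "locally_large 5 Y"
  unfolding locally_large_def large_def using star_link_flag no_cycle by (meson not_le)
 moreover have "v \<in> Inr ` pentagons X" if "v \<in> verts (star X)" "\<not> large_vertex 6 Y v" for v
 proof (cases v)
  case (Inl u)
  \<comment> \<open>Every old vertex is 6-large, so only a center can fail to be.\<close>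
  have "large 6 (link Y {v})"
   unfolding large_def using star_link_flag[OF star_vertex[OF that(1)]] no_cycle_Inl[of _ u] Inl by (meson not_le)
  then show ?thesis using that(2) by (simp add: large_vertex_def)
 next
  case (Inr p)
  then show ?thesis using that(1) by (auto simp: star_def)
 qed
 ultimately show ?thesis using star_flag by blast
qed

end
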